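(* Let $k\ge0$ and let $J:\mathbb{R}^d\to[0,+\infty)$ satisfy $J\in L^1_{k+4+d}$, $J\in L^p(\mathbb{R}^d)$ for some $p\in(1,\infty]$, $\int J(x)\,dx=1$, $\int J(x)x\,dx=0$, $\int J(x)x_ix_j\,dx=2\delta_{ij}$ for $i,j=1,\dots,d$, and $\int J(x)x^\alpha\,dx=0$ for all multi-indices $\alpha$ with $|\alpha|=3$ (integrals over $\mathbb{R}^d$). Let $u_0\in L^1_k\cap\mathcal{C}^4(\mathbb{R}^d)$ be a probability density for which there exist $c>0$ and $K>k+d$ with $|D^\alpha u_0(x)|\le c\,(1+|x|^2)^{-K/2}$ for all $x\in\mathbb{R}^d$ and all multi-indices $\alpha$ with $|\alpha|=4$. For $\varepsilon\in(0,1]$ let $u$ (depending on $\varepsilon$) be the mild solution of $$\partial_tu=\frac1{\varepsilon^2}\big(J_\varepsilon*u-u\big)+\operatorname{div}(xu)$$ with initial condition $u_0$, and let $v$ be the unique integrable solution of the Fokker–Planck equation $\partial_tv=\Delta v+\operatorname{div}(xv)$ with the same initial condition $u_0$. Then there exists a constant $C>0$, independent of $\varepsilon$ and $t$, such that $$\|u(t,\cdot)-v(t,\cdot)\|_{L^1_k}\le C\varepsilon^2\qquad\text{for every } t\ge0\text{ and }\varepsilon\in(0,1].$$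
   Context: Notation: $J_\varepsilon(x):=\varepsilon^{-d}J(x/\varepsilon)$. For $k\ge0$, $L^1_k$ is the weighted Lebesgue space with norm $\|\varphi\|_{L^1_k}=\int_{\mathbb{R}^d}(1+|x|^k)|\varphi(x)|\,dx$. Standard multi-index notation is used for $x^\alpha$ and $D^\alpha$. A probability density is a nonnegative integrable function with integral $1$. Mild solution: with $T_tf(x):=e^{(d-1/\varepsilon^2)t}f(e^tx)$, the mild solution with initial condition $u_0\in L^1_k$ is the unique $u\in\mathcal{C}([0,\infty),L^1_k)$ with $u(t)=T_tu_0+\frac1{\varepsilon^2}\int_0^tT_{t-s}[J_\varepsilon*u(s)]\,ds$ for all $t\ge0$. The integrable solution of the Fokker–Planck equation with initial datum $u_0$ is $v(t,x)=e^{dt}w\big(\tfrac12(e^{2t}-1),e^tx\big)$, where $w$ is the heat-kernel solution of $\partial_tw=\Delta w$, $w(0,\cdot)=u_0$. *)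

theory Defs
  imports "HOL-Analysis.Analysis"
begin

(* Elements of Lebesgue spaces are represented by functions, with equality almost everywhere. *)

(* For k = 0 the convention 0 powr 0 = 0 makes this weight 1 instead of 2 at the origin only,
   a null set. *)
definition weight :: "real \<Rightarrow> real ^ 'n \<Rightarrow> real" where
  "weight k x = 1 + norm x powr k"

definition L1w :: "real \<Rightarrow> (real ^ 'n \<Rightarrow> real) set" where
  "L1w k = {f \<in> borel_measurable lebesgue. integrable lebesgue (\<lambda>x. weight k x * \<bar>f x\<bar>)}"

(* The Bochner integral is 0 on non-integrable functions, so this is meaningful on L1w k only. *)
definition L1w_norm :: "real \<Rightarrow> (real ^ 'n \<Rightarrow> real) \<Rightarrow> real" where
  "L1w_norm k f = (LINT x|lebesgue. weight k x * \<bar>f x\<bar>)"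

definition Lp :: "ennreal \<Rightarrow> (real ^ 'n \<Rightarrow> real) set" where
  "Lp p = {f \<in> borel_measurable lebesgue.
     if p = \<infinity> then \<exists>B. AE x in lebesgue. \<bar>f x\<bar> \<le> B
     else integrable lebesgue (\<lambda>x. \<bar>f x\<bar> powr enn2real p)}"

definition prob_density :: "(real ^ 'n \<Rightarrow> real) \<Rightarrow> bool" where
  "prob_density f \<longleftrightarrow>
     (\<forall>x. 0 \<le> f x) \<and> integrable lebesgue f \<and> (LINT x|lebesgue. f x) = 1"

type_synonym 'n multi_index = "'n \<Rightarrow> nat"

definition mi_order :: "'n::finite multi_index \<Rightarrow> nat" where
  "mi_order \<alpha> = (\<Sum>i\<in>UNIV. \<alpha> i)"

definition mi_power :: "real ^ 'n \<Rightarrow> 'n multi_index \<Rightarrow> real" where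
  "mi_power x \<alpha> = (\<Prod>i\<in>UNIV. (x $ i) ^ \<alpha> i)"

definition partial_deriv :: "'n \<Rightarrow> (real ^ 'n \<Rightarrow> real) \<Rightarrow> real ^ 'n \<Rightarrow> real" where
  "partial_deriv i f x = deriv (\<lambda>h. f (x + h *\<^sub>R axis i 1)) 0"

(* The index type carries no order, so one enumeration of the coordinates is chosen in which to
   take the partial derivatives. The choice is immaterial for functions of class C^|alpha|. *)
definition coords :: "'n::finite list" where
  "coords = (SOME is. distinct is \<and> set is = UNIV)"

definition mi_deriv :: "'n multi_index \<Rightarrow> (real ^ 'n \<Rightarrow> real) \<Rightarrow> real ^ 'n \<Rightarrow> real" where
  "mi_deriv \<alpha> f = fold (\<lambda>i. partial_deriv i ^^ \<alpha> i) coords f"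

primrec C_class :: "nat \<Rightarrow> (real ^ 'n \<Rightarrow> real) \<Rightarrow> bool" where
  "C_class 0 f \<longleftrightarrow> continuous_on UNIV f"
| "C_class (Suc m) f \<longleftrightarrow>
     (\<forall>x. f differentiable (at x)) \<and> (\<forall>i. C_class m (partial_deriv i f))"

definition rescale :: "real \<Rightarrow> (real ^ 'n \<Rightarrow> real) \<Rightarrow> real ^ 'n \<Rightarrow> real" where
  "rescale \<epsilon> J x = J (x /\<^sub>R \<epsilon>) / \<epsilon> ^ CARD('n)"

definition convol :: "(real ^ 'n \<Rightarrow> real) \<Rightarrow> (real ^ 'n \<Rightarrow> real) \<Rightarrow> real ^ 'n \<Rightarrow> real" where
  "convol f g x = (LINT y|lebesgue. f (x - y) * g y)"

definition transport :: "real \<Rightarrow> real \<Rightarrow> (real ^ 'n \<Rightarrow> real) \<Rightarrow> real ^ 'n \<Rightarrow> real" where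
  "transport \<epsilon> t f x = exp ((real CARD('n) - 1 / \<epsilon>\<^sup>2) * t) * f (exp t *\<^sub>R x)"

(* The integral over [a,b] of a function with values in the Banach space L1w k. This space depends
   on k and so is not a type; the condition below is the one defining has_integral, with the norm
   of L1w k. For continuous integrands it agrees with the Riemann and Bochner integrals. *)
definition has_L1w_integral ::
    "real \<Rightarrow> (real \<Rightarrow> real ^ 'n \<Rightarrow> real) \<Rightarrow> (real ^ 'n \<Rightarrow> real) \<Rightarrow> real \<Rightarrow> real \<Rightarrow> bool" where
  "has_L1w_integral k F I a b \<longleftrightarrow>
     (\<forall>s\<in>{a..b}. F s \<in> L1w k) \<and> I \<in> L1w k \<and>
     (\<forall>e>0. \<exists>\<gamma>. gauge \<gamma> \<and>
        (\<forall>\<D>. \<D> tagged_division_of {a..b} \<and> \<gamma> fine \<D> \<longrightarrow>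
          L1w_norm k (\<lambda>x. (\<Sum>(s, S)\<in>\<D>. measure lborel S * F s x) - I x) < e))"

definition continuous_L1w :: "real \<Rightarrow> (real \<Rightarrow> real ^ 'n \<Rightarrow> real) \<Rightarrow> bool" where
  "continuous_L1w k u \<longleftrightarrow>
     (\<forall>t\<ge>0. u t \<in> L1w k) \<and>
     (\<forall>t\<ge>0. ((\<lambda>s. L1w_norm k (\<lambda>x. u s x - u t x)) \<longlongrightarrow> 0) (at t within {0..}))"

definition mild_solution ::
    "real \<Rightarrow> real \<Rightarrow> (real ^ 'n \<Rightarrow> real) \<Rightarrow> (real ^ 'n \<Rightarrow> real) \<Rightarrow> (real \<Rightarrow> real ^ 'n \<Rightarrow> real) \<Rightarrow> bool"
  where
  "mild_solution k \<epsilon> J u\<^sub>0 u \<longleftrightarrow>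
     continuous_L1w k u \<and>
     (\<forall>t\<ge>0. \<exists>I. has_L1w_integral k (\<lambda>s. transport \<epsilon> (t - s) (convol (rescale \<epsilon> J) (u s))) I 0 t \<and>
        (AE x in lebesgue. u t x = transport \<epsilon> t u\<^sub>0 x + 1 / \<epsilon>\<^sup>2 * I x))"

definition heat_kernel :: "real \<Rightarrow> real ^ 'n \<Rightarrow> real" where
  "heat_kernel \<tau> x = (4 * pi * \<tau>) powr (- real CARD('n) / 2) * exp (- (norm x)\<^sup>2 / (4 * \<tau>))"

definition heat_solution :: "(real ^ 'n \<Rightarrow> real) \<Rightarrow> real \<Rightarrow> real ^ 'n \<Rightarrow> real" where
  "heat_solution u\<^sub>0 \<tau> = (if \<tau> = 0 then u\<^sub>0 else convol (heat_kernel \<tau>) u\<^sub>0)"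

definition fokker_planck_solution :: "(real ^ 'n \<Rightarrow> real) \<Rightarrow> real \<Rightarrow> real ^ 'n \<Rightarrow> real" where
  "fokker_planck_solution u\<^sub>0 t x =
     exp (real CARD('n) * t) * heat_solution u\<^sub>0 ((exp (2 * t) - 1) / 2) (exp t *\<^sub>R x)"

end

theory Submission
  imports Defs "HOL-Probability.Distributions"
begin

text \<open>
  In the variable \<open>y = exp t x\<close> both equations lose their drift: the heat flow runs at speed
  \<open>exp (2 t)\<close>, and the jump process has the time-dependent jump length \<open>eps exp t\<close>. Both are studied
  through the operators \<open>Nop s\<close> (heat flow from time 0) and \<open>Pop eps s T\<close> (jump process from \<open>s\<close> to
  \<open>T\<close>) acting on continuous test functions of growth \<open>(1 + |y|^2)^(k/2)\<close>. The error at time \<open>T\<close>,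
  tested against \<open>f\<close>, is the increment over \<open>[0, T]\<close> of \<open>s \<mapsto> U0 (Nop s (Pop eps s T f))\<close>, whose
  derivative is \<open>- U0 (Rop eps s (Pop eps s T f))\<close> with the consistency error \<open>Rop\<close>.

  The moments of \<open>J\<close> cancel the Taylor expansion of \<open>Rop\<close> up to third order. For \<open>s \<ge> 1\<close> the
  remaining fourth derivative falls on the heat kernel, and \<open>Rop\<close> is of order \<open>eps^2\<close> uniformly in
  \<open>s\<close>; for \<open>s <= 1\<close> it falls on \<open>u0\<close>. The bound is uniform in \<open>T\<close> because \<open>Rop\<close> annihilates constants
  while \<open>Pop eps s T f\<close> approaches a constant exponentially fast as \<open>T - s\<close> grows. This follows from a
  Lyapunov function, which confines the process, and from a smoothing estimate: two successive jumps
  have a density bounded below on a box, and averaging over many random translations by the side of a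
  box nearly erases a shift.

  A mild solution tested against \<open>f\<close> satisfies the Duhamel equation of \<open>Pop\<close>, which determines it;
  test functions approximating the sign of the difference turn the weak bound into one in \<open>L1w k\<close>.
\<close>

text \<open>The difficulty is uniformity in eps. A unit of time contains about eps^-2 jumps, each of
  length eps exp s in the moving variable, so no estimate for a single jump survives eps -> 0. What
  survives is a balance: a fixed fraction of these jumps, still of order eps^-2, spreads the process
  over a width of order exp s, so a shift by v is forgotten in proportion to
  \<open>exp (- s) * norm v\<close>, its length in the original variable. A second balance governs
  the consistency error: the remainder (eps exp s)^4, the rate eps^-2 and a fourth derivative of the
  heat kernel of size (exp s)^-4 multiply to eps^2. The last factor is in truth \<open>tau s\<close>
  to the power -2, not integrable at s = 0, and \<open>Pop eps s T f\<close> is only known to be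
  continuous; so near 0 the datum carries the derivatives, through fourth differences and without
  integration by parts. All operators involved are averages of translations and commute. They live
  in one Banach algebra, where the evolution is the exponential of the integrated generator and no
  time ordering intervenes.\<close>

section \<open>The Banach algebra of bounded operators on bounded continuous functions\<close>

instance bcontfun :: (metric_space, banach) banach ..

text \<open>A copy of the operator space whose multiplication is composition, so that powers,
  \<open>exp\<close> and the calculus of normed algebras apply to operators.\<close>

typedef (overloaded) 'n bop = "UNIV :: (((real ^ 'n) \<Rightarrow>\<^sub>C real) \<Rightarrow>\<^sub>L ((real ^ 'n) \<Rightarrow>\<^sub>C real)) set"
  morphisms blf Bop by simp

lemma blf_inject': "X = Y \<longleftrightarrow> (\<forall>f. blf X f = blf Y f)"
  by (metis blf_inject blinfun_eqI)

lemma blf_Bop [simp]: "blf (Bop F) = F"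
  by (simp add: Bop_inverse)

instantiation bop :: (finite) real_normed_algebra_1
begin

definition "0 = Bop 0"
definition "1 = Bop id_blinfun"
definition "X + Y = Bop (blf X + blf Y)"
definition "X - Y = Bop (blf X - blf Y)"
definition "- X = Bop (- blf X)"
definition "X * Y = Bop (blf X o\<^sub>L blf Y)"
definition "scaleR r X = Bop (r *\<^sub>R blf X)"
definition "norm X = norm (blf X)"
definition "dist X Y = dist (blf X) (blf (Y :: 'a bop))"
definition "sgn X = (inverse (norm X)) *\<^sub>R (X :: 'a bop)"
definition "uniformity = (INF e\<in>{0 <..}. principal {(x :: 'a bop, y). dist x y < e})"
definition "open S = (\<forall>x\<in>S. \<forall>\<^sub>F (x', y) in uniformity. x' = x \<longrightarrow> (y :: 'a bop) \<in> S)"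

lemmas bop_defs = zero_bop_def one_bop_def plus_bop_def minus_bop_def uminus_bop_def
  times_bop_def scaleR_bop_def norm_bop_def dist_bop_def

instance
proof
  fix X Y Z :: "'a bop" and a b :: real
  show "X + Y + Z = X + (Y + Z)" "X + Y = Y + X" "0 + X = X" "- X + X = 0" "X - Y = X + - Y"
    by (simp_all add: bop_defs blf_inverse algebra_simps)
  show "a *\<^sub>R (X + Y) = a *\<^sub>R X + a *\<^sub>R Y" "(a + b) *\<^sub>R X = a *\<^sub>R X + b *\<^sub>R X"
    "a *\<^sub>R b *\<^sub>R X = (a * b) *\<^sub>R X" "1 *\<^sub>R X = X"
    by (simp_all add: bop_defs blf_inverse algebra_simps)
  show "X * Y * Z = X * (Y * Z)" "1 * X = X" "X * 1 = X"
    "(X + Y) * Z = X * Z + Y * Z" "X * (Y + Z) = X * Y + X * Z"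
    "a *\<^sub>R X * Y = a *\<^sub>R (X * Y)" "X * a *\<^sub>R Y = a *\<^sub>R (X * Y)"
    by (auto simp: bop_defs Bop_inject blf_inject' blinfun.bilinear_simps)
  show "dist X Y = norm (X - Y)" by (simp add: bop_defs dist_norm)
  show "sgn X = inverse (norm X) *\<^sub>R X" by (simp add: sgn_bop_def)
  show "(norm X = 0) = (X = 0)" by (metis Bop_inverse blf_inject norm_bop_def norm_eq_zero zero_bop_def UNIV_I)
  show "norm (X + Y) <= norm X + norm Y" by (simp add: bop_defs norm_triangle_ineq)
  show "norm (a *\<^sub>R X) = \<bar>a\<bar> * norm X" by (simp add: bop_defs)
  show "norm (X * Y) <= norm X * norm Y" by (simp add: bop_defs norm_blinfun_compose)
  show "norm (1 :: 'a bop) = 1"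
  proof (rule antisym)
    show "norm (1 :: 'a bop) <= 1"
      by (simp add: bop_defs norm_blinfun_id_le)
    have c: "norm (const_bcontfun 1 :: (real ^ 'a) \<Rightarrow>\<^sub>C real) = 1" (is "norm ?c = 1")
    proof (rule antisym)
      show "norm ?c <= 1" by (rule norm_bound) simp
      show "1 <= norm ?c" using norm_bounded[of ?c 0] by simp
    qed
    show "1 <= norm (1 :: 'a bop)"
      using norm_blinfun[of "id_blinfun" ?c] c by (simp add: bop_defs)
  qed
  show "(0 :: 'a bop) \<noteq> 1"
  proof
    assume "(0 :: 'a bop) = 1"
    then have "const_bcontfun 1 = (0 :: (real ^ 'a) \<Rightarrow>\<^sub>C real)"
      unfolding blf_inject' bop_defs by (metis blf_Bop id_blinfun.rep_eq blinfun.zero_left)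
    then have "apply_bcontfun (const_bcontfun 1 :: (real ^ 'a) \<Rightarrow>\<^sub>C real) 0 = apply_bcontfun 0 0" by simp
    then show False by simp
  qed
qed (rule uniformity_bop_def open_bop_def)+

end

instance bop :: (finite) banach
proof
  fix X :: "nat => 'a bop"
  assume X: "Cauchy X"
  have "Cauchy (\<lambda>n. blf (X n))"
    using X unfolding Cauchy_def dist_bop_def .
  then have "convergent (\<lambda>n. blf (X n))"
    by (rule Cauchy_convergent)
  then obtain L where L: "(\<lambda>n. blf (X n)) \<longlonglongrightarrow> L"
    by (auto simp only: convergent_def)
  have "X \<longlonglongrightarrow> Bop L"
    using L unfolding tendsto_iff dist_bop_def blf_Bop .
  then show "convergent X" unfolding convergent_def by blast
qed

lemma blf_simps [simp]:
  "blf (X * Y) f = blf X (blf Y f)" "blf 1 f = f" "blf (X + Y) f = blf X f + blf Y f"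
  "blf (X - Y) f = blf X f - blf Y f" "blf (- X) f = - blf X f"
  "blf (a *\<^sub>R X) f = a *\<^sub>R blf X f" "blf 0 f = 0"
  by (simp_all add: bop_defs blinfun.bilinear_simps)

lemma bounded_bilinear_blf: "bounded_bilinear (\<lambda>X f. blinfun_apply (blf X) f)"
  by (rule bounded_bilinear.intro)
     (auto simp: blinfun.bilinear_simps norm_bop_def intro!: exI[of _ 1] norm_blinfun)

interpretation blf: bounded_bilinear "\<lambda>X f. blinfun_apply (blf X) f"
  by (rule bounded_bilinear_blf)

lemma norm_blf: "norm (blf X f) <= norm X * norm f"
  unfolding norm_bop_def by (rule norm_blinfun)

lemma norm_bop_le:
  assumes "0 <= b" "\<And>f. norm (blf X f) <= b * norm f"
  shows "norm X <= b"
  unfolding norm_bop_def using assms by (intro norm_blinfun_bound)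

lemma bop_eqI: "(\<And>f. blf X f = blf Y f) ==> X = Y"
  by (simp add: blf_inject')

lemma bounded_linear_apply_bcontfun: "bounded_linear (\<lambda>f. apply_bcontfun f x)"
  by (rule bounded_linear_intro[where K=1])
    (use norm_bounded in \<open>auto\<close>)

subsection \<open>The exponential along a commuting path\<close>

text \<open>The remainder is the series shifted by two, compared term by term through 1/(n+2)! <=
  1/n!. Commutativity plays no part here, so the bound serves for operators.\<close>

lemma exp_minus_first_order:
  fixes h :: "'a::{real_normed_algebra_1,banach}"
  shows "norm (exp h - 1 - h) <= (norm h)\<^sup>2 * exp (norm h)"
proof -
  have le: "norm (inverse (fact (n + 2)) *\<^sub>R (h ^ (n + 2))) <= (norm h)\<^sup>2 * (norm h ^ n /\<^sub>R fact n)" for n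
  proof -
    have "norm (inverse (fact (n + 2)) *\<^sub>R (h ^ (n + 2))) <= inverse (fact (n + 2)) * norm h ^ (n + 2)"
      by (simp add: norm_power_ineq mult_left_mono del: fact_Suc power_Suc)
    also have "... <= inverse (fact n) * norm h ^ (n + 2)"
      by (intro mult_right_mono le_imp_inverse_le fact_mono) auto
    also have "... = (norm h)\<^sup>2 * (norm h ^ n /\<^sub>R fact n)"
      by (simp add: power2_eq_square)
    finally show ?thesis .
  qed
  have sm: "summable (\<lambda>n. (norm h)\<^sup>2 * (norm h ^ n /\<^sub>R fact n))"
    by (intro summable_mult summable_exp_generic)
  have "exp h - 1 - h = (\<Sum>n. inverse (fact (n + 2)) *\<^sub>R (h ^ (n + 2)))"
    by (subst exp_first_two_terms) simp
  also have "norm ... <= (\<Sum>n. (norm h)\<^sup>2 * (norm h ^ n /\<^sub>R fact n))"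
    by (rule norm_suminf_le[OF le sm])
  also have "... = (norm h)\<^sup>2 * exp (norm h)"
    unfolding exp_def by (intro suminf_mult summable_exp_generic)
  finally show ?thesis .
qed

lemma exp_has_derivative_0:
  "((exp :: 'a::{real_normed_algebra_1,banach} => 'a) has_derivative (\<lambda>h. h)) (at 0)"
proof (rule has_derivativeI_sandwich[of 1 _ _ _ _ "\<lambda>h. norm h * exp 1"])
  fix h :: 'a assume h: "h \<in> UNIV" "h \<noteq> 0" "dist h 0 < 1"
  have "norm (exp h - 1 - h) / norm h <= (norm h)\<^sup>2 * exp (norm h) / norm h"
    by (intro divide_right_mono exp_minus_first_order) auto
  also have "... = norm h * exp (norm h)" using h by (simp add: power2_eq_square)
  also have "... <= norm h * exp 1" using h by (intro mult_left_mono) auto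
  finally show "norm (exp h - exp 0 - (h - 0)) / norm (h - 0) <= norm h * exp 1" by simp
next
  have "((\<lambda>h::'a. norm h * exp 1) \<longlongrightarrow> norm (0::'a) * exp 1) (at 0)" by (intro tendsto_intros)
  then show "((\<lambda>h::'a. norm h * exp 1) \<longlongrightarrow> 0) (at 0)" by simp
qed auto

text \<open>Commutation of \<open>a x\<close> with the nearby values gives
  \<open>exp (a y) = exp (a x) * exp (a y - a x)\<close>; then only the derivative of
  \<open>exp\<close> at 0 is used.\<close>

lemma exp_has_vector_derivative:
  fixes a :: "real => 'a::{real_normed_algebra_1,banach}"
  assumes a: "(a has_vector_derivative a') (at x within S)" and xS: "x \<in> S"
    and comm: "\<And>y. y \<in> S ==> a x * a y = a y * a x"
  shows "((\<lambda>y. exp (a y)) has_vector_derivative exp (a x) * a') (at x within S)"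
proof -
  have "((\<lambda>y. exp (a y - a x)) has_derivative (\<lambda>h. h *\<^sub>R a')) (at x within S)"
  proof (rule has_derivative_compose[where f="\<lambda>y. a y - a x" and g=exp and g'="\<lambda>h. h"])
    show "((\<lambda>y. a y - a x) has_derivative (\<lambda>h. h *\<^sub>R a')) (at x within S)"
      using has_derivative_diff[OF a[unfolded has_vector_derivative_def] has_derivative_const[of "a x"]] by simp
  qed (simp add: exp_has_derivative_0)
  then have "((\<lambda>y. exp (a y - a x)) has_vector_derivative a') (at x within S)"
    by (simp add: has_vector_derivative_def)
  then have 1: "((\<lambda>y. exp (a x) * exp (a y - a x)) has_vector_derivative exp (a x) * a') (at x within S)"
    using bounded_linear.has_vector_derivative[OF bounded_linear_mult_right] by blast
  have 2: "exp (a x) * exp (a y - a x) = exp (a y)" if "y \<in> S" for y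
  proof -
    have "exp (a x + (a y - a x)) = exp (a x) * exp (a y - a x)"
      by (rule exp_add_commuting) (simp add: algebra_simps comm that)
    then show ?thesis by simp
  qed
  show ?thesis
    by (rule has_vector_derivative_transform[OF xS _ 1]) (simp add: 2)
qed

subsection \<open>Weights\<close>

text \<open>The Japanese bracket. It is comparable to \<open>1 + norm x\<close> but smooth, as the
  Taylor expansion of the Lyapunov function requires.\<close>

definition jb :: "real ^ 'n => real" where "jb x = sqrt (1 + (norm x)\<^sup>2)"

definition wt :: "real => real ^ 'n => real" where "wt k x = jb x powr k"

text \<open>The weight for kernels, while \<open>wt\<close> is the weight for functions:
  \<open>kw\<close> is submultiplicative and controls the growth of \<open>wt\<close> under
  translation (\<open>kw_add\<close>, \<open>wt_add\<close>).\<close>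

definition kw :: "real => real ^ 'n => real" where "kw k y = (1 + norm y) powr k"

lemma jb_ge_1: "1 <= jb x"
  by (simp add: jb_def)

lemma jb_pos [simp]: "0 < jb x"
  using jb_ge_1[of x] by linarith

lemma jb_neq_0 [simp]: "jb x \<noteq> 0"
  using jb_pos[of x] by linarith

lemma jb_power2: "(jb x)\<^sup>2 = 1 + (norm x)\<^sup>2"
  by (simp add: jb_def)

lemma norm_le_jb: "norm x <= jb x"
  by (rule power2_le_imp_le) (auto simp: jb_power2 less_imp_le)

lemma jb_le: "jb x <= 1 + norm x"
  by (rule power2_le_imp_le) (auto simp: jb_power2 power2_sum)

lemma jb_add: "jb (x + y) <= jb x * (1 + norm y)"
proof -
  have "(jb (x + y))\<^sup>2 <= (jb x + norm y)\<^sup>2"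
  proof -
    have "(norm (x + y))\<^sup>2 <= (norm x + norm y)\<^sup>2"
      by (intro power_mono norm_triangle_ineq) auto
    moreover have "norm x * norm y <= jb x * norm y"
      by (intro mult_right_mono norm_le_jb) auto
    ultimately show ?thesis by (simp add: jb_power2 power2_sum)
  qed
  then have "jb (x + y) <= jb x + norm y"
    by (rule power2_le_imp_le) (simp add: less_imp_le)
  also have "... <= jb x + jb x * norm y"
    using jb_ge_1[of x] by (simp add: mult_le_cancel_right1)
  finally show ?thesis by (simp add: algebra_simps)
qed

lemma continuous_on_jb [continuous_intros]: "continuous_on S f ==> continuous_on S (\<lambda>x. jb (f x))"
  unfolding jb_def by (intro continuous_intros)

lemma wt_pos [simp]: "0 < wt k x"
  by (simp add: wt_def)

lemma wt_nonneg [simp]: "0 <= wt k x"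
  by (simp add: less_imp_le)

lemma wt_neq_0 [simp]: "wt k x \<noteq> 0"
  using wt_pos[of k x] by linarith

lemma wt_ge_1: "0 <= k ==> 1 <= wt k x"
  by (simp add: wt_def ge_one_powr_ge_zero jb_ge_1)

lemma kw_pos [simp]: "0 < kw k y"
  unfolding kw_def using norm_ge_zero[of y] by (subst powr_gt_zero) linarith

lemma kw_nonneg [simp]: "0 <= kw k y"
  by (simp add: less_imp_le)

lemma kw_ge_1: "0 <= k ==> 1 <= kw k x"
  by (simp add: kw_def ge_one_powr_ge_zero)

lemma kw_mono: "k <= l ==> kw k x <= kw l x"
  by (simp add: kw_def powr_mono)

lemma wt_add: "0 <= k ==> wt k (x + y) <= wt k x * kw k y"
  unfolding wt_def kw_def
  by (subst powr_mult[symmetric]) (auto intro!: powr_mono2 jb_add simp: less_imp_le)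

lemma wt_le_kw: "0 <= k ==> wt k x <= kw k x"
  unfolding wt_def kw_def by (intro powr_mono2 jb_le) (auto simp: less_imp_le)

lemma kw_add: "0 <= k ==> kw k (x + y) <= kw k x * kw k y"
proof -
  have "1 + norm (x + y) <= (1 + norm x) * (1 + norm y)"
    using norm_triangle_ineq[of x y] mult_nonneg_nonneg[of "norm x" "norm y"]
    by (simp add: algebra_simps del: mult_nonneg_nonneg)
  then show "0 <= k ==> ?thesis"
    unfolding kw_def by (subst powr_mult[symmetric]) (auto intro!: powr_mono2)
qed

lemma continuous_on_wt [continuous_intros]: "continuous_on S f ==> continuous_on S (\<lambda>x. wt k (f x))"
  unfolding wt_def by (intro continuous_intros) auto

lemma continuous_on_kw [continuous_intros]: "continuous_on S f ==> continuous_on S (\<lambda>x. kw k (f x))"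
proof -
  have "1 + norm (f x) \<noteq> 0" for x using norm_ge_zero[of "f x"] by linarith
  then show "continuous_on S f ==> ?thesis"
    unfolding kw_def by (intro continuous_intros) auto
qed

lemma borel_measurable_wt [measurable]: "wt k \<in> borel_measurable borel"
  by (intro borel_measurable_continuous_onI continuous_intros)

lemma borel_measurable_kw [measurable]: "kw k \<in> borel_measurable borel"
  by (intro borel_measurable_continuous_onI continuous_intros)

subsection \<open>Weighted bounded continuous functions\<close>

text \<open>A continuous function bounded by a multiple of \<^term>\<open>wt k\<close> is encoded as its quotient by
  \<^term>\<open>wt k\<close>, an element of the Banach space of bounded continuous functions; \<open>ev\<close> decodes.\<close>

definition ev :: "real => ((real ^ 'n) \<Rightarrow>\<^sub>C real) => real ^ 'n => real" where
  "ev k f x = wt k x * apply_bcontfun f x"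

definition mk :: "real => (real ^ 'n => real) => ((real ^ 'n) \<Rightarrow>\<^sub>C real)" where
  "mk k \<phi> = Bcontfun (\<lambda>x. \<phi> x / wt k x)"

lemma ev_linear [simp]:
  "ev k (f + g) x = ev k f x + ev k g x" "ev k (f - g) x = ev k f x - ev k g x"
  "ev k (- f) x = - ev k f x" "ev k (a *\<^sub>R f) x = a * ev k f x" "ev k 0 x = 0"
  by (auto simp: ev_def algebra_simps)

lemma continuous_on_ev [continuous_intros]:
  "continuous_on S f ==> continuous_on S (\<lambda>x. ev k g (f x))"
  unfolding ev_def
  by (intro continuous_intros continuous_on_compose2[OF continuous_on_apply_bcontfun[of UNIV g]]) auto

lemma borel_measurable_ev [measurable]: "ev k f \<in> borel_measurable borel"
  by (intro borel_measurable_continuous_onI continuous_intros)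

lemma ev_bound: "\<bar>ev k f x\<bar> <= norm f * wt k x"
  using norm_bounded[of f x] by (simp add: ev_def abs_mult mult.commute)

lemma ev_inject: "(\<And>x. ev k f x = ev k g x) ==> f = g"
  by (rule bcontfun_eqI) (simp add: ev_def)

lemma norm_le_ev: "(\<And>x. \<bar>ev k f x\<bar> <= C * wt k x) ==> norm f <= C"
  by (rule norm_bound) (auto simp: ev_def abs_mult mult.commute[of C])

lemma bounded_linear_ev: "bounded_linear (\<lambda>f. ev k f x)"
  unfolding ev_def by (intro bounded_linear_const_mult bounded_linear_apply_bcontfun)

lemma ev_mk:
  assumes "continuous_on UNIV \<phi>" "\<And>x. \<bar>\<phi> x\<bar> <= C * wt k x"
  shows "ev k (mk k \<phi>) x = \<phi> x"
proof -
  have "(\<lambda>x. \<phi> x / wt k x) \<in> bcontfun"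
    using assms by (intro bcontfun_normI[of _ C] continuous_intros) (auto simp: divide_simps)
  then show ?thesis by (simp add: ev_def mk_def Bcontfun_inverse)
qed

lemma norm_mk_le:
  assumes "continuous_on UNIV \<phi>" "\<And>x. \<bar>\<phi> x\<bar> <= C * wt k x"
  shows "norm (mk k \<phi>) <= C"
  by (rule norm_le_ev[of k]) (simp add: ev_mk[OF assms] assms(2))

lemma bop_eqI_ev: "(\<And>f x. ev k (blf X f) x = ev k (blf Y f) x) ==> X = Y"
  by (intro bop_eqI ev_inject)

lemma norm_bop_le_ev:
  assumes "0 <= b" "\<And>f x. \<bar>ev k (blf X f) x\<bar> <= b * norm f * wt k x"
  shows "norm X <= b"
  using assms by (intro norm_bop_le norm_le_ev[of k]) auto

text \<open>Lifts a map on weighted functions to an operator on their encodings. The two totalised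
  constructors inside give the intended value only under the conditions of
  \<open>ev_mkop\<close>.\<close>

definition mkop :: "real => ((real ^ 'n => real) => real ^ 'n => real) => 'n bop" where
  "mkop k T = Bop (Blinfun (\<lambda>f. mk k (T (ev k f))))"

lemma ev_mkop:
  assumes c: "\<And>f. continuous_on UNIV (T (ev k f))"
    and b: "\<And>f x. \<bar>T (ev k f) x\<bar> <= C * norm f * wt k x"
    and add: "\<And>f g x. T (ev k (f + g)) x = T (ev k f) x + T (ev k g) x"
    and scale: "\<And>a f x. T (ev k (a *\<^sub>R f)) x = a * T (ev k f) x"
  shows "ev k (blf (mkop k T) f) x = T (ev k f) x"
proof -
  have e: "ev k (mk k (T (ev k f))) x = T (ev k f) x" for f x
    by (rule ev_mk[OF c b])
  have "bounded_linear (\<lambda>f. mk k (T (ev k f)))"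
    by (rule bounded_linear_intro[where K=C])
       (auto intro!: ev_inject[of k] norm_mk_le c simp: e add scale b mult.commute[of _ C])
  then show ?thesis
    by (simp add: mkop_def bounded_linear_Blinfun_apply e)
qed

text \<open>Dominated convergence along sequences. A convergent sequence is bounded, so one majorant
  for each ball of parameters suffices.\<close>

lemma continuous_on_param_integral:
  fixes F :: "'b::real_normed_vector => 'a => real"
  assumes c: "\<And>y. continuous_on UNIV (\<lambda>x. F x y)"
    and m: "\<And>x. F x \<in> borel_measurable M"
    and b: "\<And>R. \<exists>g. integrable M g \<and> (\<forall>x y. norm x <= R \<longrightarrow> \<bar>F x y\<bar> <= g y)"
  shows "continuous_on UNIV (\<lambda>x. \<integral>y. F x y \<partial>M)"
  unfolding continuous_on_sequentially
proof (intro allI ballI impI)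
  fix x :: "nat => 'b" and a assume a: "(\<forall>n. x n \<in> UNIV) \<and> x \<longlonglongrightarrow> a"
  then have "Bseq x" using convergentI[of x a] convergent_imp_Bseq by blast
  then obtain R where R: "\<And>n. norm (x n) <= R" unfolding Bseq_def by blast
  obtain g where g: "integrable M g" "\<And>x y. norm x <= R ==> \<bar>F x y\<bar> <= g y" using b[of R] by blast
  have lim: "(\<lambda>n. F (x n) y) \<longlonglongrightarrow> F a y" for y
    using c[of y] a unfolding continuous_on_sequentially comp_def by auto
  have "(\<lambda>n. \<integral>y. F (x n) y \<partial>M) \<longlonglongrightarrow> (\<integral>y. F a y \<partial>M)"
    by (rule integral_dominated_convergence[OF _ _ g(1)]) (use m lim g(2) R in auto)
  then show "((\<lambda>x. \<integral>y. F x y \<partial>M) \<circ> x) \<longlonglongrightarrow> (\<integral>y. F a y \<partial>M)" by (simp add: comp_def)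
qed

subsection \<open>Convolution operators\<close>

definition wkernel :: "real => (real ^ 'n => real) => bool" where
  "wkernel k g \<longleftrightarrow> g \<in> borel_measurable borel \<and> integrable lborel (\<lambda>y. kw k y * \<bar>g y\<bar>)"

definition kn :: "real => (real ^ 'n => real) => real" where
  "kn k g = (LBINT y. kw k y * \<bar>g y\<bar>)"

text \<open>The argument is \<open>x + y\<close>, not \<open>x - y\<close>: the operator acts on
  observables, averaging over a jump with density \<open>g\<close>, and is the adjoint of
  convolution with \<open>g\<close> on densities.\<close>

definition cop :: "real => (real ^ 'n => real) => 'n bop" where
  "cop k g = mkop k (\<lambda>\<phi> x. (LBINT y. \<phi> (x + y) * g y))"

definition shop :: "real => real ^ 'n => 'n bop" where
  "shop k h = mkop k (\<lambda>\<phi> x. \<phi> (x + h))"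

lemma wkernel_integrable_mono:
  assumes g: "wkernel k g" and "f \<in> borel_measurable borel" "\<And>y. \<bar>f y\<bar> <= C * kw k y * \<bar>g y\<bar>"
  shows "integrable lborel f"
proof (rule Bochner_Integration.integrable_bound[of _ "\<lambda>y. C * (kw k y * \<bar>g y\<bar>)"])
  show "integrable lborel (\<lambda>y. C * (kw k y * \<bar>g y\<bar>))" using g by (simp add: wkernel_def)
  show "AE x in lborel. norm (f x) <= norm (C * (kw k x * \<bar>g x\<bar>))"
    using assms(3) by (auto simp: mult.assoc intro!: AE_I2 order.trans[OF _ abs_ge_self])
qed (use assms in simp)

lemma wkernel_integrable: "0 <= k ==> wkernel k g ==> integrable lborel g"
  by (rule wkernel_integrable_mono[of k g _ 1])
     (auto simp: wkernel_def mult_le_cancel_right1 kw_ge_1)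

lemma wkernel_diff: 
  assumes "wkernel k f" "wkernel k g" shows "wkernel k (\<lambda>y. f y - g y)"
proof -
  have "integrable lborel (\<lambda>y. kw k y * \<bar>f y - g y\<bar>)"
  proof (rule Bochner_Integration.integrable_bound)
    show "integrable lborel (\<lambda>y. kw k y * \<bar>f y\<bar> + kw k y * \<bar>g y\<bar>)"
      using assms by (auto simp: wkernel_def)
    show "AE x in lborel. norm (kw k x * \<bar>f x - g x\<bar>) <= norm (kw k x * \<bar>f x\<bar> + kw k x * \<bar>g x\<bar>)"
      by (auto simp: abs_mult distrib_left[symmetric] intro!: mult_left_mono)
  qed (use assms in \<open>auto simp: wkernel_def\<close>)
  then show ?thesis using assms by (auto simp: wkernel_def)
qed

lemma wkernel_scale: "wkernel k f ==> wkernel k (\<lambda>y. c * f y)"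
  by (auto simp: wkernel_def abs_mult mult.left_commute[of _ "\<bar>c\<bar>"])

lemma kn_nonneg: "0 <= kn k g"
  unfolding kn_def by (intro integral_nonneg_AE) auto

lemma ev_shift_bound: "0 <= k ==> \<bar>ev k f (x + y)\<bar> <= norm f * wt k x * kw k y"
  by (rule order.trans[OF ev_bound]) (simp add: mult.assoc mult_left_mono wt_add)

lemma integrable_ev_shift:
  assumes "0 <= k" "wkernel k g"
  shows "integrable lborel (\<lambda>y. ev k f (x + y) * g y)"
  by (rule wkernel_integrable_mono[OF assms(2), of _ "norm f * wt k x"])
     (use assms in \<open>auto simp: abs_mult wkernel_def intro!: mult_right_mono ev_shift_bound\<close>)

lemma ev_cop:
  fixes g :: "real ^ 'n => real"
  assumes k: "0 <= k" and g: "wkernel k g"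
  shows "ev k (blf (cop k g) f) x = (LBINT y. ev k f (x + y) * g y)"
    and "norm (cop k g) <= kn k g"
proof -
  have int: "integrable lborel (\<lambda>y. kw k y * \<bar>g y\<bar>)" using g by (simp add: wkernel_def)
  have [measurable]: "g \<in> borel_measurable borel" using g by (simp add: wkernel_def)
  have b: "\<bar>LBINT y. ev k f (x + y) * g y\<bar> <= kn k g * norm f * wt k x" for f x
  proof -
    have "\<bar>LBINT y. ev k f (x + y) * g y\<bar> <= (LBINT y. (norm f * wt k x) * (kw k y * \<bar>g y\<bar>))"
      using ev_shift_bound[OF k, of f x]
      by (intro integral_abs_bound[THEN order.trans] integral_mono integrable_abs integrable_ev_shift k g integrable_mult_right int)
         (auto simp: abs_mult mult.assoc[symmetric] intro!: mult_right_mono)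
    also have "... = (norm f * wt k x) * kn k g"
      unfolding kn_def by (rule integral_mult_right_zero)
    finally show ?thesis by (simp add: ac_simps)
  qed
  have c: "continuous_on UNIV (\<lambda>x. (LBINT y. ev k f (x + y) * g y))" for f
  proof (rule continuous_on_param_integral)
    fix R
    have "integrable lborel (\<lambda>y. (norm f * (1 + R) powr k) * (kw k y * \<bar>g y\<bar>))" 
      by (intro integrable_mult_right int)
    moreover have "\<bar>ev k f (x + y) * g y\<bar> <= (norm f * (1 + R) powr k) * (kw k y * \<bar>g y\<bar>)" if "norm x <= R" for x y
    proof -
      have "wt k x <= (1 + R) powr k" unfolding wt_def
        using k that jb_le[of x] by (intro powr_mono2) (auto simp: less_imp_le)
      then have "norm f * wt k x * kw k y <= norm f * (1 + R) powr k * kw k y"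
        by (intro mult_right_mono mult_left_mono) auto
      then show ?thesis using ev_shift_bound[OF k, of f x y]
        by (auto simp: abs_mult mult.assoc[symmetric] intro!: mult_right_mono)
    qed
    ultimately show "\<exists>h. integrable lborel h \<and> (\<forall>x y. norm x <= R \<longrightarrow> \<bar>ev k f (x + y) * g y\<bar> <= h y)"
      by blast
  qed (auto intro!: continuous_intros)
  have e: "ev k (blf (cop k g) f) x = (LBINT y. ev k f (x + y) * g y)" for f x
    unfolding cop_def
    by (rule ev_mkop[OF c b])
       (simp_all add: distrib_right Bochner_Integration.integral_add integrable_ev_shift k g mult.assoc)
  then show "ev k (blf (cop k g) f) x = (LBINT y. ev k f (x + y) * g y)" .
  show "norm (cop k g) <= kn k g"
    by (rule norm_bop_le_ev[where k=k, OF kn_nonneg]) (simp add: e b)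
qed

lemma ev_shop:
  assumes k: "0 <= k" shows "ev k (blf (shop k h) f) x = ev k f (x + h)"
  unfolding shop_def
  by (rule ev_mkop[where C="kw k h"])
     (auto intro!: continuous_intros simp: ev_shift_bound[OF k] ac_simps
        intro: order.trans[OF ev_shift_bound[OF k]])

lemma cop_diff:
  assumes "0 <= k" "wkernel k f" "wkernel k g"
  shows "cop k (\<lambda>y. f y - g y) = cop k f - cop k g"
  by (rule bop_eqI_ev[of k])
     (simp add: ev_cop assms wkernel_diff right_diff_distrib Bochner_Integration.integral_diff integrable_ev_shift)

lemma cop_scale:
  assumes "0 <= k" "wkernel k f"
  shows "cop k (\<lambda>y. c * f y) = c *\<^sub>R cop k f"
  by (rule bop_eqI_ev[of k]) (simp add: ev_cop assms wkernel_scale mult.left_commute[of _ c])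

lemma shop_cop_commute:
  assumes "0 <= k" "wkernel k g"
  shows "shop k h * cop k g = cop k g * shop k h"
  by (rule bop_eqI_ev[of k]) (simp add: ev_cop ev_shop assms add.assoc add.commute[of h])

lemma shop_commute: "0 <= k ==> shop k h * shop k h' = shop k h' * shop k h"
  by (rule bop_eqI_ev[of k]) (simp add: ev_shop ac_simps)

lemma shop_add: "0 <= k ==> shop k (h + h') = shop k h * shop k h'"
  by (rule bop_eqI_ev[of k]) (simp add: ev_shop ac_simps)

lemma integrable_ev_shift2:
  assumes k: "0 <= k" and f: "wkernel k f" and g: "wkernel k g"
  shows "integrable (lborel \<Otimes>\<^sub>M lborel) (\<lambda>(y, z). ev k \<phi> (x + y + z) * f z * g y)"
proof -
  have [measurable]: "f \<in> borel_measurable borel" "g \<in> borel_measurable borel"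
    using f g by (auto simp: wkernel_def)
  have "integrable (lborel \<Otimes>\<^sub>M lborel) (\<lambda>(y, z). (kw k y * \<bar>g y\<bar>) * (kw k z * \<bar>f z\<bar>))"
    using f g by (intro lborel_pair.Fubini_integrable)
      (auto simp: wkernel_def abs_mult)
  then have "integrable (lborel \<Otimes>\<^sub>M lborel) (\<lambda>(y, z). (norm \<phi> * wt k x) * ((kw k y * \<bar>g y\<bar>) * (kw k z * \<bar>f z\<bar>)))"
    by (simp add: split_beta')
  then show ?thesis
  proof (rule Bochner_Integration.integrable_bound)
    have "\<bar>ev k \<phi> (x + y + z) * f z * g y\<bar> <= (norm \<phi> * wt k x) * ((kw k y * \<bar>g y\<bar>) * (kw k z * \<bar>f z\<bar>))" for y z
    proof -
      have "wt k (x + y) * kw k z <= wt k x * kw k y * kw k z"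
        by (intro mult_right_mono wt_add k) auto
      then have "norm \<phi> * (wt k (x + y) * kw k z) <= norm \<phi> * (wt k x * kw k y * kw k z)"
        by (intro mult_left_mono) auto
      then have "\<bar>ev k \<phi> (x + y + z)\<bar> <= norm \<phi> * (wt k x * kw k y * kw k z)"
        using ev_shift_bound[OF k, of \<phi> "x + y" z] by (simp add: mult.assoc)
      then have "\<bar>ev k \<phi> (x + y + z)\<bar> * (\<bar>f z\<bar> * \<bar>g y\<bar>) <= norm \<phi> * (wt k x * kw k y * kw k z) * (\<bar>f z\<bar> * \<bar>g y\<bar>)"
        by (intro mult_right_mono) auto
      then show ?thesis by (simp add: abs_mult ac_simps)
    qed
    then show "AE yz in lborel \<Otimes>\<^sub>M lborel. norm (case yz of (y, z) => ev k \<phi> (x + y + z) * f z * g y)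
        <= norm (case yz of (y, z) => (norm \<phi> * wt k x) * ((kw k y * \<bar>g y\<bar>) * (kw k z * \<bar>f z\<bar>)))"
      by (intro AE_I2) (auto simp: split_beta' intro!: order.trans[OF _ abs_ge_self])
  qed measurable
qed

text \<open>By Fubini both orders average over the sum of the same two jumps. On this rests the
  description of the evolution by a plain exponential.\<close>

lemma cop_commute:
  assumes k: "0 <= k" and f: "wkernel k f" and g: "wkernel k g"
  shows "cop k f * cop k g = cop k g * cop k f"
proof (rule bop_eqI_ev[of k])
  fix \<phi> :: "(real ^ 'a) \<Rightarrow>\<^sub>C real" and x
  have "ev k (blf (cop k g * cop k f) \<phi>) x = (LBINT y. (LBINT z. ev k \<phi> (x + y + z) * f z * g y))"
    by (simp add: ev_cop assms)
  also have "... = (LBINT z. (LBINT y. ev k \<phi> (x + y + z) * f z * g y))"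
    using lborel_pair.Fubini_integral[OF integrable_ev_shift2[OF assms, of \<phi> x]] by simp
  also have "... = (LBINT z. (LBINT y. ev k \<phi> (x + z + y) * g y * f z))"
    by (intro Bochner_Integration.integral_cong refl) (simp add: ac_simps)
  also have "... = ev k (blf (cop k f * cop k g) \<phi>) x"
    by (simp add: ev_cop assms)
  finally show "ev k (blf (cop k f * cop k g) \<phi>) x = ev k (blf (cop k g * cop k f) \<phi>) x" by simp
qed

subsection \<open>Positive operators\<close>

text \<open>Decoding multiplies by a positive weight, so positivity can be stated on the encodings
  and does not depend on \<open>k\<close> (\<open>bpos_ev\<close>).\<close>

definition bpos :: "'n::finite bop => bool" where
  "bpos X \<longleftrightarrow> (\<forall>f. (\<forall>x. 0 <= apply_bcontfun f x) \<longrightarrow> (\<forall>x. 0 <= apply_bcontfun (blf X f) x))"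

lemma ev_nonneg_iff: "0 <= ev k f x \<longleftrightarrow> 0 <= apply_bcontfun f x"
  using wt_pos[of k x] by (auto simp: ev_def zero_le_mult_iff simp del: wt_pos)

lemma bpos_ev: "bpos X \<longleftrightarrow> (\<forall>f. (\<forall>x. 0 <= ev k f x) \<longrightarrow> (\<forall>x. 0 <= ev k (blf X f) x))"
  by (simp add: bpos_def ev_nonneg_iff)

lemma bpos_mono: "bpos X ==> (\<And>x. ev k f x <= ev k g x) ==> ev k (blf X f) x <= ev k (blf X g) x"
  unfolding bpos_ev[of X k] 
  by (drule spec[of _ "g - f"]) (auto simp: blinfun.diff_right)

lemma bpos_cop: "0 <= k ==> wkernel k g ==> (\<And>y. 0 <= g y) ==> bpos (cop k g)"
  unfolding bpos_ev[of _ k] by (auto simp: ev_cop intro!: integral_nonneg_AE)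

lemma bpos_intros: 
  "bpos 0" "bpos 1" "bpos X ==> bpos Y ==> bpos (X + Y)" "bpos X ==> bpos Y ==> bpos (X * Y)"
  "0 <= a ==> bpos X ==> bpos (a *\<^sub>R X)"
  by (auto simp: bpos_def)

lemma bpos_sum: "(\<And>i. i \<in> A ==> bpos (X i)) ==> bpos (sum X A)"
  by (induction A rule: infinite_finite_induct) (auto intro: bpos_intros)

lemma bpos_power: "bpos X ==> bpos (X ^ n)"
  by (induction n) (auto intro: bpos_intros)

lemma bpos_lim:
  assumes "X \<longlonglongrightarrow> L" "eventually (\<lambda>n. bpos (X n)) sequentially"
  shows "bpos L"
  unfolding bpos_def
proof (intro allI impI)
  fix f :: "(real ^ 'a) \<Rightarrow>\<^sub>C real" and x assume f: "\<forall>x. 0 <= apply_bcontfun f x"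
  have "(\<lambda>n. apply_bcontfun (blf (X n) f) x) \<longlonglongrightarrow> apply_bcontfun (blf L f) x"
    by (intro bounded_linear.tendsto[OF bounded_linear_apply_bcontfun] blf.tendsto assms tendsto_const)
  moreover have "eventually (\<lambda>n. 0 <= apply_bcontfun (blf (X n) f) x) sequentially"
    using assms(2) f by (auto elim!: eventually_mono simp: bpos_def)
  ultimately show "0 <= apply_bcontfun (blf L f) x"
    using tendsto_lowerbound by fastforce
qed

text \<open>Every term of the exponential series is positive and positivity passes to limits. The
  quadratic term is singled out because it is the event of two jumps, whose joint density is bounded
  below on a box.\<close>

lemma bpos_exp_minus_square:
  assumes X: "bpos X"
  shows "bpos (exp X - (1/2) *\<^sub>R X\<^sup>2)"
proof (rule bpos_lim)
  have "(\<lambda>n. \<Sum>i<n. X ^ i /\<^sub>R fact i) \<longlonglongrightarrow> exp X"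
    using exp_converges[of X] by (simp add: sums_def)
  then show "(\<lambda>n. (\<Sum>i<n. X ^ i /\<^sub>R fact i) - (1/2) *\<^sub>R X\<^sup>2) \<longlonglongrightarrow> exp X - (1/2) *\<^sub>R X\<^sup>2"
    by (intro tendsto_intros)
  have "bpos ((\<Sum>i<n. X ^ i /\<^sub>R fact i) - (1/2) *\<^sub>R X\<^sup>2)" if "3 <= n" for n
  proof -
    have "(\<Sum>i<n. X ^ i /\<^sub>R fact i) = X\<^sup>2 /\<^sub>R fact 2 + (\<Sum>i\<in>{..<n} - {2}. X ^ i /\<^sub>R fact i)"
      using that by (subst sum.remove[of _ 2]) auto
    then have "(\<Sum>i<n. X ^ i /\<^sub>R fact i) - (1/2) *\<^sub>R X\<^sup>2 = (\<Sum>i\<in>{..<n} - {2}. X ^ i /\<^sub>R fact i)"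
      by (simp add: fact_2)
    then show ?thesis by (auto intro!: bpos_sum bpos_intros bpos_power X)
  qed
  then show "\<forall>\<^sub>F n in sequentially. bpos ((\<Sum>i<n. X ^ i /\<^sub>R fact i) - (1/2) *\<^sub>R X\<^sup>2)"
    by (auto simp: eventually_sequentially)
qed

lemma bpos_exp: "bpos X ==> bpos (exp X)"
  using bpos_intros(3)[OF bpos_exp_minus_square bpos_intros(5)[OF _ bpos_power[of X 2], of "1/2"], of X] by simp

section \<open>Constants and bounds in the unweighted supremum norm\<close>

definition onek :: "real => (real ^ 'n) \<Rightarrow>\<^sub>C real" where "onek k = mk k (\<lambda>_. 1)"

lemma ev_onek [simp]: "0 <= k ==> ev k (onek k) x = 1"
  unfolding onek_def by (rule ev_mk[where C=1]) (auto simp: wt_ge_1)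

text \<open>\<open>sbd k X C\<close>: in the unweighted supremum norm, \<open>X\<close> is bounded by \<open>C\<close> on bounded functions.\<close>

definition sbd :: "real => 'n::finite bop => real => bool" where
  "sbd k X C \<longleftrightarrow> (\<forall>f a. (\<forall>x. \<bar>ev k f x\<bar> <= a) \<longrightarrow> (\<forall>x. \<bar>ev k (blf X f) x\<bar> <= C * a))"

lemma sbdD: "sbd k X C ==> (\<And>x. \<bar>ev k f x\<bar> <= a) ==> \<bar>ev k (blf X f) x\<bar> <= C * a"
  by (auto simp: sbd_def)

text \<open>The function lies between \<open>- a\<close> and \<open>a\<close> times the constant 1,
  so positivity reduces the bound to the image of the constant.\<close>

lemma sbd_bpos:
  assumes k: "0 <= k" and X: "bpos X" and 1: "\<And>x. ev k (blf X (onek k)) x <= C"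
  shows "sbd k X C"
  unfolding sbd_def
proof (intro allI impI)
  fix f :: "(real ^ 'a) \<Rightarrow>\<^sub>C real" and a x assume f: "\<forall>x. \<bar>ev k f x\<bar> <= a"
  then have a: "0 <= a" by (meson abs_ge_zero order.trans)
  have "ev k (blf X f) x <= ev k (blf X (a *\<^sub>R onek k)) x"
    using f k by (intro bpos_mono X) (auto simp: abs_le_iff)
  moreover have "ev k (blf X (- f)) x <= ev k (blf X (a *\<^sub>R onek k)) x"
    using f k by (intro bpos_mono X) (auto simp: abs_le_iff)
  moreover have "ev k (blf X (a *\<^sub>R onek k)) x <= C * a"
    using mult_right_mono[OF 1[of x] a] by (simp add: blinfun.scaleR_right mult.commute)
  ultimately show "\<bar>ev k (blf X f) x\<bar> <= C * a"
    by (simp add: blinfun.minus_right)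
qed

lemma sbd_mult: "sbd k X C ==> sbd k Y D ==> sbd k (X * Y) (C * D)"
  unfolding sbd_def by (auto simp: mult.assoc)

lemma sbd_add: "sbd k X C ==> sbd k Y D ==> sbd k (X + Y) (C + D)"
  unfolding sbd_def by (auto simp: distrib_right intro!: order.trans[OF abs_triangle_ineq] add_mono)

lemma sbd_minus: "sbd k X C ==> sbd k (- X) C"
  unfolding sbd_def by (auto)

lemma sbd_diff: "sbd k X C ==> sbd k Y D ==> sbd k (X - Y) (C + D)"
  using sbd_add[OF _ sbd_minus] by force

lemma sbd_scale: "sbd k X C ==> sbd k (a *\<^sub>R X) (\<bar>a\<bar> * C)"
  unfolding sbd_def by (auto simp: abs_mult mult.assoc mult_left_mono)

lemma sbd_sum: "(\<And>i. i \<in> A ==> sbd k (X i) (C i)) ==> sbd k (sum X A) (sum C A)"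
proof (induction A rule: infinite_finite_induct)
  case (insert x F)
  then show ?case by (simp add: sbd_add)
qed (auto simp: sbd_def)

lemma sbd_1: "sbd k 1 1"
  by (auto simp: sbd_def)

lemma sbd_power: "sbd k X C ==> sbd k (X ^ n) (C ^ n)"
  by (induction n) (auto intro: sbd_mult sbd_1)

lemma sbd_mono: "sbd k X C ==> C <= D ==> sbd k X D"
  unfolding sbd_def by (meson abs_ge_zero mult_right_mono order.trans)

subsection \<open>Scaling of Lebesgue measure\<close>

lemma nn_integral_scale:
  fixes f :: "real ^ 'n => ennreal"
  assumes [measurable]: "f \<in> borel_measurable borel" and c: "0 < c"
  shows "(\<integral>\<^sup>+x. f x \<partial>lborel) = ennreal (c ^ CARD('n)) * (\<integral>\<^sup>+x. f (t + c *\<^sub>R x) \<partial>lborel)"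
  using c by (subst lborel_affine[of c t]) (auto simp: nn_integral_density nn_integral_distr nn_integral_cmult)

lemma integrable_scale_iff:
  fixes f :: "real ^ 'n => real"
  assumes [measurable]: "f \<in> borel_measurable borel" and c: "0 < c"
  shows "integrable lborel (\<lambda>x. f (t + c *\<^sub>R x)) \<longleftrightarrow> integrable lborel f"
proof -
  have "integrable lborel f \<longleftrightarrow> (\<integral>\<^sup>+x. norm (f x) \<partial>lborel) < \<infinity>"
    by (simp add: integrable_iff_bounded)
  also have "... \<longleftrightarrow> (\<integral>\<^sup>+x. norm (f (t + c *\<^sub>R x)) \<partial>lborel) < \<infinity>"
    using c by (subst nn_integral_scale[OF _ c, of _ t]) (auto simp: ennreal_mult_less_top)
  finally show ?thesis by (simp add: integrable_iff_bounded)
qed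

lemma integral_scale:
  fixes f :: "real ^ 'n => real"
  assumes [measurable]: "f \<in> borel_measurable borel" and c: "0 < c"
  shows "(LBINT x. f x) = c ^ CARD('n) * (LBINT x. f (t + c *\<^sub>R x))"
  using c by (subst lborel_affine[of c t]) (auto simp: integral_density integral_distr)

lemma
  fixes f :: "real ^ 'n => real"
  assumes f[measurable]: "f \<in> borel_measurable borel"
  shows integrable_shift_iff: "integrable lborel (\<lambda>x. f (x + t)) \<longleftrightarrow> integrable lborel f"
    and integral_shift: "(LBINT x. f (x + t)) = (LBINT x. f x)"
  using integrable_scale_iff[OF f, of 1 t] integral_scale[OF f, of 1 t] by (auto simp: add.commute)

lemma borel_measurable_rescale [measurable]:
  assumes [measurable]: "f \<in> borel_measurable borel" shows "rescale \<sigma> f \<in> borel_measurable borel"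
  unfolding rescale_def by measurable

lemma integral_rescale:
  fixes g J :: "real ^ 'n => real"
  assumes [measurable]: "g \<in> borel_measurable borel" "J \<in> borel_measurable borel" and s: "0 < \<sigma>"
  shows "(LBINT y. g y * rescale \<sigma> J y) = (LBINT z. g (\<sigma> *\<^sub>R z) * J z)"
    and "integrable lborel (\<lambda>y. g y * rescale \<sigma> J y) \<longleftrightarrow> integrable lborel (\<lambda>z. g (\<sigma> *\<^sub>R z) * J z)"
proof -
  have e: "g (\<sigma> *\<^sub>R z) * rescale \<sigma> J (\<sigma> *\<^sub>R z) = inverse (\<sigma> ^ CARD('n)) * (g (\<sigma> *\<^sub>R z) * J z)" for z
    using s by (simp add: rescale_def field_simps)
  show "(LBINT y. g y * rescale \<sigma> J y) = (LBINT z. g (\<sigma> *\<^sub>R z) * J z)"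
    using s by (subst integral_scale[OF _ s, of _ 0]) (simp_all add: e)
  show "integrable lborel (\<lambda>y. g y * rescale \<sigma> J y) \<longleftrightarrow> integrable lborel (\<lambda>z. g (\<sigma> *\<^sub>R z) * J z)"
    using s by (subst integrable_scale_iff[OF _ s, of _ 0, symmetric]) (simp_all add: e)
qed

lemma abs_rescale: "0 < \<sigma> ==> \<bar>rescale \<sigma> J y\<bar> = rescale \<sigma> (\<lambda>z. \<bar>J z\<bar>) y"
  by (simp add: rescale_def)

lemma kw_scale_le:
  assumes "0 <= k" "0 < \<sigma>" shows "kw k (\<sigma> *\<^sub>R z) <= max 1 \<sigma> powr k * kw k z"
proof -
  have "1 + \<sigma> * norm z <= max 1 \<sigma> + max 1 \<sigma> * norm z"
    by (intro add_mono mult_right_mono) auto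
  then have "(1 + norm (\<sigma> *\<^sub>R z)) powr k <= (max 1 \<sigma> * (1 + norm z)) powr k"
    using assms by (intro powr_mono2) (auto simp: algebra_simps)
  then show ?thesis by (simp add: kw_def powr_mult)
qed

lemma wkernel_rescale:
  fixes J :: "real ^ 'n => real"
  assumes k: "0 <= k" and J: "wkernel k J" and s: "0 < \<sigma>"
  shows "wkernel k (rescale \<sigma> J)" "kn k (rescale \<sigma> J) <= max 1 \<sigma> powr k * kn k J"
proof -
  have [measurable]: "J \<in> borel_measurable borel" using J by (simp add: wkernel_def)
  have i: "integrable lborel (\<lambda>z. max 1 \<sigma> powr k * (kw k z * \<bar>J z\<bar>))"
    using J by (intro integrable_mult_right) (simp add: wkernel_def)
  have b: "kw k (\<sigma> *\<^sub>R z) * \<bar>J z\<bar> <= max 1 \<sigma> powr k * (kw k z * \<bar>J z\<bar>)" for z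
    using mult_right_mono[OF kw_scale_le[OF k s, of z], of "\<bar>J z\<bar>"] by (simp add: mult.assoc)
  have i2: "integrable lborel (\<lambda>z. kw k (\<sigma> *\<^sub>R z) * \<bar>J z\<bar>)"
    by (rule Bochner_Integration.integrable_bound[OF i]) (use b in \<open>auto intro!: AE_I2 order.trans[OF _ abs_ge_self]\<close>)
  then have "integrable lborel (\<lambda>z. kw k z * rescale \<sigma> (\<lambda>z. \<bar>J z\<bar>) z)"
    by (subst integral_rescale(2)[OF _ _ s]) auto
  then show "wkernel k (rescale \<sigma> J)"
    by (simp add: wkernel_def abs_rescale[OF s])
  have "kn k (rescale \<sigma> J) = (LBINT z. kw k (\<sigma> *\<^sub>R z) * \<bar>J z\<bar>)"
    unfolding kn_def abs_rescale[OF s] by (rule integral_rescale(1)[OF _ _ s]) auto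
  also have "... <= (LBINT z. max 1 \<sigma> powr k * (kw k z * \<bar>J z\<bar>))"
    by (intro integral_mono i i2 b)
  finally show "kn k (rescale \<sigma> J) <= max 1 \<sigma> powr k * kn k J"
    by (simp add: kn_def)
qed

subsection \<open>Approximation by continuous functions of compact support\<close>

definition cutoff :: "real => real ^ 'n => real" where
  "cutoff N x = max 0 (min 1 (N + 1 - norm x))"

lemma cutoff_bounds: "0 <= cutoff N x" "cutoff N x <= 1" "cutoff N x \<noteq> 0 ==> norm x <= N + 1"
  by (auto simp: cutoff_def)

lemma cutoff_tendsto: "(\<lambda>n. cutoff (real n) x) \<longlonglongrightarrow> 1"
proof (rule tendsto_eventually)
  obtain m :: nat where "norm x <= real m" using real_arch_simple by blast
  then show "\<forall>\<^sub>F n in sequentially. cutoff (real n) x = 1"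
    by (auto simp: eventually_sequentially cutoff_def intro!: exI[of _ m])
qed

lemma continuous_on_cutoff [continuous_intros]: "continuous_on S f ==> continuous_on S (\<lambda>x. cutoff N (f x))"
  unfolding cutoff_def by (intro continuous_intros)

lemma borel_measurable_cutoff [measurable]: "cutoff N \<in> borel_measurable borel"
  by (intro borel_measurable_continuous_onI continuous_intros)

text \<open>Such an approximation off a negligible set is the definition of
  \<open>measurable_on\<close>.\<close>

lemma measurable_continuous_AE_limit:
  fixes f :: "real ^ 'n => real"
  assumes f: "f \<in> borel_measurable lebesgue"
  obtains g where "\<And>n. continuous_on UNIV (g n)" "AE x in lebesgue. (\<lambda>n::nat. g n x) \<longlonglongrightarrow> f x"
proof -
  have "f measurable_on UNIV" 
    using f lebesgue_measurable_imp_measurable_on_real[of f UNIV] by auto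
  then obtain N g where N: "negligible N" and g: "\<And>n. continuous_on UNIV (g n)"
    and l: "\<And>x. x \<notin> N ==> (\<lambda>n::nat. g n x) \<longlonglongrightarrow> f x"
    unfolding measurable_on_def by auto
  have "AE x in lebesgue. x \<notin> N"
    using N negligible_iff_null_sets AE_not_in by blast
  then have "AE x in lebesgue. (\<lambda>n. g n x) \<longlonglongrightarrow> f x"
    by eventually_elim (rule l)
  with that g show ?thesis by blast
qed

lemma integrable_indicator_cball: "integrable lborel (\<lambda>x::real ^ 'n. c * indicator (cball 0 R) x :: real)"
  using emeasure_bounded_finite[of "cball (0 :: real ^ 'n) R"]
  by (intro integrable_mult_right integrable_real_indicator) auto

text \<open>Truncation in size and space comes before the passage to continuous functions, so that
  the second limit has a bounded majorant of bounded support. The last clause preserves the range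
  [0, 1], which the bound for two jumps relies on.\<close>

lemma continuous_approximation:
  fixes f :: "real ^ 'n => real"
  assumes k: "0 <= k" and f: "wkernel k f" and e: "0 < e"
  obtains g R M where "continuous_on UNIV g" "\<And>x. R < norm x ==> g x = 0" "\<And>x. \<bar>g x\<bar> <= M" "0 <= M" "wkernel k g"
    "kn k (\<lambda>x. f x - g x) < e" "(\<forall>x. 0 <= f x \<and> f x <= 1) \<longrightarrow> (\<forall>x. 0 <= g x \<and> g x <= 1)"
proof -
  have fm[measurable]: "f \<in> borel_measurable borel" using f by (simp add: wkernel_def)
  \<comment> \<open>The clipping levels are 0 and 1 if \<open>f\<close> has values there, and - n
    and n otherwise; in both cases clipping does not increase the absolute value.\<close>
  define lo where "lo = (if \<forall>x. 0 <= f x \<and> f x <= 1 then (\<lambda>n::nat. 0) else (\<lambda>n. - real n))"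
  define hi where "hi = (if \<forall>x. 0 <= f x \<and> f x <= 1 then (\<lambda>n::nat. 1) else (\<lambda>n. real n))"
  define clip where "clip n t = max (lo n) (min (hi n) t)" for n t
  have clipb: "\<bar>clip n t\<bar> <= real n + 1" for n t
    by (auto simp: clip_def lo_def hi_def)
  have clipf: "\<bar>clip n (f x)\<bar> <= \<bar>f x\<bar>" for n x
    by (auto simp: clip_def lo_def hi_def)
  have cliplim: "(\<lambda>n. clip n (f x)) \<longlonglongrightarrow> f x" for x
  proof (rule tendsto_eventually)
    obtain m :: nat where m: "\<bar>f x\<bar> <= real m" using real_arch_simple by blast
    have "clip n (f x) = f x" if "m <= n" for n
    proof -
      have "\<bar>f x\<bar> <= real n" using m that by linarith
      then show ?thesis by (auto simp: clip_def lo_def hi_def)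
    qed
    then show "\<forall>\<^sub>F n in sequentially. clip n (f x) = f x"
      by (auto simp: eventually_sequentially intro!: exI[of _ m])
  qed
  have [measurable]: "(\<lambda>x. clip n (h x)) \<in> borel_measurable borel" if [measurable]: "h \<in> borel_measurable borel" for n and h :: "real ^ 'n => real"
    unfolding clip_def by measurable
  have int: "integrable lborel (\<lambda>y. 2 * (kw k y * \<bar>f y\<bar>))"
    using f by (simp add: wkernel_def)
  have "(\<lambda>n. (LBINT x. kw k x * \<bar>f x - cutoff (real n) x * clip n (f x)\<bar>)) \<longlonglongrightarrow> (\<integral>x. 0 \<partial>(lborel :: (real ^ 'n) measure))"
  proof (rule integral_dominated_convergence[OF _ _ int])
    show "AE x in lborel. (\<lambda>n. kw k x * \<bar>f x - cutoff (real n) x * clip n (f x)\<bar>) \<longlonglongrightarrow> 0"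
    proof (intro AE_I2)
      fix x
      have "(\<lambda>n. kw k x * \<bar>f x - cutoff (real n) x * clip n (f x)\<bar>) \<longlonglongrightarrow> kw k x * \<bar>f x - 1 * f x\<bar>"
        by (intro tendsto_intros cutoff_tendsto cliplim)
      then show "(\<lambda>n. kw k x * \<bar>f x - cutoff (real n) x * clip n (f x)\<bar>) \<longlonglongrightarrow> 0" by simp
    qed
    show "AE x in lborel. norm (kw k x * \<bar>f x - cutoff (real n) x * clip n (f x)\<bar>) <= 2 * (kw k x * \<bar>f x\<bar>)" for n
    proof (intro AE_I2)
      fix x
      have "\<bar>cutoff (real n) x * clip n (f x)\<bar> <= 1 * \<bar>f x\<bar>"
        unfolding abs_mult using cutoff_bounds[of "real n" x] clipf[of n x] by (intro mult_mono) auto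
      then have "\<bar>f x - cutoff (real n) x * clip n (f x)\<bar> <= 2 * \<bar>f x\<bar>" by linarith
      from mult_left_mono[OF this, of "kw k x"] show "norm (kw k x * \<bar>f x - cutoff (real n) x * clip n (f x)\<bar>) <= 2 * (kw k x * \<bar>f x\<bar>)"
        by (simp add: abs_mult)
    qed
  qed measurable
  then have "\<forall>\<^sub>F n in sequentially. (LBINT x. kw k x * \<bar>f x - cutoff (real n) x * clip n (f x)\<bar>) < e / 2"
    using e by (intro order_tendstoD(2)) auto
  then obtain n where n: "(LBINT x. kw k x * \<bar>f x - cutoff (real n) x * clip n (f x)\<bar>) < e / 2"
    using eventually_happens'[OF sequentially_bot] by blast
  obtain g where g: "\<And>m. continuous_on UNIV (g m)" and gl: "AE x in lebesgue. (\<lambda>m::nat. g m x) \<longlonglongrightarrow> f x"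
    using measurable_continuous_AE_limit[of f] measurable_completion[of f lborel borel] fm by auto
  have gl: "AE x in lborel. (\<lambda>m::nat. g m x) \<longlonglongrightarrow> f x"
    using gl AE_completion_iff by blast
  have gm[measurable]: "g m \<in> borel_measurable borel" for m using g by (rule borel_measurable_continuous_onI)
  \<comment> \<open>The continuous approximants receive the same clipping and cutoff as
    \<open>f'\<close>, so both are bounded by \<open>R\<close> and vanish outside the ball of radius
    \<open>R\<close>.\<close>
  define h where "h m x = cutoff (real n) x * clip n (g m x)" for m x
  define f' where "f' x = cutoff (real n) x * clip n (f x)" for x
  define R where "R = real n + 1"
  have hc: "continuous_on UNIV (h m)" for m
    unfolding h_def clip_def by (intro continuous_intros g)
  have hm[measurable]: "h m \<in> borel_measurable borel" for m using hc by (rule borel_measurable_continuous_onI)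
  have f'm[measurable]: "f' \<in> borel_measurable borel" unfolding f'_def by measurable
  have hR: "h m x = 0" "f' x = 0" if "R < norm x" for m x
    using that cutoff_bounds(3)[of "real n" x] by (auto simp: h_def f'_def R_def)
  have hb: "\<bar>h m x\<bar> <= R" "\<bar>f' x\<bar> <= R" for m x
  proof -
    have "\<bar>cutoff (real n) x * clip n t\<bar> <= 1 * R" for t
      unfolding abs_mult R_def using cutoff_bounds[of "real n" x] clipb[of n t] by (intro mult_mono) auto
    then show "\<bar>h m x\<bar> <= R" "\<bar>f' x\<bar> <= R" by (auto simp: h_def f'_def)
  qed
  have kwR: "kw k x <= (1 + R) powr k" if "norm x <= R" for x :: "real ^ 'n"
    unfolding kw_def using k that by (intro powr_mono2) auto
  have wk: "wkernel k q" if [measurable]: "q \<in> borel_measurable borel" and "\<And>x. R < norm x ==> q x = 0" "\<And>x. \<bar>q x\<bar> <= R" for q :: "real ^ 'n => real"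
  proof -
    have "integrable lborel (\<lambda>x. kw k x * \<bar>q x\<bar>)"
    proof (rule Bochner_Integration.integrable_bound[OF integrable_indicator_cball[of "(1 + R) powr k * R" R]])
      have "norm (kw k x * \<bar>q x\<bar>) <= norm ((1 + R) powr k * R * indicator (cball 0 R) x)" for x
      proof (cases "norm x <= R")
        case True
        have "kw k x * \<bar>q x\<bar> <= (1 + R) powr k * R"
          using that(3)[of x] kwR[OF True] by (intro mult_mono) auto
        moreover have "0 <= R" using that(3)[of x] by linarith
        ultimately show ?thesis using True by (simp add: abs_mult)
      qed (simp add: that(2))
      then show "AE x in lborel. norm (kw k x * \<bar>q x\<bar>) <= norm ((1 + R) powr k * R * indicator (cball 0 R) x)"
        by auto
    qed measurable
    then show ?thesis by (simp add: wkernel_def)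
  qed
  have wh: "wkernel k (h m)" for m by (intro wk hR hb hm)
  have wf': "wkernel k f'" by (intro wk hR hb f'm)
  have "(\<lambda>m. (LBINT x. kw k x * \<bar>f' x - h m x\<bar>)) \<longlonglongrightarrow> (\<integral>x. 0 \<partial>(lborel :: (real ^ 'n) measure))"
  proof (rule integral_dominated_convergence[OF _ _ integrable_indicator_cball[of "(1 + R) powr k * (2 * R)" R]])
    show "AE x in lborel. (\<lambda>m. kw k x * \<bar>f' x - h m x\<bar>) \<longlonglongrightarrow> 0"
      using gl
    proof eventually_elim
      fix x assume "(\<lambda>m. g m x) \<longlonglongrightarrow> f x"
      then have "(\<lambda>m. kw k x * \<bar>f' x - h m x\<bar>) \<longlonglongrightarrow> kw k x * \<bar>f' x - f' x\<bar>"
        unfolding h_def f'_def clip_def by (intro tendsto_intros)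
      then show "(\<lambda>m. kw k x * \<bar>f' x - h m x\<bar>) \<longlonglongrightarrow> 0" by simp
    qed
    show "AE x in lborel. norm (kw k x * \<bar>f' x - h m x\<bar>) <= (1 + R) powr k * (2 * R) * indicator (cball 0 R) x" for m
    proof (intro AE_I2)
      fix x show "norm (kw k x * \<bar>f' x - h m x\<bar>) <= (1 + R) powr k * (2 * R) * indicator (cball 0 R) x"
      proof (cases "norm x <= R")
        case True
        have "\<bar>f' x - h m x\<bar> <= 2 * R" using hb(1)[of m x] hb(2)[of x] by linarith
        then show ?thesis using True kwR[OF True] by (auto simp: abs_mult intro!: mult_mono)
      qed (use hR[of x] in auto)
    qed
  qed measurable
  then have "\<forall>\<^sub>F m in sequentially. (LBINT x. kw k x * \<bar>f' x - h m x\<bar>) < e / 2"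
    using e by (intro order_tendstoD(2)) auto
  then obtain m where m: "(LBINT x. kw k x * \<bar>f' x - h m x\<bar>) < e / 2"
    using eventually_happens'[OF sequentially_bot] by blast
  have "kn k (\<lambda>x. f x - h m x) <= (LBINT x. kw k x * \<bar>f x - f' x\<bar> + kw k x * \<bar>f' x - h m x\<bar>)"
    unfolding kn_def
  proof (rule integral_mono)
    show "kw k x * \<bar>f x - h m x\<bar> <= kw k x * \<bar>f x - f' x\<bar> + kw k x * \<bar>f' x - h m x\<bar>" for x
      unfolding distrib_left[symmetric] by (intro mult_left_mono) auto
  qed (use wkernel_diff[OF f wh[of m]] wkernel_diff[OF f wf'] wkernel_diff[OF wf' wh[of m]] in \<open>auto simp: wkernel_def\<close>)
  also have "... = (LBINT x. kw k x * \<bar>f x - f' x\<bar>) + (LBINT x. kw k x * \<bar>f' x - h m x\<bar>)"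
    using wkernel_diff[OF f wf'] wkernel_diff[OF wf' wh[of m]]
    by (intro Bochner_Integration.integral_add) (auto simp: wkernel_def)
  also have "... < e" using n m unfolding f'_def by linarith
  finally have fin: "kn k (\<lambda>x. f x - h m x) < e" .
  have last: "(\<forall>x. 0 <= f x \<and> f x <= 1) \<longrightarrow> (\<forall>x. 0 <= h m x \<and> h m x <= 1)"
  proof (intro impI allI)
    fix x assume a: "\<forall>x. 0 <= f x \<and> f x <= 1"
    have "0 <= clip n (g m x)" "clip n (g m x) <= 1"
      unfolding clip_def lo_def hi_def using a by auto
    then show "0 <= h m x \<and> h m x <= 1"
      unfolding h_def using cutoff_bounds[of "real n" x] by (auto intro: mult_le_one)
  qed
  have R0: "0 <= R" by (simp add: R_def)
  show ?thesis
    by (rule that[of "h m" R R]) (use hc hR hb wh fin last R0 in auto)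
qed

text \<open>Dilation is continuous in weighted L1: clear for continuous kernels of compact support,
  and passed on by density, since dilations in a bounded range of scales are uniformly bounded.
  Convergence in operator norm makes the generator a continuous path, so that its integral lies in
  the algebra.\<close>

lemma tendsto_rescale_kernel:
  fixes J :: "real ^ 'n => real"
  assumes k: "0 <= k" and J: "wkernel k J" and lim: "\<sigma> \<longlonglongrightarrow> s" and pos: "\<And>n. 0 < \<sigma> n" and s: "0 < s"
  shows "(\<lambda>n. cop k (rescale (\<sigma> n) J)) \<longlonglongrightarrow> cop k (rescale s J)"
proof (rule metric_LIMSEQ_I)
  fix e :: real assume e: "0 < e"
  obtain B where B: "\<And>n. \<sigma> n <= B" "s <= B" "1 <= B"
  proof -
    obtain b where b: "\<And>n. \<bar>\<sigma> n\<bar> <= b"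
      using convergent_imp_Bseq[OF convergentI[OF lim]] unfolding Bseq_def by auto
    show thesis
      by (rule that[of "max b (max s 1)"]) (use b in \<open>auto simp: abs_le_iff le_max_iff_disj\<close>)
  qed
  define C where "C = B powr k"
  have C: "0 < C" using B(3) by (simp add: C_def)
  \<comment> \<open>Two approximation errors of at most e/4 and the error below e/2 of the compactly
    supported kernel add up to less than e.\<close>
  define e' where "e' = e / (4 * C)"
  have e': "0 < e'" using e C by (simp add: e'_def)
  obtain g R M where g: "continuous_on UNIV g" "\<And>x. R < norm x ==> g x = 0" "\<And>x. \<bar>g x\<bar> <= M" "0 <= M" "wkernel k g"
    and ge: "kn k (\<lambda>x. J x - g x) < e'"
    using continuous_approximation[OF k J e'] by metis
  have [measurable]: "g \<in> borel_measurable borel" "J \<in> borel_measurable borel"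
    using g(5) J by (auto simp: wkernel_def)
  have near: "norm (cop k (rescale r J) - cop k (rescale r g)) <= C * e'" if "0 < r" "r <= B" for r
  proof -
    have "cop k (rescale r J) - cop k (rescale r g) = cop k (\<lambda>y. rescale r J y - rescale r g y)"
      using that by (subst cop_diff) (auto intro!: k wkernel_rescale J g)
    also have "(\<lambda>y. rescale r J y - rescale r g y) = rescale r (\<lambda>x. J x - g x)"
      by (auto simp: rescale_def diff_divide_distrib)
    also have "norm (cop k (rescale r (\<lambda>x. J x - g x))) <= max 1 r powr k * kn k (\<lambda>x. J x - g x)"
      using that by (intro order.trans[OF ev_cop(2)] wkernel_rescale wkernel_diff k J g)
    also have "... <= C * e'" unfolding C_def
      using that B ge k by (intro mult_mono powr_mono2 kn_nonneg) auto
    finally show ?thesis .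
  qed
  have [simp]: "(\<lambda>n. rescale (\<sigma> n) g y) \<longlonglongrightarrow> rescale s g y" for y
  proof -
    have "(\<lambda>n. g (y /\<^sub>R \<sigma> n)) \<longlonglongrightarrow> g (y /\<^sub>R s)"
      using s by (intro continuous_on_tendsto_compose[OF g(1)] tendsto_intros lim) auto
    then show ?thesis unfolding rescale_def using s by (intro tendsto_intros lim) auto
  qed
  \<comment> \<open>A positive lower bound for all scales: the factor \<open>r ^ CARD('n)\<close> in
    the denominator of a rescaled kernel must stay away from 0.\<close>
  obtain d where d: "0 < d" "\<And>n. d <= \<sigma> n" "d <= s"
  proof -
    have "\<forall>\<^sub>F n in sequentially. s / 2 < \<sigma> n" using lim s by (intro order_tendstoD) auto
    then obtain N where N: "\<And>n. N <= n ==> s / 2 < \<sigma> n" by (auto simp: eventually_sequentially)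
    define d where "d = Min (insert (s/2) (\<sigma> ` {..<N}))"
    have "0 < d" unfolding d_def using s pos by (subst Min_gr_iff) auto
    moreover have "d <= \<sigma> n" for n
    proof (cases "n < N")
      case True then show ?thesis unfolding d_def by (intro Min_le) auto
    next
      case False
      have "d <= s / 2" unfolding d_def by (intro Min_le) auto
      then show ?thesis using N[of n] False by linarith
    qed
    moreover have "d <= s / 2" unfolding d_def by (intro Min_le) auto
    then have "d <= s" using s by linarith
    ultimately show thesis using that by blast
  qed
  have bd: "\<bar>rescale r g y\<bar> <= M / d ^ CARD('n) * indicator (cball 0 (B * R)) y" if "d <= r" "r <= B" for r y
  proof (cases "B * R < norm y")
    case True
    have "R < norm (y /\<^sub>R r)"
    proof -
      have "R * r < norm y"
      proof (cases "0 <= R")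
        case True' : True
        then have "R * r <= R * B" using that by (intro mult_left_mono) auto
        then show ?thesis using True by (simp add: mult.commute)
      next
        case False
        then have "R * r < 0" using that d by (intro mult_neg_pos) auto
        then show ?thesis using norm_ge_zero[of y] by linarith
      qed
      then show ?thesis using that d by (simp add: field_simps)
    qed
    then have "g (y /\<^sub>R r) = 0" by (rule g(2))
    then show ?thesis using True by (simp add: rescale_def)
  next
    case False
    have "\<bar>g (y /\<^sub>R r)\<bar> / r ^ CARD('n) <= M / d ^ CARD('n)"
      using that d g(3,4) by (intro frac_le power_mono zero_less_power) auto
    then show ?thesis using False that d by (simp add: rescale_def)
  qed
  have kwB: "kw k y <= (1 + B * R) powr k" if "norm y <= B * R" for y :: "real ^ 'n"
    unfolding kw_def using k that by (intro powr_mono2) auto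
  have "(\<lambda>n. (LBINT y. kw k y * \<bar>rescale (\<sigma> n) g y - rescale s g y\<bar>)) \<longlonglongrightarrow> (\<integral>y. 0 \<partial>(lborel :: (real ^ 'n) measure))"
  proof (rule integral_dominated_convergence[OF _ _ integrable_indicator_cball[of "(1 + B * R) powr k * (2 * (M / d ^ CARD('n)))" "B * R"]])
    show "AE y in lborel. (\<lambda>n. kw k y * \<bar>rescale (\<sigma> n) g y - rescale s g y\<bar>) \<longlonglongrightarrow> 0"
    proof (intro AE_I2)
      fix y
      have "(\<lambda>n. kw k y * \<bar>rescale (\<sigma> n) g y - rescale s g y\<bar>) \<longlonglongrightarrow> kw k y * \<bar>rescale s g y - rescale s g y\<bar>"
        by (intro tendsto_intros) simp
      then show "(\<lambda>n. kw k y * \<bar>rescale (\<sigma> n) g y - rescale s g y\<bar>) \<longlonglongrightarrow> 0" by simp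
    qed
    show "AE y in lborel. norm (kw k y * \<bar>rescale (\<sigma> n) g y - rescale s g y\<bar>)
       <= (1 + B * R) powr k * (2 * (M / d ^ CARD('n))) * indicator (cball 0 (B * R)) y" for n
    proof (intro AE_I2)
      fix y :: "real ^ 'n"
      have "\<bar>rescale (\<sigma> n) g y - rescale s g y\<bar> <= (2 * (M / d ^ CARD('n))) * indicator (cball 0 (B * R)) y"
        using bd[OF d(2)[of n] B(1), of y] bd[OF d(3) B(2), of y] by linarith
      then have "kw k y * \<bar>rescale (\<sigma> n) g y - rescale s g y\<bar> <= kw k y * ((2 * (M / d ^ CARD('n))) * indicator (cball 0 (B * R)) y)"
        by (intro mult_left_mono) auto
      also have "... <= (1 + B * R) powr k * ((2 * (M / d ^ CARD('n))) * indicator (cball 0 (B * R)) y)"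
        using kwB[of y] g(4) d by (cases "norm y <= B * R") (auto intro!: mult_right_mono divide_right_mono)
      finally show "norm (kw k y * \<bar>rescale (\<sigma> n) g y - rescale s g y\<bar>)
        <= (1 + B * R) powr k * (2 * (M / d ^ CARD('n))) * indicator (cball 0 (B * R)) y"
        by (simp add: abs_mult mult.assoc)
    qed
  qed measurable
  then have "\<forall>\<^sub>F n in sequentially. (LBINT y. kw k y * \<bar>rescale (\<sigma> n) g y - rescale s g y\<bar>) < e / 2"
    using e by (intro order_tendstoD(2)) auto
  then obtain N where N: "\<And>n. N <= n ==> kn k (\<lambda>y. rescale (\<sigma> n) g y - rescale s g y) < e / 2"
    by (auto simp: eventually_sequentially kn_def)
  have "dist (cop k (rescale (\<sigma> n) J)) (cop k (rescale s J)) < e" if "N <= n" for n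
  proof -
    have "norm (cop k (rescale (\<sigma> n) g) - cop k (rescale s g)) <= kn k (\<lambda>y. rescale (\<sigma> n) g y - rescale s g y)"
      using pos s by (subst cop_diff[symmetric]) (auto intro!: k wkernel_rescale g(5) ev_cop(2) wkernel_diff)
    also have "... < e / 2" using N that .
    finally have "norm (cop k (rescale (\<sigma> n) g) - cop k (rescale s g)) < e / 2" .
    moreover have "C * e' = e / 4" using C by (simp add: e'_def)
    moreover have "norm ((cop k (rescale (\<sigma> n) J) - cop k (rescale (\<sigma> n) g)) + (cop k (rescale (\<sigma> n) g) - cop k (rescale s g)) + (cop k (rescale s g) - cop k (rescale s J)))
      <= norm (cop k (rescale (\<sigma> n) J) - cop k (rescale (\<sigma> n) g)) + norm (cop k (rescale (\<sigma> n) g) - cop k (rescale s g)) + norm (cop k (rescale s g) - cop k (rescale s J))"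
      by (intro order.trans[OF norm_triangle_ineq] add_mono norm_triangle_ineq order.refl)
    ultimately show ?thesis using near[OF pos[of n] B(1)] near[OF s B(2)]
      by (simp add: dist_norm norm_minus_commute)
  qed
  then show "\<exists>N. \<forall>n\<ge>N. dist (cop k (rescale (\<sigma> n) J)) (cop k (rescale s J)) < e" by blast
qed

subsection \<open>The evolution family of the jump process\<close>

lemma commute_exp:
  fixes X A :: "'a::{real_normed_algebra_1,banach}"
  assumes "X * A = A * X" shows "X * exp A = exp A * X"
proof (rule LIMSEQ_unique)
  have l: "(\<lambda>n. \<Sum>i<n. A ^ i /\<^sub>R fact i) \<longlonglongrightarrow> exp A"
    using exp_converges[of A] by (simp add: sums_def)
  show "(\<lambda>n. X * (\<Sum>i<n. A ^ i /\<^sub>R fact i)) \<longlonglongrightarrow> X * exp A"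
    by (intro tendsto_intros l)
  have "(\<lambda>n. (\<Sum>i<n. A ^ i /\<^sub>R fact i) * X) \<longlonglongrightarrow> exp A * X"
    by (intro tendsto_intros l)
  moreover have "X * A ^ i = A ^ i * X" for i
    using power_commuting_commutes[of A X i] assms by simp
  ultimately show "(\<lambda>n. X * (\<Sum>i<n. A ^ i /\<^sub>R fact i)) \<longlonglongrightarrow> exp A * X"
    by (simp add: sum_distrib_left sum_distrib_right)
qed

lemma commute_integral:
  fixes X :: "'a::{real_normed_algebra_1,banach}" and F :: "real => 'a"
  assumes "F integrable_on S" and "\<And>q. X * F q = F q * X"
  shows "X * integral S F = integral S F * X"
proof -
  have "X * integral S F = integral S (\<lambda>q. X * F q)"
    using integral_linear[OF assms(1) bounded_linear_mult_right[of X]] by (simp add: comp_def)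
  also have "... = integral S F * X"
    using integral_linear[OF assms(1) bounded_linear_mult_left[of X]] by (simp add: comp_def assms(2))
  finally show ?thesis .
qed

text \<open>The loss part of the generator is a multiple of the identity. Splitting it off leaves
  the exponential of a positive operator, which shows positivity of the evolution.\<close>

lemma exp_minus_scaleR_1:
  fixes A :: "'a::{real_normed_algebra_1,banach}"
  shows "exp (A - c *\<^sub>R 1) = exp (- c) *\<^sub>R exp A"
proof -
  have "exp (A + of_real (- c)) = exp A * exp (of_real (- c))"
    by (rule exp_add_commuting) (simp add: scaleR_conv_of_real[symmetric] of_real_def)
  also have "exp (of_real (- c)) = (of_real (exp (- c)) :: 'a)"
    by (rule exp_of_real)
  finally show ?thesis by (simp add: of_real_def)
qed

lemma blf_exp_fixed:
  assumes "blf A f = 0" shows "blf (exp A) f = f"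
proof -
  have "(\<lambda>n. \<Sum>i<n. A ^ i /\<^sub>R fact i) \<longlonglongrightarrow> exp A"
    using exp_converges[of A] by (simp add: sums_def)
  then have "(\<lambda>n. blf (\<Sum>i<n. A ^ i /\<^sub>R fact i) f) \<longlonglongrightarrow> blf (exp A) f"
    by (intro blf.tendsto tendsto_const)
  \<comment> \<open>The empty partial sum is 0 and does not fix \<open>f\<close>, hence the
    successor.\<close>
  moreover have "blf (\<Sum>i<Suc n. A ^ i /\<^sub>R fact i) f = f" for n
  proof (induction n)
    case (Suc n)
    have "blf (A ^ Suc n) f = 0" by (simp only: power_Suc2 blf_simps assms blf.zero_right)
    then show ?case using Suc by (simp del: power_Suc)
  qed simp
  then have "eventually (\<lambda>n. blf (\<Sum>i<n. A ^ i /\<^sub>R fact i) f = f) sequentially"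
    unfolding eventually_sequentially by (metis Suc_le_D)
  then have "(\<lambda>n. blf (\<Sum>i<n. A ^ i /\<^sub>R fact i) f) \<longlonglongrightarrow> f"
    by (rule tendsto_eventually)
  ultimately show ?thesis by (rule LIMSEQ_unique)
qed

text \<open>The exponent k + 5 is what the Taylor remainder consumes: a factor
  \<open>norm z ^ 4\<close> times a growth \<open>kw a z\<close> with a at most k + 1. The case a =
  k serves weighted functions, a = 1 a modulus of continuity of linear growth.\<close>

locale jump_kernel =
  fixes k :: real and J :: "real ^ 'n => real"
  assumes k0: "0 <= k" and Jk5: "wkernel (k + 5) J" and J0: "\<And>x. 0 <= J x"
    and J1: "(LBINT x. J x) = 1"
    and Jx: "\<And>i. (LBINT z. z $ i * J z) = 0"
    and Jxx: "\<And>i j. (LBINT z. z $ i * z $ j * J z) = (if i = j then 2 else 0)"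
    and Jxxx: "\<And>i j l. (LBINT z. z $ i * z $ j * z $ l * J z) = 0"
begin

lemma Jm [measurable]: "J \<in> borel_measurable borel"
  using Jk5 by (simp add: wkernel_def)

lemma J_integrable:
  assumes [measurable]: "g \<in> borel_measurable borel" and "\<And>z. \<bar>g z\<bar> <= C * kw (k + 5) z"
  shows "integrable lborel (\<lambda>z. g z * J z)"
  by (rule wkernel_integrable_mono[OF Jk5, of _ C])
     (use assms in \<open>auto simp: abs_mult intro!: mult_right_mono\<close>)

lemma Jk: "wkernel k J"
proof -
  have "integrable lborel (\<lambda>z. kw k z * J z)"
    by (rule J_integrable[where C=1]) (auto simp: kw_mono)
  then show ?thesis by (simp add: wkernel_def J0)
qed

definition K :: "real => 'n bop" where "K \<sigma> = cop k (rescale \<sigma> J)"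

lemma wkernel_rescale_J: "0 < \<sigma> ==> wkernel k (rescale \<sigma> J)"
  by (intro wkernel_rescale k0 Jk)

lemma ev_K: "0 < \<sigma> ==> ev k (blf (K \<sigma>) f) x = (LBINT z. ev k f (x + \<sigma> *\<^sub>R z) * J z)"
  unfolding K_def by (subst ev_cop[OF k0 wkernel_rescale_J]) (auto intro!: integral_rescale)

lemma K_one: "0 < \<sigma> ==> blf (K \<sigma>) (onek k) = onek k"
  by (rule ev_inject[of k]) (simp add: ev_K k0 J1)

lemma bpos_K: "0 < \<sigma> ==> bpos (K \<sigma>)"
  unfolding K_def by (intro bpos_cop k0 wkernel_rescale_J) (auto simp: rescale_def J0)

lemma K_commute: "0 < \<sigma> ==> 0 < \<sigma>' ==> K \<sigma> * K \<sigma>' = K \<sigma>' * K \<sigma>"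
  unfolding K_def by (intro cop_commute k0 wkernel_rescale_J)

text \<open>In the variable \<open>y = exp t x\<close> the drift disappears and the jumps acquire the length
  \<open>eps exp t\<close>. \<open>Pop eps s t\<close> transports observables backwards in time, from \<open>t\<close> to \<open>s\<close>.\<close>

definition gen :: "real => real => 'n bop" where
  "gen eps q = (1 / eps\<^sup>2) *\<^sub>R (K (eps * exp q) - 1)"

lemma continuous_on_K: "0 < eps ==> continuous_on S (\<lambda>q. K (eps * exp q))"
  unfolding continuous_on_sequentially comp_def K_def
  by (intro allI ballI impI tendsto_rescale_kernel k0 Jk) (auto intro!: tendsto_intros)

lemma continuous_on_gen: "0 < eps ==> continuous_on S (gen eps)"
  unfolding gen_def by (intro continuous_intros continuous_on_K)

text \<open>Generators at different times commute, so the exponential of this integral solves the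
  time-dependent equation.\<close>

definition acc :: "real => real => 'n bop" where "acc eps t = integral {0..t} (gen eps)"

definition Pop :: "real => real => real => 'n bop" where "Pop eps s t = exp (acc eps t - acc eps s)"

lemma commute_gen: "0 < eps ==> (\<And>\<sigma>. 0 < \<sigma> ==> X * K \<sigma> = K \<sigma> * X) ==> X * gen eps q = gen eps q * X"
  by (simp add: gen_def right_diff_distrib left_diff_distrib)

lemma commute_acc:
  assumes "0 < eps" "\<And>\<sigma>. 0 < \<sigma> ==> X * K \<sigma> = K \<sigma> * X"
  shows "X * acc eps t = acc eps t * X"
  unfolding acc_def
  by (intro commute_integral integrable_continuous_interval continuous_on_gen commute_gen assms)

lemma commute_Pop:
  assumes "0 < eps" "\<And>\<sigma>. 0 < \<sigma> ==> X * K \<sigma> = K \<sigma> * X"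
  shows "X * Pop eps s t = Pop eps s t * X"
  unfolding Pop_def
  by (rule commute_exp) (simp add: right_diff_distrib left_diff_distrib commute_acc[OF assms])

lemma acc_commute: "0 < eps ==> acc eps s * acc eps t = acc eps t * acc eps s"
  by (intro commute_acc) (auto intro!: commute_acc[symmetric] K_commute)

lemma Pop_split: "0 < eps ==> Pop eps s t = Pop eps s r * Pop eps r t"
  unfolding Pop_def
  by (subst exp_add_commuting[symmetric]) (simp_all add: algebra_simps acc_commute)

lemma Pop_same [simp]: "Pop eps s s = 1"
  by (simp add: Pop_def)

lemma shop_commute_Pop: "0 < eps ==> shop k h * Pop eps s t = Pop eps s t * shop k h"
  by (intro commute_Pop) (auto simp: K_def intro!: shop_cop_commute k0 wkernel_rescale_J)

lemma gen_commute_Pop: "0 < eps ==> gen eps q * Pop eps s t = Pop eps s t * gen eps q"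
  by (intro commute_Pop) (auto intro!: commute_gen[symmetric] K_commute)

lemma acc_has_vector_derivative:
  assumes "0 < eps" "t \<in> {0..T}"
  shows "(acc eps has_vector_derivative gen eps t) (at t within {0..T})"
  unfolding acc_def by (rule integral_has_vector_derivative[OF continuous_on_gen assms(2)]) fact

lemma Pop_has_vector_derivative_upper:
  assumes "0 < eps" "t \<in> {0..T}"
  shows "((\<lambda>t. Pop eps s t) has_vector_derivative Pop eps s t * gen eps t) (at t within {0..T})"
  unfolding Pop_def
proof (rule exp_has_vector_derivative[OF _ assms(2)])
  show "((\<lambda>t. acc eps t - acc eps s) has_vector_derivative gen eps t) (at t within {0..T})"
    using has_vector_derivative_diff[OF acc_has_vector_derivative[OF assms] has_vector_derivative_const] by simp
qed (simp add: algebra_simps acc_commute assms)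

lemma Pop_has_vector_derivative_lower:
  assumes "0 < eps" "s \<in> {0..T}"
  shows "((\<lambda>s. Pop eps s t) has_vector_derivative - (Pop eps s t * gen eps s)) (at s within {0..T})"
proof -
  have "((\<lambda>s. Pop eps s t) has_vector_derivative Pop eps s t * (- gen eps s)) (at s within {0..T})"
    unfolding Pop_def
  proof (rule exp_has_vector_derivative[OF _ assms(2)])
    show "((\<lambda>s. acc eps t - acc eps s) has_vector_derivative - gen eps s) (at s within {0..T})"
      using has_vector_derivative_diff[OF has_vector_derivative_const acc_has_vector_derivative[OF assms]] by simp
  qed (simp add: algebra_simps acc_commute assms)
  then show ?thesis by simp
qed

lemma acc_diff:
  assumes "0 < eps" "0 <= s" "s <= t"
  shows "acc eps t - acc eps s = (1 / eps\<^sup>2) *\<^sub>R integral {s..t} (\<lambda>q. K (eps * exp q)) - ((t - s) / eps\<^sup>2) *\<^sub>R 1"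
proof -
  have "acc eps t - acc eps s = integral {s..t} (gen eps)"
    unfolding acc_def
    using Henstock_Kurzweil_Integration.integral_combine[of 0 s t "gen eps"] assms
    by (simp add: algebra_simps integrable_continuous_interval continuous_on_gen)
  also have "... = (1 / eps\<^sup>2) *\<^sub>R (integral {s..t} (\<lambda>q. K (eps * exp q)) - integral {s..t} (\<lambda>q. 1))"
    unfolding gen_def
    by (subst integral_cmul, subst Henstock_Kurzweil_Integration.integral_diff)
       (auto intro!: integrable_continuous_interval continuous_on_K assms)
  finally show ?thesis using assms by (simp add: scaleR_diff_right)
qed

lemma apply_integral_K:
  assumes "0 < eps"
  shows "ev k (blf (integral {s..t} (\<lambda>q. K (eps * exp q))) f) x = integral {s..t} (\<lambda>q. ev k (blf (K (eps * exp q)) f) x)"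
    and "(\<lambda>q. ev k (blf (K (eps * exp q)) f) x) integrable_on {s..t}"
proof -
  have bl: "bounded_linear (\<lambda>X. ev k (blf X f) x)"
    using bounded_linear_compose[OF bounded_linear_ev[of k x] blf.bounded_linear_left[of f]] .
  have i: "(\<lambda>q. K (eps * exp q)) integrable_on {s..t}"
    by (intro integrable_continuous_interval continuous_on_K assms)
  show "ev k (blf (integral {s..t} (\<lambda>q. K (eps * exp q))) f) x = integral {s..t} (\<lambda>q. ev k (blf (K (eps * exp q)) f) x)"
    using integral_linear[OF i bl] by (simp add: comp_def)
  show "(\<lambda>q. ev k (blf (K (eps * exp q)) f) x) integrable_on {s..t}"
    using integrable_linear[OF i bl] by (simp add: comp_def)
qed

lemma bpos_integral_K: "0 < eps ==> bpos (integral {s..t} (\<lambda>q. K (eps * exp q)))"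
  unfolding bpos_ev[of _ k]
  using bpos_K unfolding bpos_ev[of _ k]
  by (auto simp: apply_integral_K intro!: Henstock_Kurzweil_Integration.integral_nonneg)

lemma integral_K_one: "0 < eps ==> s <= t ==> blf (integral {s..t} (\<lambda>q. K (eps * exp q))) (onek k) = (t - s) *\<^sub>R onek k"
  by (rule ev_inject[of k]) (simp add: apply_integral_K K_one k0)

lemma bpos_Pop: 
  assumes "0 < eps" "0 <= s" "s <= t"
  shows "bpos (Pop eps s t)"
  unfolding Pop_def acc_diff[OF assms] exp_minus_scaleR_1
  by (intro bpos_intros bpos_exp bpos_integral_K assms) auto

lemma Pop_one: 
  assumes "0 < eps" "0 <= s" "s <= t"
  shows "blf (Pop eps s t) (onek k) = onek k"
  unfolding Pop_def acc_diff[OF assms]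
  by (rule blf_exp_fixed) (use assms in \<open>simp add: integral_K_one\<close>)

lemma sbd_Pop: "0 < eps ==> 0 <= s ==> s <= t ==> sbd k (Pop eps s t) 1"
  by (intro sbd_bpos k0 bpos_Pop) (auto simp: Pop_one k0)

end

subsection \<open>Taylor expansion on the unit interval\<close>

lemma taylor_unit_2:
  fixes F0 F1 F2 :: "real => real"
  assumes "\<And>u. 0 <= u ==> u <= 1 ==> (F0 has_real_derivative F1 u) (at u)"
    and "\<And>u. 0 <= u ==> u <= 1 ==> (F1 has_real_derivative F2 u) (at u)"
  obtains u where "0 < u" "u < 1" "F0 1 = F0 0 + F1 0 + F2 u / 2"
proof -
  define diff where "diff = (\<lambda>m::nat. if m = 0 then F0 else if m = 1 then F1 else F2)"
  have "\<exists>t>0. t < 1 \<and> F0 1 = (\<Sum>m<2. diff m 0 / fact m * 1 ^ m) + diff 2 t / fact 2 * 1 ^ 2"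
    by (rule Maclaurin) (use assms in \<open>auto simp: diff_def less_2_cases_iff\<close>)
  then show ?thesis using that by (auto simp: diff_def numeral_2_eq_2)
qed

lemma taylor_unit_4:
  fixes F :: "nat => real => real"
  assumes "\<And>m u. m < 4 ==> 0 <= u ==> u <= 1 ==> (F m has_real_derivative F (Suc m) u) (at u)"
  obtains u where "0 < u" "u < 1" "F 0 1 = F 0 0 + F 1 0 + F 2 0 / 2 + F 3 0 / 6 + F 4 u / 24"
proof -
  have "\<exists>t>0. t < 1 \<and> F 0 1 = (\<Sum>m<4. F m 0 / fact m * 1 ^ m) + F 4 t / fact 4 * 1 ^ 4"
    by (rule Maclaurin) (use assms in auto)
  then show ?thesis using that by (auto simp: eval_nat_numeral)
qed

lemma taylor_bound_2:
  fixes f f1 f2 :: "real => real"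
  assumes f: "\<And>u. u \<in> closed_segment a b ==> (f has_real_derivative f1 u) (at u)"
    and f1: "\<And>u. u \<in> closed_segment a b ==> (f1 has_real_derivative f2 u) (at u)"
    and f2: "\<And>u. u \<in> closed_segment a b ==> \<bar>f2 u\<bar> <= M"
  shows "\<bar>f b - f a - (b - a) * f1 a\<bar> <= M * (b - a)\<^sup>2"
proof -
  have seg: "a + u * (b - a) \<in> closed_segment a b" if "0 <= u" "u <= 1" for u
    using that by (auto simp: in_segment algebra_simps intro!: exI[of _ u])
  obtain u where u: "0 < u" "u < 1"
    "f (a + 1 * (b - a)) = f (a + 0 * (b - a)) + (b - a) * f1 (a + 0 * (b - a)) + ((b - a)\<^sup>2 * f2 (a + u * (b - a))) / 2"
  proof (rule taylor_unit_2[of "\<lambda>u. f (a + u * (b - a))" "\<lambda>u. (b - a) * f1 (a + u * (b - a))" "\<lambda>u. (b - a)\<^sup>2 * f2 (a + u * (b - a))"])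
    fix u :: real assume u: "0 <= u" "u <= 1"
    show "((\<lambda>u. f (a + u * (b - a))) has_real_derivative (b - a) * f1 (a + u * (b - a))) (at u)"
      by (rule DERIV_chain2[where f=f and g="\<lambda>u. a + u * (b - a)", OF f[OF seg[OF u]], THEN DERIV_cong]) (auto intro!: derivative_eq_intros)
    show "((\<lambda>u. (b - a) * f1 (a + u * (b - a))) has_real_derivative (b - a)\<^sup>2 * f2 (a + u * (b - a))) (at u)"
      by (rule DERIV_cmult[OF DERIV_chain2[where f=f1 and g="\<lambda>u. a + u * (b - a)", OF f1[OF seg[OF u]]], THEN DERIV_cong])
         (auto intro!: derivative_eq_intros simp: power2_eq_square)
  qed (rule that)
  have "0 <= M" using f2[of a] by (simp add: order.trans[OF abs_ge_zero])
  have "\<bar>f b - f a - (b - a) * f1 a\<bar> = (b - a)\<^sup>2 * \<bar>f2 (a + u * (b - a))\<bar> / 2"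
    using u(3) by (simp add: abs_mult)
  also have "... <= (b - a)\<^sup>2 * \<bar>f2 (a + u * (b - a))\<bar>" by simp
  also have "... <= (b - a)\<^sup>2 * M"
    using u by (intro mult_left_mono f2 seg) auto
  finally show ?thesis by (simp add: mult.commute)
qed

lemma has_vector_derivative_quadratic:
  fixes W :: "real => 'a::real_normed_vector"
  assumes d: "0 < d" and "\<And>t'. t' \<in> S ==> \<bar>t' - t\<bar> < d ==> norm (W t' - W t - (t' - t) *\<^sub>R W') <= C * (t' - t)\<^sup>2"
  shows "(W has_vector_derivative W') (at t within S)"
  unfolding has_vector_derivative_def
proof (rule has_derivativeI_sandwich[of d _ _ _ _ "\<lambda>t'. C * \<bar>t' - t\<bar>"])
  fix t' assume t': "t' \<in> S" "t' \<noteq> t" "dist t' t < d"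
  have "norm (W t' - W t - (t' - t) *\<^sub>R W') / norm (t' - t) <= C * (t' - t)\<^sup>2 / \<bar>t' - t\<bar>"
    using t' assms(2)[of t'] by (auto simp: dist_real_def intro!: divide_right_mono)
  also have "... = C * \<bar>t' - t\<bar>"
    using t' by (simp add: power2_eq_square abs_if field_simps)
  finally show "norm (W t' - W t - (t' - t) *\<^sub>R W') / norm (t' - t) <= C * \<bar>t' - t\<bar>" .
next
  have "((\<lambda>t'. C * \<bar>t' - t\<bar>) \<longlongrightarrow> C * \<bar>t - t\<bar>) (at t within S)" by (intro tendsto_intros)
  then show "((\<lambda>t'. C * \<bar>t' - t\<bar>) \<longlongrightarrow> 0) (at t within S)" by simp
qed (use d in \<open>auto intro: bounded_linear_scaleR_left\<close>)

subsection \<open>A Lyapunov estimate\<close>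

lemma wt_eq: "wt k x = (1 + (norm x)\<^sup>2) powr (k / 2)"
proof -
  have "1 + (norm x)\<^sup>2 \<noteq> 0" by (smt (verit) zero_le_power2)
  then show ?thesis
    unfolding wt_def jb_def by (simp add: powr_half_sqrt[symmetric] powr_powr)
qed

lemma jb_scale_le: "0 <= u ==> u <= 1 ==> jb (u *\<^sub>R x) <= jb x"
  unfolding jb_def by (auto intro!: power_mono mult_left_le_one_le)

lemma wt_scale_le: "0 <= k ==> 0 <= u ==> u <= 1 ==> wt k (u *\<^sub>R x) <= wt k x"
  unfolding wt_def by (intro powr_mono2 jb_scale_le) (auto simp: less_imp_le)

text \<open>For k >= 2 the bracket is submultiplicative under shifts. For k < 2 the exponent is
  negative and the left side is at most 1, which the summand 1 on the right absorbs.\<close>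

lemma jb_powr_shift:
  assumes k: "0 <= k"
  shows "jb (x + v) powr (k - 2) <= kw k v * (1 + jb x powr (k - 2))"
proof (cases "2 <= k")
  case True
  have "jb (x + v) powr (k - 2) <= (jb x * (1 + norm v)) powr (k - 2)"
    using True by (intro powr_mono2 jb_add) (auto simp: less_imp_le)
  also have "... = (1 + norm v) powr (k - 2) * jb x powr (k - 2)"
    by (subst powr_mult) (auto simp: less_imp_le)
  also have "... <= kw k v * (1 + jb x powr (k - 2))"
    unfolding kw_def by (intro mult_mono powr_mono) auto
  finally show ?thesis .
next
  case False
  have "jb (x + v) powr (k - 2) <= jb (x + v) powr 0"
    using False by (intro powr_mono jb_ge_1) auto
  also have "... <= 1 * (1 + jb x powr (k - 2))" by simp
  also have "... <= kw k v * (1 + jb x powr (k - 2))"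
    using kw_ge_1[OF k] by (intro mult_right_mono) auto
  finally show ?thesis .
qed

text \<open>The first-order term is linear in \<open>v\<close>, hence vanishes on averaging against a centred measure.\<close>

lemma wt_taylor:
  fixes x v :: "real ^ 'n"
  assumes k: "0 <= k"
  shows "wt k (x + v) <= wt k x + k * jb x powr (k - 2) * (x \<bullet> v)
    + k * (\<bar>k - 2\<bar> + 1) * (norm v)\<^sup>2 * kw k v * (1 + jb x powr (k - 2))"
proof -
  \<comment> \<open>The squared bracket along the segment from \<open>x\<close> to
    \<open>x + v\<close>: a quadratic polynomial in \<open>u\<close>, and the weight is its power
    k/2.\<close>
  define q where "q u = 1 + (norm (x + u *\<^sub>R v))\<^sup>2" for u :: real
  define q1 where "q1 u = 2 * ((x + u *\<^sub>R v) \<bullet> v)" for u :: real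
  have qpos: "0 < q u" for u unfolding q_def by (smt (verit) zero_le_power2)
  have q_eq: "q u = 1 + (x + u *\<^sub>R v) \<bullet> (x + u *\<^sub>R v)" for u
    by (simp add: q_def power2_norm_eq_inner)
  have dq: "(q has_real_derivative q1 u) (at u)" for u
    unfolding q_eq q1_def
    by (auto intro!: derivative_eq_intros simp: inner_add_left inner_add_right inner_commute algebra_simps)
  have dq1: "(q1 has_real_derivative 2 * (norm v)\<^sup>2) (at u)" for u
    unfolding q1_def inner_add_left by (auto intro!: derivative_eq_intros simp: power2_norm_eq_inner)
  define f1 where "f1 u = (k / 2) * q u powr (k / 2 - 1) * q1 u" for u
  define f2 where "f2 u = (k / 2) * ((k / 2 - 1) * q u powr (k / 2 - 2) * (q1 u)\<^sup>2 + q u powr (k / 2 - 1) * (2 * (norm v)\<^sup>2))" for u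
  obtain u where u: "0 < u" "u < 1" "q 1 powr (k/2) = q 0 powr (k/2) + f1 0 + f2 u / 2"
  proof (rule taylor_unit_2[of "\<lambda>u. q u powr (k/2)" f1 f2])
    fix u :: real
    show "((\<lambda>u. q u powr (k / 2)) has_real_derivative f1 u) (at u)"
      unfolding f1_def by (rule DERIV_fun_powr[OF dq qpos, THEN DERIV_cong]) simp
    have "((\<lambda>u. q u powr (k / 2 - 1)) has_real_derivative (k / 2 - 1) * q u powr (k / 2 - 2) * q1 u) (at u)"
      by (rule DERIV_fun_powr[OF dq qpos, THEN DERIV_cong]) (simp add: algebra_simps)
    then have "((\<lambda>u. (k / 2) * (q u powr (k / 2 - 1) * q1 u)) has_real_derivative
       (k / 2) * (((k / 2 - 1) * q u powr (k / 2 - 2) * q1 u) * q1 u + (2 * (norm v)\<^sup>2) * q u powr (k / 2 - 1))) (at u)"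
      by (intro DERIV_cmult DERIV_mult dq1)
    then show "(f1 has_real_derivative f2 u) (at u)"
      unfolding f1_def f2_def by (simp add: power2_eq_square algebra_simps)
  qed (rule that)
  have qj: "q u powr (k / 2 - 1) = jb (x + u *\<^sub>R v) powr (k - 2)" for u
    using wt_eq[of "k - 2" "x + u *\<^sub>R v"] by (simp add: wt_def q_def diff_divide_distrib)
  have q1b: "(q1 u)\<^sup>2 <= 4 * (norm v)\<^sup>2 * q u" for u
  proof -
    have "\<bar>(x + u *\<^sub>R v) \<bullet> v\<bar> <= norm (x + u *\<^sub>R v) * norm v" by (rule Cauchy_Schwarz_ineq2)
    then have "((x + u *\<^sub>R v) \<bullet> v)\<^sup>2 <= (norm (x + u *\<^sub>R v) * norm v)\<^sup>2"
      by (metis abs_ge_zero power2_abs power_mono)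
    also have "... <= q u * (norm v)\<^sup>2" by (simp add: power_mult_distrib q_def mult_right_mono)
    finally show ?thesis by (simp add: q1_def power_mult_distrib mult.commute)
  qed
  have "f2 u <= (k / 2) * (\<bar>k / 2 - 1\<bar> * q u powr (k / 2 - 2) * (4 * (norm v)\<^sup>2 * q u) + q u powr (k / 2 - 1) * (2 * (norm v)\<^sup>2))"
    unfolding f2_def using k by (intro mult_left_mono add_mono mult_mono q1b mult_right_mono) auto
  also have "q u powr (k / 2 - 2) * (4 * (norm v)\<^sup>2 * q u) = 4 * (norm v)\<^sup>2 * q u powr (k / 2 - 1)"
    using qpos[of u] powr_mult_base[of "q u" "k / 2 - 2"] by (simp add: algebra_simps)
  then have "(k / 2) * (\<bar>k / 2 - 1\<bar> * q u powr (k / 2 - 2) * (4 * (norm v)\<^sup>2 * q u) + q u powr (k / 2 - 1) * (2 * (norm v)\<^sup>2))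
     = (k / 2) * (\<bar>k / 2 - 1\<bar> * (4 * (norm v)\<^sup>2 * q u powr (k / 2 - 1)) + q u powr (k / 2 - 1) * (2 * (norm v)\<^sup>2))"
    by (simp add: mult.assoc)
  also have "... = k * (2 * \<bar>k / 2 - 1\<bar> + 1) * (norm v)\<^sup>2 * q u powr (k / 2 - 1)"
    by (simp add: algebra_simps)
  also have "2 * \<bar>k / 2 - 1\<bar> = \<bar>k - 2\<bar>" by (simp add: abs_if)
  also have "k * (\<bar>k - 2\<bar> + 1) * (norm v)\<^sup>2 * q u powr (k / 2 - 1)
     <= k * (\<bar>k - 2\<bar> + 1) * (norm v)\<^sup>2 * (kw k (u *\<^sub>R v) * (1 + jb x powr (k - 2)))"
    unfolding qj using k by (intro mult_left_mono jb_powr_shift) auto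
  also have "... <= k * (\<bar>k - 2\<bar> + 1) * (norm v)\<^sup>2 * (kw k v * (1 + jb x powr (k - 2)))"
  proof (intro mult_left_mono mult_right_mono)
    show "kw k (u *\<^sub>R v) <= kw k v" unfolding kw_def
      using u k by (intro powr_mono2) (auto intro!: mult_left_le_one_le)
  qed (use k in auto)
  finally have f2: "f2 u <= k * (\<bar>k - 2\<bar> + 1) * (norm v)\<^sup>2 * kw k v * (1 + jb x powr (k - 2))"
    by (simp add: mult.assoc)
  have "0 <= k * (\<bar>k - 2\<bar> + 1) * (norm v)\<^sup>2 * kw k v * (1 + jb x powr (k - 2))"
    using k by (intro mult_nonneg_nonneg) auto
  moreover have "f1 0 = k * jb x powr (k - 2) * (x \<bullet> v)"
    using qj[of 0] by (simp add: f1_def q1_def)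
  moreover have "q 1 powr (k/2) = wt k (x + v)" "q 0 powr (k/2) = wt k x"
    by (simp_all add: q_def wt_eq)
  ultimately show ?thesis using u(3) f2 by linarith
qed

text \<open>The confining term of order \<open>X powr k\<close> beats the diffusive one of order
  \<open>X powr (k - 2)\<close> for large X. The constant is written as a product with
  \<open>c\<close> so that the right side reads - c (X^k - C') when it is used as a differential
  inequality.\<close>

lemma lyapunov_scalar:
  assumes k: "0 <= k" and C: "0 <= C"
  obtains c C' where "0 < c" "0 <= C'"
    "\<And>X. 1 <= X ==> C * (1 + X powr (k - 2)) - k * (X powr k - X powr (k - 2)) <= - c * X powr k + c * (C'::real)"
proof (cases "k = 0")
  case True
  show ?thesis
  \<comment> \<open>For k = 0 the weight is constant and there is no confinement; the right side is
    then 2 C, and any rate would do.\<close>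
  proof (rule that[of 1 "1 + 2 * C"])
    fix X :: real assume X: "1 <= X"
    have "X powr (k - 2) <= X powr 0" using X True by (intro powr_mono) auto
    then have "C * (1 + X powr (k - 2)) <= C * 2" using X by (intro mult_left_mono C) auto
    then show "C * (1 + X powr (k - 2)) - k * (X powr k - X powr (k - 2)) <= - 1 * X powr k + 1 * (1 + 2 * C)"
      using X by (simp add: True)
  qed (use C in auto)
next
  case False
  then have kp: "0 < k" using k by simp
  \<comment> \<open>For X^2 >= B the term with \<open>X powr (k - 2)\<close> is at most half of the
    confining term; below that threshold it is at most the constant \<open>D\<close>.\<close>
  define B where "B = max 1 (2 * (C + k) / k)"
  define D where "D = (C + k) * B powr (k / 2)"
  have D: "0 <= D" using C kp by (simp add: D_def)
  show ?thesis
  proof (rule that[of "k / 2" "2 / k * (C + D)"])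
    fix X :: real assume X: "1 <= X"
    have e: "X powr k = X\<^sup>2 * X powr (k - 2)"
      using X powr_add[of X 2 "k - 2"] by (simp add: powr_numeral)
    have "(C + k) * X powr (k - 2) <= k / 2 * X powr k + D"
    proof (cases "B <= X\<^sup>2")
      case True
      then have "2 * (C + k) / k <= X\<^sup>2" by (simp add: B_def)
      then have "C + k <= k / 2 * X\<^sup>2" using kp by (simp add: field_simps)
      then have "(C + k) * X powr (k - 2) <= k / 2 * X\<^sup>2 * X powr (k - 2)" by (intro mult_right_mono) auto
      then show ?thesis using D e by simp
    next
      case False
      have "X powr (k - 2) <= X powr k" using X by (intro powr_mono) auto
      also have "X powr k = (X\<^sup>2) powr (k / 2)"
        using X powr_powr[of X 2 "k/2"] by (simp add: powr_numeral)
      also have "... <= B powr (k / 2)" using False kp by (intro powr_mono2) auto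
      finally have "(C + k) * X powr (k - 2) <= D" unfolding D_def using C kp by (intro mult_left_mono) auto
      moreover have "0 <= k / 2 * X powr k" using kp by simp
      ultimately show ?thesis by linarith
    qed
    moreover have "k / 2 * (2 / k * (C + D)) = C + D" using kp by simp
    ultimately show "C * (1 + X powr (k - 2)) - k * (X powr k - X powr (k - 2)) <= - (k / 2) * X powr k + k / 2 * (2 / k * (C + D))"
      by (simp add: algebra_simps)
  qed (use kp C D in auto)
qed

context jump_kernel
begin

text \<open>The weight of the original variable \<open>x = exp (- t) y\<close>.\<close>

definition om :: "real => real ^ 'n => real" where "om t y = wt k (exp (- t) *\<^sub>R y)"

definition W :: "real => (real ^ 'n) \<Rightarrow>\<^sub>C real" where "W t = mk k (om t)"

text \<open>The time derivative of \<open>om\<close>. With x = exp (- t) y it is - x . grad wt, the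
  confining drift, because |x|^2 = jb^2 - 1.\<close>

definition om' :: "real => real ^ 'n => real" where
  "om' t y = - k * (wt k (exp (- t) *\<^sub>R y) - jb (exp (- t) *\<^sub>R y) powr (k - 2))"

lemma om_le_wt: "0 <= t ==> om t y <= wt k y"
  unfolding om_def by (intro wt_scale_le k0) auto

lemma om_ge_1: "1 <= om t y"
  unfolding om_def by (rule wt_ge_1[OF k0])

lemma om_nonneg [simp]: "0 <= om t y"
  by (simp add: om_def)

lemma ev_W: "0 <= t ==> ev k (W t) y = om t y"
  unfolding W_def
  by (rule ev_mk[where C=1]) (auto simp: om_le_wt om_def[abs_def] intro!: continuous_intros om_le_wt[unfolded om_def])

lemma om_add: "om s (x + y) <= om s x * kw k (exp (- s) *\<^sub>R y)"
  unfolding om_def scaleR_add_right by (rule wt_add[OF k0])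

lemma jb_powr_le: "jb x powr (k - 2) <= wt k x"
  unfolding wt_def by (intro powr_mono jb_ge_1) auto

lemma om'_bound: "0 <= t ==> \<bar>om' t y\<bar> <= k * wt k y"
proof -
  assume t: "0 <= t"
  have "\<bar>wt k (exp (- t) *\<^sub>R y) - jb (exp (- t) *\<^sub>R y) powr (k - 2)\<bar> <= wt k (exp (- t) *\<^sub>R y)"
    using jb_powr_le[of "exp (- t) *\<^sub>R y"] powr_ge_zero[of "jb (exp (- t) *\<^sub>R y)" "k - 2"] by linarith
  also have "... <= wt k y" using om_le_wt[OF t] by (simp add: om_def)
  finally show ?thesis unfolding om'_def using k0 by (simp add: abs_mult mult_left_mono)
qed

lemma ev_om': "0 <= t ==> ev k (mk k (om' t)) y = om' t y"
proof (rule ev_mk[where C=k])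
  show "continuous_on UNIV (om' t)" unfolding om'_def[abs_def]
    by (intro continuous_intros) auto
qed (rule om'_bound)

text \<open>The second time derivative of \<open>om\<close> is bounded by a multiple of
  \<open>wt k y\<close>, uniformly in t >= 0 and y; hence the pointwise derivative is one in the
  norm.\<close>

lemma W_has_vector_derivative:
  assumes t: "t \<in> {0..T}"
  shows "(W has_vector_derivative mk k (om' t)) (at t within {0..T})"
proof (rule has_vector_derivative_quadratic[where C="2 * k * (1 + \<bar>k / 2 - 1\<bar>)", OF zero_less_one])
  fix t' assume t': "t' \<in> {0..T}"
  show "norm (W t' - W t - (t' - t) *\<^sub>R mk k (om' t)) <= 2 * k * (1 + \<bar>k / 2 - 1\<bar>) * (t' - t)\<^sup>2"
  proof (rule norm_le_ev[of k])
    fix y :: "real ^ 'n"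
    \<comment> \<open>The quantity satisfies r' = - 2 r, so both derivatives of (1 + r)^(k/2) are
      again expressions in r and 1 + r.\<close>
    define r where "r u = exp (- 2 * u) * (norm y)\<^sup>2" for u
    have r0: "0 <= r u" for u by (simp add: r_def)
    have rpos: "0 < 1 + r u" for u using r0[of u] by linarith
    have nr: "(norm (exp (- u) *\<^sub>R y))\<^sup>2 = r u" for u
      by (simp add: r_def power_mult_distrib flip: exp_of_nat_mult)
    have om_r: "om u y = (1 + r u) powr (k / 2)" for u
      by (simp only: om_def wt_eq nr)
    have jb_r: "jb (exp (- u) *\<^sub>R y) powr (k - 2) = (1 + r u) powr (k / 2 - 1)" for u
      using wt_eq[of "k - 2" "exp (- u) *\<^sub>R y"]
      by (simp only: wt_def nr) (simp add: diff_divide_distrib)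
    have split: "(1 + r u) powr (k / 2) = (1 + r u) * (1 + r u) powr (k / 2 - 1)" 
      "(1 + r u) powr (k / 2 - 1) = (1 + r u) * (1 + r u) powr (k / 2 - 2)" for u
      using powr_mult_base[of "1 + r u" "k / 2 - 1"] powr_mult_base[of "1 + r u" "k / 2 - 2"] rpos[of u] by (simp_all add: algebra_simps)
    define f1 where "f1 u = - k * (r u * (1 + r u) powr (k / 2 - 1))" for u
    define f2 where "f2 u = - k * (- 2 * r u * (1 + r u) powr (k / 2 - 1) + r u * ((k / 2 - 1) * (1 + r u) powr (k / 2 - 2) * (- 2 * r u)))" for u
    have om'_r: "om' u y = f1 u" for u
      using om_r[of u] split(1)[of u] by (simp add: om'_def jb_r f1_def om_def[symmetric] algebra_simps)
    have dr: "(r has_real_derivative - 2 * r u) (at u)" for u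
      unfolding r_def by (auto intro!: derivative_eq_intros)
    have dr1: "((\<lambda>u. 1 + r u) has_real_derivative - 2 * r u) (at u)" for u
      by (auto intro!: derivative_eq_intros dr)
    have "\<bar>(\<lambda>u. (1 + r u) powr (k / 2)) t' - (\<lambda>u. (1 + r u) powr (k / 2)) t - (t' - t) * f1 t\<bar>
       <= (2 * k * (1 + \<bar>k / 2 - 1\<bar>) * wt k y) * (t' - t)\<^sup>2"
    proof (rule taylor_bound_2[of t t' _ f1 f2])
      fix u assume "u \<in> closed_segment t t'"
      then have u: "0 <= u" using t t' by (auto simp: closed_segment_eq_real_ivl split: if_splits)
      show "((\<lambda>u. (1 + r u) powr (k / 2)) has_real_derivative f1 u) (at u)"
        unfolding f1_def by (rule DERIV_fun_powr[OF dr1 rpos, THEN DERIV_cong]) (simp add: algebra_simps)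
      have "((\<lambda>u. (1 + r u) powr (k / 2 - 1)) has_real_derivative (k / 2 - 1) * (1 + r u) powr (k / 2 - 2) * (- 2 * r u)) (at u)"
        by (rule DERIV_fun_powr[OF dr1 rpos, THEN DERIV_cong]) (simp add: algebra_simps)
      then have "((\<lambda>u. - k * (r u * (1 + r u) powr (k / 2 - 1))) has_real_derivative
          - k * ((- 2 * r u) * (1 + r u) powr (k / 2 - 1) + ((k / 2 - 1) * (1 + r u) powr (k / 2 - 2) * (- 2 * r u)) * r u)) (at u)"
        by (intro DERIV_cmult DERIV_mult dr)
      then show "(f1 has_real_derivative f2 u) (at u)"
        unfolding f1_def f2_def by (simp only: mult.commute[of "r u"])
      have b1: "r u * (1 + r u) powr (k / 2 - 1) <= (1 + r u) powr (k / 2)"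
        unfolding split(1)[of u] using r0[of u] by (intro mult_right_mono) auto
      have b2: "r u * ((1 + r u) powr (k / 2 - 2) * r u) <= (1 + r u) powr (k / 2)"
        unfolding split(1)[of u] using r0[of u]
        by (subst split(2), subst mult.commute[of _ "r u"]) (intro mult_mono mult_right_mono, auto)
      have "f2 u = 2 * k * (r u * (1 + r u) powr (k / 2 - 1) + (k / 2 - 1) * (r u * ((1 + r u) powr (k / 2 - 2) * r u)))"
        unfolding f2_def by (simp only: mult.assoc mult.commute mult.left_commute distrib_left distrib_right mult_minus_left mult_minus_right minus_add_distrib minus_minus mult_1)
      also have "\<bar>...\<bar> <= 2 * k * (\<bar>r u * (1 + r u) powr (k / 2 - 1)\<bar> + \<bar>k / 2 - 1\<bar> * \<bar>r u * ((1 + r u) powr (k / 2 - 2) * r u)\<bar>)"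
        using k0 by (simp add: abs_mult[of "2 * k"] abs_mult[of "k / 2 - 1", symmetric] mult_left_mono abs_triangle_ineq)
      also have "... <= 2 * k * ((1 + r u) powr (k / 2) + \<bar>k / 2 - 1\<bar> * (1 + r u) powr (k / 2))"
        using b1 b2 r0[of u] k0 by (intro mult_left_mono add_mono) auto
      also have "... = 2 * k * (1 + \<bar>k / 2 - 1\<bar>) * om u y" unfolding om_r by (simp add: algebra_simps)
      also have "... <= 2 * k * (1 + \<bar>k / 2 - 1\<bar>) * wt k y"
        using k0 by (intro mult_left_mono om_le_wt u) auto
      finally show "\<bar>f2 u\<bar> <= 2 * k * (1 + \<bar>k / 2 - 1\<bar>) * wt k y" .
    qed
    then show "\<bar>ev k (W t' - W t - (t' - t) *\<^sub>R mk k (om' t)) y\<bar> <= 2 * k * (1 + \<bar>k / 2 - 1\<bar>) * (t' - t)\<^sup>2 * wt k y"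
      using t t' by (simp add: ev_W ev_om' om_r om'_r ac_simps)
  qed
qed

text \<open>The linear term of \<open>wt_taylor\<close> averages out because J is centred; the
  quadratic one carries eps^2, which cancels the jump rate. Hence the bound is uniform in
  eps.\<close>

lemma gen_W_bound:
  obtains C where "0 <= C" "\<And>eps t y. 0 < eps ==> eps <= 1 ==> 0 <= t ==>
    ev k (blf (gen eps t) (W t)) y <= C * (1 + jb (exp (- t) *\<^sub>R y) powr (k - 2))"
proof -
  define M where "M = (LBINT z. (norm z)\<^sup>2 * kw k z * J z)"
  have kw2: "(norm z)\<^sup>2 * kw k z <= kw (k + 5) z" for z :: "real ^ 'n"
  proof -
    have "(norm z)\<^sup>2 <= (1 + norm z) powr 2" by (simp add: power_mono)
    then have "(norm z)\<^sup>2 * kw k z <= (1 + norm z) powr 2 * (1 + norm z) powr k"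
      unfolding kw_def by (intro mult_right_mono) auto
    also have "... <= (1 + norm z) powr (k + 5)"
      unfolding powr_add[symmetric] by (intro powr_mono) auto
    finally show ?thesis by (simp add: kw_def)
  qed
  have iM: "integrable lborel (\<lambda>z. (norm z)\<^sup>2 * kw k z * J z)"
    by (rule J_integrable[where C=1]) (use kw2 in auto)
  have M: "0 <= M" unfolding M_def by (intro integral_nonneg_AE) (auto simp: J0)
  define C where "C = k * (\<bar>k - 2\<bar> + 1) * M"
  have "ev k (blf (gen eps t) (W t)) y <= C * (1 + jb (exp (- t) *\<^sub>R y) powr (k - 2))" if "0 < eps" "eps <= 1" "0 <= t" for eps t y
  proof -
    define x where "x = exp (- t) *\<^sub>R y"
    define D where "D = k * (\<bar>k - 2\<bar> + 1) * (1 + jb x powr (k - 2))"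
    have D: "0 <= D" using k0 by (auto simp: D_def intro!: mult_nonneg_nonneg)
    \<comment> \<open>In the original variable the jump of length eps exp t has length eps again, at
      every time.\<close>
    have omx: "om t (y + (eps * exp t) *\<^sub>R z) = wt k (x + eps *\<^sub>R z)" for z
      by (simp add: om_def x_def scaleR_add_right mult.assoc[symmetric] mult.commute[of eps] exp_minus_inverse)
         (simp add: mult.commute exp_minus_inverse)
    have b: "wt k (x + eps *\<^sub>R z) * J z <= (wt k x) * J z + (k * jb x powr (k - 2) * eps) * ((x \<bullet> z) * J z) + (eps\<^sup>2 * D) * ((norm z)\<^sup>2 * kw k z * J z)" for z
    proof -
      have "kw k (eps *\<^sub>R z) <= kw k z" unfolding kw_def
        using that k0 by (intro powr_mono2) (auto intro!: mult_left_le_one_le)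
      then have "k * (\<bar>k - 2\<bar> + 1) * (norm (eps *\<^sub>R z))\<^sup>2 * kw k (eps *\<^sub>R z) * (1 + jb x powr (k - 2)) <= k * (\<bar>k - 2\<bar> + 1) * (norm (eps *\<^sub>R z))\<^sup>2 * kw k z * (1 + jb x powr (k - 2))"
        using k0 by (intro mult_right_mono mult_left_mono) auto
      also have "... = eps\<^sup>2 * D * ((norm z)\<^sup>2 * kw k z)" by (simp add: D_def power_mult_distrib)
      finally have "wt k (x + eps *\<^sub>R z) <= wt k x + (k * jb x powr (k - 2) * eps) * (x \<bullet> z) + eps\<^sup>2 * D * ((norm z)\<^sup>2 * kw k z)"
        using wt_taylor[OF k0, of x "eps *\<^sub>R z"] by simp
      from mult_right_mono[OF this J0[of z]] show ?thesis by (simp add: algebra_simps)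
    qed
    have i1: "integrable lborel (\<lambda>z. z $ i * J z)" for i
    proof (rule J_integrable[where C=1])
      fix z :: "real ^ 'n"
      have "\<bar>z $ i\<bar> <= 1 + norm z" using component_le_norm_cart[of z i] by linarith
      also have "... = kw 1 z" by (simp add: kw_def)
      also have "... <= kw (k + 5) z" using k0 by (intro kw_mono) auto
      finally show "\<bar>z $ i\<bar> <= 1 * kw (k + 5) z" by simp
    qed simp
    have xz: "(x \<bullet> z) * J z = (\<Sum>i\<in>UNIV. x $ i * (z $ i * J z))" for z
      by (simp add: inner_vec_def sum_distrib_right mult.assoc)
    have i2: "integrable lborel (\<lambda>z. (x \<bullet> z) * J z)" and z2: "(LBINT z. (x \<bullet> z) * J z) = 0"
      unfolding xz using i1 by (auto simp: Jx)
    have iJ: "integrable lborel J" using wkernel_integrable[OF _ Jk5] k0 by simp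
    have iw: "integrable lborel (\<lambda>z. wt k (x + eps *\<^sub>R z) * J z)"
    proof (rule J_integrable[where C="wt k x"])
      fix z :: "real ^ 'n"
      have "wt k (x + eps *\<^sub>R z) <= wt k x * kw k (eps *\<^sub>R z)" by (rule wt_add[OF k0])
      also have "kw k (eps *\<^sub>R z) <= kw k z" unfolding kw_def
        using that k0 by (intro powr_mono2) (auto intro!: mult_left_le_one_le)
      also have "kw k z <= kw (k + 5) z" by (rule kw_mono) simp
      finally show "\<bar>wt k (x + eps *\<^sub>R z)\<bar> <= wt k x * kw (k + 5) z" by (simp add: mult_left_mono)
    qed measurable
    have "(LBINT z. wt k (x + eps *\<^sub>R z) * J z) <= (LBINT z. (wt k x) * J z + (k * jb x powr (k - 2) * eps) * ((x \<bullet> z) * J z) + (eps\<^sup>2 * D) * ((norm z)\<^sup>2 * kw k z * J z))"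
      by (intro integral_mono iw b Bochner_Integration.integrable_add integrable_mult_right iJ i2 iM)
    also have "... = wt k x + eps\<^sup>2 * D * M"
      by (subst Bochner_Integration.integral_add | intro Bochner_Integration.integrable_add integrable_mult_right iJ i2 iM)+
         (simp add: J1 z2 M_def)
    finally have le: "(LBINT z. wt k (x + eps *\<^sub>R z) * J z) - wt k x <= eps\<^sup>2 * (D * M)" by simp
    have "ev k (blf (gen eps t) (W t)) y = 1 / eps\<^sup>2 * ((LBINT z. wt k (x + eps *\<^sub>R z) * J z) - wt k x)"
      using that by (simp add: gen_def ev_K ev_W omx) (simp add: om_def x_def)
    also have "... <= 1 / eps\<^sup>2 * (eps\<^sup>2 * (D * M))" by (intro mult_left_mono le) auto
    also have "... = C * (1 + jb x powr (k - 2))" using that by (simp add: C_def D_def)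
    finally show ?thesis by (simp add: x_def)
  qed
  moreover have "0 <= C" using k0 M by (auto simp: C_def)
  ultimately show ?thesis using that by blast
qed

text \<open>Gronwall's argument: generator plus time derivative send \<open>W t\<close> to at most -
  c (W t - C), and \<open>Pop\<close> is positive, so exp (c t) times the propagated
  \<open>W t - C\<close> decreases in the final time t.\<close>

lemma lyapunov:
  obtains c C where "0 < c" "0 <= C" "\<And>eps s t x. 0 < eps ==> eps <= 1 ==> 0 <= s ==> s <= t ==>
    ev k (blf (Pop eps s t) (W t)) x <= exp (- c * (t - s)) * om s x + C"
proof -
  obtain C0 where C0: "0 <= C0" "\<And>eps t y. 0 < eps ==> eps <= 1 ==> 0 <= t ==>
    ev k (blf (gen eps t) (W t)) y <= C0 * (1 + jb (exp (- t) *\<^sub>R y) powr (k - 2))"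
    using gen_W_bound by blast
  obtain c C where c: "0 < c" "0 <= C" and cC: "\<And>X. 1 <= X ==> C0 * (1 + X powr (k - 2)) - k * (X powr k - X powr (k - 2)) <= - c * X powr k + c * C"
    using lyapunov_scalar[OF k0 C0(1)] by metis
  have "ev k (blf (Pop eps s T) (W T)) x <= exp (- c * (T - s)) * om s x + C"
    if e: "0 < eps" "eps <= 1" "0 <= s" "s <= T" for eps s T x
  proof -
    \<comment> \<open>The constant C is preserved by \<open>Pop\<close> and annihilated by the
      generator, so subtracting it costs nothing.\<close>
    define Z where "Z t = exp (c * t) *\<^sub>R blf (Pop eps s t) (W t - C *\<^sub>R onek k)" for t
    define Z' where "Z' t = exp (c * t) *\<^sub>R blf (Pop eps s t) (c *\<^sub>R (W t - C *\<^sub>R onek k) + blf (gen eps t) (W t) + mk k (om' t))" for t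
    have one: "blf (gen eps t) (onek k) = 0" for t
      using e by (simp add: gen_def K_one)
    have dZ: "(Z has_vector_derivative Z' t) (at t within {0..T})" if t: "t \<in> {0..T}" for t
    proof -
      have 1: "((\<lambda>t. blf (Pop eps s t) (W t - C *\<^sub>R onek k)) has_vector_derivative
         (blf (Pop eps s t) (mk k (om' t) - 0) + blf (Pop eps s t * gen eps t) (W t - C *\<^sub>R onek k))) (at t within {0..T})"
        by (intro bounded_bilinear.has_vector_derivative[OF bounded_bilinear_blf] Pop_has_vector_derivative_upper e t
             has_vector_derivative_diff W_has_vector_derivative has_vector_derivative_const)
      have 2: "((\<lambda>t. exp (c * t)) has_real_derivative c * exp (c * t)) (at t within {0..T})"
        by (auto intro!: derivative_eq_intros)
      show ?thesis unfolding Z_def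
        using has_vector_derivative_scaleR[OF 2 1]
        by (simp add: Z'_def blinfun.diff_right blinfun.scaleR_right blinfun.add_right one scaleR_add_right algebra_simps)
    qed
    define h where "h t = ev k (Z t) x" for t
    have dh: "(h has_real_derivative ev k (Z' t) x) (at t within {0..T})" if "t \<in> {0..T}" for t
      unfolding h_def has_real_derivative_iff_has_vector_derivative
      by (rule bounded_linear.has_vector_derivative[OF bounded_linear_ev dZ[OF that]])
    have neg: "ev k (Z' t) x <= 0" if "s <= t" "t <= T" for t
    proof -
      have t0: "0 <= t" using that e by simp
      have "ev k (c *\<^sub>R (W t - C *\<^sub>R onek k) + blf (gen eps t) (W t) + mk k (om' t)) y <= ev k 0 y" for y
      proof -
        have "jb (exp (- t) *\<^sub>R y) powr k = om t y" by (simp add: om_def wt_def)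
        then show ?thesis
          using C0(2)[OF e(1,2) t0, of y] cC[OF jb_ge_1, of "exp (- t) *\<^sub>R y"] t0
          by (simp add: ev_W ev_om' k0 om'_def om_def[symmetric] algebra_simps)
      qed
      from bpos_mono[OF bpos_Pop[OF e(1,3) that(1)] this, of x]
      show ?thesis unfolding Z'_def by (simp add: blinfun.zero_right mult_nonneg_nonpos)
    qed
    have "h T <= h s"
    proof (cases "s = T")
      case False
      then have sT: "s < T" using e by simp
      show ?thesis
      proof (rule DERIV_nonpos_imp_decreasing_open[OF e(4)])
        fix t assume t: "s < t" "t < T"
        have "at t within {0..T} = at t" using t e by (intro at_within_interior) auto
        then show "\<exists>y. (h has_real_derivative y) (at t) \<and> y <= 0"
          using dh[of t] neg[of t] t e by auto
      next
        have "continuous_on {0..T} h"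
          unfolding continuous_on_eq_continuous_within using DERIV_continuous[OF dh] by blast
        then show "continuous_on {s..T} h" by (rule continuous_on_subset) (use e in auto)
      qed
    qed simp
    then have "exp (c * T) * (ev k (blf (Pop eps s T) (W T)) x - C) <= exp (c * s) * (om s x - C)"
      using e by (simp add: h_def Z_def blinfun.diff_right blinfun.scaleR_right Pop_one ev_W k0)
    then have "exp (- (c * T)) * (exp (c * T) * (ev k (blf (Pop eps s T) (W T)) x - C)) <= exp (- (c * T)) * (exp (c * s) * (om s x - C))"
      by (intro mult_left_mono) auto
    then have *: "exp (- (c * T)) * (exp (c * T) * (ev k (blf (Pop eps s T) (W T)) x - C)) <= exp (- (c * T)) * (exp (c * s) * (om s x - C))" .
    have "ev k (blf (Pop eps s T) (W T)) x - C <= exp (- c * (T - s)) * (om s x - C)"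
    proof -
      have "exp (- (c * T)) * (exp (c * T) * A) = A" for A
        by (simp add: exp_minus)
      moreover have "- c * (T - s) = - (c * T) + c * s" by (simp add: algebra_simps)
      then have "exp (- c * (T - s)) = exp (- (c * T)) * exp (c * s)" by (metis exp_add)
      ultimately show ?thesis using * by (simp only: mult.assoc)
    qed
    also have "... <= exp (- c * (T - s)) * om s x" using c by (intro mult_left_mono) auto
    finally show ?thesis by simp
  qed
  with c show ?thesis using that by blast
qed

end

subsection \<open>Binomial averages\<close>

lemma binomial_commuting:
  fixes X Y :: "'a::real_algebra_1"
  assumes c: "X * Y = Y * X"
  shows "(X + Y) ^ n = (\<Sum>j\<le>n. real (n choose j) *\<^sub>R (X ^ j * Y ^ (n - j)))"
proof (induction n)
  case (Suc n)
  have YX: "Y * X ^ j = X ^ j * Y" for j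
    using power_commuting_commutes[of X Y j] c by simp
  have "(X + Y) ^ Suc n = X * (\<Sum>j\<le>n. real (n choose j) *\<^sub>R (X ^ j * Y ^ (n - j))) + Y * (\<Sum>j\<le>n. real (n choose j) *\<^sub>R (X ^ j * Y ^ (n - j)))"
    by (simp add: Suc distrib_right)
  also have "X * (\<Sum>j\<le>n. real (n choose j) *\<^sub>R (X ^ j * Y ^ (n - j))) = (\<Sum>j\<le>n. real (n choose j) *\<^sub>R (X ^ Suc j * Y ^ (n - j)))"
    by (simp add: sum_distrib_left mult.assoc)
  also have "... = (\<Sum>j\<in>{1..Suc n}. real (n choose (j - 1)) *\<^sub>R (X ^ j * Y ^ (Suc n - j)))"
    by (rule sum.reindex_bij_witness[where i="\<lambda>j. j - 1" and j=Suc]) auto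
  also have "... = (\<Sum>j\<le>Suc n. (if j = 0 then 0 else real (n choose (j - 1))) *\<^sub>R (X ^ j * Y ^ (Suc n - j)))"
    by (rule sum.mono_neutral_cong_left) (auto)
  also have "Y * (\<Sum>j\<le>n. real (n choose j) *\<^sub>R (X ^ j * Y ^ (n - j))) = (\<Sum>j\<le>n. real (n choose j) *\<^sub>R (X ^ j * Y ^ (Suc n - j)))"
    by (auto simp: sum_distrib_left mult.assoc[symmetric] YX Suc_diff_le intro!: sum.cong)
  also have "... = (\<Sum>j\<le>Suc n. real (n choose j) *\<^sub>R (X ^ j * Y ^ (Suc n - j)))"
    by simp
  also have "(\<Sum>j\<le>Suc n. (if j = 0 then 0 else real (n choose (j - 1))) *\<^sub>R (X ^ j * Y ^ (Suc n - j))) + (\<Sum>j\<le>Suc n. real (n choose j) *\<^sub>R (X ^ j * Y ^ (Suc n - j)))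
     = (\<Sum>j\<le>Suc n. real (Suc n choose j) *\<^sub>R (X ^ j * Y ^ (Suc n - j)))"
    unfolding sum.distrib[symmetric] scaleR_add_left[symmetric]
  proof (intro sum.cong refl arg_cong2[where f=scaleR])
    fix j show "(if j = 0 then 0 else real (n choose (j - 1))) + real (n choose j) = real (Suc n choose j)"
      by (cases j) auto
  qed
  finally show ?case .
qed simp

text \<open>Cauchy-Schwarz against the variance: for a fair binomial j the quantity 2 j - N has mean
  0 and variance N, read off from the moments of the Bernstein polynomials at 1/2.\<close>

lemma binomial_central_deviation:
  assumes N: "0 < N"
  shows "(\<Sum>j\<le>N. real (N choose j) * \<bar>2 * real j - real N\<bar>) <= 2 ^ N * sqrt (real N)"
proof -
  have B: "Bernstein N j (1/2) = real (N choose j) / 2 ^ N" if "j <= N" for j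
    using that by (simp add: Bernstein_def power_divide power_add[symmetric] flip: power_divide)
       (simp add: power_divide power_add[symmetric])
  have "(\<Sum>j\<le>N. (2 * real j - real N)\<^sup>2 * Bernstein N j (1/2))
      = (\<Sum>j\<le>N. 4 * (real j * (real j - 1) * Bernstein N j (1/2)) + (4 - 4 * real N) * (real j * Bernstein N j (1/2)) + (real N)\<^sup>2 * Bernstein N j (1/2))"
    by (intro sum.cong refl) (simp add: power2_eq_square algebra_simps)
  also have "... = 4 * (real N * (real N - 1) * (1/2)\<^sup>2) + (4 - 4 * real N) * (real N * (1/2)) + (real N)\<^sup>2 * 1"
    unfolding sum.distrib sum_distrib_left[symmetric] by (simp only: sum_kk_Bernstein sum_k_Bernstein sum_Bernstein)
  also have "... = real N" by (simp add: power2_eq_square algebra_simps)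
  finally have var: "(\<Sum>j\<le>N. (2 * real j - real N)\<^sup>2 * Bernstein N j (1/2)) = real N" .
  have nn: "0 <= Bernstein N j (1/2)" for j by (rule Bernstein_nonneg) auto
  have "(\<Sum>j\<le>N. sqrt (Bernstein N j (1/2)) * (sqrt (Bernstein N j (1/2)) * \<bar>2 * real j - real N\<bar>))\<^sup>2
     <= (\<Sum>j\<le>N. (sqrt (Bernstein N j (1/2)))\<^sup>2) * (\<Sum>j\<le>N. (sqrt (Bernstein N j (1/2)) * \<bar>2 * real j - real N\<bar>)\<^sup>2)"
    by (rule Cauchy_Schwarz_ineq_sum)
  also have "... = 1 * real N"
    using var by (simp add: power_mult_distrib nn mult.commute)
  finally have "(\<Sum>j\<le>N. Bernstein N j (1/2) * \<bar>2 * real j - real N\<bar>)\<^sup>2 <= real N"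
    by (simp add: mult.assoc[symmetric] nn)
  then have "(\<Sum>j\<le>N. Bernstein N j (1/2) * \<bar>2 * real j - real N\<bar>) <= sqrt (real N)"
    by (rule real_le_rsqrt)
  then have "2 ^ N * (\<Sum>j\<le>N. Bernstein N j (1/2) * \<bar>2 * real j - real N\<bar>) <= 2 ^ N * sqrt (real N)"
    by (intro mult_left_mono) auto
  then show ?thesis by (simp add: sum_distrib_left B)
qed

text \<open>After n fair choices between staying and shifting, the mass is spread over about sqrt n
  steps, so one more step is hardly noticed. The coefficients are differences of neighbouring
  binomial coefficients, equal to (n+1 choose j) (2 j - n - 1) / (n + 1), and their absolute sum is
  the mean deviation bounded above.\<close>

lemma sbd_shift_binomial:
  fixes S :: "'n::finite bop"
  assumes S: "sbd k S 1"
  shows "sbd k ((S - 1) * ((1/2) *\<^sub>R (S + 1)) ^ n) (2 / sqrt (real n + 1))"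
proof -
  \<comment> \<open>The case j = 0 is separate because j - 1 is truncated there.\<close>
  define c where "c j = (if j = 0 then 0 else real (n choose (j - 1))) - real (n choose j)" for j
  have "(S - 1) * (S + 1) ^ n = S * (\<Sum>j\<le>n. real (n choose j) *\<^sub>R S ^ j) - (\<Sum>j\<le>n. real (n choose j) *\<^sub>R S ^ j)"
    using binomial_commuting[of S 1 n] by (simp add: left_diff_distrib)
  also have "S * (\<Sum>j\<le>n. real (n choose j) *\<^sub>R S ^ j) = (\<Sum>j\<le>n. real (n choose j) *\<^sub>R S ^ Suc j)"
    by (simp add: sum_distrib_left)
  also have "... = (\<Sum>j\<in>{1..Suc n}. real (n choose (j - 1)) *\<^sub>R S ^ j)"
    by (rule sum.reindex_bij_witness[where i="\<lambda>j. j - 1" and j=Suc]) auto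
  also have "... = (\<Sum>j\<le>Suc n. (if j = 0 then 0 else real (n choose (j - 1))) *\<^sub>R S ^ j)"
    by (rule sum.mono_neutral_cong_left) auto
  also have "(\<Sum>j\<le>n. real (n choose j) *\<^sub>R S ^ j) = (\<Sum>j\<le>Suc n. real (n choose j) *\<^sub>R S ^ j)"
    by simp
  also have "(\<Sum>j\<le>Suc n. (if j = 0 then 0 else real (n choose (j - 1))) *\<^sub>R S ^ j) - (\<Sum>j\<le>Suc n. real (n choose j) *\<^sub>R S ^ j)
     = (\<Sum>j\<le>Suc n. c j *\<^sub>R S ^ j)"
    unfolding c_def scaleR_diff_left sum_subtractf ..
  finally have e: "(S - 1) * (S + 1) ^ n = (\<Sum>j\<le>Suc n. c j *\<^sub>R S ^ j)" .
  have "sbd k (\<Sum>j\<le>Suc n. c j *\<^sub>R S ^ j) (\<Sum>j\<le>Suc n. \<bar>c j\<bar> * 1 ^ j)"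
    by (intro sbd_sum sbd_scale sbd_power S)
  then have s1: "sbd k ((1/2)^n *\<^sub>R ((S - 1) * (S + 1) ^ n)) (\<bar>(1/2)^n\<bar> * (\<Sum>j\<le>Suc n. \<bar>c j\<bar> * 1 ^ j))"
    unfolding e by (rule sbd_scale)
  have cj: "\<bar>c j\<bar> = real (Suc n choose j) * \<bar>2 * real j - real (Suc n)\<bar> / real (Suc n)" if j: "j <= Suc n" for j
  proof -
    have 1: "(if j = 0 then 0 else real (n choose (j - 1))) * real (Suc n) = real j * real (Suc n choose j)"
    proof (cases j)
      case (Suc i)
      have "Suc i * (Suc n choose Suc i) = Suc n * (n choose i)"
        using Suc_times_binomial_eq[of n i] by (metis mult.commute)
      then have "real (Suc i * (Suc n choose Suc i)) = real (Suc n * (n choose i))"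
        by (simp only:)
      then show ?thesis using Suc by (simp only: of_nat_mult) (simp add: mult.commute)
    qed simp
    have 2: "real (n choose j) * real (Suc n) = (real (Suc n) - real j) * real (Suc n choose j)"
    proof -
      have "real (Suc n choose j) = (if j = 0 then 0 else real (n choose (j - 1))) + real (n choose j)"
        by (cases j) auto
      then have "real (Suc n choose j) * real (Suc n) = real j * real (Suc n choose j) + real (n choose j) * real (Suc n)"
        using 1 by (simp only: distrib_right)
      then show ?thesis unfolding left_diff_distrib
        using mult.commute[of "real (Suc n)" "real (Suc n choose j)"] by linarith
    qed
    have "c j * real (Suc n) = real (Suc n choose j) * (2 * real j - real (Suc n))"
      unfolding c_def left_diff_distrib 1 2 by (simp only: algebra_simps)
    then have "c j = real (Suc n choose j) * (2 * real j - real (Suc n)) / real (Suc n)"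
      by (simp add: field_simps del: of_nat_Suc)
    then show ?thesis by (simp add: abs_mult del: of_nat_Suc)
  qed
  have "(\<Sum>j\<le>Suc n. \<bar>c j\<bar> * 1 ^ j) = (\<Sum>j\<le>Suc n. real (Suc n choose j) * \<bar>2 * real j - real (Suc n)\<bar>) / real (Suc n)"
    unfolding sum_divide_distrib by (intro sum.cong refl) (simp only: cj power_one mult_1_right atMost_iff)
  also have "... <= 2 ^ Suc n * sqrt (real (Suc n)) / real (Suc n)"
    by (intro divide_right_mono binomial_central_deviation) auto
  also have "... = 2 ^ Suc n / sqrt (real (Suc n))"
    by (simp add: real_div_sqrt field_simps del: of_nat_Suc power_Suc)
  finally have le: "(\<Sum>j\<le>Suc n. \<bar>c j\<bar> * 1 ^ j) <= 2 ^ Suc n / sqrt (real (Suc n))" .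
  have ab: "\<bar>(1/2)^n\<bar> = (1/2::real)^n" by simp
  from le have "\<bar>(1/2)^n\<bar> * (\<Sum>j\<le>Suc n. \<bar>c j\<bar> * 1 ^ j) <= (1/2)^n * (2 ^ Suc n / sqrt (real (Suc n)))"
    unfolding ab by (intro mult_left_mono) auto
  also have "... = 2 / sqrt (real n + 1)" by (simp add: power_divide add.commute)
  finally have s2: "\<bar>(1/2)^n\<bar> * (\<Sum>j\<le>Suc n. \<bar>c j\<bar> * 1 ^ j) <= 2 / sqrt (real n + 1)" .
  have "(S - 1) * ((1/2) *\<^sub>R (S + 1)) ^ n = (1/2)^n *\<^sub>R ((S - 1) * (S + 1) ^ n)"
    by (simp add: scaleR_power)
  then show ?thesis using sbd_mono[OF s1 s2] by simp
qed

text \<open>The mean of 1/(n+1) under a binomial law of N trials is, up to the factor (N+1) x, the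
  mass of the positive outcomes for N + 1 trials. Cauchy-Schwarz then passes to the square
  root.\<close>

lemma binomial_inverse_moment:
  assumes x: "0 < x" "x <= 1"
  shows "(\<Sum>n\<le>N. Bernstein N n x * (2 / sqrt (real n + 1))) <= 2 / sqrt ((real N + 1) * x)"
proof -
  have nn: "0 <= Bernstein N n x" for N n using x by (intro Bernstein_nonneg) auto
  have "(\<Sum>n\<le>N. Bernstein N n x / (real n + 1)) * ((real N + 1) * x) = (\<Sum>n\<le>N. Bernstein (Suc N) (Suc n) x)"
    unfolding sum_distrib_right
  proof (intro sum.cong refl)
    fix n assume "n \<in> {..N}"
    have "real (Suc n) * real (Suc N choose Suc n) = real (Suc N) * real (N choose n)"
      unfolding of_nat_mult[symmetric] using Suc_times_binomial_eq[of N n] by (simp only: mult.commute)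
    then have e: "real (Suc N choose Suc n) = (real N + 1) * real (N choose n) / (real n + 1)"
      by (simp add: field_simps del: binomial_Suc_Suc)
    show "Bernstein N n x / (real n + 1) * ((real N + 1) * x) = Bernstein (Suc N) (Suc n) x"
      unfolding Bernstein_def e by simp
  qed
  also have "... <= (\<Sum>n\<le>Suc N. Bernstein (Suc N) n x)"
    unfolding sum.atMost_Suc_shift using nn[of "Suc N" 0] by simp
  also have "... = 1" by (rule sum_Bernstein)
  finally have 1: "(\<Sum>n\<le>N. Bernstein N n x / (real n + 1)) <= 1 / ((real N + 1) * x)"
    using x by (simp add: pos_le_divide_eq)
  \<comment> \<open>The factors are the roots of the weights, which sum to 1, and the roots of the
    terms bounded just before.\<close>
  have "(\<Sum>n\<le>N. sqrt (Bernstein N n x) * (sqrt (Bernstein N n x) / sqrt (real n + 1)))\<^sup>2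
     <= (\<Sum>n\<le>N. (sqrt (Bernstein N n x))\<^sup>2) * (\<Sum>n\<le>N. (sqrt (Bernstein N n x) / sqrt (real n + 1))\<^sup>2)"
    by (rule Cauchy_Schwarz_ineq_sum)
  also have "... = (\<Sum>n\<le>N. Bernstein N n x / (real n + 1))"
    by (simp add: nn power_divide)
  also note 1
  finally have "(\<Sum>n\<le>N. Bernstein N n x / sqrt (real n + 1))\<^sup>2 <= 1 / ((real N + 1) * x)"
    by (simp add: nn mult.assoc[symmetric])
  then have "(\<Sum>n\<le>N. Bernstein N n x / sqrt (real n + 1)) <= sqrt (1 / ((real N + 1) * x))"
    by (rule real_le_rsqrt)
  then have "2 * (\<Sum>n\<le>N. Bernstein N n x / sqrt (real n + 1)) <= 2 * sqrt (1 / ((real N + 1) * x))"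
    by simp
  then show ?thesis by (simp add: sum_distrib_left real_sqrt_divide mult.commute[of 2])
qed

subsection \<open>Uniform densities on boxes\<close>

lemma nn_integral_prod_vec:
  fixes f :: "'n::finite => real => ennreal"
  assumes [measurable]: "\<And>i. f i \<in> borel_measurable borel"
  shows "(\<integral>\<^sup>+x. (\<Prod>i\<in>UNIV. f i (x $ i)) \<partial>(lborel :: (real ^ 'n) measure)) = (\<Prod>i\<in>UNIV. \<integral>\<^sup>+t. f i t \<partial>lborel)"
proof -
  define ax where "ax = (\<lambda>i::'n. axis i (1::real))"
  have inj: "inj ax" by (auto simp: inj_on_def ax_def axis_eq_axis)
  have B: "Basis = range ax" by (auto simp: Basis_vec_def ax_def)
  have "(\<integral>\<^sup>+x. (\<Prod>b\<in>Basis. f (inv ax b) (x \<bullet> b)) \<partial>(lborel :: (real ^ 'n) measure)) = (\<Prod>b\<in>Basis. \<integral>\<^sup>+t. f (inv ax b) t \<partial>lborel)"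
    by (rule nn_integral_lborel_prod) auto
  moreover have "(\<Prod>b\<in>Basis. f (inv ax b) (x \<bullet> b)) = (\<Prod>i\<in>UNIV. f i (x $ i))" for x
    unfolding B prod.reindex[OF inj] comp_def inv_f_f[OF inj] by (simp add: ax_def inner_axis)
  moreover have "(\<Prod>b\<in>Basis. \<integral>\<^sup>+t. f (inv ax b) t \<partial>lborel) = (\<Prod>i\<in>UNIV. \<integral>\<^sup>+t. f i t \<partial>lborel)"
    unfolding B prod.reindex[OF inj] comp_def inv_f_f[OF inj] ..
  ultimately show ?thesis by simp
qed

definition bx1 :: "real => real => real => real" where
  "bx1 a l t = (if a <= t \<and> t < a + l then 1 / l else 0)"

text \<open>Half-open boxes make the decompositions below hold pointwise and not only almost everywhere.\<close>

definition bx :: "real ^ 'n => ('n => real) => real ^ 'n => real" where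
  "bx p l y = (\<Prod>i\<in>UNIV. bx1 (p $ i) (l i) (y $ i))"

lemma bx1_measurable [measurable]: "bx1 a l \<in> borel_measurable borel"
  unfolding bx1_def by measurable

lemma bx_measurable [measurable]: "bx p l \<in> borel_measurable borel"
  unfolding bx_def[abs_def] by measurable

lemma bx1_nonneg: "0 < l ==> 0 <= bx1 a l t"
  by (simp add: bx1_def)

lemma bx_nonneg: "(\<And>i. 0 < l i) ==> 0 <= bx p l y"
  by (simp add: bx_def prod_nonneg bx1_nonneg)

lemma nn_integral_bx1: "0 < l ==> (\<integral>\<^sup>+t. ennreal (bx1 a l t) \<partial>lborel) = 1"
proof -
  assume l: "0 < l"
  have "(\<integral>\<^sup>+t. ennreal (bx1 a l t) \<partial>lborel) = (\<integral>\<^sup>+t. ennreal (1 / l) * indicator {a..<a + l} t \<partial>lborel)"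
    by (intro nn_integral_cong) (auto simp: bx1_def indicator_def)
  also have "... = ennreal (1 / l) * ennreal l" using l by (simp add: nn_integral_cmult_indicator)
  also have "... = 1" using l by (simp add: ennreal_mult[symmetric])
  finally show ?thesis .
qed

lemma nn_integral_bx: 
  assumes l: "\<And>i. 0 < l i" shows "(\<integral>\<^sup>+y. ennreal (bx p l y) \<partial>lborel) = 1"
proof -
  have "(\<integral>\<^sup>+y. ennreal (bx p l y) \<partial>lborel) = (\<integral>\<^sup>+y. (\<Prod>i\<in>UNIV. ennreal (bx1 (p $ i) (l i) (y $ i))) \<partial>lborel)"
    unfolding bx_def by (simp add: prod_ennreal bx1_nonneg l)
  also have "... = 1"
    by (subst nn_integral_prod_vec) (simp_all add: nn_integral_bx1 l)
  finally show ?thesis .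
qed

lemma bx_support:
  assumes "bx p l y \<noteq> 0" and l: "\<And>i. 0 < l i"
  shows "norm (y - p) <= (\<Sum>i\<in>UNIV. l i)"
proof -
  have nz: "bx1 (p $ i) (l i) (y $ i) \<noteq> 0" for i using assms(1) by (auto simp: bx_def)
  have "\<bar>(y - p) $ i\<bar> <= l i" for i using nz[of i] by (auto simp: bx1_def split: if_splits)
  then have "(\<Sum>i\<in>UNIV. \<bar>(y - p) $ i\<bar>) <= (\<Sum>i\<in>UNIV. l i)" by (intro sum_mono)
  then show ?thesis using norm_le_l1_cart[of "y - p"] by linarith
qed

lemma integrable_bx: "(\<And>i. 0 < l i) ==> integrable lborel (bx p l)"
  by (rule integrableI_nonneg) (auto simp: nn_integral_bx bx_nonneg)

lemma integral_bx: "(\<And>i. 0 < l i) ==> (LBINT y. bx p l y) = 1"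
  by (subst integral_eq_nn_integral) (auto simp: nn_integral_bx bx_nonneg)

lemma wkernel_bx:
  assumes k: "0 <= k" and l: "\<And>i. 0 < l i" shows "wkernel k (bx p l)"
proof -
  define R where "R = norm p + (\<Sum>i\<in>UNIV. l i)"
  have "integrable lborel (\<lambda>y. kw k y * \<bar>bx p l y\<bar>)"
  proof (rule Bochner_Integration.integrable_bound)
    show "integrable lborel (\<lambda>y. (1 + R) powr k * bx p l y)" by (intro integrable_mult_right integrable_bx l)
    have "kw k y * \<bar>bx p l y\<bar> <= (1 + R) powr k * \<bar>bx p l y\<bar>" for y
    proof (cases "bx p l y = 0")
      case False
      have "norm y <= R" using bx_support[OF False l] norm_triangle_ineq2[of y p] unfolding R_def by linarith
      then have "kw k y <= (1 + R) powr k" unfolding kw_def using k by (intro powr_mono2) auto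
      then show ?thesis by (intro mult_right_mono) auto
    qed simp
    then show "AE y in lborel. norm (kw k y * \<bar>bx p l y\<bar>) <= norm ((1 + R) powr k * bx p l y)"
      by (intro AE_I2) (simp add: abs_mult)
  qed measurable
  then show ?thesis by (simp add: wkernel_def)
qed

lemma cop_one:
  assumes "0 <= k" "wkernel k g" "(LBINT y. g y) = 1"
  shows "blf (cop k g) (onek k) = onek k"
  using assms by (intro ev_inject[of k]) (simp add: ev_cop)

lemma sbd_cop_bx:
  assumes "0 <= k" "\<And>i. 0 < l i" shows "sbd k (cop k (bx p l)) 1"
  using assms by (intro sbd_bpos bpos_cop wkernel_bx bx_nonneg) (auto simp: cop_one wkernel_bx integral_bx)

lemma sbd_shop: "0 <= k ==> sbd k (shop k h) 1"
  by (auto simp: sbd_def ev_shop)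

lemma bx_update: "bx p (l(i := a)) y = bx1 (p $ i) a (y $ i) * (\<Prod>j\<in>UNIV - {i}. bx1 (p $ j) (l j) (y $ j))"
proof -
  have "bx p (l(i := a)) y = bx1 (p $ i) a (y $ i) * (\<Prod>j\<in>UNIV - {i}. bx1 (p $ j) ((l(i := a)) j) (y $ j))"
    unfolding bx_def by (subst prod.remove[of UNIV i]) auto
  also have "(\<Prod>j\<in>UNIV - {i}. bx1 (p $ j) ((l(i := a)) j) (y $ j)) = (\<Prod>j\<in>UNIV - {i}. bx1 (p $ j) (l j) (y $ j))"
    by (intro prod.cong) auto
  finally show ?thesis .
qed

lemma bx_update_shift:
  "bx p (l(i := a)) (y - h *\<^sub>R axis i 1) = bx1 (p $ i) a (y $ i - h) * (\<Prod>j\<in>UNIV - {i}. bx1 (p $ j) (l j) (y $ j))"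
proof -
  have "(\<Prod>j\<in>UNIV - {i}. bx1 (p $ j) (l j) ((y - h *\<^sub>R axis i 1) $ j)) = (\<Prod>j\<in>UNIV - {i}. bx1 (p $ j) (l j) (y $ j))"
    by (intro prod.cong) (auto simp: axis_def)
  then show ?thesis by (simp add: bx_update)
qed

lemma wkernel_shift:
  assumes k: "0 <= k" and g: "wkernel k g"
  shows "wkernel k (\<lambda>y. g (y - h))"
proof -
  have [measurable]: "g \<in> borel_measurable borel" using g by (simp add: wkernel_def)
  have "integrable lborel (\<lambda>y. kw k (y + h) * \<bar>g y\<bar>)"
    by (rule wkernel_integrable_mono[OF g, of _ "kw k h"])
       (auto simp: abs_mult mult.commute[of "kw k h"] intro!: mult_right_mono kw_add k)
  then have "integrable lborel (\<lambda>y. kw k y * \<bar>g (y - h)\<bar>)"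
    by (subst integrable_shift_iff[of "\<lambda>y. kw k y * \<bar>g (y - h)\<bar>" h, symmetric]) auto
  then show ?thesis by (simp add: wkernel_def)
qed

lemma shop_cop:
  assumes k: "0 <= k" and g: "wkernel k g"
  shows "shop k h * cop k g = cop k (\<lambda>y. g (y - h))"
proof (rule bop_eqI_ev[of k])
  fix f x
  have [measurable]: "g \<in> borel_measurable borel" using g by (simp add: wkernel_def)
  have "ev k (blf (cop k (\<lambda>y. g (y - h))) f) x = (LBINT y. ev k f (x + (y + h)) * g (y + h - h))"
    unfolding ev_cop[OF k wkernel_shift[OF k g]]
    by (subst integral_shift[of "\<lambda>y. ev k f (x + y) * g (y - h)" h, symmetric]) auto
  then show "ev k (blf (shop k h * cop k g) f) x = ev k (blf (cop k (\<lambda>y. g (y - h))) f) x"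
    by (simp add: ev_shop ev_cop k g ac_simps)
qed

lemma wkernel_add: 
  assumes "wkernel k f" "wkernel k g" shows "wkernel k (\<lambda>y. f y + g y)"
  using wkernel_diff[OF assms(1) wkernel_scale[OF assms(2), of "-1"]] by simp

lemma cop_add:
  assumes "0 <= k" "wkernel k f" "wkernel k g"
  shows "cop k (\<lambda>y. f y + g y) = cop k f + cop k g"
  using cop_diff[OF assms(1,2) wkernel_scale[OF assms(3), of "-1"]] cop_scale[OF assms(1,3), of "-1"] by simp

text \<open>A box of side \<open>2 s\<close> in direction \<open>i\<close> is the average of two translates of the box of side \<open>s\<close>.\<close>

lemma cop_bx_halve:
  assumes k: "0 <= k" and l: "\<And>j. 0 < l j" and s: "0 < s"
  shows "cop k (bx p (l(i := 2 * s))) = (1/2) *\<^sub>R (shop k (s *\<^sub>R axis i 1) + 1) * cop k (bx p (l(i := s)))"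
proof -
  have w: "wkernel k (bx p (l(i := a)))" if "0 < a" for a using that l by (intro wkernel_bx k) auto
  have e: "bx p (l(i := 2 * s)) y = (1/2) * (bx p (l(i := s)) (y - s *\<^sub>R axis i 1) + bx p (l(i := s)) y)" for y
  proof -
    have "bx1 (p $ i) (2 * s) (y $ i) = (1/2) * (bx1 (p $ i) s (y $ i - s) + bx1 (p $ i) s (y $ i))"
      using s by (auto simp: bx1_def)
    then show ?thesis unfolding bx_update_shift unfolding bx_update by (simp add: algebra_simps)
  qed
  have "cop k (bx p (l(i := 2 * s))) = cop k (\<lambda>y. (1/2) * (bx p (l(i := s)) (y - s *\<^sub>R axis i 1) + bx p (l(i := s)) y))"
    by (rule arg_cong[where f="cop k"]) (use e in blast)
  also have "... = (1/2) *\<^sub>R (cop k (\<lambda>y. bx p (l(i := s)) (y - s *\<^sub>R axis i 1)) + cop k (bx p (l(i := s))))"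
    using s by (subst cop_scale, simp add: k, intro wkernel_add wkernel_shift k w s)
      (subst cop_add, auto intro!: k w wkernel_shift)
  also have "cop k (\<lambda>y. bx p (l(i := s)) (y - s *\<^sub>R axis i 1)) = shop k (s *\<^sub>R axis i 1) * cop k (bx p (l(i := s)))"
    using s by (intro shop_cop[symmetric] k w)
  finally show ?thesis by (simp only: distrib_right mult_1_left mult_scaleR_left)
qed

text \<open>Translating a box by \<open>h\<close> trades for translating a thinner box by the full side \<open>s\<close>.\<close>

lemma cop_bx_exchange:
  assumes k: "0 <= k" and l: "\<And>j. 0 < l j" and s: "0 < s" and h: "0 < h"
  shows "(shop k (h *\<^sub>R axis i 1) - 1) * cop k (bx p (l(i := s)))
    = (h / s) *\<^sub>R ((shop k (s *\<^sub>R axis i 1) - 1) * cop k (bx p (l(i := h))))"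
proof -
  have w: "wkernel k (bx p (l(i := a)))" if "0 < a" for a using that l by (intro wkernel_bx k) auto
  have d: "(shop k (b *\<^sub>R axis i 1) - 1) * cop k (bx p (l(i := a))) = cop k (\<lambda>y. bx p (l(i := a)) (y - b *\<^sub>R axis i 1) - bx p (l(i := a)) y)" if "0 < a" for a b
    using that by (simp add: left_diff_distrib shop_cop k w cop_diff wkernel_shift)
  have e: "bx p (l(i := s)) (y - h *\<^sub>R axis i 1) - bx p (l(i := s)) y = (h / s) * (bx p (l(i := h)) (y - s *\<^sub>R axis i 1) - bx p (l(i := h)) y)" for y
  proof -
    have 1: "bx1 (p $ i) s (y $ i - h) - bx1 (p $ i) s (y $ i) = (h / s) * (bx1 (p $ i) h (y $ i - s) - bx1 (p $ i) h (y $ i))"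
      using s h by (auto simp: bx1_def)
    show ?thesis unfolding bx_update_shift unfolding bx_update left_diff_distrib[symmetric] 1 by (simp add: mult.assoc)
  qed
  have "(shop k (h *\<^sub>R axis i 1) - 1) * cop k (bx p (l(i := s))) = cop k (\<lambda>y. (h / s) * (bx p (l(i := h)) (y - s *\<^sub>R axis i 1) - bx p (l(i := h)) y))"
    unfolding d[OF s] by (rule arg_cong[where f="cop k"]) (use e in blast)
  also have "... = (h / s) *\<^sub>R ((shop k (s *\<^sub>R axis i 1) - 1) * cop k (bx p (l(i := h))))"
    using h by (subst cop_scale) (auto intro!: k w wkernel_diff wkernel_shift simp: d)
  finally show ?thesis .
qed

subsection \<open>A uniform lower bound for the two-jump operator\<close>

lemma
  fixes f :: "real ^ 'n => real"
  assumes [measurable]: "f \<in> borel_measurable borel"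
  shows integrable_reflect_iff: "integrable lborel (\<lambda>x. f (- x)) \<longleftrightarrow> integrable lborel f"
    and integral_reflect: "(LBINT x. f (- x)) = (LBINT x. f x)"
proof -
  have l: "lborel = distr (lborel :: (real ^ 'n) measure) borel uminus"
    using lborel_affine[of "-1" "0 :: real ^ 'n"] by (simp add: density_1)
  show "integrable lborel (\<lambda>x. f (- x)) \<longleftrightarrow> integrable lborel f"
    by (subst (2) l) (simp add: integrable_distr_eq)
  show "(LBINT x. f (- x)) = (LBINT x. f x)"
    by (subst (2) l) (simp add: integral_distr)
qed

lemma kw_0: "kw 0 x = 1"
proof -
  have "1 + norm x \<noteq> 0" using norm_ge_zero[of x] by linarith
  then show ?thesis by (simp add: kw_def)
qed

text \<open>The convolution of two bounded densities is continuous, so it is bounded below on some box.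
  Both factors may be dilated slightly.\<close>

lemma convolution_lower_bound:
  fixes j :: "real ^ 'n => real"
  assumes jm[measurable]: "j \<in> borel_measurable borel" and j: "\<And>x. 0 <= j x \<and> j x <= 1"
    and ji: "integrable lborel j" and jpos: "(LBINT x. j x) > 0"
  obtains p \<rho> \<eta> \<gamma> where "0 < \<rho>" "0 < \<eta>" "\<eta> <= 1" "0 < \<gamma>"
    "\<And>y a b. norm (y - p) <= real CARD('n) * (2 * \<rho>) ==> 0 <= a ==> a <= \<eta> ==> 0 <= b ==> b <= \<eta> ==>
      \<gamma> <= (LBINT z. j (exp (- b) *\<^sub>R (y - exp a *\<^sub>R z)) * j z)"
proof -
  have bnd: "integrable lborel (\<lambda>z. f (\<beta> *\<^sub>R z + v) * g z)"
    if [measurable]: "f \<in> borel_measurable borel" and "\<And>x. \<bar>f x\<bar> <= 1" and gi: "integrable lborel g" for f g :: "real ^ 'n => real" and \<beta> v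
  proof (rule Bochner_Integration.integrable_bound[OF gi])
    show "(\<lambda>z. f (\<beta> *\<^sub>R z + v) * g z) \<in> borel_measurable lborel"
      using borel_measurable_integrable[OF gi] by simp
    show "AE x in lborel. norm (f (\<beta> *\<^sub>R x + v) * g x) <= norm (g x)"
      using that(2) by (auto simp: abs_mult intro!: AE_I2 mult_left_le_one_le)
  qed
  \<comment> \<open>Otherwise the nonnegative convolution vanishes everywhere, while by Tonelli its
    integral is the square of the positive mass of \<open>j\<close>.\<close>
  have "\<exists>y0. 0 < (LBINT z. j (y0 - z) * j z)"
  proof (rule ccontr)
    assume "\<not> ?thesis"
    then have le: "(LBINT z. j (y - z) * j z) <= 0" for y by (simp add: not_less)
    have int: "integrable lborel (\<lambda>z. j (y - z) * j z)" for y
      using bnd[OF jm _ ji, of "-1" y] j by (simp add: add.commute)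
    have z: "(\<integral>\<^sup>+z. ennreal (j (y - z) * j z) \<partial>lborel) = 0" for y
      by (subst nn_integral_eq_integral[OF int]) (use j le in \<open>auto simp: ennreal_eq_0_iff\<close>)
    have "(\<integral>\<^sup>+y. \<integral>\<^sup>+z. ennreal (j (y - z) * j z) \<partial>lborel \<partial>lborel) = (\<integral>\<^sup>+z. \<integral>\<^sup>+y. ennreal (j (y - z) * j z) \<partial>lborel \<partial>lborel)"
      by (rule lborel_pair.Fubini') measurable
    also have "... = (\<integral>\<^sup>+z. (\<integral>\<^sup>+y. ennreal (j y) \<partial>lborel) * ennreal (j z) \<partial>lborel)"
    proof (intro nn_integral_cong)
      fix z
      have "(\<integral>\<^sup>+y. ennreal (j (y - z) * j z) \<partial>lborel) = (\<integral>\<^sup>+y. ennreal (j (y - z)) * ennreal (j z) \<partial>lborel)"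
        using j by (simp add: ennreal_mult)
      also have "... = (\<integral>\<^sup>+y. ennreal (j (y - z)) \<partial>lborel) * ennreal (j z)"
        by (rule nn_integral_multc) measurable
      also have "(\<integral>\<^sup>+y. ennreal (j (y - z)) \<partial>lborel) = (\<integral>\<^sup>+y. ennreal (j y) \<partial>lborel)"
        by (subst nn_integral_scale[of "\<lambda>y. ennreal (j (y - z))" 1 z]) auto
      finally show "(\<integral>\<^sup>+y. ennreal (j (y - z) * j z) \<partial>lborel) = (\<integral>\<^sup>+y. ennreal (j y) \<partial>lborel) * ennreal (j z)" .
    qed
    also have "... = (\<integral>\<^sup>+y. ennreal (j y) \<partial>lborel) * (\<integral>\<^sup>+y. ennreal (j y) \<partial>lborel)"
      by (rule nn_integral_cmult) measurable
    also have "(\<integral>\<^sup>+y. ennreal (j y) \<partial>lborel) = ennreal (LBINT x. j x)"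
      using j by (intro nn_integral_eq_integral ji) auto
    finally show False using z jpos by (simp add: ennreal_mult[symmetric])
  qed
  then obtain y0 where y0: "0 < (LBINT z. j (y0 - z) * j z)" by blast
  define c where "c = (LBINT z. j (y0 - z) * j z)"
  have c: "0 < c" using y0 by (simp add: c_def)
  \<comment> \<open>The factor bounding the error of replacing \<open>j\<close> by \<open>g\<close>:
    the dilated argument costs at most exp 1 for each dimension, the second factor of the product
    costs 1.\<close>
  define E :: real where "E = exp 1 ^ CARD('n) + 1"
  have E: "0 < E" by (simp add: E_def add_pos_pos)
  \<comment> \<open>Then each replacement of \<open>j\<close> by \<open>g\<close> changes the
    convolution by at most c/8.\<close>
  define \<delta> where "\<delta> = c / (8 * E)"
  have d: "0 < \<delta>" using c E by (simp add: \<delta>_def)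
  have wj: "wkernel 0 j" using ji j by (auto simp: wkernel_def kw_0)
  obtain g R M where gc: "continuous_on UNIV g" and gR: "\<And>x. R < norm x ==> g x = 0" and "\<And>x. \<bar>g x\<bar> <= M" "0 <= M" and wg: "wkernel 0 g"
    and gd: "kn 0 (\<lambda>x. j x - g x) < \<delta>" and g01: "(\<forall>x. 0 <= j x \<and> j x <= 1) \<longrightarrow> (\<forall>x. 0 <= g x \<and> g x <= 1)"
    by (rule continuous_approximation[OF order.refl wj d]) (rule that; assumption)
  have g: "0 <= g x \<and> g x <= 1" for x using g01 j by blast
  have gm[measurable]: "g \<in> borel_measurable borel" using gc by (rule borel_measurable_continuous_onI)
  have gi: "integrable lborel g" using wg g by (auto simp: wkernel_def kw_0)
  have di: "integrable lborel (\<lambda>x. \<bar>j x - g x\<bar>)" using ji gi by auto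
  have dint: "(LBINT x. \<bar>j x - g x\<bar>) <= \<delta>" using gd by (simp add: kn_def kw_0)
  define F where "F f v \<beta> = (LBINT z. f (v - \<beta> *\<^sub>R z) * f z)" for f :: "real ^ 'n => real" and v \<beta>
  have close: "\<bar>F j v \<beta> - F g v \<beta>\<bar> <= E * \<delta>" if b: "exp (- 1) <= \<beta>" for v \<beta>
  proof -
    have bp: "0 < \<beta>" using b by (meson exp_gt_zero less_le_trans)
    have i1: "integrable lborel (\<lambda>z. h (v - \<beta> *\<^sub>R z) * h' z)" if "h \<in> borel_measurable borel" "\<And>x. \<bar>h x\<bar> <= 1" "integrable lborel h'" for h h' :: "real ^ 'n => real"
      using bnd[OF that(1,2,3), of "-\<beta>" v] by simp
    have sc: "integrable lborel (\<lambda>z. \<bar>j (v - \<beta> *\<^sub>R z) - g (v - \<beta> *\<^sub>R z)\<bar>) \<and> (LBINT z. \<bar>j (v - \<beta> *\<^sub>R z) - g (v - \<beta> *\<^sub>R z)\<bar>) <= exp 1 ^ CARD('n) * \<delta>"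
    proof -
      define q where "q x = \<bar>j (- x) - g (- x)\<bar>" for x
      have [measurable]: "q \<in> borel_measurable borel" unfolding q_def by measurable
      have qi: "integrable lborel q" and qe: "(LBINT x. q x) = (LBINT x. \<bar>j x - g x\<bar>)"
        using di integrable_reflect_iff[of "\<lambda>x. \<bar>j x - g x\<bar>"] integral_reflect[of "\<lambda>x. \<bar>j x - g x\<bar>"] unfolding q_def by auto
      have e: "\<bar>j (v - \<beta> *\<^sub>R z) - g (v - \<beta> *\<^sub>R z)\<bar> = q (- v + \<beta> *\<^sub>R z)" for z by (simp add: q_def)
      have "(LBINT x. q x) = \<beta> ^ CARD('n) * (LBINT z. q (- v + \<beta> *\<^sub>R z))"
        by (rule integral_scale) (use bp in auto)
      then have "(LBINT z. q (- v + \<beta> *\<^sub>R z)) = (1 / \<beta>) ^ CARD('n) * (LBINT x. q x)"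
        using bp by (simp add: power_divide)
      also have "... <= exp 1 ^ CARD('n) * \<delta>"
      proof (intro mult_mono power_mono)
        have "1 / \<beta> <= 1 / exp (- 1)" using b bp by (intro divide_left_mono) auto
        then show "1 / \<beta> <= exp 1" by (simp add: exp_minus field_simps)
        show "0 <= (LBINT x. q x)" by (intro integral_nonneg_AE) (simp add: q_def)
      qed (use bp dint qe in auto)
      finally show ?thesis using integrable_scale_iff[of q \<beta> "-v"] bp qi by (simp add: e)
    qed
    have "F j v \<beta> - F g v \<beta> = (LBINT z. (j (v - \<beta> *\<^sub>R z) - g (v - \<beta> *\<^sub>R z)) * j z + g (v - \<beta> *\<^sub>R z) * (j z - g z))"
    proof -
      have "integrable lborel (\<lambda>z. j (v - \<beta> *\<^sub>R z) * j z)" "integrable lborel (\<lambda>z. g (v - \<beta> *\<^sub>R z) * g z)"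
        by (rule i1[OF jm _ ji], use j in simp, rule i1[OF gm _ gi], use g in simp)
      from Bochner_Integration.integral_diff[OF this] show ?thesis
        unfolding F_def by (simp add: algebra_simps)
    qed
    also have "\<bar>...\<bar> <= (LBINT z. \<bar>j (v - \<beta> *\<^sub>R z) - g (v - \<beta> *\<^sub>R z)\<bar> + \<bar>j z - g z\<bar>)"
    proof (rule order.trans[OF integral_abs_bound], rule integral_mono)
      have "integrable lborel (\<lambda>z. j (v - \<beta> *\<^sub>R z) * j z - g (v - \<beta> *\<^sub>R z) * j z + g (v - \<beta> *\<^sub>R z) * (j z - g z))"
        using j g by (intro Bochner_Integration.integrable_add Bochner_Integration.integrable_diff i1 ji gi) auto
      then show "integrable lborel (\<lambda>z. \<bar>(j (v - \<beta> *\<^sub>R z) - g (v - \<beta> *\<^sub>R z)) * j z + g (v - \<beta> *\<^sub>R z) * (j z - g z)\<bar>)"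
        unfolding left_diff_distrib by (rule integrable_abs)
      show "integrable lborel (\<lambda>z. \<bar>j (v - \<beta> *\<^sub>R z) - g (v - \<beta> *\<^sub>R z)\<bar> + \<bar>j z - g z\<bar>)"
        using sc di by auto
      fix z
      have "\<bar>(j (v - \<beta> *\<^sub>R z) - g (v - \<beta> *\<^sub>R z)) * j z\<bar> <= \<bar>j (v - \<beta> *\<^sub>R z) - g (v - \<beta> *\<^sub>R z)\<bar>"
        using j[of z] by (auto simp: abs_mult intro!: mult_right_le_one_le)
      moreover have "\<bar>g (v - \<beta> *\<^sub>R z) * (j z - g z)\<bar> <= \<bar>j z - g z\<bar>"
        using g[of "v - \<beta> *\<^sub>R z"] by (auto simp: abs_mult intro!: mult_left_le_one_le)
      ultimately show "\<bar>(j (v - \<beta> *\<^sub>R z) - g (v - \<beta> *\<^sub>R z)) * j z + g (v - \<beta> *\<^sub>R z) * (j z - g z)\<bar> <= \<bar>j (v - \<beta> *\<^sub>R z) - g (v - \<beta> *\<^sub>R z)\<bar> + \<bar>j z - g z\<bar>"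
        by linarith
    qed
    also have "... = (LBINT z. \<bar>j (v - \<beta> *\<^sub>R z) - g (v - \<beta> *\<^sub>R z)\<bar>) + (LBINT z. \<bar>j z - g z\<bar>)"
      using sc di by (intro Bochner_Integration.integral_add) auto
    also have "... <= E * \<delta>" using sc dint by (simp add: E_def algebra_simps)
    finally show ?thesis .
  qed
  have Ed: "E * \<delta> = c / 8" using E by (simp add: \<delta>_def)
  \<comment> \<open>Passing to the continuous \<open>g\<close> makes the value jointly continuous in
    the position and both dilation exponents, so one neighbourhood handles all three.\<close>
  define H where "H w = F g (exp (- snd (snd w)) *\<^sub>R fst w) (exp (fst (snd w) - snd (snd w)))" for w :: "(real ^ 'n) \<times> real \<times> real"
  have Hc: "continuous_on UNIV H"
    unfolding H_def F_def
  proof (rule continuous_on_param_integral)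
    fix R :: real
    show "\<exists>h. integrable lborel h \<and> (\<forall>(x :: (real ^ 'n) \<times> real \<times> real) y. norm x <= R \<longrightarrow> \<bar>g (exp (- snd (snd x)) *\<^sub>R fst x - exp (fst (snd x) - snd (snd x)) *\<^sub>R y) * g y\<bar> <= h y)"
      using gi g by (intro exI[of _ g]) (auto simp: abs_mult intro!: mult_left_le_one_le)
  qed (auto intro!: continuous_intros continuous_on_compose2[OF gc])
  have H0: "H (y0, 0, 0) \<ge> 7 * c / 8"
  proof -
    have "\<bar>c - H (y0, 0, 0)\<bar> <= c / 8"
      using close[of 1 y0] unfolding Ed by (simp add: H_def F_def c_def[symmetric])
    then show ?thesis by linarith
  qed
  obtain r where r: "0 < r" "\<And>w. dist w (y0, 0, 0) < r ==> dist (H w) (H (y0, 0, 0)) < c / 8"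
    using Hc[unfolded continuous_on_iff, rule_format, of "(y0, 0, 0)" "c / 8"] c by auto
  define \<eta> where "\<eta> = min 1 (r / 4)"
  \<comment> \<open>The factor CARD('n) matches the l1 estimate for the diameter of a box in
    \<open>bx_support\<close>; position and both exponents then use at most 3 r/4 of the radius
    r.\<close>
  define \<rho> where "\<rho> = r / (8 * real CARD('n))"
  have lower: "c / 8 <= (LBINT z. j (exp (- b) *\<^sub>R (y - exp a *\<^sub>R z)) * j z)"
    if "norm (y - y0) <= real CARD('n) * (2 * \<rho>)" "0 <= a" "a <= \<eta>" "0 <= b" "b <= \<eta>" for y a b
  proof -
    have "dist (y, a, b) (y0, 0, 0) <= dist y y0 + (\<bar>a\<bar> + \<bar>b\<bar>)"
      unfolding dist_Pair_Pair
      by (rule order.trans[OF sqrt_sum_squares_le_sum_abs])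
         (auto intro!: order.trans[OF sqrt_sum_squares_le_sum_abs] simp: dist_real_def)
    also have "... < r"
    proof -
      have "real CARD('n) * (2 * \<rho>) = r / 4" by (simp add: \<rho>_def)
      then have "dist y y0 <= r / 4" using that(1) by (simp add: dist_norm)
      moreover have "\<bar>a\<bar> <= r / 4" "\<bar>b\<bar> <= r / 4" using that by (auto simp: \<eta>_def)
      ultimately show ?thesis using r(1) by linarith
    qed
    finally have "dist (H (y, a, b)) (H (y0, 0, 0)) < c / 8" by (rule r(2))
    then have "F g (exp (- b) *\<^sub>R y) (exp (a - b)) \<ge> 6 * c / 8"
    proof -
      have "\<bar>H (y, a, b) - H (y0, 0, 0)\<bar> < c / 8"
        using \<open>dist (H (y, a, b)) (H (y0, 0, 0)) < c / 8\<close> by (simp add: dist_real_def)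
      then have "6 * c / 8 <= H (y, a, b)" using H0 by linarith
      then show ?thesis by (simp add: H_def)
    qed
    moreover have "exp (- 1) <= exp (a - b)" using that by (auto simp: \<eta>_def)
    note close[OF this, of "exp (- b) *\<^sub>R y"]
    ultimately have "c / 8 <= F j (exp (- b) *\<^sub>R y) (exp (a - b))" using Ed c by linarith
    also have "... = (LBINT z. j (exp (- b) *\<^sub>R (y - exp a *\<^sub>R z)) * j z)"
      unfolding F_def by (simp add: scaleR_diff_right exp_diff exp_minus divide_inverse mult.commute)
    finally show ?thesis .
  qed
  show ?thesis
    by (rule that[of \<rho> \<eta> "c / 8" y0]) (use r c lower in \<open>auto simp: \<rho>_def \<eta>_def\<close>)
qed

text \<open>Two successive averages are one average with the convolved density. The comparison is
  stated with nonnegative integrals so that Tonelli's theorem applies directly to the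
  convolution.\<close>

lemma cop_cop_lower_bound:
  assumes k: "0 <= k" and f: "wkernel k f" "\<And>y. 0 <= f y" and g: "wkernel k g" "\<And>y. 0 <= g y"
    and h: "wkernel k h" "\<And>y. 0 <= h y" and le: "\<And>x. ennreal (h x) <= (\<integral>\<^sup>+y. ennreal (g (x - y) * f y) \<partial>lborel)"
  shows "bpos (cop k f * cop k g - cop k h)"
  unfolding bpos_ev[of _ k]
proof (intro allI impI)
  fix \<phi> :: "(real ^ 'a) \<Rightarrow>\<^sub>C real" and x assume p: "\<forall>x. 0 <= ev k \<phi> x"
  have [measurable]: "f \<in> borel_measurable borel" "g \<in> borel_measurable borel" "h \<in> borel_measurable borel"
    using f g h by (auto simp: wkernel_def)
  have gp: "0 <= ev k (blf (cop k g) \<phi>) x" for x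
    using p g by (auto simp: ev_cop k intro!: integral_nonneg_AE)
  have "ennreal (ev k (blf (cop k h) \<phi>) x) = (\<integral>\<^sup>+z. ennreal (ev k \<phi> (x + z) * h z) \<partial>lborel)"
    unfolding ev_cop(1)[OF k h(1)] using p h by (intro nn_integral_eq_integral[symmetric] integrable_ev_shift k) auto
  also have "... <= (\<integral>\<^sup>+z. (\<integral>\<^sup>+y. ennreal (ev k \<phi> (x + z) * (g (z - y) * f y)) \<partial>lborel) \<partial>lborel)"
  proof (rule nn_integral_mono)
    fix z
    have "ennreal (ev k \<phi> (x + z) * h z) <= ennreal (ev k \<phi> (x + z)) * (\<integral>\<^sup>+y. ennreal (g (z - y) * f y) \<partial>lborel)"
      using p h by (simp add: ennreal_mult mult_left_mono le)
    also have "... = (\<integral>\<^sup>+y. ennreal (ev k \<phi> (x + z) * (g (z - y) * f y)) \<partial>lborel)"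
      using p f g by (subst nn_integral_cmult[symmetric]) (auto simp: ennreal_mult[symmetric])
    finally show "ennreal (ev k \<phi> (x + z) * h z) <= (\<integral>\<^sup>+y. ennreal (ev k \<phi> (x + z) * (g (z - y) * f y)) \<partial>lborel)" .
  qed
  also have "... = (\<integral>\<^sup>+y. (\<integral>\<^sup>+z. ennreal (ev k \<phi> (x + z) * (g (z - y) * f y)) \<partial>lborel) \<partial>lborel)"
    by (rule lborel_pair.Fubini') measurable
  also have "... = (\<integral>\<^sup>+y. ennreal (ev k (blf (cop k g) \<phi>) (x + y) * f y) \<partial>lborel)"
  proof (rule nn_integral_cong)
    fix y
    have "(\<integral>\<^sup>+z. ennreal (ev k \<phi> (x + z) * (g (z - y) * f y)) \<partial>lborel) = (\<integral>\<^sup>+z. ennreal (ev k \<phi> (x + y + z) * g z) * ennreal (f y) \<partial>lborel)"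
      using f g p by (subst nn_integral_scale[of _ 1 y]) (auto simp: ennreal_mult add.assoc mult.assoc intro!: nn_integral_cong)
    also have "... = (\<integral>\<^sup>+z. ennreal (ev k \<phi> (x + y + z) * g z) \<partial>lborel) * ennreal (f y)"
      by (rule nn_integral_multc) measurable
    also have "(\<integral>\<^sup>+z. ennreal (ev k \<phi> (x + y + z) * g z) \<partial>lborel) = ennreal (ev k (blf (cop k g) \<phi>) (x + y))"
      unfolding ev_cop(1)[OF k g(1)] using p g by (intro nn_integral_eq_integral integrable_ev_shift k) auto
    finally show "(\<integral>\<^sup>+z. ennreal (ev k \<phi> (x + z) * (g (z - y) * f y)) \<partial>lborel) = ennreal (ev k (blf (cop k g) \<phi>) (x + y) * f y)"
      using gp f by (simp add: ennreal_mult)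
  qed
  also have "... = ennreal (ev k (blf (cop k f) (blf (cop k g) \<phi>)) x)"
    unfolding ev_cop(1)[OF k f(1)] using gp f by (intro nn_integral_eq_integral integrable_ev_shift k) auto
  finally have "ev k (blf (cop k h) \<phi>) x <= ev k (blf (cop k f) (blf (cop k g) \<phi>)) x"
    using bpos_cop[OF k f] gp unfolding bpos_ev[of _ k] by (subst (asm) ennreal_le_iff) auto
  then show "0 <= ev k (blf (cop k f * cop k g - cop k h) \<phi>) x" by simp
qed

lemma bpos_trans: "bpos (X - Y) ==> bpos (Y - Z) ==> bpos (X - Z)"
  using bpos_intros(3)[of "X - Y" "Y - Z"] by simp

lemma bpos_mult_mono: 
  assumes "bpos (X - X')" "bpos (Y - Y')" "bpos X'" "bpos Y"
  shows "bpos (X * Y - X' * Y')"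
  using bpos_intros(3)[OF bpos_intros(4)[OF assms(1,4)] bpos_intros(4)[OF assms(3,2)]]
  by (simp add: algebra_simps)

context jump_kernel
begin

text \<open>Measured in the unit \<sigma> the two jump lengths are exp a and exp b, so
  \<open>convolution_lower_bound\<close> applies and none of the constants depends on \<sigma>, that
  is, on eps or on time. The slack \<eta> lets the two jumps occur at different times.\<close>

lemma two_jump_lower_bound:
  obtains p \<rho> \<eta> \<kappa> where "0 < \<rho>" "0 < \<eta>" "\<eta> <= 1" "0 < \<kappa>"
    "\<And>\<sigma> a b. 0 < \<sigma> ==> 0 <= a ==> a <= \<eta> ==> 0 <= b ==> b <= \<eta> ==>
      bpos (K (\<sigma> * exp a) * K (\<sigma> * exp b) - \<kappa> *\<^sub>R cop k (bx (\<sigma> *\<^sub>R p) (\<lambda>_. 2 * (\<sigma> * \<rho>))))"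
proof -
  \<comment> \<open>Truncation gives a bounded density below J, still of positive mass.\<close>
  define j where "j x = min (J x) 1" for x
  have jm[measurable]: "j \<in> borel_measurable borel" unfolding j_def by measurable
  have j: "0 <= j x \<and> j x <= 1" and jJ: "j x <= J x" for x using J0[of x] by (auto simp: j_def)
  have wj: "wkernel k j"
  proof -
    have "integrable lborel (\<lambda>y. kw k y * \<bar>j y\<bar>)"
      by (rule wkernel_integrable_mono[OF Jk, of _ 1]) (use j jJ J0 in \<open>auto simp: abs_mult intro!: mult_left_mono\<close>)
    then show ?thesis by (simp add: wkernel_def)
  qed
  have ji: "integrable lborel j" by (rule wkernel_integrable[OF k0 wj])
  have jpos: "0 < (LBINT x. j x)"
  proof -
    have "0 <= (LBINT x. j x)" using j by (intro integral_nonneg_AE) auto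
    moreover have "(LBINT x. j x) \<noteq> 0"
    proof
      assume "(LBINT x. j x) = 0"
      then have "AE x in lborel. j x = 0"
        using integral_nonneg_eq_0_iff_AE[OF ji] j by auto
      then have "AE x in lborel. J x = 0" by eventually_elim (auto simp: j_def min_def split: if_splits)
      then have "(LBINT x. J x) = (\<integral>x. 0 \<partial>(lborel :: (real ^ 'n) measure))" by (intro integral_cong_AE) auto
      then show False by (simp add: J1)
    qed
    ultimately show ?thesis by simp
  qed
  obtain p \<rho> \<eta> \<gamma> where r: "0 < \<rho>" "0 < \<eta>" "\<eta> <= 1" "0 < \<gamma>" and low:
    "\<And>y a b. norm (y - p) <= real CARD('n) * (2 * \<rho>) ==> 0 <= a ==> a <= \<eta> ==> 0 <= b ==> b <= \<eta> ==>
      \<gamma> <= (LBINT z. j (exp (- b) *\<^sub>R (y - exp a *\<^sub>R z)) * j z)"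
    by (rule convolution_lower_bound[OF jm j ji jpos]) (rule that; assumption)
  \<comment> \<open>The normalised box has height (2 \<rho>)^-d in units of \<sigma>, the rescaling
    of one factor loses exp (- b)^d >= exp (- \<eta>)^d, and \<gamma> bounds the
    convolution.\<close>
  define \<kappa> where "\<kappa> = (2 * \<rho>) ^ CARD('n) * exp (- \<eta>) ^ CARD('n) * \<gamma>"
  have kp: "0 < \<kappa>" using r by (simp add: \<kappa>_def)
  have "bpos (K (\<sigma> * exp a) * K (\<sigma> * exp b) - \<kappa> *\<^sub>R cop k (bx (\<sigma> *\<^sub>R p) (\<lambda>_. 2 * (\<sigma> * \<rho>))))"
    if s: "0 < \<sigma>" and ab: "0 <= a" "a <= \<eta>" "0 <= b" "b <= \<eta>" for \<sigma> a b
  proof -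
    have sa: "0 < \<sigma> * exp a" "0 < \<sigma> * exp b" using s by auto
    have wr: "wkernel k (rescale t j)" if "0 < t" for t by (intro wkernel_rescale k0 wj that)
    have pj: "bpos (cop k (rescale t j))" "bpos (K t - cop k (rescale t j))" if "0 < t" for t
    proof -
      show "bpos (cop k (rescale t j))" using that j by (intro bpos_cop k0 wr) (auto simp: rescale_def)
      have "K t - cop k (rescale t j) = cop k (\<lambda>y. rescale t J y - rescale t j y)"
        unfolding K_def using that by (intro cop_diff[symmetric] k0 wkernel_rescale_J wr)
      also have "bpos ..." using that jJ by (intro bpos_cop k0 wkernel_diff wkernel_rescale_J wr) (auto simp: rescale_def divide_right_mono)
      finally show "bpos (K t - cop k (rescale t j))" .
    qed
    have l: "\<And>i. 0 < 2 * (\<sigma> * \<rho>)" using s r by simp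
    have "bpos (cop k (rescale (\<sigma> * exp a) j) * cop k (rescale (\<sigma> * exp b) j) - cop k (\<lambda>y. \<kappa> * bx (\<sigma> *\<^sub>R p) (\<lambda>_. 2 * (\<sigma> * \<rho>)) y))"
    proof (rule cop_cop_lower_bound[OF k0 wr[OF sa(1)] _ wr[OF sa(2)] _ wkernel_scale[OF wkernel_bx[OF k0 l]]])
      fix x :: "real ^ 'n"
      show "0 <= rescale (\<sigma> * exp a) j x" "0 <= rescale (\<sigma> * exp b) j x"
        using j s by (auto simp: rescale_def)
      show "0 <= \<kappa> * bx (\<sigma> *\<^sub>R p) (\<lambda>_. 2 * (\<sigma> * \<rho>)) x"
        using kp by (intro mult_nonneg_nonneg bx_nonneg l) auto
      show "ennreal (\<kappa> * bx (\<sigma> *\<^sub>R p) (\<lambda>_. 2 * (\<sigma> * \<rho>)) x) <= (\<integral>\<^sup>+y. ennreal (rescale (\<sigma> * exp b) j (x - y) * rescale (\<sigma> * exp a) j y) \<partial>lborel)"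
      proof (cases "bx (\<sigma> *\<^sub>R p) (\<lambda>_. 2 * (\<sigma> * \<rho>)) x = 0")
        case False
        define y where "y = x /\<^sub>R \<sigma>"
        have x: "x = \<sigma> *\<^sub>R y" using s by (simp add: y_def)
        have "norm (x - \<sigma> *\<^sub>R p) <= (\<Sum>i\<in>(UNIV::'n set). 2 * (\<sigma> * \<rho>))"
          by (rule bx_support[OF False l])
        moreover have "norm (x - \<sigma> *\<^sub>R p) = \<sigma> * norm (y - p)"
          unfolding x scaleR_diff_right[symmetric] norm_scaleR using s by simp
        ultimately have "\<sigma> * norm (y - p) <= \<sigma> * (real CARD('n) * (2 * \<rho>))"
          by (simp add: algebra_simps)
        then have yp: "norm (y - p) <= real CARD('n) * (2 * \<rho>)" using s by simp
        have bxv: "bx (\<sigma> *\<^sub>R p) (\<lambda>_. 2 * (\<sigma> * \<rho>)) x <= (1 / (2 * (\<sigma> * \<rho>))) ^ CARD('n)"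
        proof -
          have "bx (\<sigma> *\<^sub>R p) (\<lambda>_. 2 * (\<sigma> * \<rho>)) x <= (\<Prod>i\<in>(UNIV::'n set). 1 / (2 * (\<sigma> * \<rho>)))"
            unfolding bx_def using l by (intro prod_mono) (auto simp: bx1_def)
          then show ?thesis by (simp add: power_divide)
        qed
        define q where "q z = rescale (\<sigma> * exp b) j (x - (\<sigma> * exp a) *\<^sub>R z) * j z" for z
        have qe: "q z = (1 / (\<sigma> * exp b)) ^ CARD('n) * (j (exp (- b) *\<^sub>R (y - exp a *\<^sub>R z)) * j z)" for z
        proof -
          have i: "inverse (\<sigma> * exp b) * \<sigma> = exp (- b)" "inverse (\<sigma> * exp b) * (\<sigma> * exp a) = exp (- b) * exp a"
            using s by (simp_all add: exp_minus field_simps)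
          have "(x - (\<sigma> * exp a) *\<^sub>R z) /\<^sub>R (\<sigma> * exp b) = exp (- b) *\<^sub>R (y - exp a *\<^sub>R z)"
            by (simp only: x scaleR_diff_right scaleR_scaleR i)
          then show ?thesis by (simp add: q_def rescale_def power_divide)
        qed
        have ij: "integrable lborel (\<lambda>z. j (exp (- b) *\<^sub>R (y - exp a *\<^sub>R z)) * j z)"
          by (rule Bochner_Integration.integrable_bound[OF ji])
             (use j in \<open>auto simp: abs_mult intro!: mult_left_le_one_le\<close>)
        have "(\<integral>\<^sup>+y. ennreal (rescale (\<sigma> * exp b) j (x - y) * rescale (\<sigma> * exp a) j y) \<partial>lborel) = (\<integral>\<^sup>+z. ennreal (q z) \<partial>lborel)"
        proof (subst nn_integral_scale[OF _ sa(1), of _ 0], simp, subst nn_integral_cmult[symmetric], simp, rule nn_integral_cong)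
          fix z :: "real ^ 'n"
          have "(\<sigma> * exp a) ^ CARD('n) * (rescale (\<sigma> * exp b) j (x - (0 + (\<sigma> * exp a) *\<^sub>R z)) * rescale (\<sigma> * exp a) j (0 + (\<sigma> * exp a) *\<^sub>R z)) = q z"
          proof -
            have "((\<sigma> * exp a) *\<^sub>R z) /\<^sub>R (\<sigma> * exp a) = z"
            proof -
              have ne: "\<sigma> * exp a \<noteq> 0" using sa(1) by linarith
              show ?thesis by (simp only: scaleR_scaleR left_inverse[OF ne] scaleR_one)
            qed
            note eq = this
            have "(\<sigma> * exp a) ^ CARD('n) \<noteq> 0" using sa(1) by (metis less_irrefl zero_less_power)
            then show ?thesis unfolding q_def add_0_left rescale_def[of "\<sigma> * exp a"] eq by (simp del: power_mult_distrib)
          qed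
          then show "ennreal ((\<sigma> * exp a) ^ CARD('n)) * ennreal (rescale (\<sigma> * exp b) j (x - (0 + (\<sigma> * exp a) *\<^sub>R z)) * rescale (\<sigma> * exp a) j (0 + (\<sigma> * exp a) *\<^sub>R z)) = ennreal (q z)"
            using s j by (subst ennreal_mult'[symmetric]) (auto simp: rescale_def)
        qed
        also have "... = ennreal (LBINT z. q z)"
          unfolding qe using ij j s by (intro nn_integral_eq_integral integrable_mult_right) auto
        finally have e: "(\<integral>\<^sup>+y. ennreal (rescale (\<sigma> * exp b) j (x - y) * rescale (\<sigma> * exp a) j y) \<partial>lborel) = ennreal (LBINT z. q z)" .
        have "\<kappa> * bx (\<sigma> *\<^sub>R p) (\<lambda>_. 2 * (\<sigma> * \<rho>)) x <= \<kappa> * (1 / (2 * (\<sigma> * \<rho>))) ^ CARD('n)"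
          using kp bxv by (intro mult_left_mono) auto
        also have "... = (exp (- \<eta>) / \<sigma>) ^ CARD('n) * \<gamma>"
          unfolding \<kappa>_def using r s by (simp add: power_divide power_mult_distrib)
        also have "... <= (1 / (\<sigma> * exp b)) ^ CARD('n) * \<gamma>"
        proof (intro mult_right_mono power_mono)
          have "exp (- \<eta>) <= exp (- b)" using ab by simp
          then have "exp (- \<eta>) / \<sigma> <= exp (- b) / \<sigma>" using s by (intro divide_right_mono) auto
          then show "exp (- \<eta>) / \<sigma> <= 1 / (\<sigma> * exp b)" by (simp add: exp_minus field_simps)
        qed (use r s in auto)
        also have "... <= (1 / (\<sigma> * exp b)) ^ CARD('n) * (LBINT z. j (exp (- b) *\<^sub>R (y - exp a *\<^sub>R z)) * j z)"
          using s by (intro mult_left_mono low[OF yp ab]) auto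
        also have "... = (LBINT z. q z)" unfolding qe by simp
        finally show ?thesis unfolding e by (rule ennreal_leI)
      qed simp
    qed
    then have "bpos (cop k (rescale (\<sigma> * exp a) j) * cop k (rescale (\<sigma> * exp b) j) - \<kappa> *\<^sub>R cop k (bx (\<sigma> *\<^sub>R p) (\<lambda>_. 2 * (\<sigma> * \<rho>))))"
      using cop_scale[OF k0 wkernel_bx[OF k0 l], of \<kappa> "\<sigma> *\<^sub>R p"] by simp
    moreover have "bpos (K (\<sigma> * exp a) * K (\<sigma> * exp b) - cop k (rescale (\<sigma> * exp a) j) * cop k (rescale (\<sigma> * exp b) j))"
      by (intro bpos_mult_mono pj bpos_K sa)
    ultimately show ?thesis using bpos_trans by blast
  qed
  with r kp that show ?thesis by blast
qed

end

subsection \<open>Smoothing of the evolution family\<close>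

lemma exp_scaleR_power:
  fixes Y :: "'a::{real_normed_algebra_1,banach}"
  shows "exp (real N *\<^sub>R Y) = exp Y ^ N"
proof (induction N)
  case (Suc N)
  have "exp (Y + real N *\<^sub>R Y) = exp Y * exp (real N *\<^sub>R Y)"
    by (rule exp_add_commuting) simp
  then show ?case by (simp add: Suc scaleR_add_left)
qed simp

lemma power_mult_commuting:
  fixes X Y :: "'a::monoid_mult"
  assumes "X * Y = Y * X" shows "(X * Y) ^ n = X ^ n * Y ^ n"
proof (induction n)
  case (Suc n)
  have "(X * Y) ^ Suc n = X * (Y * X ^ n) * Y ^ n" by (simp add: Suc mult.assoc)
  also have "Y * X ^ n = X ^ n * Y" by (rule power_commuting_commutes[OF assms, symmetric])
  finally show ?case by (simp add: mult.assoc)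
qed simp

text \<open>A translation is a product of translations along the axes, and the difference to the
  identity telescopes. Negative steps reduce to positive ones by factoring out a translation, which
  preserves the supremum norm.\<close>

lemma sbd_shop_diff_vec:
  assumes k: "0 <= k" and C: "0 <= C"
    and b: "\<And>i h. 0 < h ==> sbd k ((shop k (h *\<^sub>R axis i 1) - 1) * X) (C * h)"
  shows "sbd k ((shop k v - 1) * X) (C * real CARD('n) * norm (v :: real ^ 'n))"
proof -
  have b': "sbd k ((shop k (h *\<^sub>R axis i 1) - 1) * X) (C * \<bar>h\<bar>)" for i h
  proof -
    consider "0 < h" | "h = 0" | "h < 0" by linarith
    then show ?thesis
    proof cases
      case 2
      have "shop k (0 :: real ^ 'n) = 1" by (rule bop_eqI_ev[of k]) (simp add: ev_shop k)
      then show ?thesis using 2 by (simp add: sbd_def)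
    next
      case 3
      have "shop k (h *\<^sub>R axis i 1) * shop k ((- h) *\<^sub>R axis i (1::real)) = shop k (0 :: real ^ 'n)"
        by (subst shop_add[OF k, symmetric]) simp
      also have "... = 1" by (rule bop_eqI_ev[of k]) (simp add: ev_shop k)
      finally have "(shop k (h *\<^sub>R axis i 1) - 1) * X = - (shop k (h *\<^sub>R axis i 1) * ((shop k ((- h) *\<^sub>R axis i 1) - 1) * X))"
        by (simp add: algebra_simps flip: mult.assoc)
      moreover have "sbd k (- (shop k (h *\<^sub>R axis i 1) * ((shop k ((- h) *\<^sub>R axis i 1) - 1) * X))) (1 * (C * (- h)))"
        using 3 by (intro sbd_minus sbd_mult sbd_shop k b) auto
      ultimately show ?thesis using 3 by simp
    qed (use b in simp)
  qed
  have "sbd k ((shop k (\<Sum>i\<in>A. v $ i *\<^sub>R axis i 1) - 1) * X) (\<Sum>i\<in>A. C * \<bar>v $ i\<bar>)" for A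
  proof (induction A rule: infinite_finite_induct)
    case (insert i A)
    have "(shop k (\<Sum>i\<in>insert i A. v $ i *\<^sub>R axis i 1) - 1) * X =
      shop k (v $ i *\<^sub>R axis i 1) * ((shop k (\<Sum>i\<in>A. v $ i *\<^sub>R axis i 1) - 1) * X) + (shop k (v $ i *\<^sub>R axis i 1) - 1) * X"
      using insert by (simp add: shop_add[OF k] algebra_simps)
    moreover have "sbd k (shop k (v $ i *\<^sub>R axis i 1) * ((shop k (\<Sum>i\<in>A. v $ i *\<^sub>R axis i 1) - 1) * X) + (shop k (v $ i *\<^sub>R axis i 1) - 1) * X)
       (1 * (\<Sum>i\<in>A. C * \<bar>v $ i\<bar>) + C * \<bar>v $ i\<bar>)"
      by (intro sbd_add sbd_mult sbd_shop k b' insert)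
    ultimately show ?case using insert by (simp add: add.commute)
  next
    case empty
    have "shop k (0 :: real ^ 'n) = 1" by (rule bop_eqI_ev[of k]) (simp add: ev_shop k)
    then show ?case by (simp add: sbd_def)
  qed (simp add: sbd_def)
  note all = this[of UNIV]
  have v: "(\<Sum>i\<in>UNIV. v $ i *\<^sub>R axis i 1) = v"
    using basis_expansion[of v] unfolding scalar_mult_eq_scaleR .
  have "sbd k ((shop k v - 1) * X) (\<Sum>i\<in>UNIV. C * \<bar>v $ i\<bar>)"
    using all unfolding v .
  moreover have "(\<Sum>i\<in>UNIV. C * \<bar>v $ i\<bar>) <= (\<Sum>i\<in>(UNIV::'n set). C * norm v)"
    by (intro sum_mono mult_left_mono component_le_norm_cart C)
  moreover have "(\<Sum>i\<in>(UNIV::'n set). C * norm v) = C * real CARD('n) * norm v" by simp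
  ultimately show ?thesis using sbd_mono by metis
qed

text \<open>Each box of side 2 s is a fair choice \<open>D\<close> between staying and shifting by
  s, followed by a box \<open>V\<close> that is only s long in direction i. One \<open>V\<close>
  trades the shift by h for one by s, which is the step of the n choices, so
  \<open>sbd_shift_binomial\<close> applies. At least one box is needed for the trade.\<close>

lemma sbd_shift_box_power:
  assumes k: "0 <= k" and s: "0 < s" and h: "0 < h" and n: "0 < n"
  shows "sbd k ((shop k (h *\<^sub>R axis i 1) - 1) * cop k (bx p (\<lambda>_. 2 * s)) ^ n) (h / s * (2 / sqrt (real n + 1)))"
proof -
  define l where "l = (\<lambda>_::'a. 2 * s)"
  have l: "\<And>j. 0 < l j" using s by (simp add: l_def)
  define S where "S = shop k (s *\<^sub>R axis i (1::real))"
  define D where "D = (1/2) *\<^sub>R (S + 1)"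
  define V where "V = cop k (bx p (l(i := s)))"
  define V' where "V' = cop k (bx p (l(i := h)))"
  have ls: "\<And>j. 0 < (l(i := s)) j" "\<And>j. 0 < (l(i := h)) j" using l s h by auto
  have e: "cop k (bx p (\<lambda>_. 2 * s)) = D * V"
  proof -
    have "l(i := 2 * s) = (\<lambda>_. 2 * s)" by (auto simp: l_def)
    then show ?thesis using cop_bx_halve[where l=l and p=p and i=i, OF k l s] unfolding D_def S_def V_def by (simp only:)
  qed
  have SV: "S * V = V * S" unfolding S_def V_def by (intro shop_cop_commute k wkernel_bx ls)
  have SV': "S * V' = V' * S" unfolding S_def V'_def by (intro shop_cop_commute k wkernel_bx ls)
  have DV: "D * V = V * D" unfolding D_def by (simp add: algebra_simps SV)
  define T where "T = (shop k (h *\<^sub>R axis i 1) - 1 :: 'a bop)"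
  have TD: "T * D = D * T"
    unfolding T_def D_def S_def by (simp add: algebra_simps shop_commute[OF k])
  have DnT: "T * D ^ n = D ^ n * T" using power_commuting_commutes[of D T n] TD by simp
  have TV: "T * V = (h / s) *\<^sub>R ((S - 1) * V')"
    unfolding T_def V_def V'_def S_def by (rule cop_bx_exchange[OF k l s h])
  have SD: "(S - 1) * D = D * (S - 1)" unfolding D_def by (simp add: algebra_simps)
  have SDn: "(S - 1) * D ^ n = D ^ n * (S - 1)" using power_commuting_commutes[of D "S - 1" n] SD by simp
  have "T * (D * V) ^ n = T * D ^ n * V ^ n" unfolding power_mult_commuting[OF DV] by (simp add: mult.assoc)
  also have "... = D ^ n * (T * V) * V ^ (n - 1)"
  proof -
    have "V ^ n = V * V ^ (n - 1)" using n by (simp add: power_eq_if)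
    then show ?thesis by (simp only: DnT mult.assoc)
  qed
  also have "... = (h / s) *\<^sub>R (((S - 1) * D ^ n) * (V' * V ^ (n - 1)))"
    unfolding TV SDn by (simp only: mult.assoc mult_scaleR_left mult_scaleR_right)
  finally have eq: "T * (D * V) ^ n = (h / s) *\<^sub>R (((S - 1) * D ^ n) * (V' * V ^ (n - 1)))" .
  have "sbd k ((h / s) *\<^sub>R (((S - 1) * D ^ n) * (V' * V ^ (n - 1)))) (\<bar>h / s\<bar> * ((2 / sqrt (real n + 1)) * (1 * 1 ^ (n - 1))))"
    unfolding D_def V_def V'_def using sbd_shop[OF k]
    by (intro sbd_scale sbd_mult sbd_power sbd_cop_bx k ls sbd_shift_binomial) (auto simp: S_def)
  then show ?thesis unfolding e eq[symmetric] T_def using s h by simp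
qed

context jump_kernel
begin

text \<open>The evolution over a unit of time is an N-th power with N about eps^-2, and each factor
  dominates a fixed multiple of a box average. Expanding the power, \<open>A\<close> collects the
  terms with at least one box. The number of boxes is binomial, so its inverse root has mean of
  order eps; this cancels the factor 1/eps that comes from the side of the boxes, of order eps exp
  r, and leaves exp (- r).\<close>

lemma unit_step_decomposition:
  obtains b C where "1/2 <= b" "b < 1" "0 <= C"
    "\<And>eps r. 0 < eps ==> eps <= 1 ==> 0 <= r ==> \<exists>A B. Pop eps r (r + 1) = A + B \<and> sbd k B b \<and>
      (\<forall>v. sbd k ((shop k v - 1) * A) (C * exp (- r) * norm v))"
proof -
  obtain p \<rho> \<eta> \<kappa> where r: "0 < \<rho>" "0 < \<eta>" "\<eta> <= 1" "0 < \<kappa>" and low: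
    "\<And>\<sigma> a b. 0 < \<sigma> ==> 0 <= a ==> a <= \<eta> ==> 0 <= b ==> b <= \<eta> ==>
      bpos (K (\<sigma> * exp a) * K (\<sigma> * exp b) - \<kappa> *\<^sub>R cop k (bx (\<sigma> *\<^sub>R p) (\<lambda>_. 2 * (\<sigma> * \<rho>))))"
    by (rule two_jump_lower_bound) (rule that; assumption)
  \<comment> \<open>The factor is exp (- \<beta>) \<beta>^2 / 2 at its worst for 1/2 <= \<beta> <=
    1, estimated by exp (- 1) / 8. The cap 1/2 ensures 1/2 <= b, which \<open>smoothing\<close>
    uses.\<close>
  define \<kappa>1 where "\<kappa>1 = min (1/2) (exp (- 1) / 8 * (\<eta>\<^sup>2 * \<kappa>))"
  have kp1: "0 < \<kappa>1" using r by (auto simp: \<kappa>1_def)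
  define C where "C = 2 / (\<rho> * sqrt \<kappa>1) * real CARD('n)"
  have C0: "0 <= C" using r kp1 by (simp add: C_def)
  have main: "\<exists>A B. Pop eps t (t + 1) = A + B \<and> sbd k B (1 - \<kappa>1) \<and>
      (\<forall>v. sbd k ((shop k v - 1) * A) (C * exp (- t) * norm v))" if e: "0 < eps" "eps <= 1" and t: "0 <= t" for eps t
  proof -
    define \<sigma> where "\<sigma> = eps * exp t"
    have sp: "0 < \<sigma>" using e by (simp add: \<sigma>_def)
    define s where "s = \<sigma> * \<rho>"
    have s0: "0 < s" using sp r by (simp add: s_def)
    define V where "V = cop k (bx (\<sigma> *\<^sub>R p) (\<lambda>_. 2 * s))"
    have w: "wkernel k (bx (\<sigma> *\<^sub>R p) (\<lambda>_. 2 * s))" using s0 by (intro wkernel_bx k0) auto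
    have Vpos: "bpos V" unfolding V_def using s0 by (intro bpos_cop k0 w bx_nonneg) auto
    have V1: "blf V (onek k) = onek k" unfolding V_def using s0 by (intro cop_one k0 w integral_bx) auto
    define X where "X a b = integral {a..b} (\<lambda>q. K (eps * exp q))" for a b
    have Xpos: "bpos (X a b)" for a b unfolding X_def by (rule bpos_integral_K[OF e(1)])
    have Xe: "ev k (blf (X a b) f) x = integral {a..b} (\<lambda>q. ev k (blf (K (eps * exp q)) f) x)"
      "(\<lambda>q. ev k (blf (K (eps * exp q)) f) x) integrable_on {a..b}" for a b f x
      unfolding X_def by (rule apply_integral_K[OF e(1)])+
    have qs: "K (eps * exp q) = K (\<sigma> * exp (q - t))" for q
      by (simp add: \<sigma>_def exp_diff)
    have low': "bpos (K (eps * exp q) * K (eps * exp q') - \<kappa> *\<^sub>R V)" if "q \<in> {t..t + \<eta>}" "q' \<in> {t..t + \<eta>}" for q q'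
      unfolding qs V_def s_def using that by (intro low sp) auto
    \<comment> \<open>The bound for a pair of jump times is integrated over one time here and over
      the other below, giving the factor \<eta>^2. Both run over the initial part of the unit
      interval, where the box belonging to the starting time is valid.\<close>
    have XK: "bpos (K (eps * exp q) * X t (t + \<eta>) - (\<eta> * \<kappa>) *\<^sub>R V)" if q: "q \<in> {t..t + \<eta>}" for q
    proof -
      have c: "K (eps * exp q) * X t (t + \<eta>) = X t (t + \<eta>) * K (eps * exp q)"
        unfolding X_def using e by (intro commute_integral integrable_continuous_interval continuous_on_K K_commute) auto
      show ?thesis unfolding bpos_ev[of _ k]
      proof (intro allI impI)
        fix f :: "(real ^ 'n) \<Rightarrow>\<^sub>C real" and x assume f: "\<forall>x. 0 <= ev k f x"
        have "integral {t..t + \<eta>} (\<lambda>q'. \<kappa> * ev k (blf V f) x) <= integral {t..t + \<eta>} (\<lambda>q'. ev k (blf (K (eps * exp q')) (blf (K (eps * exp q)) f)) x)"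
        proof (rule integral_le)
          fix q' assume q': "q' \<in> {t..t + \<eta>}"
          show "\<kappa> * ev k (blf V f) x <= ev k (blf (K (eps * exp q')) (blf (K (eps * exp q)) f)) x"
            using low'[OF q' q] f unfolding bpos_ev[of _ k] by auto
        qed (use Xe(2) in auto)
        then show "0 <= ev k (blf (K (eps * exp q) * X t (t + \<eta>) - (\<eta> * \<kappa>) *\<^sub>R V) f) x"
          unfolding c using r by (simp add: Xe mult_ac)
      qed
    qed
    have XX: "bpos (X t (t + \<eta>) * X t (t + \<eta>) - (\<eta>\<^sup>2 * \<kappa>) *\<^sub>R V)"
      unfolding bpos_ev[of _ k]
    proof (intro allI impI)
      fix f :: "(real ^ 'n) \<Rightarrow>\<^sub>C real" and x assume f: "\<forall>x. 0 <= ev k f x"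
      have "integral {t..t + \<eta>} (\<lambda>q. \<eta> * \<kappa> * ev k (blf V f) x) <= integral {t..t + \<eta>} (\<lambda>q. ev k (blf (K (eps * exp q)) (blf (X t (t + \<eta>)) f)) x)"
      proof (rule integral_le)
        fix q assume q: "q \<in> {t..t + \<eta>}"
        show "\<eta> * \<kappa> * ev k (blf V f) x <= ev k (blf (K (eps * exp q)) (blf (X t (t + \<eta>)) f)) x"
          using XK[OF q] f unfolding bpos_ev[of _ k] by auto
      qed (use Xe(2) in auto)
      then show "0 <= ev k (blf (X t (t + \<eta>) * X t (t + \<eta>) - (\<eta>\<^sup>2 * \<kappa>) *\<^sub>R V) f) x"
        using r by (simp add: Xe power2_eq_square mult_ac)
    qed
    have Xsplit: "X t (t + 1) - X t (t + \<eta>) = X (t + \<eta>) (t + 1)"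
      unfolding X_def using r e
      by (subst Henstock_Kurzweil_Integration.integral_combine[of t "t + \<eta>" "t + 1", symmetric])
         (auto intro!: integrable_continuous_interval continuous_on_K)
    have X2: "bpos (X t (t + 1) * X t (t + 1) - (\<eta>\<^sup>2 * \<kappa>) *\<^sub>R V)"
      by (rule bpos_trans[OF bpos_mult_mono XX]) (simp_all add: Xsplit Xpos)
    \<comment> \<open>Since 1 <= eps^-2, rounding up at most doubles, so each factor carries an
      expected number \<beta> of jumps between 1/2 and 1.\<close>
    define N where "N = nat \<lceil>1 / eps\<^sup>2\<rceil>"
    have e2: "1 <= 1 / eps\<^sup>2" using e by (simp add: power_le_one)
    have N1: "1 / eps\<^sup>2 <= real N" "real N <= 2 * (1 / eps\<^sup>2)" "1 <= N"
    proof -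
      show a: "1 / eps\<^sup>2 <= real N" unfolding N_def by linarith
      show "real N <= 2 * (1 / eps\<^sup>2)" unfolding N_def using e2 by linarith
      show "1 <= N" using a e2 by linarith
    qed
    define \<beta> where "\<beta> = 1 / eps\<^sup>2 / real N"
    have be: "1/2 <= \<beta>" "\<beta> <= 1" unfolding \<beta>_def using N1 by (auto simp: pos_le_divide_eq pos_divide_le_eq simp del: divide_divide_eq_left)
    have bN: "real N * \<beta> = 1 / eps\<^sup>2" using N1 by (simp add: \<beta>_def)
    \<comment> \<open>A factor is not the evolution over a shorter interval but the N-th root over
      the whole unit interval; hence all factors are equal and share one box.\<close>
    define Q where "Q = exp (- \<beta>) *\<^sub>R exp (\<beta> *\<^sub>R X t (t + 1))"
    have "Pop eps t (t + 1) = exp ((1 / eps\<^sup>2) *\<^sub>R X t (t + 1) - (1 / eps\<^sup>2) *\<^sub>R 1)"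
      unfolding Pop_def X_def using e t by (subst acc_diff) auto
    also have "(1 / eps\<^sup>2) *\<^sub>R X t (t + 1) - (1 / eps\<^sup>2) *\<^sub>R 1 = real N *\<^sub>R (\<beta> *\<^sub>R X t (t + 1) - \<beta> *\<^sub>R 1)"
      unfolding scaleR_diff_right scaleR_scaleR bN ..
    also have "exp ... = Q ^ N" unfolding exp_scaleR_power exp_minus_scaleR_1 Q_def ..
    finally have PQ: "Pop eps t (t + 1) = Q ^ N" .
    have Q1: "blf Q (onek k) = onek k"
    proof -
      have "Q = exp (\<beta> *\<^sub>R X t (t + 1) - \<beta> *\<^sub>R 1)" unfolding Q_def exp_minus_scaleR_1 ..
      moreover have "blf (exp (\<beta> *\<^sub>R X t (t + 1) - \<beta> *\<^sub>R 1)) (onek k) = onek k"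
        by (rule blf_exp_fixed) (use e in \<open>simp add: X_def integral_K_one\<close>)
      ultimately show ?thesis by simp
    qed
    define N' where "N' = Q - \<kappa>1 *\<^sub>R V"
    have N'pos: "bpos N'"
    proof -
      have 1: "bpos (exp (\<beta> *\<^sub>R X t (t + 1)) - (1/2) *\<^sub>R (\<beta> *\<^sub>R X t (t + 1))\<^sup>2)"
        by (intro bpos_exp_minus_square bpos_intros Xpos) (use be in auto)
      have 2: "bpos ((1/2) *\<^sub>R (\<beta> *\<^sub>R X t (t + 1))\<^sup>2 - (\<beta>\<^sup>2 / 2 * (\<eta>\<^sup>2 * \<kappa>)) *\<^sub>R V)"
        using bpos_intros(5)[OF _ X2, of "\<beta>\<^sup>2 / 2"] by (simp add: scaleR_diff_right power2_eq_square algebra_simps)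
      have 3: "bpos (Q - (exp (- \<beta>) * (\<beta>\<^sup>2 / 2 * (\<eta>\<^sup>2 * \<kappa>))) *\<^sub>R V)"
        using bpos_intros(5)[OF _ bpos_trans[OF 1 2], of "exp (- \<beta>)"] by (simp add: Q_def scaleR_diff_right)
      have "\<kappa>1 <= exp (- 1) / 8 * (\<eta>\<^sup>2 * \<kappa>)" by (simp add: \<kappa>1_def)
      also have "exp (- 1) / 8 * (\<eta>\<^sup>2 * \<kappa>) <= (exp (- \<beta>) * (\<beta>\<^sup>2 / 2)) * (\<eta>\<^sup>2 * \<kappa>)"
      proof (rule mult_right_mono)
        have "exp (- 1) * ((1/2)\<^sup>2 / 2) <= exp (- \<beta>) * (\<beta>\<^sup>2 / 2)"
          using be by (intro mult_mono divide_right_mono power_mono) auto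
        then show "exp (- 1) / 8 <= exp (- \<beta>) * (\<beta>\<^sup>2 / 2)" by (simp add: power2_eq_square)
      qed (use r in auto)
      finally have "bpos (((exp (- \<beta>) * (\<beta>\<^sup>2 / 2 * (\<eta>\<^sup>2 * \<kappa>))) - \<kappa>1) *\<^sub>R V)"
        by (intro bpos_intros Vpos) auto
      then have 4: "bpos ((exp (- \<beta>) * (\<beta>\<^sup>2 / 2 * (\<eta>\<^sup>2 * \<kappa>))) *\<^sub>R V - \<kappa>1 *\<^sub>R V)"
        by (simp add: scaleR_diff_left)
      show ?thesis unfolding N'_def by (rule bpos_trans[OF 3 4])
    qed
    have k1: "\<kappa>1 <= 1/2" by (simp add: \<kappa>1_def)
    have N's: "sbd k N' (1 - \<kappa>1)"
      by (rule sbd_bpos[OF k0 N'pos]) (simp add: N'_def Q1 V1 k0)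
    have VX: "V * X a b = X a b * V" for a b
      unfolding X_def V_def using e
      by (intro commute_integral integrable_continuous_interval continuous_on_K)
         (auto simp: K_def intro!: cop_commute k0 w wkernel_rescale_J)
    have VQ: "V * Q = Q * V" unfolding Q_def using commute_exp[of V "\<beta> *\<^sub>R X t (t + 1)"] VX by simp
    have VN': "(\<kappa>1 *\<^sub>R V) * N' = N' * (\<kappa>1 *\<^sub>R V)" unfolding N'_def by (simp add: algebra_simps VQ)
    define c where "c n = real (N choose n) *\<^sub>R ((\<kappa>1 *\<^sub>R V) ^ n * N' ^ (N - n))" for n
    \<comment> \<open>The index counts the boxes. The term with n = 0 is left out, since without a
      box there is nothing to smooth.\<close>
    define A where "A = (\<Sum>n\<in>{1..N}. c n)"
    have QN: "Q ^ N = A + N' ^ N"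
    proof -
      have "Q ^ N = (\<kappa>1 *\<^sub>R V + N') ^ N" by (simp add: N'_def)
      also have "... = (\<Sum>n\<le>N. c n)" unfolding c_def by (rule binomial_commuting[OF VN'])
      also have "... = c 0 + A"
      proof -
        have "{..N} = insert 0 {1..N}" by auto
        then show ?thesis by (simp add: A_def)
      qed
      finally show ?thesis by (simp add: c_def add.commute)
    qed
    have As: "sbd k ((shop k (h *\<^sub>R axis i 1) - 1) * A) (2 / (\<rho> * sqrt \<kappa>1) * exp (- t) * h)" if h: "0 < h" for h i
    proof -
      have "sbd k (\<Sum>n\<in>{1..N}. (shop k (h *\<^sub>R axis i 1) - 1) * c n) (\<Sum>n\<in>{1..N}. h / s * (Bernstein N n \<kappa>1 * (2 / sqrt (real n + 1))))"
      proof (rule sbd_sum)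
        fix n assume n: "n \<in> {1..N}"
        have "(shop k (h *\<^sub>R axis i 1) - 1) * c n = (real (N choose n) * \<kappa>1 ^ n) *\<^sub>R (((shop k (h *\<^sub>R axis i 1) - 1) * V ^ n) * N' ^ (N - n))"
          by (simp add: c_def scaleR_power mult.assoc)
        moreover have "sbd k ... (\<bar>real (N choose n) * \<kappa>1 ^ n\<bar> * ((h / s * (2 / sqrt (real n + 1))) * (1 - \<kappa>1) ^ (N - n)))"
          unfolding V_def using n by (intro sbd_scale sbd_mult sbd_power N's sbd_shift_box_power k0 s0 h) auto
        moreover have "\<bar>real (N choose n) * \<kappa>1 ^ n\<bar> * ((h / s * (2 / sqrt (real n + 1))) * (1 - \<kappa>1) ^ (N - n)) = h / s * (Bernstein N n \<kappa>1 * (2 / sqrt (real n + 1)))"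
          using kp1 by (simp add: Bernstein_def)
        ultimately show "sbd k ((shop k (h *\<^sub>R axis i 1) - 1) * c n) (h / s * (Bernstein N n \<kappa>1 * (2 / sqrt (real n + 1))))"
          by (simp only:)
      qed
      moreover have "(\<Sum>n\<in>{1..N}. h / s * (Bernstein N n \<kappa>1 * (2 / sqrt (real n + 1)))) <= 2 / (\<rho> * sqrt \<kappa>1) * exp (- t) * h"
      proof -
        have nn: "0 <= Bernstein N n \<kappa>1" for n using kp1 k1 by (intro Bernstein_nonneg) auto
        have "(\<Sum>n\<in>{1..N}. Bernstein N n \<kappa>1 * (2 / sqrt (real n + 1))) <= (\<Sum>n\<le>N. Bernstein N n \<kappa>1 * (2 / sqrt (real n + 1)))"
          using nn by (intro sum_mono2) auto
        also have "... <= 2 / sqrt ((real N + 1) * \<kappa>1)" using kp1 k1 by (intro binomial_inverse_moment) auto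
        also have "... <= 2 / (1 / eps * sqrt \<kappa>1)"
        proof (rule divide_left_mono)
          have "1 / eps = sqrt (1 / eps\<^sup>2)" using e by (simp add: real_sqrt_divide)
          also have "... <= sqrt (real N + 1)" using N1 by simp
          finally show "1 / eps * sqrt \<kappa>1 <= sqrt ((real N + 1) * \<kappa>1)"
            unfolding real_sqrt_mult using kp1 by (intro mult_right_mono) auto
        qed (use kp1 e in \<open>auto intro!: mult_pos_pos\<close>)
        finally have "h / s * (\<Sum>n\<in>{1..N}. Bernstein N n \<kappa>1 * (2 / sqrt (real n + 1))) <= h / s * (2 / (1 / eps * sqrt \<kappa>1))"
          using h s0 by (intro mult_left_mono) auto
        also have "... = 2 / (\<rho> * sqrt \<kappa>1) * exp (- t) * h"
          using e r by (simp add: s_def \<sigma>_def exp_minus divide_inverse ac_simps)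
        finally show ?thesis by (simp add: sum_distrib_left)
      qed
      ultimately show ?thesis unfolding A_def sum_distrib_left by (rule sbd_mono)
    qed
    have Av: "sbd k ((shop k v - 1) * A) (C * exp (- t) * norm v)" for v
    proof -
      have "sbd k ((shop k v - 1) * A) (2 / (\<rho> * sqrt \<kappa>1) * exp (- t) * real CARD('n) * norm v)"
        by (rule sbd_shop_diff_vec[OF k0 _ As]) (use r kp1 in auto)
      then show ?thesis
        by (rule sbd_mono) (simp add: C_def mult.commute mult.left_commute)
    qed
    have "sbd k (N' ^ N) ((1 - \<kappa>1) ^ N)" by (rule sbd_power[OF N's])
    \<comment> \<open>One factor of the contraction is enough, and N is at least 1 for every
      eps.\<close>
    moreover have "(1 - \<kappa>1) ^ N <= (1 - \<kappa>1) ^ 1" using N1 kp1 k1 by (intro power_decreasing) auto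
    ultimately have "sbd k (N' ^ N) (1 - \<kappa>1)" by (simp add: sbd_mono[of k "N' ^ N"])
    note Bs = this
    show ?thesis
    proof (intro exI conjI allI)
      show "Pop eps t (t + 1) = A + N' ^ N" using PQ QN by simp
    qed (rule Bs, rule Av)
  qed
  show ?thesis
    by (rule that[of "1 - \<kappa>1" C]) (use main kp1 C0 in \<open>auto simp: \<kappa>1_def\<close>)
qed

text \<open>In each unit step the part \<open>A\<close> pays C exp (- (s + n)) |v| and the part
  \<open>B\<close> contracts the previous bound by b. The payments decrease faster than b^n, so
  their sum divided by b^n stays bounded.\<close>

lemma smoothing:
  obtains C \<delta> where "0 <= C" "0 < \<delta>" "\<And>eps s t v. 0 < eps ==> eps <= 1 ==> 0 <= s ==> s <= t ==>
    sbd k ((shop k v - 1) * Pop eps s t) (C * (1 + exp (- s) * norm v) * exp (- \<delta> * (t - s)))"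
proof -
  obtain b C where b: "1/2 <= b" "b < 1" "0 <= C" and dec:
    "\<And>eps r. 0 < eps ==> eps <= 1 ==> 0 <= r ==> \<exists>A B. Pop eps r (r + 1) = A + B \<and> sbd k B b \<and>
      (\<forall>v. sbd k ((shop k v - 1) * A) (C * exp (- r) * norm v))"
    by (rule unit_step_decomposition) (rule that; assumption)
  \<comment> \<open>Here 1/2 <= b enters: exp (- 1) <= 2/5. The ratio 4/5 makes the payments
    summable relative to b^n.\<close>
  have ex: "exp (- 1) <= 4 / 5 * b"
  proof -
    have "5 / 2 <= exp (1::real)"
      using exp_lower_Taylor_quadratic[of 1] by simp
    then have "exp (- 1 :: real) <= 2 / 5" by (simp add: exp_minus field_simps)
    then show ?thesis using b by linarith
  qed
  \<comment> \<open>A partial geometric sum with increments 2 C (4/5)^n; the 2 compensates for the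
    step having b^(n+1) where b^n would fit, as 1 <= 2 b.\<close>
  define c where "c n = 10 * C * (1 - (4/5) ^ n)" for n :: nat
  have step: "sbd k ((shop k v - 1) * Pop eps s (s + real n)) (b ^ n * (2 + c n * (exp (- s) * norm v)))"
    if e: "0 < eps" "eps <= 1" and s: "0 <= s" for eps s v n
  proof (induction n)
    case 0
    have "sbd k (shop k v - 1) (1 + 1)" by (intro sbd_diff sbd_shop k0 sbd_1)
    then show ?case by (simp add: c_def)
  next
    case (Suc n)
    obtain A B where AB: "Pop eps (s + real n) (s + real n + 1) = A + B" "sbd k B b"
      "\<And>v. sbd k ((shop k v - 1) * A) (C * exp (- (s + real n)) * norm v)"
      using dec[OF e, of "s + real n"] s by auto
    define P where "P = Pop eps s (s + real n)"
    have "(shop k v - 1) * Pop eps s (s + real (Suc n)) = (shop k v - 1) * P * (A + B)"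
    proof -
      have "s + real (Suc n) = s + real n + 1" by simp
      then show ?thesis
        using Pop_split[OF e(1), of s "s + real n + 1" "s + real n"] AB(1) by (simp only: P_def mult.assoc)
    qed
    also have "... = P * ((shop k v - 1) * A) + ((shop k v - 1) * P) * B"
      using shop_commute_Pop[OF e(1), of v s "s + real n"] by (simp add: P_def algebra_simps flip: mult.assoc)
    finally have eq: "(shop k v - 1) * Pop eps s (s + real (Suc n)) = P * ((shop k v - 1) * A) + ((shop k v - 1) * P) * B" .
    have "sbd k (P * ((shop k v - 1) * A) + ((shop k v - 1) * P) * B)
       (1 * (C * exp (- (s + real n)) * norm v) + b ^ n * (2 + c n * (exp (- s) * norm v)) * b)"
      unfolding P_def by (intro sbd_add sbd_mult AB Suc sbd_Pop e s) simp
    moreover have "1 * (C * exp (- (s + real n)) * norm v) + b ^ n * (2 + c n * (exp (- s) * norm v)) * b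
       <= b ^ Suc n * (2 + c (Suc n) * (exp (- s) * norm v))"
    proof -
      have "exp (- real n) = exp (- 1) ^ n" by (simp add: exp_of_nat_mult[symmetric])
      also have "... <= (4 / 5 * b) ^ n" using ex by (intro power_mono) auto
      finally have "C * exp (- real n) <= C * (4 / 5 * b) ^ n" using b by (intro mult_left_mono) auto
      also have "... <= b ^ Suc n * (2 * C * (4/5) ^ n)"
      proof -
        have "C * (4/5) ^ n * b ^ n * 1 <= C * (4/5) ^ n * b ^ n * (2 * b)" using b by (intro mult_left_mono) auto
        moreover have "(4 / 5 * b) ^ n = (4/5) ^ n * b ^ n" by (rule power_mult_distrib)
        ultimately show ?thesis by (simp add: ac_simps)
      qed
      also have "2 * C * (4/5) ^ n = c (Suc n) - c n" by (simp add: c_def algebra_simps)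
      finally have "C * exp (- real n) * (exp (- s) * norm v) <= b ^ Suc n * (c (Suc n) - c n) * (exp (- s) * norm v)"
        by (intro mult_right_mono) auto
      moreover have "exp (- (s + real n)) = exp (- real n) * exp (- s)" by (simp add: exp_add[symmetric])
      ultimately show ?thesis by (simp add: algebra_simps)
    qed
    ultimately show ?case unfolding eq by (rule sbd_mono)
  qed
  define D where "D = 2 * (2 + 10 * C)"
  have fin: "sbd k ((shop k v - 1) * Pop eps s t) (D * (1 + exp (- s) * norm v) * exp (- (- ln b) * (t - s)))"
    if e: "0 < eps" "eps <= 1" and s: "0 <= s" "s <= t" for eps s t v
  proof -
    \<comment> \<open>Only the whole unit steps contract; the fractional rest loses a factor 1/b <=
      2, which enters \<open>D\<close>.\<close>
    define n where "n = nat \<lfloor>t - s\<rfloor>"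
    have n: "real n <= t - s" "t - s - 1 <= real n" unfolding n_def using s by linarith+
    have "(shop k v - 1) * Pop eps s t = ((shop k v - 1) * Pop eps s (s + real n)) * Pop eps (s + real n) t"
      using Pop_split[OF e(1), of s t "s + real n"] by (simp add: mult.assoc)
    moreover have "sbd k ... (b ^ n * (2 + c n * (exp (- s) * norm v)) * 1)"
      using n s by (intro sbd_mult step sbd_Pop e) auto
    moreover have "b ^ n * (2 + c n * (exp (- s) * norm v)) * 1 <= D * (1 + exp (- s) * norm v) * exp (- (- ln b) * (t - s))"
    proof -
      have "b ^ n = exp (real n * ln b)" using b by (simp add: exp_of_nat_mult)
      also have "... <= exp ((t - s - 1) * ln b)" using n b by (auto intro!: mult_right_mono_neg)
      also have "(t - s - 1) * ln b = ln b * (t - s) - ln b" by (simp add: algebra_simps)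
      also have "exp (ln b * (t - s) - ln b) = exp (ln b * (t - s)) * (1 / b)"
        using b unfolding exp_diff by simp
      also have "... <= exp (ln b * (t - s)) * 2" using b by (intro mult_left_mono) (auto simp: field_simps)
      finally have 1: "b ^ n <= 2 * exp (ln b * (t - s))" by simp
      have "c n <= 10 * C" unfolding c_def using b by (simp add: mult_left_le)
      then have *: "c n * (exp (- s) * norm v) <= 10 * C * (exp (- s) * norm v)" by (intro mult_right_mono) auto
      have 2: "2 + c n * (exp (- s) * norm v) <= (2 + 10 * C) * (1 + exp (- s) * norm v)"
      proof -
        define x where "x = exp (- s) * norm v"
        have "0 <= x" by (simp add: x_def)
        moreover have "(2 + 10 * C) * (1 + x) = 2 + 10 * C + 2 * x + 10 * C * x" by (simp add: algebra_simps)
        ultimately show ?thesis using *[folded x_def] b unfolding x_def[symmetric] by linarith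
      qed
      have "b ^ n * (2 + c n * (exp (- s) * norm v)) <= 2 * exp (ln b * (t - s)) * ((2 + 10 * C) * (1 + exp (- s) * norm v))"
      proof (intro mult_mono 1 2)
        have "0 <= c n" unfolding c_def using b by (simp add: power_le_one)
        then show "0 <= 2 + c n * (exp (- s) * norm v)" by (simp add: add_nonneg_nonneg)
      qed auto
      also have "2 * exp (ln b * (t - s)) * ((2 + 10 * C) * (1 + exp (- s) * norm v)) = D * (1 + exp (- s) * norm v) * exp (ln b * (t - s))"
        unfolding D_def by (simp only: mult.assoc mult.commute mult.left_commute)
      finally show ?thesis by simp
    qed
    ultimately show ?thesis by (simp only: sbd_mono)
  qed
  show ?thesis
    by (rule that[of D "- ln b"]) (use fin b in \<open>auto simp: D_def\<close>)
qed

end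

subsection \<open>Differentiation under the integral sign\<close>

text \<open>The mean value theorem bounds all difference quotients by the majorant of the
  derivative, and dominated convergence does the rest.\<close>

lemma has_real_derivative_integral:
  fixes f f' :: "real => 'a => real"
  assumes d: "\<And>r x. a < r ==> r < b ==> ((\<lambda>r. f r x) has_real_derivative f' r x) (at r)"
    and fi: "\<And>r. a < r ==> r < b ==> integrable M (f r)"
    and fm: "\<And>r. a < r ==> r < b ==> f' r \<in> borel_measurable M"
    and g: "integrable M g" "\<And>r x. a < r ==> r < b ==> \<bar>f' r x\<bar> <= g x"
    and r: "a < r" "r < b"
  shows "((\<lambda>r. \<integral>x. f r x \<partial>M) has_real_derivative (\<integral>x. f' r x \<partial>M)) (at r)"
  unfolding has_field_derivative_iff tendsto_at_iff_sequentially comp_def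
proof (intro allI impI)
  fix X :: "nat => real" assume X: "\<forall>i. X i \<in> UNIV - {r}" "X \<longlonglongrightarrow> r"
  have "eventually (\<lambda>i. a < X i \<and> X i < b) sequentially"
    using order_tendstoD(1)[OF X(2) r(1)] order_tendstoD(2)[OF X(2) r(2)] by eventually_elim auto
  then obtain N where N: "\<And>i. N <= i ==> a < X i \<and> X i < b" unfolding eventually_sequentially by blast
  \<comment> \<open>Dropping finitely many terms keeps the whole sequence inside the interval where
    the majorant is valid.\<close>
  define Y where "Y i = X (i + N)" for i
  have Y: "a < Y i" "Y i < b" "Y i \<noteq> r" for i using N[of "i + N"] X(1) by (auto simp: Y_def)
  have Yl: "Y \<longlonglongrightarrow> r" unfolding Y_def using X(2) by (rule LIMSEQ_ignore_initial_segment)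
  have q: "\<bar>(f (Y i) x - f r x) / (Y i - r)\<bar> <= g x" for i x
  proof -
    have "\<exists>\<xi>. a < \<xi> \<and> \<xi> < b \<and> f (Y i) x - f r x = (Y i - r) * f' \<xi> x"
    proof (cases "r < Y i")
      case True
      then obtain \<xi> where "r < \<xi>" "\<xi> < Y i" "f (Y i) x - f r x = (Y i - r) * f' \<xi> x"
        using MVT2[of r "Y i" "\<lambda>r. f r x" "\<lambda>r. f' r x"] d r Y[of i] by (metis less_trans order.strict_trans1 order.strict_trans2)
      then show ?thesis using r Y[of i] by (intro exI[of _ \<xi>]) auto
    next
      case False
      then have "Y i < r" using Y(3)[of i] by simp
      then obtain \<xi> where "Y i < \<xi>" "\<xi> < r" "f r x - f (Y i) x = (r - Y i) * f' \<xi> x"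
        using MVT2[of "Y i" r "\<lambda>r. f r x" "\<lambda>r. f' r x"] d r Y[of i] by (metis less_trans order.strict_trans1 order.strict_trans2)
      then show ?thesis using r Y[of i] by (intro exI[of _ \<xi>]) (auto simp: algebra_simps)
    qed
    then obtain \<xi> where xi: "a < \<xi>" "\<xi> < b" "f (Y i) x - f r x = (Y i - r) * f' \<xi> x" by blast
    then have "(f (Y i) x - f r x) / (Y i - r) = f' \<xi> x" using Y(3)[of i] by simp
    then show ?thesis using g(2)[OF xi(1,2)] by simp
  qed
  have "(\<lambda>i. \<integral>x. (f (Y i) x - f r x) / (Y i - r) \<partial>M) \<longlonglongrightarrow> (\<integral>x. f' r x \<partial>M)"
  proof (rule integral_dominated_convergence[OF fm[OF r] _ g(1)])
    show "(\<lambda>x. (f (Y i) x - f r x) / (Y i - r)) \<in> borel_measurable M" for i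
      using borel_measurable_integrable[OF fi[OF Y(1,2)], of i] borel_measurable_integrable[OF fi[OF r]] by measurable
    show "AE x in M. (\<lambda>i. (f (Y i) x - f r x) / (Y i - r)) \<longlonglongrightarrow> f' r x"
      using d[OF r] Y Yl unfolding has_field_derivative_iff tendsto_at_iff_sequentially comp_def by auto
    show "AE x in M. norm ((f (Y i) x - f r x) / (Y i - r)) <= g x" for i
      using q by auto
  qed
  moreover have "(\<integral>x. (f (Y i) x - f r x) / (Y i - r) \<partial>M) = ((\<integral>x. f (Y i) x \<partial>M) - (\<integral>x. f r x \<partial>M)) / (Y i - r)" for i
    by (simp add: Bochner_Integration.integral_diff fi Y r)
  ultimately have "(\<lambda>i. ((\<integral>x. f (Y i) x \<partial>M) - (\<integral>x. f r x \<partial>M)) / (Y i - r)) \<longlonglongrightarrow> (\<integral>x. f' r x \<partial>M)"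
    by (simp only:)
  then have "(\<lambda>i. ((\<integral>x. f (X (i + N)) x \<partial>M) - (\<integral>x. f r x \<partial>M)) / (X (i + N) - r)) \<longlonglongrightarrow> (\<integral>x. f' r x \<partial>M)"
    by (simp only: Y_def)
  then show "(\<lambda>i. ((\<integral>x. f (X i) x \<partial>M) - (\<integral>x. f r x \<partial>M)) / (X i - r)) \<longlonglongrightarrow> (\<integral>x. f' r x \<partial>M)"
    by (rule LIMSEQ_offset)
qed

subsection \<open>The heat kernel\<close>

abbreviation Hk :: "real => real ^ 'n => real" where "Hk \<equiv> heat_kernel"

lemma heat_kernel_measurable [measurable]: "Hk \<tau> \<in> borel_measurable borel"
  unfolding heat_kernel_def[abs_def] by measurable

lemma heat_kernel_pos: "0 < \<tau> ==> 0 < Hk \<tau> y"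
  by (simp add: heat_kernel_def)

lemma heat_kernel_nonneg: "0 < \<tau> ==> 0 <= Hk \<tau> y"
  by (simp add: less_imp_le heat_kernel_pos)

lemma heat_kernel_prod:
  fixes y :: "real ^ 'n"
  assumes t: "0 < \<tau>"
  shows "Hk \<tau> y = (\<Prod>i\<in>UNIV. normal_density 0 (sqrt (2 * \<tau>)) (y $ i))"
proof -
  have nd: "normal_density 0 (sqrt (2 * \<tau>)) x = 1 / sqrt (4 * pi * \<tau>) * exp (- x\<^sup>2 / (4 * \<tau>))" for x
    using t by (simp add: normal_density_def)
  have "(\<Prod>i\<in>UNIV. normal_density 0 (sqrt (2 * \<tau>)) (y $ i)) = (\<Prod>i\<in>(UNIV::'n set). 1 / sqrt (4 * pi * \<tau>)) * (\<Prod>i\<in>UNIV. exp (- (y $ i)\<^sup>2 / (4 * \<tau>)))"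
    unfolding nd by (rule prod.distrib)
  also have "(\<Prod>i\<in>UNIV. exp (- (y $ i)\<^sup>2 / (4 * \<tau>))) = exp (- (norm y)\<^sup>2 / (4 * \<tau>))"
    by (simp add: exp_sum[symmetric] norm_vec_def L2_set_def real_sqrt_pow2 sum_nonneg sum_negf sum_divide_distrib)
  also have "(\<Prod>i\<in>(UNIV::'n set). 1 / sqrt (4 * pi * \<tau>)) = (4 * pi * \<tau>) powr (- real CARD('n) / 2)"
  proof -
    have "(4 * pi * \<tau>) powr (- real CARD('n) / 2) = ((4 * pi * \<tau>) powr (- 1 / 2)) powr real CARD('n)"
      by (simp add: powr_powr)
    also have "(4 * pi * \<tau>) powr (- 1 / 2) = 1 / sqrt (4 * pi * \<tau>)"
    proof -
      have "(4 * pi * \<tau>) powr (- (1 / 2)) = inverse ((4 * pi * \<tau>) powr (1 / 2))" by (rule powr_minus)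
      also have "(4 * pi * \<tau>) powr (1 / 2) = sqrt (4 * pi * \<tau>)" using t by (intro powr_half_sqrt) simp
      finally show ?thesis by (simp add: inverse_eq_divide)
    qed
    also have "(1 / sqrt (4 * pi * \<tau>)) powr real CARD('n) = (1 / sqrt (4 * pi * \<tau>)) ^ CARD('n)"
      by (rule powr_realpow) (use t in simp)
    finally show ?thesis by (simp only: prod_constant)
  qed
  finally show ?thesis by (simp add: heat_kernel_def)
qed

lemma
  assumes t: "0 < \<tau>"
  shows integrable_heat_kernel: "integrable lborel (Hk \<tau> :: real ^ 'n => real)"
    and integral_heat_kernel: "(LBINT y. Hk \<tau> (y :: real ^ 'n)) = 1"
proof -
  have nd: "(\<integral>\<^sup>+x. ennreal (normal_density 0 (sqrt (2 * \<tau>)) x) \<partial>lborel) = 1"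
    using t by (subst nn_integral_eq_integral) auto
  have "(\<integral>\<^sup>+y. ennreal (Hk \<tau> (y :: real ^ 'n)) \<partial>lborel) = (\<integral>\<^sup>+y. (\<Prod>i\<in>(UNIV::'n set). ennreal (normal_density 0 (sqrt (2 * \<tau>)) (y $ i))) \<partial>lborel)"
    using t by (simp add: heat_kernel_prod prod_ennreal)
  also have "... = 1" by (subst nn_integral_prod_vec) (simp_all add: nd)
  finally have e: "(\<integral>\<^sup>+y. ennreal (Hk \<tau> (y :: real ^ 'n)) \<partial>lborel) = 1" .
  show "integrable lborel (Hk \<tau> :: real ^ 'n => real)"
    by (rule integrableI_nonneg) (use e t heat_kernel_nonneg in auto)
  show "(LBINT y. Hk \<tau> (y :: real ^ 'n)) = 1"
    by (subst integral_eq_nn_integral) (use e t heat_kernel_nonneg in auto)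
qed

lemma integrable_kw_gauss:
  fixes c :: real
  assumes a: "0 <= a" and c: "0 < c"
  shows "integrable lborel (\<lambda>y :: real ^ 'n. kw a y * exp (- c * (norm y)\<^sup>2))"
proof (rule Bochner_Integration.integrable_bound)
  \<comment> \<open>Half of the Gaussian exponent absorbs the algebraic weight, by completing the
    square; the other half is a heat kernel at this time.\<close>
  define \<tau> where "\<tau> = 1 / (2 * c)"
  have t: "0 < \<tau>" using c by (simp add: \<tau>_def)
  define D where "D = exp (a\<^sup>2 / (2 * c)) * (4 * pi * \<tau>) powr (real CARD('n) / 2)"
  show "integrable lborel (\<lambda>y :: real ^ 'n. D * Hk \<tau> y)" by (intro integrable_mult_right integrable_heat_kernel t)
  have h: "kw a y * exp (- c * (norm y)\<^sup>2) <= D * Hk \<tau> y" for y :: "real ^ 'n"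
  proof -
    have "kw a y <= exp (norm y) powr a" unfolding kw_def using a exp_ge_add_one_self[of "norm y"] by (intro powr_mono2) auto
    also have "... = exp (a * norm y)" by (simp add: powr_def)
    also have "... <= exp (c / 2 * (norm y)\<^sup>2 + a\<^sup>2 / (2 * c))"
    proof -
      have "0 <= (c * norm y - a)\<^sup>2 / (2 * c)" using c by simp
      also have "... = c / 2 * (norm y)\<^sup>2 + a\<^sup>2 / (2 * c) - a * norm y" using c by (simp add: power2_eq_square field_simps)
      finally show ?thesis by simp
    qed
    finally have "kw a y * exp (- c * (norm y)\<^sup>2) <= exp (c / 2 * (norm y)\<^sup>2 + a\<^sup>2 / (2 * c)) * exp (- c * (norm y)\<^sup>2)"
      by (intro mult_right_mono) auto
    also have "... = exp (a\<^sup>2 / (2 * c)) * exp (- (c / 2) * (norm y)\<^sup>2)"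
      unfolding exp_add[symmetric] by (simp add: algebra_simps)
    also have "... = D * Hk \<tau> y"
    proof -
      have "(4 * pi * \<tau>) powr (real CARD('n) / 2) * (4 * pi * \<tau>) powr (- real CARD('n) / 2) = 1"
        using t by (simp add: powr_add[symmetric])
      moreover have "exp (- (norm y)\<^sup>2 / (4 * \<tau>)) = exp (- (c / 2) * (norm y)\<^sup>2)" using c by (simp add: \<tau>_def)
      moreover have "D * Hk \<tau> y = exp (a\<^sup>2 / (2 * c)) * ((4 * pi * \<tau>) powr (real CARD('n) / 2) * (4 * pi * \<tau>) powr (- real CARD('n) / 2)) * exp (- (norm y)\<^sup>2 / (4 * \<tau>))"
        by (simp only: D_def heat_kernel_def mult.assoc)
      ultimately show ?thesis by (simp only: mult_1_right)
    qed
    finally show ?thesis .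
  qed
  show "AE y in lborel. norm (kw a y * exp (- c * (norm y)\<^sup>2)) <= norm (D * Hk \<tau> (y :: real ^ 'n))"
  proof (intro AE_I2)
    fix y :: "real ^ 'n"
    have "norm (kw a y * exp (- c * (norm y)\<^sup>2)) = kw a y * exp (- c * (norm y)\<^sup>2)" by (simp add: abs_mult)
    also have "... <= norm (D * Hk \<tau> y)" unfolding real_norm_def by (rule order.trans[OF h abs_ge_self])
    finally show "norm (kw a y * exp (- c * (norm y)\<^sup>2)) <= norm (D * Hk \<tau> y)" .
  qed
qed measurable

lemma heat_kernel_rescale:
  fixes y :: "real ^ 'n"
  assumes t: "0 < \<tau>" shows "Hk \<tau> y = rescale (sqrt \<tau>) (Hk 1) y"
proof -
  have "(4 * pi * \<tau>) powr (- real CARD('n) / 2) = (4 * pi) powr (- real CARD('n) / 2) * \<tau> powr (- real CARD('n) / 2)"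
    by (rule powr_mult)
  also have "\<tau> powr (- real CARD('n) / 2) = 1 / sqrt \<tau> ^ CARD('n)"
  proof -
    have "\<tau> powr (- real CARD('n) / 2) = 1 / (\<tau> powr (1/2)) powr real CARD('n)"
      by (simp add: powr_powr powr_minus_divide)
    also have "\<tau> powr (1/2) = sqrt \<tau>" using t by (intro powr_half_sqrt) simp
    also have "sqrt \<tau> powr real CARD('n) = sqrt \<tau> ^ CARD('n)" by (rule powr_realpow) (use t in simp)
    finally show ?thesis .
  qed
  finally have p: "(4 * pi * \<tau>) powr (- real CARD('n) / 2) = (4 * pi) powr (- real CARD('n) / 2) * (1 / sqrt \<tau> ^ CARD('n))" .
  have "norm (y /\<^sub>R sqrt \<tau>) = norm y / sqrt \<tau>" using t by (simp add: inverse_eq_divide)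
  then have n: "(norm (y /\<^sub>R sqrt \<tau>))\<^sup>2 = (norm y)\<^sup>2 / \<tau>" using t by (simp only: power_divide real_sqrt_pow2 less_imp_le)
  show ?thesis unfolding heat_kernel_def rescale_def n p by simp
qed

definition hkM :: "'n::finite itself => real => real" where
  "hkM _ a = (LBINT y. kw a y * Hk 1 (y :: real ^ 'n))"

lemma integrable_kw_heat_1:
  assumes a: "0 <= a" shows "integrable lborel (\<lambda>y :: real ^ 'n. kw a y * Hk 1 y)"
  using integrable_mult_right[OF integrable_kw_gauss[OF a, of "1/4", where 'n='n], of "(4 * pi) powr (- real CARD('n) / 2)"]
  by (simp add: heat_kernel_def ac_simps)

lemma kw_heat_kernel:
  assumes a: "0 <= a" and t: "0 < \<tau>"
  shows "integrable lborel (\<lambda>y :: real ^ 'n. kw a (y /\<^sub>R sqrt \<tau>) * Hk \<tau> y)"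
    "(LBINT y. kw a (y /\<^sub>R sqrt \<tau>) * Hk \<tau> (y :: real ^ 'n)) = hkM TYPE('n) a"
proof -
  have s: "0 < sqrt \<tau>" using t by simp
  show "integrable lborel (\<lambda>y :: real ^ 'n. kw a (y /\<^sub>R sqrt \<tau>) * Hk \<tau> y)"
    unfolding heat_kernel_rescale[OF t]
    by (subst integral_rescale(2)[OF _ _ s]) (use s integrable_kw_heat_1[OF a, where 'n='n] in auto)
  show "(LBINT y. kw a (y /\<^sub>R sqrt \<tau>) * Hk \<tau> (y :: real ^ 'n)) = hkM TYPE('n) a"
    unfolding heat_kernel_rescale[OF t] hkM_def
    by (subst integral_rescale(1)[OF _ _ s]) (use s in auto)
qed

lemma wkernel_heat: "0 <= k ==> 0 < \<tau> ==> wkernel k (Hk \<tau>)"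
proof -
  assume k: "0 <= k" and t: "0 < \<tau>"
  have "integrable lborel (\<lambda>y :: real ^ 'a. (4 * pi * \<tau>) powr (- real CARD('a) / 2) * (kw k y * exp (- (1 / (4 * \<tau>)) * (norm y)\<^sup>2)))"
    using t by (intro integrable_mult_right integrable_kw_gauss k) auto
  then have "integrable lborel (\<lambda>y :: real ^ 'a. kw k y * \<bar>Hk \<tau> y\<bar>)"
    by (simp add: heat_kernel_def abs_mult ac_simps)
  then show "wkernel k (Hk \<tau> :: real ^ 'a => real)" by (simp add: wkernel_def)
qed

subsection \<open>Directional derivatives of the heat kernel\<close>

text \<open>\<open>hkd j \<tau> z y\<close> is the \<open>j\<close>-th derivative of \<open>r \<mapsto> Hk \<tau> (y - r z)\<close> at \<open>r = 0\<close>, for \<open>j <= 4\<close>.\<close>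

fun hkd :: "nat => real => real ^ 'n => real ^ 'n => real" where
  "hkd j \<tau> z y = (let a = (y \<bullet> z) / (2 * \<tau>); b = (z \<bullet> z) / (2 * \<tau>) in
     (if j = 0 then 1 else if j = 1 then a else if j = 2 then a\<^sup>2 - b else if j = 3 then a ^ 3 - 3 * a * b
      else a ^ 4 - 6 * a\<^sup>2 * b + 3 * b\<^sup>2) * Hk \<tau> y)"

declare hkd.simps [simp del]

lemma hkd_measurable [measurable]: "(\<lambda>(z, y). hkd j \<tau> z y) \<in> borel_measurable (borel \<Otimes>\<^sub>M borel)"
  unfolding hkd.simps Let_def heat_kernel_def by measurable

lemma hkd_measurable' [measurable]: "hkd j \<tau> z \<in> borel_measurable borel"
  unfolding hkd.simps[abs_def] Let_def by measurable

lemma hkd_0: "hkd 0 \<tau> z = Hk \<tau>"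
  by (rule ext) (simp add: hkd.simps)

lemma hkd_has_derivative:
  assumes t: "0 < \<tau>" and j: "j < 4"
  shows "((\<lambda>r. hkd j \<tau> z (y - r *\<^sub>R z)) has_real_derivative hkd (Suc j) \<tau> z (y - r *\<^sub>R z)) (at r)"
proof -
  define b where "b = (z \<bullet> z) / (2 * \<tau>)"
  define a where "a r = ((y - r *\<^sub>R z) \<bullet> z) / (2 * \<tau>)" for r
  define E where "E r = Hk \<tau> (y - r *\<^sub>R z)" for r
  have da: "(a has_real_derivative - b) (at r)" for r
    unfolding a_def b_def inner_diff_left inner_scaleR_left
    using t by (auto intro!: derivative_eq_intros)
  have dE: "(E has_real_derivative a r * E r) (at r)" for r
  proof -
    have n: "(norm (y - r *\<^sub>R z))\<^sup>2 = y \<bullet> y - 2 * r * (y \<bullet> z) + r\<^sup>2 * (z \<bullet> z)" for r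
      unfolding power2_norm_eq_inner by (simp add: inner_diff_left inner_diff_right inner_commute power2_eq_square algebra_simps)
    have 1: "((\<lambda>r. - (y \<bullet> y - 2 * r * (y \<bullet> z) + r\<^sup>2 * (z \<bullet> z)) / (4 * \<tau>)) has_real_derivative a r) (at r)"
      unfolding a_def inner_diff_left inner_scaleR_left
      using t by (auto intro!: derivative_eq_intros simp: field_simps)
    have "((\<lambda>r. (4 * pi * \<tau>) powr (- real CARD('a) / 2) * exp (- (y \<bullet> y - 2 * r * (y \<bullet> z) + r\<^sup>2 * (z \<bullet> z)) / (4 * \<tau>))) has_real_derivative
      (4 * pi * \<tau>) powr (- real CARD('a) / 2) * (exp (- (y \<bullet> y - 2 * r * (y \<bullet> z) + r\<^sup>2 * (z \<bullet> z)) / (4 * \<tau>)) * a r)) (at r)"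
      by (intro DERIV_cmult DERIV_fun_exp 1)
    then show ?thesis unfolding E_def heat_kernel_def n by (simp add: mult.commute mult.left_commute)
  qed
  have hkde: "hkd i \<tau> z (y - r *\<^sub>R z) = (if i = 0 then 1 else if i = 1 then a r else if i = 2 then (a r)\<^sup>2 - b else if i = 3 then (a r) ^ 3 - 3 * a r * b
      else (a r) ^ 4 - 6 * (a r)\<^sup>2 * b + 3 * b\<^sup>2) * E r" for i r
    by (simp add: hkd.simps Let_def a_def b_def E_def)
  consider "j = 0" | "j = 1" | "j = 2" | "j = 3" using j by linarith
  then show ?thesis
    by cases (simp_all add: hkde, (rule derivative_eq_intros da dE refl | simp add: power2_eq_square power3_eq_cube power4_eq_xxxx algebra_simps)+)
qed

text \<open>With \<zeta> = |z| / sqrt \<tau>, the quantities a and b are of first and second order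
  in \<zeta>, so each derivative is homogeneous of order j. The constant 10 = 1 + 6 + 3 is the sum
  of the coefficients at j = 4 and covers the lower orders.\<close>

lemma hkd_bound:
  assumes t: "0 < \<tau>" and j: "j <= 4"
  shows "\<bar>hkd j \<tau> z y\<bar> <= 10 * (norm z / sqrt \<tau>) ^ j * (kw 4 (y /\<^sub>R sqrt \<tau>) * Hk \<tau> y)"
proof -
  define a where "a = (y \<bullet> z) / (2 * \<tau>)"
  define b where "b = (z \<bullet> z) / (2 * \<tau>)"
  define \<zeta> where "\<zeta> = norm z / sqrt \<tau>"
  define Y where "Y = 1 + norm (y /\<^sub>R sqrt \<tau>)"
  have Y1: "1 <= Y" by (simp add: Y_def)
  have z0: "0 <= \<zeta>" using t by (simp add: \<zeta>_def)
  have a: "\<bar>a\<bar> <= \<zeta> * Y"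
  proof -
    have "\<bar>a\<bar> <= norm y * norm z / (2 * \<tau>)" unfolding a_def abs_divide
      using t Cauchy_Schwarz_ineq2[of y z] by (intro frac_le) auto
    also have "... <= norm y * norm z / \<tau>" using t by (intro divide_left_mono) auto
    also have "... = (norm z / sqrt \<tau>) * (norm y / sqrt \<tau>)" using t by (simp add: real_sqrt_mult_self field_simps)
    also have "... <= \<zeta> * Y" unfolding \<zeta>_def Y_def using t by (intro mult_left_mono) (auto simp: divide_inverse mult.commute)
    finally show ?thesis .
  qed
  have b: "0 <= b" "b <= \<zeta>\<^sup>2"
    using t by (auto simp: b_def \<zeta>_def power_divide power2_norm_eq_inner real_sqrt_pow2 intro!: divide_left_mono)
  have Yp: "Y ^ i <= Y ^ 4" if "i <= 4" for i using Y1 that by (intro power_increasing) auto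
  have ap: "\<bar>a\<bar> ^ i <= \<zeta> ^ i * Y ^ i" for i using power_mono[OF a, of i] by (simp add: power_mult_distrib)
  have key: "\<bar>a\<bar> ^ i * b ^ m <= \<zeta> ^ (i + 2 * m) * Y ^ 4" if "i <= 4" for i m
  proof -
    have "b ^ m <= (\<zeta>\<^sup>2) ^ m" using b by (intro power_mono) auto
    then have "\<bar>a\<bar> ^ i * b ^ m <= (\<zeta> ^ i * Y ^ i) * (\<zeta>\<^sup>2) ^ m" using b z0 Y1 by (intro mult_mono ap) auto
    also have "... = \<zeta> ^ (i + 2 * m) * Y ^ i" by (simp add: power_add power_mult)
    also have "... <= \<zeta> ^ (i + 2 * m) * Y ^ 4" using z0 by (intro mult_left_mono Yp that) auto
    finally show ?thesis .
  qed
  have "\<bar>if j = 0 then 1 else if j = 1 then a else if j = 2 then a\<^sup>2 - b else if j = 3 then a ^ 3 - 3 * a * b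
      else a ^ 4 - 6 * a\<^sup>2 * b + 3 * b\<^sup>2\<bar> <= 10 * \<zeta> ^ j * Y ^ 4"
  proof -
    consider "j = 0" | "j = 1" | "j = 2" | "j = 3" | "j = 4" using j by linarith
    then show ?thesis
    proof cases
      case 1
      have "1 <= Y ^ 4" using Y1 by (rule one_le_power)
      then show ?thesis using 1 by simp
    next
      case 2
      have "0 <= \<zeta> * Y ^ 4" using z0 Y1 by simp
      then show ?thesis using 2 key[of 1 0] by simp
    next
      case 3
      have "\<bar>a\<^sup>2 - b\<bar> <= \<bar>a\<bar>\<^sup>2 + b" using b by (simp add: abs_le_iff)
      moreover have "\<bar>a\<bar>\<^sup>2 <= \<zeta>\<^sup>2 * Y ^ 4" using key[of 2 0] by simp
      moreover have "b <= \<zeta>\<^sup>2 * Y ^ 4" using key[of 0 1] by (simp add: power2_eq_square)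
      moreover have "0 <= \<zeta>\<^sup>2 * Y ^ 4" by simp
      ultimately have "\<bar>a\<^sup>2 - b\<bar> <= 10 * (\<zeta>\<^sup>2 * Y ^ 4)" by linarith
      then show ?thesis using 3 by simp
    next
      case 4
      have "\<bar>a ^ 3 - 3 * a * b\<bar> <= \<bar>a ^ 3\<bar> + \<bar>3 * a * b\<bar>" by (rule abs_triangle_ineq4)
      then have "\<bar>a ^ 3 - 3 * a * b\<bar> <= \<bar>a\<bar> ^ 3 + 3 * (\<bar>a\<bar> * b)" using b by (simp add: abs_mult power_abs)
      moreover have "\<bar>a\<bar> ^ 3 <= \<zeta> ^ 3 * Y ^ 4" using key[of 3 0] by simp
      moreover have "\<bar>a\<bar> * b <= \<zeta> ^ 3 * Y ^ 4" using key[of 1 1] by (simp add: power3_eq_cube)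
      moreover have "0 <= \<zeta> ^ 3 * Y ^ 4" using z0 by simp
      ultimately have "\<bar>a ^ 3 - 3 * a * b\<bar> <= 10 * (\<zeta> ^ 3 * Y ^ 4)" by linarith
      then show ?thesis using 4 by simp
    next
      case 5
      have "\<bar>a ^ 4 - 6 * a\<^sup>2 * b + 3 * b\<^sup>2\<bar> <= a ^ 4 + 6 * (a\<^sup>2 * b) + 3 * b\<^sup>2"
        using b by (simp add: abs_le_iff)
      then show ?thesis using 5 key[of 4 0] key[of 2 1] key[of 0 2] by simp
    qed
  qed
  then have "\<bar>hkd j \<tau> z y\<bar> <= (10 * \<zeta> ^ j * Y ^ 4) * Hk \<tau> y"
    unfolding hkd.simps Let_def a_def[symmetric] b_def[symmetric] abs_mult
    using heat_kernel_nonneg[OF t, of y] by (simp add: mult_right_mono)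
  also have "Y ^ 4 = kw 4 (y /\<^sub>R sqrt \<tau>)"
    unfolding kw_def Y_def using norm_ge_zero[of "y /\<^sub>R sqrt \<tau>"] by (subst powr_numeral) linarith+
  finally show ?thesis by (simp add: \<zeta>_def mult.assoc)
qed

lemma kw_mult: "kw a y * kw b y = kw (a + b) y"
  by (simp add: kw_def powr_add)

lemma kw_norm_mono: "0 <= a ==> norm x <= norm y ==> kw a x <= kw a y"
  unfolding kw_def by (intro powr_mono2) auto

text \<open>A shift in a fixed ball costs half of the Gaussian exponent, through |y|^2 <= 2 |y -
  v|^2 + 2 |v|^2. The result is one majorant for all shifts and all orders, as differentiation under
  the integral demands.\<close>

lemma hkd_shift_bound:
  assumes t: "0 < \<tau>"
  obtains C where "0 <= C" "\<And>j (y :: real ^ 'n) v. j <= 4 ==> norm v <= B ==> \<bar>hkd j \<tau> z (y - v)\<bar> <= C * (kw 4 y * exp (- (1 / (8 * \<tau>)) * (norm y)\<^sup>2))"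
proof -
  define b where "b = (1 + norm z / sqrt \<tau>) ^ 4"
  define P where "P = (4 * pi * \<tau>) powr (- real CARD('n) / 2)"
  define C where "C = 10 * b * (max 1 (1 / sqrt \<tau>) powr 4 * (1 + \<bar>B\<bar>) powr 4 * (P * exp (B\<^sup>2 / (4 * \<tau>))))"
  have b0: "0 <= b" by (simp add: b_def)
  have C0: "0 <= C" by (simp add: C_def b0 P_def)
  have main: "\<bar>hkd j \<tau> z (y - v)\<bar> <= C * (kw 4 y * exp (- (1 / (8 * \<tau>)) * (norm y)\<^sup>2))"
    if j: "j <= 4" and v: "norm v <= B" for j and y v :: "real ^ 'n"
  proof -
    have z0: "0 <= norm z / sqrt \<tau>" using t by simp
    have 1: "(norm z / sqrt \<tau>) ^ j <= b"
    proof -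
      have "(norm z / sqrt \<tau>) ^ j <= (1 + norm z / sqrt \<tau>) ^ j" using z0 by (intro power_mono) auto
      also have "... <= b" unfolding b_def using z0 j by (intro power_increasing) auto
      finally show ?thesis .
    qed
    have 2: "kw 4 ((y - v) /\<^sub>R sqrt \<tau>) <= max 1 (1 / sqrt \<tau>) powr 4 * ((1 + \<bar>B\<bar>) powr 4 * kw 4 y)"
    proof -
      have "kw 4 ((y - v) /\<^sub>R sqrt \<tau>) <= max 1 (1 / sqrt \<tau>) powr 4 * kw 4 (y - v)"
        using kw_scale_le[of 4 "1 / sqrt \<tau>" "y - v"] t by (simp add: inverse_eq_divide)
      also have "max 1 (1 / sqrt \<tau>) powr 4 * kw 4 (y - v) <= max 1 (1 / sqrt \<tau>) powr 4 * ((1 + \<bar>B\<bar>) powr 4 * kw 4 y)"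
      proof (intro mult_left_mono)
        have "kw 4 (- v) <= (1 + \<bar>B\<bar>) powr 4" unfolding kw_def using v by (intro powr_mono2) auto
        then have "kw 4 y * kw 4 (- v) <= kw 4 y * (1 + \<bar>B\<bar>) powr 4" by (intro mult_left_mono) auto
        then have "kw 4 (y + - v) <= kw 4 y * (1 + \<bar>B\<bar>) powr 4" by (rule order.trans[OF kw_add, rotated]) simp
        then show "kw 4 (y - v) <= (1 + \<bar>B\<bar>) powr 4 * kw 4 y" by (simp only: mult.commute add_uminus_conv_diff)
      qed auto
      finally show ?thesis .
    qed
    have 3: "Hk \<tau> (y - v) <= P * exp (B\<^sup>2 / (4 * \<tau>)) * exp (- (1 / (8 * \<tau>)) * (norm y)\<^sup>2)"
    proof -
      have "(norm y)\<^sup>2 <= (norm (y - v) + norm v)\<^sup>2"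
        using norm_triangle_ineq[of "y - v" v] by (intro power_mono) auto
      also have "... <= 2 * (norm (y - v))\<^sup>2 + 2 * (norm v)\<^sup>2"
        using zero_le_power2[of "norm (y - v) - norm v"] by (simp add: power2_sum power2_diff)
      also have "(norm v)\<^sup>2 <= B\<^sup>2" using v by (intro power_mono) auto
      finally have "(norm y)\<^sup>2 / (8 * \<tau>) <= (2 * (norm (y - v))\<^sup>2 + 2 * B\<^sup>2) / (8 * \<tau>)"
        using t by (intro divide_right_mono) auto
      then have "- (norm (y - v))\<^sup>2 / (4 * \<tau>) <= B\<^sup>2 / (4 * \<tau>) + - (1 / (8 * \<tau>)) * (norm y)\<^sup>2"
        using t by (simp add: field_simps)
      then have "exp (- (norm (y - v))\<^sup>2 / (4 * \<tau>)) <= exp (B\<^sup>2 / (4 * \<tau>)) * exp (- (1 / (8 * \<tau>)) * (norm y)\<^sup>2)"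
        unfolding exp_add[symmetric] by (subst exp_le_cancel_iff)
      then have "P * exp (- (norm (y - v))\<^sup>2 / (4 * \<tau>)) <= P * (exp (B\<^sup>2 / (4 * \<tau>)) * exp (- (1 / (8 * \<tau>)) * (norm y)\<^sup>2))"
        by (intro mult_left_mono) (simp_all add: P_def)
      then show ?thesis by (simp add: heat_kernel_def P_def mult.assoc)
    qed
    have "\<bar>hkd j \<tau> z (y - v)\<bar> <= 10 * (norm z / sqrt \<tau>) ^ j * (kw 4 ((y - v) /\<^sub>R sqrt \<tau>) * Hk \<tau> (y - v))"
      by (rule hkd_bound[OF t j])
    also have "... <= 10 * b * ((max 1 (1 / sqrt \<tau>) powr 4 * ((1 + \<bar>B\<bar>) powr 4 * kw 4 y)) * (P * exp (B\<^sup>2 / (4 * \<tau>)) * exp (- (1 / (8 * \<tau>)) * (norm y)\<^sup>2)))"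
      using b0 heat_kernel_nonneg[OF t] z0
      by (intro mult_mono 1 2 3 mult_left_mono mult_nonneg_nonneg) auto
    also have "... = C * (kw 4 y * exp (- (1 / (8 * \<tau>)) * (norm y)\<^sup>2))" by (simp add: C_def ac_simps)
    finally show ?thesis .
  qed
  show ?thesis by (rule that[OF C0 main])
qed

lemma integrable_gauss_weight:
  assumes "0 <= k" "0 < \<tau>"
  shows "integrable lborel (\<lambda>y :: real ^ 'n. kw k y * (kw 4 y * exp (- (1 / (8 * \<tau>)) * (norm y)\<^sup>2)))"
  using integrable_kw_gauss[of "k + 4" "1 / (8 * \<tau>)", where 'n='n] assms
  by (simp add: mult.assoc[symmetric] kw_mult)

lemma wkernel_gauss_bound:
  assumes k: "0 <= k" and t: "0 < \<tau>" and [measurable]: "g \<in> borel_measurable borel"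
    and b: "\<And>y :: real ^ 'n. \<bar>g y\<bar> <= C * (kw 4 y * exp (- (1 / (8 * \<tau>)) * (norm y)\<^sup>2))"
  shows "wkernel k g"
proof -
  have "integrable lborel (\<lambda>y. kw k y * \<bar>g y\<bar>)"
  proof (rule Bochner_Integration.integrable_bound[OF integrable_mult_right[OF integrable_gauss_weight[OF k t], of C]])
    have "kw k y * \<bar>g y\<bar> <= C * (kw k y * (kw 4 y * exp (- (1 / (8 * \<tau>)) * (norm y)\<^sup>2)))" for y
      using mult_left_mono[OF b[of y], of "kw k y"] by (simp add: ac_simps)
    then show "AE y in lborel. norm (kw k y * \<bar>g y\<bar>) <= norm (C * (kw k y * (kw 4 y * exp (- (1 / (8 * \<tau>)) * (norm y)\<^sup>2))))"
      by (intro AE_I2) (auto intro: order.trans[OF _ abs_ge_self])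
  qed measurable
  then show ?thesis by (simp add: wkernel_def)
qed

lemma wkernel_hkd:
  assumes "0 <= k" "0 < \<tau>" "j <= 4" shows "wkernel k (hkd j \<tau> z)"
proof -
  obtain C where C: "0 <= C" "\<And>j y v. j <= 4 ==> norm v <= (0::real) ==> \<bar>hkd j \<tau> z (y - v)\<bar> <= C * (kw 4 y * exp (- (1 / (8 * \<tau>)) * (norm y)\<^sup>2))"
    by (rule hkd_shift_bound[OF assms(2)]) (rule that; assumption)
  show ?thesis by (rule wkernel_gauss_bound[OF assms(1,2), of _ C]) (use C(2)[OF assms(3), of 0] in auto)
qed

text \<open>The j-th derivative in direction z of the heat flow of \<open>f\<close>. All derivatives
  sit on the kernel because \<open>f\<close> is only continuous.\<close>

definition nj :: "real => nat => (real ^ 'n) \<Rightarrow>\<^sub>C real => real => real ^ 'n => real ^ 'n => real" where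
  "nj k j f \<tau> z x = (LBINT y. ev k f (x + y) * hkd j \<tau> z y)"

lemma nj_measurable [measurable]: "(\<lambda>(z, x). nj k j f \<tau> z x) \<in> borel_measurable (borel \<Otimes>\<^sub>M borel)"
proof -
  have "(\<lambda>p. (LBINT y. ev k f (snd p + y) * (\<lambda>(z, y). hkd j \<tau> z y) (fst p, y))) \<in> borel_measurable (borel \<Otimes>\<^sub>M borel)"
    by measurable
  then show ?thesis by (simp add: nj_def split_beta')
qed

lemma nj_has_derivative:
  assumes k: "0 <= k" and t: "0 < \<tau>" and j: "j < 4"
  shows "((\<lambda>r. nj k j f \<tau> z (x + r *\<^sub>R z)) has_real_derivative nj k (Suc j) f \<tau> z (x + r *\<^sub>R z)) (at r)"
proof -
  define B where "B = (\<bar>r\<bar> + 1) * norm z"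
  obtain C where C: "0 <= C" "\<And>j y v. j <= 4 ==> norm v <= B ==> \<bar>hkd j \<tau> z (y - v)\<bar> <= C * (kw 4 y * exp (- (1 / (8 * \<tau>)) * (norm y)\<^sup>2))"
    by (rule hkd_shift_bound[OF t]) (rule that; assumption)
  \<comment> \<open>Translating the integration variable moves the parameter from the continuous
    function to the smooth kernel.\<close>
  have e: "nj k i f \<tau> z (x + u *\<^sub>R z) = (LBINT y. ev k f (x + y) * hkd i \<tau> z (y - u *\<^sub>R z))" for i u
    unfolding nj_def
    by (subst integral_shift[of "\<lambda>y. ev k f (x + y) * hkd i \<tau> z (y - u *\<^sub>R z)" "u *\<^sub>R z", symmetric]) (auto simp: ac_simps)
  have nB: "norm (u *\<^sub>R z) <= B" if "r - 1 < u" "u < r + 1" for u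
    unfolding B_def norm_scaleR using that by (intro mult_right_mono) auto
  have bd: "\<bar>ev k f (x + y) * hkd i \<tau> z (y - u *\<^sub>R z)\<bar> <= (norm f * wt k x * C) * (kw k y * (kw 4 y * exp (- (1 / (8 * \<tau>)) * (norm y)\<^sup>2)))"
    if "i <= 4" "r - 1 < u" "u < r + 1" for i u y
  proof -
    have "\<bar>ev k f (x + y)\<bar> * \<bar>hkd i \<tau> z (y - u *\<^sub>R z)\<bar> <= (norm f * wt k x * kw k y) * (C * (kw 4 y * exp (- (1 / (8 * \<tau>)) * (norm y)\<^sup>2)))"
      by (intro mult_mono ev_shift_bound k C(2) that nB) auto
    then show ?thesis by (simp add: abs_mult ac_simps)
  qed
  have gi: "integrable lborel (\<lambda>y. (norm f * wt k x * C) * (kw k y * (kw 4 y * exp (- (1 / (8 * \<tau>)) * (norm y)\<^sup>2))))"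
    by (intro integrable_mult_right integrable_gauss_weight k t)
  show ?thesis unfolding e
  proof (rule has_real_derivative_integral[of "r - 1" "r + 1"])
    fix u y assume u: "r - 1 < u" "u < r + 1"
    show "((\<lambda>r. ev k f (x + y) * hkd j \<tau> z (y - r *\<^sub>R z)) has_real_derivative ev k f (x + y) * hkd (Suc j) \<tau> z (y - u *\<^sub>R z)) (at u)"
      by (intro DERIV_cmult hkd_has_derivative t j)
    show "\<bar>ev k f (x + y) * hkd (Suc j) \<tau> z (y - u *\<^sub>R z)\<bar> <= (norm f * wt k x * C) * (kw k y * (kw 4 y * exp (- (1 / (8 * \<tau>)) * (norm y)\<^sup>2)))"
      using j u by (intro bd) auto
    show "integrable lborel (\<lambda>y. ev k f (x + y) * hkd j \<tau> z (y - u *\<^sub>R z))"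
      by (rule Bochner_Integration.integrable_bound[OF gi])
         (use bd[of j u] j u in \<open>auto intro!: AE_I2 order.trans[OF _ abs_ge_self]\<close>)
    show "(\<lambda>y. ev k f (x + y) * hkd (Suc j) \<tau> z (y - u *\<^sub>R z)) \<in> borel_measurable lborel" by measurable
  qed (use gi in auto)
qed

lemma nj_bound:
  fixes f :: "(real ^ 'n) \<Rightarrow>\<^sub>C real"
  assumes t: "0 < \<tau>" and j: "j <= 4" and a: "0 <= a" and A: "0 <= A"
    and b: "\<And>y. \<bar>ev k f (x + y)\<bar> <= A * kw a (y /\<^sub>R sqrt \<tau>)"
  shows "\<bar>nj k j f \<tau> z x\<bar> <= A * (10 * (norm z / sqrt \<tau>) ^ j * hkM TYPE('n) (a + 4))"
proof -
  have bd: "\<bar>ev k f (x + y) * hkd j \<tau> z y\<bar> <= (A * (10 * (norm z / sqrt \<tau>) ^ j)) * (kw (a + 4) (y /\<^sub>R sqrt \<tau>) * Hk \<tau> y)" for y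
  proof -
    have "\<bar>ev k f (x + y)\<bar> * \<bar>hkd j \<tau> z y\<bar> <= (A * kw a (y /\<^sub>R sqrt \<tau>)) * (10 * (norm z / sqrt \<tau>) ^ j * (kw 4 (y /\<^sub>R sqrt \<tau>) * Hk \<tau> y))"
      using A by (intro mult_mono b hkd_bound t j) auto
    also have "... = (A * (10 * (norm z / sqrt \<tau>) ^ j)) * ((kw a (y /\<^sub>R sqrt \<tau>) * kw 4 (y /\<^sub>R sqrt \<tau>)) * Hk \<tau> y)"
      by (simp only: ac_simps)
    finally show ?thesis by (simp only: abs_mult kw_mult)
  qed
  have a4: "0 <= a + 4" using a by simp
  have gi: "integrable lborel (\<lambda>y :: real ^ 'n. (A * (10 * (norm z / sqrt \<tau>) ^ j)) * (kw (a + 4) (y /\<^sub>R sqrt \<tau>) * Hk \<tau> y))"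
    by (intro integrable_mult_right kw_heat_kernel t a4)
  have fi: "integrable lborel (\<lambda>y. ev k f (x + y) * hkd j \<tau> z y)"
    by (rule Bochner_Integration.integrable_bound[OF gi]) (use bd in \<open>auto intro!: AE_I2 order.trans[OF _ abs_ge_self]\<close>)
  have "\<bar>nj k j f \<tau> z x\<bar> <= (LBINT y. \<bar>ev k f (x + y) * hkd j \<tau> z y\<bar>)"
    unfolding nj_def by (rule integral_abs_bound)
  also have "... <= (LBINT y. (A * (10 * (norm z / sqrt \<tau>) ^ j)) * (kw (a + 4) (y /\<^sub>R sqrt \<tau>) * Hk \<tau> (y :: real ^ 'n)))"
    by (rule integral_mono[OF integrable_abs[OF fi] gi bd])
  also have "... = (A * (10 * (norm z / sqrt \<tau>) ^ j)) * hkM TYPE('n) (a + 4)"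
    by (simp only: integral_mult_right_zero kw_heat_kernel(2)[OF a4 t])
  finally show ?thesis by (simp add: mult.assoc)
qed

subsection \<open>The heat equation\<close>

text \<open>The derivative of \<open>Hk \<tau>\<close> in \<open>\<tau>\<close>, which is also its Laplacian.\<close>

definition dHk :: "real => real ^ 'n => real" where
  "dHk \<tau> y = ((norm y)\<^sup>2 / (4 * \<tau>\<^sup>2) - real CARD('n) / (2 * \<tau>)) * Hk \<tau> y"

lemma dHk_measurable [measurable]: "dHk \<tau> \<in> borel_measurable borel"
  unfolding dHk_def[abs_def] by measurable

lemma heat_kernel_tau_derivative:
  fixes y :: "real ^ 'n"
  assumes t: "0 < \<tau>"
  shows "((\<lambda>\<tau>. Hk \<tau> y) has_real_derivative dHk \<tau> y) (at \<tau>)"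
    and "((\<lambda>\<tau>. dHk \<tau> y) has_real_derivative
      (((norm y)\<^sup>2 / (4 * \<tau>\<^sup>2) - real CARD('n) / (2 * \<tau>))\<^sup>2 + (real CARD('n) / (2 * \<tau>\<^sup>2) - (norm y)\<^sup>2 / (2 * \<tau> ^ 3))) * Hk \<tau> y) (at \<tau>)"
proof -
  define d where "d = real CARD('n)"
  define m where "m = (norm y)\<^sup>2"
  have 1: "((\<lambda>\<tau>. (4 * pi * \<tau>) powr (- d / 2)) has_real_derivative (- d / 2) * (4 * pi * \<tau>) powr (- d / 2 - 1) * (4 * pi)) (at \<tau>)"
    using t by (intro DERIV_fun_powr[THEN DERIV_cong]) (auto intro!: derivative_eq_intros)
  have p: "(4 * pi * \<tau>) powr (- d / 2 - 1) = (4 * pi * \<tau>) powr (- d / 2) / (4 * pi * \<tau>)"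
    using t by (simp add: powr_diff)
  have 2: "((\<lambda>\<tau>. exp (- m / (4 * \<tau>))) has_real_derivative exp (- m / (4 * \<tau>)) * (m / (4 * \<tau>\<^sup>2))) (at \<tau>)"
    using t by (intro DERIV_fun_exp) (auto intro!: derivative_eq_intros simp: field_simps power2_eq_square)
  have 3: "((\<lambda>\<tau>. (4 * pi * \<tau>) powr (- d / 2) * exp (- m / (4 * \<tau>))) has_real_derivative
     ((- d / 2) * (4 * pi * \<tau>) powr (- d / 2 - 1) * (4 * pi)) * exp (- m / (4 * \<tau>)) + (exp (- m / (4 * \<tau>)) * (m / (4 * \<tau>\<^sup>2))) * (4 * pi * \<tau>) powr (- d / 2)) (at \<tau>)"
    by (intro DERIV_mult 1 2)
  have 4: "((- d / 2) * (4 * pi * \<tau>) powr (- d / 2 - 1) * (4 * pi)) * exp (- m / (4 * \<tau>)) + (exp (- m / (4 * \<tau>)) * (m / (4 * \<tau>\<^sup>2))) * (4 * pi * \<tau>) powr (- d / 2) = dHk \<tau> y"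
    unfolding p dHk_def heat_kernel_def m_def[symmetric] d_def[symmetric] using t by (simp add: field_simps)
  show D: "((\<lambda>\<tau>. Hk \<tau> y) has_real_derivative dHk \<tau> y) (at \<tau>)"
    using 3 unfolding 4 by (simp add: heat_kernel_def m_def d_def)
  have 5: "((\<lambda>\<tau>. m / (4 * \<tau>\<^sup>2) - d / (2 * \<tau>)) has_real_derivative (d / (2 * \<tau>\<^sup>2) - m / (2 * \<tau> ^ 3))) (at \<tau>)"
    using t by (auto intro!: derivative_eq_intros simp: field_simps power2_eq_square power3_eq_cube)
  have "((\<lambda>\<tau>. (m / (4 * \<tau>\<^sup>2) - d / (2 * \<tau>)) * Hk \<tau> y) has_real_derivative
     (d / (2 * \<tau>\<^sup>2) - m / (2 * \<tau> ^ 3)) * Hk \<tau> y + dHk \<tau> y * (m / (4 * \<tau>\<^sup>2) - d / (2 * \<tau>))) (at \<tau>)"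
    by (intro DERIV_mult 5 D)
  moreover have "(d / (2 * \<tau>\<^sup>2) - m / (2 * \<tau> ^ 3)) * Hk \<tau> y + dHk \<tau> y * (m / (4 * \<tau>\<^sup>2) - d / (2 * \<tau>))
     = ((m / (4 * \<tau>\<^sup>2) - d / (2 * \<tau>))\<^sup>2 + (d / (2 * \<tau>\<^sup>2) - m / (2 * \<tau> ^ 3))) * Hk \<tau> y"
  proof -
    have "w * H + (u * H) * u = (u\<^sup>2 + w) * H" for u w H :: real
      by (simp add: power2_eq_square algebra_simps)
    then show ?thesis unfolding dHk_def m_def[symmetric] d_def[symmetric] .
  qed
  ultimately show "((\<lambda>\<tau>. dHk \<tau> y) has_real_derivative
      (((norm y)\<^sup>2 / (4 * \<tau>\<^sup>2) - real CARD('n) / (2 * \<tau>))\<^sup>2 + (real CARD('n) / (2 * \<tau>\<^sup>2) - (norm y)\<^sup>2 / (2 * \<tau> ^ 3))) * Hk \<tau> y) (at \<tau>)"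
    unfolding dHk_def m_def[symmetric] d_def[symmetric] by simp
qed

text \<open>A quadratic remainder with an integrable majorant, uniform over nearby times, turns the
  pointwise derivative in \<tau> into one in the kernel norm and thus in operator norm.\<close>

lemma heat_kernel_tau_bounds:
  assumes t: "0 < \<tau>"
  obtains C where "0 <= C"
    "\<And>(y :: real ^ 'n) \<tau>'. \<bar>\<tau>' - \<tau>\<bar> < \<tau> / 2 ==> \<bar>Hk \<tau>' y - Hk \<tau> y - (\<tau>' - \<tau>) * dHk \<tau> y\<bar> <= C * (kw 4 y * exp (- (1 / (8 * \<tau>)) * (norm y)\<^sup>2)) * (\<tau>' - \<tau>)\<^sup>2"
    "\<And>y :: real ^ 'n. \<bar>dHk \<tau> y\<bar> <= C * (kw 4 y * exp (- (1 / (8 * \<tau>)) * (norm y)\<^sup>2))"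
proof -
  \<comment> \<open>Nearby times lie between h and 2 \<tau>. The prefactor of the kernel is largest
    at h and the exponential at 2 \<tau>, whence the exponent 1/(8 \<tau>).\<close>
  define h where "h = \<tau> / 2"
  have h: "0 < h" using t by (simp add: h_def)
  define d where "d = real CARD('n)"
  have d0: "0 <= d" by (simp add: d_def)
  define P where "P = (4 * pi * h) powr (- d / 2)"
  define A where "A = 1 / (4 * h\<^sup>2) + d / (2 * h)"
  define A2 where "A2 = d / (2 * h\<^sup>2) + 1 / (2 * h ^ 3)"
  have A0: "0 <= A" "0 <= A2" using h d0 by (auto simp: A_def A2_def)
  define C where "C = (A + A\<^sup>2 + A2) * P"
  have P0: "0 <= P" by (simp add: P_def)
  have C0: "0 <= C" using A0 P0 by (simp add: C_def)
  define G where "G y = exp (- (1 / (8 * \<tau>)) * (norm y)\<^sup>2)" for y :: "real ^ 'n"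
  have H: "0 <= Hk u y \<and> Hk u y <= P * G y" if u: "h <= u" "u <= 2 * \<tau>" for u and y :: "real ^ 'n"
  proof -
    have u0: "0 < u" using u h by linarith
    have "(4 * pi * u) powr (- d / 2) <= P" unfolding P_def using u h d0 by (intro powr_mono2') auto
    moreover have "exp (- (norm y)\<^sup>2 / (4 * u)) <= G y"
    proof -
      have "(norm y)\<^sup>2 / (8 * \<tau>) <= (norm y)\<^sup>2 / (4 * u)" using u u0 t by (intro divide_left_mono) auto
      then show ?thesis by (simp add: G_def)
    qed
    ultimately have "Hk u y <= P * G y" unfolding heat_kernel_def d_def[symmetric] using P0 by (intro mult_mono) auto
    then show ?thesis using heat_kernel_nonneg[OF u0] by auto
  qed
  have K4: "kw 4 y = (1 + norm y) ^ 4" for y :: "real ^ 'n"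
    unfolding kw_def using norm_ge_zero[of y] by (subst powr_numeral) linarith+
  have n2: "(norm y)\<^sup>2 <= (1 + norm y)\<^sup>2" "1 <= (1 + norm y)\<^sup>2" "(1 + norm y)\<^sup>2 <= kw 4 y" for y :: "real ^ 'n"
  proof -
    show "(norm y)\<^sup>2 <= (1 + norm y)\<^sup>2" by (intro power_mono) auto
    show "1 <= (1 + norm y)\<^sup>2" by (intro one_le_power) auto
    show "(1 + norm y)\<^sup>2 <= kw 4 y" unfolding K4 by (intro power_increasing) auto
  qed
  have a: "\<bar>(norm y)\<^sup>2 / (4 * u\<^sup>2) - d / (2 * u)\<bar> <= A * (1 + norm y)\<^sup>2" if u: "h <= u" for u and y :: "real ^ 'n"
  proof -
    have "(norm y)\<^sup>2 / (4 * u\<^sup>2) <= (1 + norm y)\<^sup>2 / (4 * h\<^sup>2)" (is "_ <= ?P") using u h n2[of y] by (intro frac_le mult_left_mono power_mono) auto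
    moreover have "d / (2 * u) <= d / (2 * h) * (1 + norm y)\<^sup>2"
    proof -
      have "d / (2 * u) <= d / (2 * h) * 1" using u h d0 by (simp add: frac_le)
      also have "... <= d / (2 * h) * (1 + norm y)\<^sup>2" using n2(2)[of y] d0 h by (intro mult_left_mono) auto
      finally show ?thesis .
    qed
    moreover have "0 <= (norm y)\<^sup>2 / (4 * u\<^sup>2)" "0 <= d / (2 * u)" using u h d0 by auto
    moreover have "A * (1 + norm y)\<^sup>2 = ?P + d / (2 * h) * (1 + norm y)\<^sup>2" by (simp add: A_def distrib_right)
    ultimately show ?thesis by linarith
  qed
  have dH: "\<bar>dHk u y\<bar> <= C * (kw 4 y * G y)" if u: "h <= u" "u <= 2 * \<tau>" for u and y :: "real ^ 'n"
  proof -
    have "\<bar>dHk u y\<bar> <= (A * (1 + norm y)\<^sup>2) * (P * G y)"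
      unfolding dHk_def d_def[symmetric] abs_mult using H[OF u, of y] a[OF u(1), of y] A0 by (intro mult_mono) auto
    also have "... <= (A * kw 4 y) * (P * G y)" using n2[of y] A0 P0 by (intro mult_right_mono mult_left_mono) (auto simp: G_def)
    also have "... = (A * P) * (kw 4 y * G y)" by simp
    also have "... <= C * (kw 4 y * G y)" unfolding C_def using A0 P0 by (intro mult_right_mono) (auto simp: G_def)
    finally show ?thesis .
  qed
  have main: "\<bar>Hk \<tau>' y - Hk \<tau> y - (\<tau>' - \<tau>) * dHk \<tau> y\<bar> <= C * (kw 4 y * G y) * (\<tau>' - \<tau>)\<^sup>2" if t': "\<bar>\<tau>' - \<tau>\<bar> < \<tau> / 2" for \<tau>' and y :: "real ^ 'n"
  proof (rule taylor_bound_2[of \<tau> \<tau>' "\<lambda>\<tau>. Hk \<tau> y" "\<lambda>\<tau>. dHk \<tau> y"])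
    fix u assume "u \<in> closed_segment \<tau> \<tau>'"
    then have u: "h <= u" "u <= 2 * \<tau>" using t' t by (auto simp: closed_segment_eq_real_ivl h_def abs_less_iff split: if_splits)
    have u0: "0 < u" using u h by linarith
    show "((\<lambda>\<tau>. Hk \<tau> y) has_real_derivative dHk u y) (at u)" by (rule heat_kernel_tau_derivative[OF u0])
    show "((\<lambda>\<tau>. dHk \<tau> y) has_real_derivative
      (((norm y)\<^sup>2 / (4 * u\<^sup>2) - real CARD('n) / (2 * u))\<^sup>2 + (real CARD('n) / (2 * u\<^sup>2) - (norm y)\<^sup>2 / (2 * u ^ 3))) * Hk u y) (at u)"
      by (rule heat_kernel_tau_derivative[OF u0])
    have 1: "((norm y)\<^sup>2 / (4 * u\<^sup>2) - d / (2 * u))\<^sup>2 <= A\<^sup>2 * kw 4 y"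
    proof -
      have "((norm y)\<^sup>2 / (4 * u\<^sup>2) - d / (2 * u))\<^sup>2 <= (A * (1 + norm y)\<^sup>2)\<^sup>2"
        using a[OF u(1), of y] by (metis abs_ge_zero power2_abs power_mono)
      also have "... = A\<^sup>2 * kw 4 y" by (simp add: power_mult_distrib K4 flip: power_mult)
      finally show ?thesis .
    qed
    have 2: "\<bar>d / (2 * u\<^sup>2) - (norm y)\<^sup>2 / (2 * u ^ 3)\<bar> <= A2 * kw 4 y"
    proof -
      have "(norm y)\<^sup>2 / (2 * u ^ 3) <= kw 4 y / (2 * h ^ 3)" (is "_ <= ?P") using u h order.trans[OF n2(1,3), of y] by (intro frac_le mult_left_mono power_mono) auto
      moreover have "d / (2 * u\<^sup>2) <= d / (2 * h\<^sup>2) * kw 4 y"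
      proof -
        have "d / (2 * u\<^sup>2) <= d / (2 * h\<^sup>2) * 1" using u h d0 by (simp add: frac_le power_mono)
        also have "... <= d / (2 * h\<^sup>2) * kw 4 y" using order.trans[OF n2(2,3), of y] d0 h by (intro mult_left_mono) auto
        finally show ?thesis .
      qed
      moreover have "0 <= (norm y)\<^sup>2 / (2 * u ^ 3)" "0 <= d / (2 * u\<^sup>2)" using u0 d0 by auto
      moreover have "A2 * kw 4 y = d / (2 * h\<^sup>2) * kw 4 y + ?P" by (simp add: A2_def distrib_right)
      ultimately show ?thesis by linarith
    qed
    have "\<bar>(((norm y)\<^sup>2 / (4 * u\<^sup>2) - d / (2 * u))\<^sup>2 + (d / (2 * u\<^sup>2) - (norm y)\<^sup>2 / (2 * u ^ 3))) * Hk u y\<bar> <= ((A\<^sup>2 + A2) * kw 4 y) * (P * G y)"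
      unfolding abs_mult
    proof (intro mult_mono)
      show "\<bar>((norm y)\<^sup>2 / (4 * u\<^sup>2) - d / (2 * u))\<^sup>2 + (d / (2 * u\<^sup>2) - (norm y)\<^sup>2 / (2 * u ^ 3))\<bar> <= (A\<^sup>2 + A2) * kw 4 y"
        using 1 2 zero_le_power2[of "(norm y)\<^sup>2 / (4 * u\<^sup>2) - d / (2 * u)"] unfolding distrib_right by linarith
    qed (use H[OF u, of y] A0 in auto)
    also have "... = ((A\<^sup>2 + A2) * P) * (kw 4 y * G y)" by simp
    also have "... <= C * (kw 4 y * G y)" unfolding C_def using A0 P0 by (intro mult_right_mono) (auto simp: G_def)
    finally show "\<bar>(((norm y)\<^sup>2 / (4 * u\<^sup>2) - real CARD('n) / (2 * u))\<^sup>2 + (real CARD('n) / (2 * u\<^sup>2) - (norm y)\<^sup>2 / (2 * u ^ 3))) * Hk u y\<bar> <= C * (kw 4 y * G y)"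
      by (simp only: d_def)
  qed
  show ?thesis
    by (rule that[OF C0]) (use main dH[of \<tau>] t in \<open>auto simp: G_def h_def\<close>)
qed

lemma wkernel_dHk: "0 <= k ==> 0 < \<tau> ==> wkernel k (dHk \<tau> :: real ^ 'n => real)"
  by (rule heat_kernel_tau_bounds[of \<tau>, where 'n='n], assumption)
     (rule wkernel_gauss_bound; assumption?; simp)

lemma heat_operator_derivative:
  assumes k: "0 <= k" and t: "0 < \<tau>"
  shows "((\<lambda>\<tau>. cop k (Hk \<tau>) :: 'n::finite bop) has_vector_derivative cop k (dHk \<tau>)) (at \<tau>)"
proof -
  obtain C where C: "0 <= C"
    "\<And>(y :: real ^ 'n) \<tau>'. \<bar>\<tau>' - \<tau>\<bar> < \<tau> / 2 ==> \<bar>Hk \<tau>' y - Hk \<tau> y - (\<tau>' - \<tau>) * dHk \<tau> y\<bar> <= C * (kw 4 y * exp (- (1 / (8 * \<tau>)) * (norm y)\<^sup>2)) * (\<tau>' - \<tau>)\<^sup>2"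
    "\<And>y :: real ^ 'n. \<bar>dHk \<tau> y\<bar> <= C * (kw 4 y * exp (- (1 / (8 * \<tau>)) * (norm y)\<^sup>2))"
    by (rule heat_kernel_tau_bounds[OF t, where 'n='n]) (rule that; assumption)
  define M where "M = (LBINT y. C * (kw k y * (kw 4 y * exp (- (1 / (8 * \<tau>)) * (norm (y :: real ^ 'n))\<^sup>2))))"
  show ?thesis
  proof (rule has_vector_derivative_quadratic[where d="\<tau> / 2" and C=M])
    fix \<tau>' assume t': "\<bar>\<tau>' - \<tau>\<bar> < \<tau> / 2"
    have tp: "0 < \<tau>'" using t' t by linarith
    have w: "wkernel k (\<lambda>y :: real ^ 'n. Hk \<tau>' y - Hk \<tau> y - (\<tau>' - \<tau>) * dHk \<tau> y)"
      by (intro wkernel_diff wkernel_heat wkernel_scale wkernel_dHk k t tp)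
    have e: "cop k (Hk \<tau>') - cop k (Hk \<tau>) - (\<tau>' - \<tau>) *\<^sub>R cop k (dHk \<tau>) = (cop k (\<lambda>y. Hk \<tau>' y - Hk \<tau> y - (\<tau>' - \<tau>) * dHk \<tau> y) :: 'n bop)"
    proof -
      have a: "wkernel k (Hk \<tau>' :: real ^ 'n => real)" "wkernel k (Hk \<tau> :: real ^ 'n => real)" "wkernel k (dHk \<tau> :: real ^ 'n => real)"
        by (intro wkernel_heat wkernel_dHk k t tp)+
      show ?thesis
        unfolding cop_diff[OF k wkernel_diff[OF a(1,2)] wkernel_scale[OF a(3)]] cop_diff[OF k a(1,2)] cop_scale[OF k a(3)] ..
    qed
    have "kn k (\<lambda>y :: real ^ 'n. Hk \<tau>' y - Hk \<tau> y - (\<tau>' - \<tau>) * dHk \<tau> y) <= (LBINT y. (\<tau>' - \<tau>)\<^sup>2 * (C * (kw k y * (kw 4 y * exp (- (1 / (8 * \<tau>)) * (norm (y :: real ^ 'n))\<^sup>2)))))"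
      unfolding kn_def
    proof (rule integral_mono)
      show "integrable lborel (\<lambda>y :: real ^ 'n. kw k y * \<bar>Hk \<tau>' y - Hk \<tau> y - (\<tau>' - \<tau>) * dHk \<tau> y\<bar>)" using w by (simp add: wkernel_def)
      show "integrable lborel (\<lambda>y :: real ^ 'n. (\<tau>' - \<tau>)\<^sup>2 * (C * (kw k y * (kw 4 y * exp (- (1 / (8 * \<tau>)) * (norm y)\<^sup>2)))))"
        by (intro integrable_mult_right integrable_gauss_weight k t)
      fix y :: "real ^ 'n"
      show "kw k y * \<bar>Hk \<tau>' y - Hk \<tau> y - (\<tau>' - \<tau>) * dHk \<tau> y\<bar> <= (\<tau>' - \<tau>)\<^sup>2 * (C * (kw k y * (kw 4 y * exp (- (1 / (8 * \<tau>)) * (norm y)\<^sup>2))))"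
        using mult_left_mono[OF C(2)[OF t', of y], of "kw k y"] by (simp add: ac_simps)
    qed
    also have "... = M * (\<tau>' - \<tau>)\<^sup>2" unfolding M_def by (simp only: integral_mult_right_zero mult.commute)
    finally show "norm ((cop k (Hk \<tau>') :: 'n bop) - cop k (Hk \<tau>) - (\<tau>' - \<tau>) *\<^sub>R cop k (dHk \<tau>)) <= M * (\<tau>' - \<tau>)\<^sup>2"
      unfolding e using ev_cop(2)[OF k w] by linarith
  qed (use t in auto)
qed

subsection \<open>Fourth-order consistency\<close>

definition fdiff :: "real => (real => real) => real => real" where
  "fdiff r g \<rho> = g (\<rho> + r) - g \<rho>"

text \<open>Induction over the family of first differences, with the mean value theorem in each
  step. It allows a derivative to be bounded by differences, which can be moved between factors by
  translation alone.\<close>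

lemma fdiff_mean_value:
  fixes G :: "nat => real => real"
  assumes r: "0 < r" and "\<And>j \<rho>. j < n ==> (G j has_real_derivative G (Suc j) \<rho>) (at \<rho>)"
  shows "\<exists>\<xi>. \<rho> <= \<xi> \<and> \<xi> <= \<rho> + real n * r \<and> (fdiff r ^^ n) (G 0) \<rho> = r ^ n * G n \<xi>"
  using assms(2)
proof (induction n arbitrary: G)
  case (Suc n)
  have "\<exists>\<xi>. \<rho> <= \<xi> \<and> \<xi> <= \<rho> + real n * r \<and> (fdiff r ^^ n) (fdiff r (G 0)) \<rho> = r ^ n * fdiff r (G n) \<xi>"
    by (rule Suc.IH[of "\<lambda>j. fdiff r (G j)"])
       (auto simp: fdiff_def[abs_def] intro!: DERIV_diff Suc.prems DERIV_shift[THEN iffD1])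
  then obtain \<xi> where xi: "\<rho> <= \<xi>" "\<xi> <= \<rho> + real n * r" "(fdiff r ^^ n) (fdiff r (G 0)) \<rho> = r ^ n * fdiff r (G n) \<xi>" by blast
  obtain \<xi>' where "\<xi> < \<xi>'" "\<xi>' < \<xi> + r" "G n (\<xi> + r) - G n \<xi> = (\<xi> + r - \<xi>) * G (Suc n) \<xi>'"
    using MVT2[of \<xi> "\<xi> + r" "G n" "G (Suc n)"] r Suc.prems[of n] by auto
  moreover have "(fdiff r ^^ Suc n) (G 0) \<rho> = (fdiff r ^^ n) (fdiff r (G 0)) \<rho>"
    by (simp add: funpow_swap1)
  ultimately have "(fdiff r ^^ Suc n) (G 0) \<rho> = r ^ Suc n * G (Suc n) \<xi>'"
    unfolding xi(3) by (simp add: fdiff_def)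
  then show ?case
    using xi \<open>\<xi> < \<xi>'\<close> \<open>\<xi>' < \<xi> + r\<close> by (intro exI[of _ \<xi>']) (auto simp: algebra_simps)
qed auto

lemma fdiff_4: "(fdiff r ^^ 4) g \<rho> = g (\<rho> + 4 * r) - 4 * g (\<rho> + 3 * r) + 6 * g (\<rho> + 2 * r) - 4 * g (\<rho> + r) + g \<rho>"
  by (simp add: eval_nat_numeral fdiff_def add.assoc algebra_simps)

lemma norm_power_le_kw: "j <= 4 ==> norm z ^ j <= kw 4 z"
proof -
  assume j: "j <= 4"
  have "norm z ^ j <= (1 + norm z) ^ j" by (intro power_mono) auto
  also have "... <= (1 + norm z) ^ 4" using j by (intro power_increasing) auto
  also have "... = kw 4 z" unfolding kw_def using norm_ge_zero[of z] by (subst powr_numeral) linarith+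
  finally show ?thesis .
qed

lemma nj_0: "nj k 0 f \<tau> z = nj k 0 f \<tau> z'"
  by (rule ext) (simp add: nj_def hkd_0)

lemma nj_eq_ev: "0 <= k ==> 0 < \<tau> ==> j <= 4 ==> nj k j f \<tau> z x = ev k (blf (cop k (hkd j \<tau> z)) f) x"
  by (simp add: nj_def ev_cop wkernel_hkd)

lemma nj_wt_bound:
  fixes f :: "(real ^ 'n) \<Rightarrow>\<^sub>C real"
  assumes k: "0 <= k" and t: "0 < \<tau>" and j: "j <= 4"
  shows "\<bar>nj k j f \<tau> z x\<bar> <= (norm f * (max 1 (sqrt \<tau>) powr k * (10 * (1 / sqrt \<tau>) ^ j * hkM TYPE('n) (k + 4)))) * (norm z ^ j * wt k x)"
proof -
  have "\<bar>nj k j f \<tau> z x\<bar> <= (norm f * wt k x * max 1 (sqrt \<tau>) powr k) * (10 * (norm z / sqrt \<tau>) ^ j * hkM TYPE('n) (k + 4))"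
  proof (rule nj_bound[OF t j k])
    fix y :: "real ^ 'n"
    have "\<bar>ev k f (x + y)\<bar> <= norm f * wt k x * kw k y" by (rule ev_shift_bound[OF k])
    also have "kw k y <= max 1 (sqrt \<tau>) powr k * kw k (y /\<^sub>R sqrt \<tau>)"
      using kw_scale_le[OF k, of "sqrt \<tau>" "y /\<^sub>R sqrt \<tau>"] t by simp
    finally show "\<bar>ev k f (x + y)\<bar> <= norm f * wt k x * max 1 (sqrt \<tau>) powr k * kw k (y /\<^sub>R sqrt \<tau>)"
      by (simp add: mult_left_mono mult.assoc)
  qed simp
  also have "... = (norm f * (max 1 (sqrt \<tau>) powr k * (10 * (1 / sqrt \<tau>) ^ j * hkM TYPE('n) (k + 4)))) * (norm z ^ j * wt k x)"
    by (simp add: power_divide ac_simps)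
  finally show ?thesis .
qed

context jump_kernel
begin

lemma J_integrable_power:
  assumes a: "a <= k + 1" and j: "j <= 4"
  shows "integrable lborel (\<lambda>z. norm z ^ j * kw a z * J z)"
proof (rule J_integrable[where C=1])
  fix z :: "real ^ 'n"
  have "norm z ^ j * kw a z <= kw 4 z * kw a z" by (intro mult_right_mono norm_power_le_kw j) auto
  also have "... <= kw (k + 5) z" unfolding kw_mult using a by (intro kw_mono) auto
  finally show "\<bar>norm z ^ j * kw a z\<bar> <= 1 * kw (k + 5) z" by simp
qed measurable

definition MJ :: "real => real" where "MJ a = (LBINT z. norm z ^ 4 * kw a z * J z)"

lemma MJ_nonneg: "0 <= MJ a"
  unfolding MJ_def by (intro integral_nonneg_AE) (auto simp: J0)

text \<open>Taylor's formula on [0, 1] for the J-average as a function of the jump length. Orders 1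
  and 3 vanish, order 2 is the heat generator. The bounds \<open>D\<close> only justify
  differentiation under the integral; the estimate sees \<open>E\<close> alone. It is applied to
  pointwise values with \<open>nj\<close> and to averages over the datum with
  \<open>ch\<close>.\<close>

lemma taylor_J:
  fixes chi :: "nat => real ^ 'n => real => real"
  assumes s: "0 < \<sigma>"
    and d: "\<And>j z \<rho>. j < 4 ==> (chi j z has_real_derivative chi (Suc j) z \<rho>) (at \<rho>)"
    and m: "\<And>j \<rho>. j <= 4 ==> (\<lambda>z. chi j z \<rho>) \<in> borel_measurable borel"
    and b: "\<And>j z \<rho>. j <= 4 ==> \<bar>chi j z \<rho>\<bar> <= D j * (norm z ^ j * kw k (\<rho> *\<^sub>R z))" and D: "\<And>j. 0 <= D j"
    and z1: "(LBINT z. chi 1 z 0 * J z) = 0" and z2: "(LBINT z. chi 2 z 0 * J z) = 2 * \<Delta>"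
    and z3: "(LBINT z. chi 3 z 0 * J z) = 0"
    and top: "\<And>z \<rho>. 0 <= \<rho> ==> \<rho> <= \<sigma> ==> \<bar>chi 4 z \<rho>\<bar> <= E * (norm z ^ 4 * kw a z)" and a: "a <= k + 1"
  shows "\<bar>(LBINT z. chi 0 z \<sigma> * J z) - (LBINT z. chi 0 z 0 * J z) - \<sigma>\<^sup>2 * \<Delta>\<bar> <= \<sigma> ^ 4 * (E * MJ a) / 24"
proof -
  define F where "F j \<theta> = \<sigma> ^ j * (LBINT z. chi j z (\<theta> * \<sigma>) * J z)" for j \<theta>
  define L where "L = max 1 (2 * \<sigma>) powr k"
  \<comment> \<open>The majorant holds on an open interval around [0, 1], since two-sided
    derivatives are needed at both ends.\<close>
  have bd: "\<bar>chi j z (\<theta> * \<sigma>) * J z\<bar> <= (D j * L) * (norm z ^ j * kw k z * J z)" if "j <= 4" "- 1 < \<theta>" "\<theta> < 2" for j z \<theta>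
  proof -
    have "kw k ((\<theta> * \<sigma>) *\<^sub>R z) <= kw k ((2 * \<sigma>) *\<^sub>R z)"
      using that s by (intro kw_norm_mono k0) (auto simp: abs_mult intro!: mult_right_mono)
    also have "... <= L * kw k z" unfolding L_def using s by (intro kw_scale_le k0) auto
    finally have "D j * (norm z ^ j * kw k ((\<theta> * \<sigma>) *\<^sub>R z)) <= D j * (norm z ^ j * (L * kw k z))"
      by (intro mult_left_mono D) auto
    then have "\<bar>chi j z (\<theta> * \<sigma>)\<bar> * J z <= D j * (norm z ^ j * (L * kw k z)) * J z"
      using b[OF that(1), of z "\<theta> * \<sigma>"] J0[of z] by (intro mult_right_mono) auto
    then show ?thesis using J0[of z] by (simp add: abs_mult ac_simps)
  qed
  have gi: "integrable lborel (\<lambda>z. C * (norm z ^ j * kw k z * J z))" if "j <= 4" for j C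
    using that by (intro integrable_mult_right J_integrable_power) auto
  have mm: "(\<lambda>z. chi j z \<rho> * J z) \<in> borel_measurable lborel" if "j <= 4" for j \<rho>
    using m[OF that, of \<rho>] by simp
  have fi: "integrable lborel (\<lambda>z. chi j z (\<theta> * \<sigma>) * J z)" if "j <= 4" "- 1 < \<theta>" "\<theta> < 2" for j \<theta>
    by (rule Bochner_Integration.integrable_bound[OF gi[OF that(1)] mm[OF that(1)]])
       (use bd[OF that] in \<open>auto intro!: AE_I2 order.trans[OF _ abs_ge_self]\<close>)
  have dF: "(F j has_real_derivative F (Suc j) \<theta>) (at \<theta>)" if j: "j < 4" and th: "0 <= \<theta>" "\<theta> <= 1" for j \<theta>
  proof -
    have "((\<lambda>r. (LBINT z. chi j z (r * \<sigma>) * J z)) has_real_derivative (LBINT z. \<sigma> * (chi (Suc j) z (\<theta> * \<sigma>) * J z))) (at \<theta>)"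
    proof (rule has_real_derivative_integral[of "-1" 2])
      fix r z assume r: "- 1 < r" "r < (2::real)"
      have "((\<lambda>r. chi j z (r * \<sigma>)) has_real_derivative chi (Suc j) z (r * \<sigma>) * \<sigma>) (at r)"
        by (rule DERIV_chain2[where f="chi j z" and g="\<lambda>r. r * \<sigma>", OF d[OF j]]) (auto intro!: derivative_eq_intros)
      then show "((\<lambda>r. chi j z (r * \<sigma>) * J z) has_real_derivative \<sigma> * (chi (Suc j) z (r * \<sigma>) * J z)) (at r)"
        by (rule DERIV_cmult_right[THEN DERIV_cong]) simp
      show "\<bar>\<sigma> * (chi (Suc j) z (r * \<sigma>) * J z)\<bar> <= (\<sigma> * (D (Suc j) * L)) * (norm z ^ Suc j * kw k z * J z)"
        using mult_left_mono[OF bd[OF _ r, of "Suc j" z], of \<sigma>] j s by (simp add: abs_mult mult.assoc)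
      show "integrable lborel (\<lambda>z. chi j z (r * \<sigma>) * J z)" using j r by (intro fi) auto
      show "(\<lambda>z. \<sigma> * (chi (Suc j) z (r * \<sigma>) * J z)) \<in> borel_measurable lborel"
        using mm[of "Suc j" "r * \<sigma>"] j by auto
    next
      show "integrable lborel (\<lambda>z. (\<sigma> * (D (Suc j) * L)) * (norm z ^ Suc j * kw k z * J z))" using j by (intro gi) auto
    qed (use th in auto)
    then have "((\<lambda>r. \<sigma> ^ j * (LBINT z. chi j z (r * \<sigma>) * J z)) has_real_derivative \<sigma> ^ j * (LBINT z. \<sigma> * (chi (Suc j) z (\<theta> * \<sigma>) * J z))) (at \<theta>)"
      by (rule DERIV_cmult)
    then show ?thesis unfolding F_def by (simp add: mult.left_commute mult.assoc)
  qed
  obtain u where u: "0 < u" "u < 1" "F 0 1 = F 0 0 + F 1 0 + F 2 0 / 2 + F 3 0 / 6 + F 4 u / 24"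
    by (rule taylor_unit_4[of F]) (use dF in auto)
  have "F 1 0 = 0" "F 2 0 = \<sigma>\<^sup>2 * (2 * \<Delta>)" "F 3 0 = 0"
    using z1 z2 z3 by (simp_all add: F_def)
  then have e: "(LBINT z. chi 0 z \<sigma> * J z) - (LBINT z. chi 0 z 0 * J z) - \<sigma>\<^sup>2 * \<Delta> = F 4 u / 24"
  proof -
    have "F 0 1 = (LBINT z. chi 0 z \<sigma> * J z)" "F 0 0 = (LBINT z. chi 0 z 0 * J z)" by (simp_all add: F_def)
    then show ?thesis using u(3) \<open>F 1 0 = 0\<close> \<open>F 2 0 = \<sigma>\<^sup>2 * (2 * \<Delta>)\<close> \<open>F 3 0 = 0\<close> by simp
  qed
  have "\<bar>LBINT z. chi 4 z (u * \<sigma>) * J z\<bar> <= (LBINT z. \<bar>chi 4 z (u * \<sigma>) * J z\<bar>)" by (rule integral_abs_bound)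
  also have "... <= (LBINT z. E * (norm z ^ 4 * kw a z * J z))"
  proof (rule integral_mono)
    show "integrable lborel (\<lambda>z. \<bar>chi 4 z (u * \<sigma>) * J z\<bar>)" using u by (intro integrable_abs fi) auto
    show "integrable lborel (\<lambda>z. E * (norm z ^ 4 * kw a z * J z))" by (intro integrable_mult_right J_integrable_power a) simp
    fix z
    have "\<bar>chi 4 z (u * \<sigma>)\<bar> * J z <= E * (norm z ^ 4 * kw a z) * J z"
      using u s J0[of z] by (intro mult_right_mono top) auto
    then show "\<bar>chi 4 z (u * \<sigma>) * J z\<bar> <= E * (norm z ^ 4 * kw a z * J z)" using J0[of z] by (simp add: abs_mult mult.assoc)
  qed
  also have "... = E * MJ a" unfolding MJ_def by (rule integral_mult_right_zero)
  finally have "\<sigma> ^ 4 * \<bar>LBINT z. chi 4 z (u * \<sigma>) * J z\<bar> <= \<sigma> ^ 4 * (E * MJ a)" using s by (intro mult_left_mono) auto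
  then have "\<bar>F 4 u\<bar> <= \<sigma> ^ 4 * (E * MJ a)" unfolding F_def abs_mult using s by simp
  then show ?thesis unfolding e by simp
qed

lemma J_coord_integrable:
  "integrable lborel (\<lambda>z. z $ i * J z)" "integrable lborel (\<lambda>z. z $ i * z $ j * J z)"
  "integrable lborel (\<lambda>z. z $ i * z $ j * z $ l * J z)"
proof -
  have c: "\<bar>z $ i\<bar> <= norm z" for z :: "real ^ 'n" and i by (rule component_le_norm_cart)
  have k4: "kw 4 z <= kw (k + 5) z" for z :: "real ^ 'n" using k0 by (intro kw_mono) auto
  show "integrable lborel (\<lambda>z. z $ i * J z)"
  proof (rule J_integrable[where C=1])
    fix z :: "real ^ 'n"
    show "\<bar>z $ i\<bar> <= 1 * kw (k + 5) z" using c[of z i] norm_power_le_kw[of 1 z] k4[of z] by simp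
  qed measurable
  show "integrable lborel (\<lambda>z. z $ i * z $ j * J z)"
  proof (rule J_integrable[where C=1])
    fix z :: "real ^ 'n"
    have "\<bar>z $ i * z $ j\<bar> <= norm z * norm z" unfolding abs_mult by (intro mult_mono c) auto
    then show "\<bar>z $ i * z $ j\<bar> <= 1 * kw (k + 5) z" using norm_power_le_kw[of 2 z] k4[of z] by (simp add: power2_eq_square)
  qed measurable
  show "integrable lborel (\<lambda>z. z $ i * z $ j * z $ l * J z)"
  proof (rule J_integrable[where C=1])
    fix z :: "real ^ 'n"
    have "\<bar>z $ i * z $ j * z $ l\<bar> <= norm z * norm z * norm z" unfolding abs_mult by (intro mult_mono c) auto
    then show "\<bar>z $ i * z $ j * z $ l\<bar> <= 1 * kw (k + 5) z" using norm_power_le_kw[of 3 z] k4[of z] by (simp add: power3_eq_cube)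
  qed measurable
qed

text \<open>As a function of z, \<open>hkd j\<close> is a homogeneous polynomial of degree j, so the
  moment conditions apply to it coefficientwise. At order two the covariance 2 \<delta>_ij produces
  twice the Laplacian of the kernel.\<close>

lemma J_hkd:
  "(LBINT z. hkd 1 \<tau> z y * J z) = 0"
  "0 < \<tau> ==> (LBINT z. hkd 2 \<tau> z y * J z) = 2 * dHk \<tau> y"
  "(LBINT z. hkd 3 \<tau> z y * J z) = 0"
proof -
  have "(\<lambda>z. hkd 1 \<tau> z y * J z) = (\<lambda>z. Hk \<tau> y / (2 * \<tau>) * (\<Sum>i\<in>UNIV. y $ i * (z $ i * J z)))"
    by (rule ext) (simp add: hkd.simps Let_def inner_vec_def sum_distrib_right sum_distrib_left sum_divide_distrib ac_simps)
  then show "(LBINT z. hkd 1 \<tau> z y * J z) = 0"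
    by (simp add: Bochner_Integration.integral_sum J_coord_integrable Jx)
  show "(LBINT z. hkd 2 \<tau> z y * J z) = 2 * dHk \<tau> y" if t: "0 < \<tau>"
  proof -
    have "(\<lambda>z. hkd 2 \<tau> z y * J z) = (\<lambda>z. Hk \<tau> y / (4 * \<tau>\<^sup>2) * (\<Sum>i\<in>UNIV. \<Sum>j\<in>UNIV. y $ i * y $ j * (z $ i * z $ j * J z))
        - Hk \<tau> y / (2 * \<tau>) * (\<Sum>i\<in>UNIV. z $ i * z $ i * J z))"
    proof (rule ext)
      fix z :: "real ^ 'n"
      have 1: "(y \<bullet> z)\<^sup>2 * J z = (\<Sum>i\<in>UNIV. \<Sum>j\<in>UNIV. y $ i * y $ j * (z $ i * z $ j * J z))"
        by (simp add: power2_eq_square inner_vec_def sum_product sum_distrib_right sum_distrib_left ac_simps)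
      have 2: "(z \<bullet> z) * J z = (\<Sum>i\<in>UNIV. z $ i * z $ i * J z)"
        by (simp add: inner_vec_def sum_distrib_right)
      show "hkd 2 \<tau> z y * J z = Hk \<tau> y / (4 * \<tau>\<^sup>2) * (\<Sum>i\<in>UNIV. \<Sum>j\<in>UNIV. y $ i * y $ j * (z $ i * z $ j * J z))
        - Hk \<tau> y / (2 * \<tau>) * (\<Sum>i\<in>UNIV. z $ i * z $ i * J z)"
        unfolding 1[symmetric] 2[symmetric]
        by (simp add: hkd.simps Let_def power_divide power_mult_distrib algebra_simps)
    qed
    then have "(LBINT z. hkd 2 \<tau> z y * J z) = Hk \<tau> y / (4 * \<tau>\<^sup>2) * (\<Sum>i\<in>UNIV. \<Sum>j\<in>UNIV. y $ i * y $ j * (if i = j then 2 else 0))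
        - Hk \<tau> y / (2 * \<tau>) * (\<Sum>i\<in>(UNIV :: 'n set). 2)"
      by (simp add: Bochner_Integration.integral_diff Bochner_Integration.integral_sum J_coord_integrable Jxx)
    also have "(\<Sum>i\<in>UNIV. \<Sum>j\<in>UNIV. y $ i * y $ j * (if i = j then 2 else 0)) = 2 * (norm y)\<^sup>2"
      by (simp add: power2_norm_eq_inner inner_vec_def sum_distrib_left mult.commute if_distrib[of "\<lambda>x. _ * x"] cong: if_cong)
    finally show ?thesis using t by (simp add: dHk_def field_simps power2_eq_square)
  qed
  have "(\<lambda>z. hkd 3 \<tau> z y * J z) = (\<lambda>z. Hk \<tau> y / (8 * \<tau> ^ 3) * (\<Sum>i\<in>UNIV. \<Sum>j\<in>UNIV. \<Sum>l\<in>UNIV. y $ i * y $ j * y $ l * (z $ i * z $ j * z $ l * J z))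
        - 3 * Hk \<tau> y / (4 * \<tau>\<^sup>2) * (\<Sum>i\<in>UNIV. \<Sum>j\<in>UNIV. y $ i * (z $ i * z $ j * z $ j * J z)))"
  proof (rule ext)
    fix z :: "real ^ 'n"
    have 1: "(y \<bullet> z) ^ 3 * J z = (\<Sum>i\<in>UNIV. \<Sum>j\<in>UNIV. \<Sum>l\<in>UNIV. y $ i * y $ j * y $ l * (z $ i * z $ j * z $ l * J z))"
      by (simp add: power3_eq_cube inner_vec_def sum_product sum_distrib_right sum_distrib_left ac_simps)
    have 2: "(y \<bullet> z) * (z \<bullet> z) * J z = (\<Sum>i\<in>UNIV. \<Sum>j\<in>UNIV. y $ i * (z $ i * z $ j * z $ j * J z))"
      unfolding inner_vec_def inner_real_def sum_product sum_distrib_right by (intro sum.cong refl) (simp add: sum_distrib_left ac_simps)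
    show "hkd 3 \<tau> z y * J z = Hk \<tau> y / (8 * \<tau> ^ 3) * (\<Sum>i\<in>UNIV. \<Sum>j\<in>UNIV. \<Sum>l\<in>UNIV. y $ i * y $ j * y $ l * (z $ i * z $ j * z $ l * J z))
        - 3 * Hk \<tau> y / (4 * \<tau>\<^sup>2) * (\<Sum>i\<in>UNIV. \<Sum>j\<in>UNIV. y $ i * (z $ i * z $ j * z $ j * J z))"
      unfolding 1[symmetric] 2[symmetric]
      by (simp add: hkd.simps Let_def power_divide power_mult_distrib power2_eq_square algebra_simps)
  qed
  then show "(LBINT z. hkd 3 \<tau> z y * J z) = 0"
    by (simp add: Bochner_Integration.integral_diff Bochner_Integration.integral_sum J_coord_integrable Jxxx)
qed

lemma nj_moments:
  fixes f :: "(real ^ 'n) \<Rightarrow>\<^sub>C real"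
  assumes t: "0 < \<tau>"
  shows "(LBINT z. nj k 1 f \<tau> z x * J z) = 0"
    "(LBINT z. nj k 2 f \<tau> z x * J z) = 2 * ev k (blf (cop k (dHk \<tau>)) f) x"
    "(LBINT z. nj k 3 f \<tau> z x * J z) = 0"
proof -
  have swap: "(LBINT z. nj k j f \<tau> z x * J z) = (LBINT y. ev k f (x + y) * (LBINT z. hkd j \<tau> z y * J z))" if j: "j <= 4" for j
  proof -
    define B where "B y = 10 * (1 / sqrt \<tau>) ^ j * norm f * wt k x * max 1 (sqrt \<tau>) powr k * (kw (k + 4) (y /\<^sub>R sqrt \<tau>) * Hk \<tau> y)" for y :: "real ^ 'n"
    have "integrable (lborel \<Otimes>\<^sub>M lborel) (\<lambda>(y, z). B y * (norm z ^ j * kw 0 z * J z))"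
    proof (rule lborel_pair.Fubini_integrable)
      have B: "integrable lborel B" unfolding B_def using t k0 by (intro integrable_mult_right kw_heat_kernel) auto
      then show "(\<lambda>(y, z). B y * (norm z ^ j * kw 0 z * J z)) \<in> borel_measurable (lborel \<Otimes>\<^sub>M lborel)"
        unfolding B_def by measurable
      have i: "integrable lborel (\<lambda>z. norm z ^ j * kw 0 z * J z)" using k0 j by (intro J_integrable_power) auto
      show "integrable lborel (\<lambda>x. LINT y|lborel. norm (case (x, y) of (y, z) => B y * (norm z ^ j * kw 0 z * J z)))"
        using B i by (simp add: abs_mult)
      show "AE x in lborel. integrable lborel (\<lambda>y. case (x, y) of (y, z) => B y * (norm z ^ j * kw 0 z * J z))"
        using i by auto
    qed
    then have "integrable (lborel \<Otimes>\<^sub>M lborel) (\<lambda>(y, z). ev k f (x + y) * hkd j \<tau> z y * J z)"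
    proof (rule Bochner_Integration.integrable_bound)
      have "\<bar>ev k f (x + y) * hkd j \<tau> z y * J z\<bar> <= B y * (norm z ^ j * kw 0 z * J z)" for y z
      proof -
        have "kw k y <= max 1 (sqrt \<tau>) powr k * kw k (y /\<^sub>R sqrt \<tau>)"
          using kw_scale_le[OF k0, of "sqrt \<tau>" "y /\<^sub>R sqrt \<tau>"] t by simp
        then have "norm f * wt k x * kw k y <= norm f * wt k x * (max 1 (sqrt \<tau>) powr k * kw k (y /\<^sub>R sqrt \<tau>))"
          by (intro mult_left_mono) auto
        then have "\<bar>ev k f (x + y)\<bar> <= norm f * wt k x * (max 1 (sqrt \<tau>) powr k * kw k (y /\<^sub>R sqrt \<tau>))"
          using ev_shift_bound[OF k0, of f x y] by linarith
        then have "\<bar>ev k f (x + y)\<bar> * \<bar>hkd j \<tau> z y\<bar> * J z <= (norm f * wt k x * (max 1 (sqrt \<tau>) powr k * kw k (y /\<^sub>R sqrt \<tau>))) * (10 * (norm z / sqrt \<tau>) ^ j * (kw 4 (y /\<^sub>R sqrt \<tau>) * Hk \<tau> y)) * J z"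
          using J0[of z] by (intro mult_right_mono mult_mono hkd_bound t j) auto
        also have "... = B y * (norm z ^ j * kw 0 z * J z)"
          by (simp add: B_def kw_0 power_divide kw_mult[symmetric] ac_simps)
        finally show ?thesis using J0[of z] by (simp add: abs_mult)
      qed
      then show "AE yz in lborel \<Otimes>\<^sub>M lborel. norm (case yz of (y, z) => ev k f (x + y) * hkd j \<tau> z y * J z) <= norm (case yz of (y, z) => B y * (norm z ^ j * kw 0 z * J z))"
        by (intro AE_I2) (auto simp: split_beta' intro: order.trans[OF _ abs_ge_self])
    qed measurable
    from lborel_pair.Fubini_integral[OF this]
    have "(LBINT z. (LBINT y. ev k f (x + y) * hkd j \<tau> z y * J z)) = (LBINT y. (LBINT z. ev k f (x + y) * hkd j \<tau> z y * J z))" .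
    then show ?thesis by (simp add: nj_def mult.assoc flip: integral_mult_right_zero integral_mult_left_zero)
  qed
  show "(LBINT z. nj k 1 f \<tau> z x * J z) = 0" by (simp only: swap J_hkd) simp
  show "(LBINT z. nj k 3 f \<tau> z x * J z) = 0" by (simp only: swap J_hkd) simp
  have "(LBINT z. nj k 2 f \<tau> z x * J z) = (LBINT y. 2 * (ev k f (x + y) * dHk \<tau> y))"
    by (simp only: swap J_hkd(2)[OF t]) (simp add: mult.left_commute)
  then show "(LBINT z. nj k 2 f \<tau> z x * J z) = 2 * ev k (blf (cop k (dHk \<tau>)) f) x"
    by (simp add: ev_cop k0 wkernel_dHk t)
qed

definition tau :: "real => real" where "tau s = (exp (2 * s) - 1) / 2"

definition Nop :: "real => 'n bop" where "Nop s = cop k (Hk (tau s))"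

text \<open>The consistency error: the difference of the two generators, applied to the heat flow.\<close>

definition Rop :: "real => real => 'n bop" where
  "Rop eps s = gen eps s * Nop s - exp (2 * s) *\<^sub>R cop k (dHk (tau s))"

lemma tau_pos: "0 < s ==> 0 < tau s"
  by (simp add: tau_def)

lemma tau_le: "sqrt (tau s) <= exp s"
proof -
  have "tau s <= (exp s)\<^sup>2" 
  proof -
    have "(x - 1) / 2 <= x" if "0 <= x" for x :: real using that by simp
    from this[of "(exp s)\<^sup>2"] show ?thesis by (simp add: tau_def exp_double)
  qed
  then show ?thesis by (rule real_le_lsqrt[rotated]) simp
qed

text \<open>Away from s = 0 the width sqrt (tau s) of the kernel is comparable to exp s, the unit in
  which jumps are measured. Near 0 it degenerates, which forces the separate treatment of small
  s.\<close>

lemma tau_ge: "1 <= s ==> exp s / 2 <= sqrt (tau s)"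
proof -
  assume s: "1 <= s"
  have "2 <= exp (2 * s)" using exp_ge_add_one_self[of "2 * s"] s by linarith
  then have "(exp s / 2)\<^sup>2 <= tau s" by (simp add: tau_def exp_double power_divide)
  then show ?thesis by (rule real_le_rsqrt)
qed

lemma ev_Rop:
  assumes e: "0 < eps" and s: "0 < s"
  shows "ev k (blf (Rop eps s) f) x = (1 / eps\<^sup>2) * ((LBINT z. nj k 0 f (tau s) z (x + (eps * exp s) *\<^sub>R z) * J z)
    - (LBINT z. nj k 0 f (tau s) z x * J z) - (eps * exp s)\<^sup>2 * ev k (blf (cop k (dHk (tau s))) f) x)"
proof -
  have N: "ev k (blf (Nop s) f) y = nj k 0 f (tau s) z y" for y z
    using s by (simp add: Nop_def nj_eq_ev k0 tau_pos hkd_0)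
  have J1': "(LBINT z. nj k 0 f (tau s) z x * J z) = ev k (blf (Nop s) f) x"
    unfolding N[symmetric] by (simp add: J1)
  have "ev k (blf (gen eps s * Nop s) f) x = (1 / eps\<^sup>2) * ((LBINT z. nj k 0 f (tau s) z (x + (eps * exp s) *\<^sub>R z) * J z) - ev k (blf (Nop s) f) x)"
    using e by (simp add: gen_def ev_K N[symmetric])
  moreover have "exp (2 * s) = (1 / eps\<^sup>2) * (eps * exp s)\<^sup>2" using e by (simp add: exp_double power_mult_distrib)
  ultimately show ?thesis unfolding J1' Rop_def by (simp only: blf_simps ev_linear) (simp add: algebra_simps)
qed

text \<open>The powers of exp s cancel between the jump length to the fourth and the fourth kernel
  derivative. Only the growth of \<open>f\<close> around x enters, in the unit exp s, so the lemma
  can be used after a constant has been subtracted.\<close>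

lemma Rop_pointwise_bound:
  assumes a: "0 <= a" "a <= k + 1"
  obtains C where "0 <= C" "\<And>eps s f x A. 0 < eps ==> eps <= 1 ==> 1 <= s ==> 0 <= A ==>
    (\<forall>y. \<bar>ev k f (x + y)\<bar> <= A * kw a (exp (- s) *\<^sub>R y)) ==> \<bar>ev k (blf (Rop eps s) f) x\<bar> <= C * eps\<^sup>2 * A"
proof -
  define M where "M = hkM TYPE('n) (a + 4)"
  have M0: "0 <= M" unfolding M_def hkM_def
    by (intro integral_nonneg_AE) (auto intro!: AE_I2 mult_nonneg_nonneg heat_kernel_nonneg)
  \<comment> \<open>160 is 10 from \<open>hkd_bound\<close> times 2^4 from \<open>tau_ge\<close>; 24
    is the factorial of 4.\<close>
  define C where "C = 160 * M * MJ a / 24"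
  have "\<bar>ev k (blf (Rop eps s) f) x\<bar> <= C * eps\<^sup>2 * A"
    if e: "0 < eps" "eps <= 1" and s: "1 <= s" and A: "0 <= A" and fb: "\<forall>y. \<bar>ev k f (x + y)\<bar> <= A * kw a (exp (- s) *\<^sub>R y)" for eps s f x A
  proof -
    define \<tau> where "\<tau> = tau s"
    have t: "0 < \<tau>" using s by (simp add: \<tau>_def tau_pos)
    define \<sigma> where "\<sigma> = eps * exp s"
    have s0: "0 < \<sigma>" using e by (simp add: \<sigma>_def)
    define chi where "chi j z \<rho> = nj k j f \<tau> z (x + \<rho> *\<^sub>R z)" for j z \<rho>
    define D where "D j = (norm f * (max 1 (sqrt \<tau>) powr k * (10 * (1 / sqrt \<tau>) ^ j * hkM TYPE('n) (k + 4)))) * wt k x" for j :: nat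
    have hM: "0 <= hkM TYPE('n) (k + 4)" unfolding hkM_def
      by (intro integral_nonneg_AE) (auto intro!: AE_I2 mult_nonneg_nonneg heat_kernel_nonneg)
    have D0: "0 <= D j" for j unfolding D_def using t hM by (intro mult_nonneg_nonneg) auto
    define E where "E = A * (160 * exp (- 4 * s) * M)"
    have "\<bar>(LBINT z. chi 0 z \<sigma> * J z) - (LBINT z. chi 0 z 0 * J z) - \<sigma>\<^sup>2 * ev k (blf (cop k (dHk \<tau>)) f) x\<bar> <= \<sigma> ^ 4 * (E * MJ a) / 24"
    proof (rule taylor_J[OF s0, where D=D])
      show "(chi j z has_real_derivative chi (Suc j) z \<rho>) (at \<rho>)" if "j < 4" for j z \<rho>
        unfolding chi_def by (rule nj_has_derivative[OF k0 t that])
      show "(\<lambda>z. chi j z \<rho>) \<in> borel_measurable borel" for j \<rho>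
        unfolding chi_def by measurable
      show "\<bar>chi j z \<rho>\<bar> <= D j * (norm z ^ j * kw k (\<rho> *\<^sub>R z))" if "j <= 4" for j z \<rho>
      proof -
        have "\<bar>chi j z \<rho>\<bar> <= (norm f * (max 1 (sqrt \<tau>) powr k * (10 * (1 / sqrt \<tau>) ^ j * hkM TYPE('n) (k + 4)))) * (norm z ^ j * wt k (x + \<rho> *\<^sub>R z))"
          unfolding chi_def by (rule nj_wt_bound[OF k0 t that])
        also have "... <= (norm f * (max 1 (sqrt \<tau>) powr k * (10 * (1 / sqrt \<tau>) ^ j * hkM TYPE('n) (k + 4)))) * (norm z ^ j * (wt k x * kw k (\<rho> *\<^sub>R z)))"
          using t hM by (intro mult_left_mono wt_add k0 mult_nonneg_nonneg) auto
        finally show ?thesis by (simp add: D_def ac_simps)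
      qed
      show "(LBINT z. chi 1 z 0 * J z) = 0" "(LBINT z. chi 2 z 0 * J z) = 2 * ev k (blf (cop k (dHk \<tau>)) f) x" "(LBINT z. chi 3 z 0 * J z) = 0"
        using nj_moments[OF t, of f x] by (simp_all add: chi_def)
      show "\<bar>chi 4 z \<rho>\<bar> <= E * (norm z ^ 4 * kw a z)" if r: "0 <= \<rho>" "\<rho> <= \<sigma>" for z \<rho>
      proof -
        have "\<bar>chi 4 z \<rho>\<bar> <= (A * kw a z) * (10 * (norm z / sqrt \<tau>) ^ 4 * hkM TYPE('n) (a + 4))"
          unfolding chi_def
        proof (rule nj_bound[OF t _ a(1)])
          fix y
          have "\<bar>ev k f (x + \<rho> *\<^sub>R z + y)\<bar> <= A * kw a (exp (- s) *\<^sub>R (\<rho> *\<^sub>R z + y))" using fb[rule_format, of "\<rho> *\<^sub>R z + y"] by (simp add: add.assoc)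
          also have "... <= A * (kw a (exp (- s) *\<^sub>R (\<rho> *\<^sub>R z)) * kw a (exp (- s) *\<^sub>R y))"
            unfolding scaleR_add_right by (intro mult_left_mono kw_add a A)
          also have "... <= A * (kw a z * kw a (y /\<^sub>R sqrt \<tau>))"
          proof (intro mult_left_mono mult_mono A kw_norm_mono a)
            have "exp (- s) * \<rho> <= exp (- s) * \<sigma>" using r by (intro mult_left_mono) auto
            also have "... = eps" by (simp add: \<sigma>_def exp_minus)
            finally have "exp (- s) * \<rho> <= 1" using e by linarith
            then show "norm (exp (- s) *\<^sub>R \<rho> *\<^sub>R z) <= norm z" using r by (simp add: mult_left_le_one_le mult.assoc[symmetric])
            have "exp (- s) <= inverse (sqrt \<tau>)"
              using tau_le[of s] t unfolding \<tau>_def[symmetric] exp_minus by (intro le_imp_inverse_le) auto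
            then show "norm (exp (- s) *\<^sub>R y) <= norm (y /\<^sub>R sqrt \<tau>)" using t by (simp add: mult_right_mono)
          qed auto
          finally show "\<bar>ev k f (x + \<rho> *\<^sub>R z + y)\<bar> <= A * kw a z * kw a (y /\<^sub>R sqrt \<tau>)" by (simp add: mult.assoc)
        qed (use A in auto)
        also have "(norm z / sqrt \<tau>) ^ 4 <= (norm z * (2 * exp (- s))) ^ 4"
        proof (rule power_mono)
          have "norm z / sqrt \<tau> <= norm z / (exp s / 2)" using tau_ge[OF s] t by (intro divide_left_mono) (auto simp: \<tau>_def)
          also have "... = norm z * (2 * exp (- s))" unfolding exp_minus by (simp add: field_simps)
          finally show "norm z / sqrt \<tau> <= norm z * (2 * exp (- s))" .
        qed (use t in simp)
        then have "(A * kw a z) * (10 * (norm z / sqrt \<tau>) ^ 4 * hkM TYPE('n) (a + 4)) <= (A * kw a z) * (10 * (norm z * (2 * exp (- s))) ^ 4 * M)"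
          unfolding M_def[symmetric] using A M0 by (intro mult_left_mono mult_right_mono) auto
        also have "(norm z * (2 * exp (- s))) ^ 4 = 16 * exp (- 4 * s) * norm z ^ 4"
          by (simp add: power_mult_distrib exp_of_nat_mult[symmetric])
        finally show ?thesis by (simp add: E_def ac_simps)
      qed
    qed (use D0 a in auto)
    from mult_left_mono[OF this, of "1 / eps\<^sup>2"] have "\<bar>ev k (blf (Rop eps s) f) x\<bar> <= (1 / eps\<^sup>2) * (\<sigma> ^ 4 * (E * MJ a) / 24)"
      unfolding ev_Rop[OF e(1), of s, OF less_le_trans[OF zero_less_one s]] \<sigma>_def[symmetric] \<tau>_def[symmetric] chi_def
      by (simp only: abs_mult abs_divide) simp
    also have "\<sigma> ^ 4 = eps ^ 4 * exp (4 * s)" by (simp add: \<sigma>_def power_mult_distrib exp_of_nat_mult[symmetric])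
    also have "(1 / eps\<^sup>2) * (eps ^ 4 * exp (4 * s) * (E * MJ a) / 24) = (eps ^ 4 / eps\<^sup>2) * (exp (4 * s) * exp (- 4 * s)) * (A * (160 * M * MJ a / 24))"
      by (simp add: E_def)
    also have "eps ^ 4 / eps\<^sup>2 = eps\<^sup>2" using e by (simp add: power4_eq_xxxx power2_eq_square)
    also have "exp (4 * s) * exp (- 4 * s) = 1" by (simp flip: exp_add)
    finally show ?thesis by (simp add: C_def ac_simps)
  qed
  moreover have "0 <= C" using M0 MJ_nonneg[of a] by (simp add: C_def)
  ultimately show ?thesis using that by blast
qed

end

section \<open>The consistency error paired with the initial datum, for small times\<close>

definition nb :: "real => nat => (real ^ 'n::finite) \<Rightarrow>\<^sub>C real => real => real" where
  "nb k j f \<tau> = norm f * (max 1 (sqrt \<tau>) powr k * (10 * (1 / sqrt \<tau>) ^ j * hkM TYPE('n) (k + 4)))"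

lemma hkM_nonneg: "0 <= hkM TYPE('n::finite) a"
  unfolding hkM_def by (intro integral_nonneg_AE) (auto intro!: AE_I2 mult_nonneg_nonneg heat_kernel_nonneg)

lemma nb_nonneg: "0 < \<tau> ==> 0 <= nb k j f \<tau>"
  unfolding nb_def by (intro mult_nonneg_nonneg hkM_nonneg) auto

lemma nj_ray_bound:
  assumes k: "0 <= k" and t: "0 < \<tau>" and j: "j <= 4" and "\<bar>\<rho>\<bar> <= R"
  shows "\<bar>nj k j f \<tau> z (x + \<rho> *\<^sub>R z)\<bar> <= nb k j f \<tau> * (norm z ^ j * kw k (R *\<^sub>R z)) * wt k x"
proof -
  have "\<bar>nj k j f \<tau> z (x + \<rho> *\<^sub>R z)\<bar> <= nb k j f \<tau> * (norm z ^ j * wt k (x + \<rho> *\<^sub>R z))"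
    unfolding nb_def by (rule nj_wt_bound[OF k t j])
  also have "... <= nb k j f \<tau> * (norm z ^ j * (wt k x * kw k (\<rho> *\<^sub>R z)))"
    by (intro mult_left_mono wt_add k nb_nonneg t) auto
  also have "... <= nb k j f \<tau> * (norm z ^ j * (wt k x * kw k (R *\<^sub>R z)))"
    using assms(4) by (intro mult_left_mono kw_norm_mono k nb_nonneg t) (auto intro!: mult_right_mono)
  finally show ?thesis by (simp only: mult_ac)
qed

text \<open>The smoothness of the datum enters through fourth differences with an integrable
  majorant \<open>m\<close>. The differences go backwards because a shift of the heat flow by h
  becomes a shift of the datum by - h.\<close>

locale jump_datum = jump_kernel k J for k and J :: "real ^ 'n => real" +
  fixes u0 m :: "real ^ 'n => real"
  assumes u0m [measurable]: "u0 \<in> borel_measurable borel" and u0_nonneg: "\<And>x. 0 <= u0 x"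
    and u0i: "integrable lborel (\<lambda>x. wt k x * u0 x)"
    and mm [measurable]: "m \<in> borel_measurable borel" and m_nonneg: "\<And>x. 0 <= m x"
    and mi: "integrable lborel (\<lambda>x. wt k x * m x)"
    and fourth_difference: "\<And>h x. norm h <= 1 ==>
      \<bar>u0 (x - 4 *\<^sub>R h) - 4 * u0 (x - 3 *\<^sub>R h) + 6 * u0 (x - 2 *\<^sub>R h) - 4 * u0 (x - h) + u0 x\<bar> <= norm h ^ 4 * m x"
begin

definition I0 :: real where "I0 = (LBINT x. wt k x * u0 x)"

lemma I0_nonneg: "0 <= I0"
  unfolding I0_def by (intro integral_nonneg_AE) (auto simp: u0_nonneg)

definition U0 :: "((real ^ 'n) \<Rightarrow>\<^sub>C real) => real" where "U0 g = (LBINT x. ev k g x * u0 x)"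

lemma integrable_wt_bound:
  assumes [measurable]: "g \<in> borel_measurable borel" and "\<And>x. \<bar>g x\<bar> <= A * wt k x"
  shows "integrable lborel (\<lambda>x. g x * u0 x)" "\<bar>LBINT x. g x * u0 x\<bar> <= A * I0"
proof -
  have b: "\<bar>g x * u0 x\<bar> <= A * (wt k x * u0 x)" for x
    using mult_right_mono[OF assms(2) u0_nonneg[of x], of x] u0_nonneg[of x] by (simp add: abs_mult mult.assoc)
  show i: "integrable lborel (\<lambda>x. g x * u0 x)"
    by (rule Bochner_Integration.integrable_bound[OF integrable_mult_right[OF u0i, of A]])
       (use b in \<open>auto intro!: AE_I2 order.trans[OF _ abs_ge_self]\<close>)
  have "\<bar>LBINT x. g x * u0 x\<bar> <= (LBINT x. A * (wt k x * u0 x))"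
    by (rule order.trans[OF integral_abs_bound]) (intro integral_mono integrable_abs i integrable_mult_right u0i b)
  then show "\<bar>LBINT x. g x * u0 x\<bar> <= A * I0" by (simp add: I0_def)
qed

lemma integrable_ev_u0: "integrable lborel (\<lambda>x. ev k g x * u0 x)"
  by (rule integrable_wt_bound[OF _ ev_bound]) measurable

lemma U0_bound: "(\<And>x. \<bar>ev k g x\<bar> <= A * wt k x) ==> \<bar>U0 g\<bar> <= A * I0"
  unfolding U0_def by (rule integrable_wt_bound) measurable

lemma U0_linear: "U0 (f + g) = U0 f + U0 g" "U0 (f - g) = U0 f - U0 g" "U0 (a *\<^sub>R f) = a * U0 f"
  by (simp_all add: U0_def distrib_right left_diff_distrib mult.assoc integrable_ev_u0)

lemma bounded_linear_U0: "bounded_linear U0"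
  by (rule bounded_linear_intro[where K=I0])
     (use U0_bound[OF ev_bound] in \<open>auto simp: U0_linear\<close>)

text \<open>Averaging over the datum allows a shift along z to be read on the heat flow or, after
  translating the integral, on \<open>u0\<close>.\<close>

definition ch :: "nat => ((real ^ 'n) \<Rightarrow>\<^sub>C real) => real => real ^ 'n => real => real" where
  "ch j f \<tau> z \<rho> = (LBINT x. nj k j f \<tau> z (x + \<rho> *\<^sub>R z) * u0 x)"

lemma integrable_ch:
  assumes "0 < \<tau>" "j <= 4"
  shows "integrable lborel (\<lambda>x. nj k j f \<tau> z (x + \<rho> *\<^sub>R z) * u0 x)"
  by (rule integrable_wt_bound[OF _ nj_ray_bound[OF k0 assms order.refl]]) measurable

lemma ch_bound:
  assumes "0 < \<tau>" "j <= 4"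
  shows "\<bar>ch j f \<tau> z \<rho>\<bar> <= nb k j f \<tau> * I0 * (norm z ^ j * kw k (\<rho> *\<^sub>R z))"
proof -
  have "kw k (\<bar>\<rho>\<bar> *\<^sub>R z) = kw k (\<rho> *\<^sub>R z)" by (simp add: kw_def)
  then have "\<bar>ch j f \<tau> z \<rho>\<bar> <= nb k j f \<tau> * (norm z ^ j * kw k (\<rho> *\<^sub>R z)) * I0"
    using integrable_wt_bound(2)[OF _ nj_ray_bound[OF k0 assms order.refl, of f z _ \<rho>]] unfolding ch_def by simp
  then show ?thesis by (simp only: mult_ac)
qed

lemma ch_has_derivative:
  assumes t: "0 < \<tau>" and j: "j < 4"
  shows "(ch j f \<tau> z has_real_derivative ch (Suc j) f \<tau> z \<rho>) (at \<rho>)"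
proof -
  have "((\<lambda>\<rho>. (LBINT x. nj k j f \<tau> z (x + \<rho> *\<^sub>R z) * u0 x)) has_real_derivative
      (LBINT x. nj k (Suc j) f \<tau> z (x + \<rho> *\<^sub>R z) * u0 x)) (at \<rho>)"
  proof (rule has_real_derivative_integral[of "\<rho> - 1" "\<rho> + 1"])
    fix r x assume r: "\<rho> - 1 < r" "r < \<rho> + 1"
    show "((\<lambda>r. nj k j f \<tau> z (x + r *\<^sub>R z) * u0 x) has_real_derivative nj k (Suc j) f \<tau> z (x + r *\<^sub>R z) * u0 x) (at r)"
      by (rule DERIV_cmult_right[OF nj_has_derivative[OF k0 t j]])
    show "\<bar>nj k (Suc j) f \<tau> z (x + r *\<^sub>R z) * u0 x\<bar> <= nb k (Suc j) f \<tau> * (norm z ^ Suc j * kw k ((\<bar>\<rho>\<bar> + 1) *\<^sub>R z)) * (wt k x * u0 x)"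
      unfolding abs_mult abs_of_nonneg[OF u0_nonneg] mult.assoc[symmetric]
      using r j by (intro mult_right_mono nj_ray_bound[OF k0 t, unfolded mult.assoc[symmetric]] u0_nonneg) auto
    show "integrable lborel (\<lambda>x. nj k j f \<tau> z (x + r *\<^sub>R z) * u0 x)" using j by (intro integrable_ch t) auto
    show "(\<lambda>x. nj k (Suc j) f \<tau> z (x + r *\<^sub>R z) * u0 x) \<in> borel_measurable lborel" by measurable
  next
    show "integrable lborel (\<lambda>x. nb k (Suc j) f \<tau> * (norm z ^ Suc j * kw k ((\<bar>\<rho>\<bar> + 1) *\<^sub>R z)) * (wt k x * u0 x))"
      by (intro integrable_mult_right u0i)
  qed auto
  then show ?thesis unfolding ch_def[abs_def] .
qed

lemma ch_4_continuous:
  assumes t: "0 < \<tau>"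
  shows "continuous_on UNIV (ch 4 f \<tau> z)"
  unfolding ch_def[abs_def]
proof (rule continuous_on_param_integral)
  show "continuous_on UNIV (\<lambda>\<rho>. nj k 4 f \<tau> z (x + \<rho> *\<^sub>R z) * u0 x)" for x
    unfolding nj_eq_ev[OF k0 t order.refl] by (intro continuous_intros)
  fix R :: real
  have "integrable lborel (\<lambda>x. nb k 4 f \<tau> * (norm z ^ 4 * kw k (R *\<^sub>R z)) * (wt k x * u0 x))"
    by (intro integrable_mult_right u0i)
  moreover have "\<bar>nj k 4 f \<tau> z (x + \<rho> *\<^sub>R z) * u0 x\<bar> <= nb k 4 f \<tau> * (norm z ^ 4 * kw k (R *\<^sub>R z)) * (wt k x * u0 x)"
    if "norm \<rho> <= R" for \<rho> x
    unfolding abs_mult abs_of_nonneg[OF u0_nonneg] mult.assoc[symmetric]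
    using that by (intro mult_right_mono nj_ray_bound[OF k0 t, unfolded mult.assoc[symmetric]] u0_nonneg) auto
  ultimately show "\<exists>g. integrable lborel g \<and> (\<forall>\<rho> x. norm \<rho> <= R \<longrightarrow> \<bar>nj k 4 f \<tau> z (x + \<rho> *\<^sub>R z) * u0 x\<bar> <= g x)"
    by blast
qed measurable

text \<open>The fourth derivative is a limit of difference quotients, and translation puts the
  differences on the datum. The heat flow stays undifferentiated: the constant is
  \<open>nb k 0\<close>, without a negative power of \<tau>.\<close>

lemma ch_4_bound:
  assumes t: "0 < \<tau>"
  shows "\<bar>ch 4 f \<tau> z \<rho>\<bar> <= nb k 0 f \<tau> * (norm z ^ 4 * kw k (\<rho> *\<^sub>R z)) * (LBINT x. wt k x * m x)"
    (is "_ <= ?B")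
proof -
  have diff: "\<bar>(fdiff r ^^ 4) (ch 0 f \<tau> z) \<rho>\<bar> <= r ^ 4 * ?B" if r: "0 < r" "r * norm z <= 1" for r
  proof -
    define g where "g x = nj k 0 f \<tau> z (x + \<rho> *\<^sub>R z)" for x
    have [measurable]: "g \<in> borel_measurable borel" unfolding g_def by measurable
    have g0: "nj k 0 f \<tau> z' (x + \<rho> *\<^sub>R z) = g x" for x z'
      unfolding g_def by (simp add: nj_0[of k f \<tau> z' z])
    have sh: "integrable lborel (\<lambda>x. g x * u0 (x - c *\<^sub>R (r *\<^sub>R z)))"
        "ch 0 f \<tau> z (\<rho> + c * r) = (LBINT x. g x * u0 (x - c *\<^sub>R (r *\<^sub>R z)))" for c
    proof -
      define q where "q x = g x * u0 (x - c *\<^sub>R (r *\<^sub>R z))" for x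
      have [measurable]: "q \<in> borel_measurable borel" unfolding q_def by measurable
      have e: "q (c *\<^sub>R (r *\<^sub>R z) + x) = nj k 0 f \<tau> z (x + (\<rho> + c * r) *\<^sub>R z) * u0 x" for x
        by (simp add: q_def g_def algebra_simps)
      have "integrable lborel (\<lambda>x. q (c *\<^sub>R (r *\<^sub>R z) + x))" unfolding e by (intro integrable_ch t) simp
      then show "integrable lborel (\<lambda>x. g x * u0 (x - c *\<^sub>R (r *\<^sub>R z)))"
        using integrable_scale_iff[of q 1 "c *\<^sub>R (r *\<^sub>R z)"] unfolding q_def[symmetric] by simp
      show "ch 0 f \<tau> z (\<rho> + c * r) = (LBINT x. g x * u0 (x - c *\<^sub>R (r *\<^sub>R z)))"
      proof -
        have "(LBINT x. q x) = (LBINT x. q (c *\<^sub>R (r *\<^sub>R z) + x))"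
          using integral_scale[of q 1 "c *\<^sub>R (r *\<^sub>R z)"] by simp
        also have "... = ch 0 f \<tau> z (\<rho> + c * r)" unfolding e ch_def ..
        finally show ?thesis unfolding q_def ..
      qed
    qed
    define h where "h = r *\<^sub>R z"
    have "(fdiff r ^^ 4) (ch 0 f \<tau> z) \<rho> = (LBINT x. g x * u0 (x - 4 *\<^sub>R h)) - 4 * (LBINT x. g x * u0 (x - 3 *\<^sub>R h))
        + 6 * (LBINT x. g x * u0 (x - 2 *\<^sub>R h)) - 4 * (LBINT x. g x * u0 (x - 1 *\<^sub>R h)) + (LBINT x. g x * u0 (x - 0 *\<^sub>R h))"
      unfolding fdiff_4 h_def sh(2)[symmetric] by simp
    also have "... = (LBINT x. g x * u0 (x - 4 *\<^sub>R h) - 4 * (g x * u0 (x - 3 *\<^sub>R h)) + 6 * (g x * u0 (x - 2 *\<^sub>R h)) - 4 * (g x * u0 (x - 1 *\<^sub>R h)) + g x * u0 (x - 0 *\<^sub>R h))"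
      using sh(1) unfolding h_def[symmetric] by (simp del: scaleR_one scaleR_zero_left)
    also have "... = (LBINT x. g x * (u0 (x - 4 *\<^sub>R h) - 4 * u0 (x - 3 *\<^sub>R h) + 6 * u0 (x - 2 *\<^sub>R h) - 4 * u0 (x - h) + u0 x))"
      by (intro Bochner_Integration.integral_cong refl) (simp add: algebra_simps)
    finally have eq: "(fdiff r ^^ 4) (ch 0 f \<tau> z) \<rho> = (LBINT x. g x * (u0 (x - 4 *\<^sub>R h) - 4 * u0 (x - 3 *\<^sub>R h) + 6 * u0 (x - 2 *\<^sub>R h) - 4 * u0 (x - h) + u0 x))" .
    have "\<bar>(fdiff r ^^ 4) (ch 0 f \<tau> z) \<rho>\<bar> <= (LBINT x. (r ^ 4 * (nb k 0 f \<tau> * (norm z ^ 4 * kw k (\<rho> *\<^sub>R z)))) * (wt k x * m x))"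
    proof -
      have b: "\<bar>g x * (u0 (x - 4 *\<^sub>R h) - 4 * u0 (x - 3 *\<^sub>R h) + 6 * u0 (x - 2 *\<^sub>R h) - 4 * u0 (x - h) + u0 x)\<bar>
          <= (r ^ 4 * (nb k 0 f \<tau> * (norm z ^ 4 * kw k (\<rho> *\<^sub>R z)))) * (wt k x * m x)" for x
      proof -
        have h: "norm h <= 1" "norm h ^ 4 = r ^ 4 * norm z ^ 4" using r by (simp_all add: h_def power_mult_distrib)
        have kk: "kw k (\<bar>\<rho>\<bar> *\<^sub>R z) = kw k (\<rho> *\<^sub>R z)" by (simp add: kw_def)
        have "\<bar>g x\<bar> <= nb k 0 f \<tau> * (norm z ^ 0 * kw k (\<rho> *\<^sub>R z)) * wt k x"
          using nj_ray_bound[OF k0 t, of 0 \<rho> "\<bar>\<rho>\<bar>" f z x] unfolding g_def kk by simp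
        then have "\<bar>g x\<bar> * \<bar>u0 (x - 4 *\<^sub>R h) - 4 * u0 (x - 3 *\<^sub>R h) + 6 * u0 (x - 2 *\<^sub>R h) - 4 * u0 (x - h) + u0 x\<bar>
          <= (nb k 0 f \<tau> * (norm z ^ 0 * kw k (\<rho> *\<^sub>R z)) * wt k x) * (norm h ^ 4 * m x)"
          by (intro mult_mono fourth_difference h) (auto intro!: mult_nonneg_nonneg nb_nonneg t)
        then show ?thesis unfolding abs_mult h(2) by (simp add: ac_simps)
      qed
      have i: "integrable lborel (\<lambda>x. (r ^ 4 * (nb k 0 f \<tau> * (norm z ^ 4 * kw k (\<rho> *\<^sub>R z)))) * (wt k x * m x))"
        by (intro integrable_mult_right mi)
      have i': "integrable lborel (\<lambda>x. g x * (u0 (x - 4 *\<^sub>R h) - 4 * u0 (x - 3 *\<^sub>R h) + 6 * u0 (x - 2 *\<^sub>R h) - 4 * u0 (x - h) + u0 x))"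
        by (rule Bochner_Integration.integrable_bound[OF i]) (unfold real_norm_def, measurable, intro AE_I2 order.trans[OF b abs_ge_self])
      show ?thesis unfolding eq
        by (rule order.trans[OF integral_abs_bound]) (intro integral_mono integrable_abs i i' b)
    qed
    then show ?thesis unfolding integral_mult_right_zero by (simp only: mult.assoc)
  qed
  \<comment> \<open>Steps tending to 0 with r n |z| <= 1, the range in which
    \<open>fourth_difference\<close> is available.\<close>
  define r where "r n = inverse (real (Suc n)) / (1 + norm z)" for n
  have z1: "0 < 1 + norm z" using norm_ge_zero[of z] by linarith
  have r: "0 < r n" "r n * norm z <= 1" for n
  proof -
    show "0 < r n" unfolding r_def using z1 by (intro divide_pos_pos) auto
    have "inverse (real (Suc n)) * (norm z / (1 + norm z)) <= 1"
      using z1 by (intro mult_le_one) (auto simp: inverse_le_1_iff)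
    then show "r n * norm z <= 1" by (simp add: r_def)
  qed
  have rl: "r \<longlonglongrightarrow> 0"
    unfolding r_def using tendsto_divide[OF LIMSEQ_inverse_real_of_nat tendsto_const[of "1 + norm z"]] z1 by simp
  have "\<exists>\<xi>. \<rho> <= \<xi> \<and> \<xi> <= \<rho> + 4 * r n \<and> \<bar>ch 4 f \<tau> z \<xi>\<bar> <= ?B" for n
  proof -
    obtain \<xi> where xi: "\<rho> <= \<xi>" "\<xi> <= \<rho> + real 4 * r n" "(fdiff (r n) ^^ 4) (ch 0 f \<tau> z) \<rho> = r n ^ 4 * ch 4 f \<tau> z \<xi>"
      using fdiff_mean_value[OF r(1)[of n], of 4 "\<lambda>j. ch j f \<tau> z" \<rho>] ch_has_derivative[OF t] by blast
    have "r n ^ 4 * \<bar>ch 4 f \<tau> z \<xi>\<bar> <= r n ^ 4 * ?B"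
      using diff[OF r, of n] r(1)[of n] unfolding xi(3) by (simp add: abs_mult)
    then have "\<bar>ch 4 f \<tau> z \<xi>\<bar> <= ?B" using r(1)[of n] by (simp add: mult_le_cancel_left_pos)
    then show ?thesis using xi by auto
  qed
  then have "\<forall>n. \<exists>\<xi>. \<rho> <= \<xi> \<and> \<xi> <= \<rho> + 4 * r n \<and> \<bar>ch 4 f \<tau> z \<xi>\<bar> <= ?B" by blast
  from choice[OF this] obtain \<xi> where xi: "\<And>n. \<rho> <= \<xi> n" "\<And>n. \<xi> n <= \<rho> + 4 * r n" "\<And>n. \<bar>ch 4 f \<tau> z (\<xi> n)\<bar> <= ?B" by blast
  have "(\<lambda>n. \<rho> + 4 * r n) \<longlonglongrightarrow> \<rho> + 4 * 0" by (intro tendsto_intros rl)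
  then have "\<xi> \<longlonglongrightarrow> \<rho>"
    by (intro tendsto_sandwich[OF _ _ tendsto_const[of \<rho>], of \<xi> sequentially "\<lambda>n. \<rho> + 4 * r n"]) (use xi in auto)
  then have "(\<lambda>n. ch 4 f \<tau> z (\<xi> n)) \<longlonglongrightarrow> ch 4 f \<tau> z \<rho>"
    by (rule continuous_on_tendsto_compose[OF ch_4_continuous[OF t]]) auto
  then show ?thesis
    by (intro LIMSEQ_le_const2[OF tendsto_rabs]) (use xi(3) in auto)
qed

lemma
  assumes t: "0 < \<tau>" and j: "j <= 4"
  shows ch_swap: "(LBINT z. ch j f \<tau> z \<rho> * J z) = (LBINT x. (LBINT z. nj k j f \<tau> z (x + \<rho> *\<^sub>R z) * J z) * u0 x)"
    and integrable_ch_swap: "integrable lborel (\<lambda>x. (LBINT z. nj k j f \<tau> z (x + \<rho> *\<^sub>R z) * J z) * u0 x)"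
proof -
  define L where "L = max 1 (\<bar>\<rho>\<bar> + 1) powr k"
  define B where "B z = nb k j f \<tau> * L * (norm z ^ j * kw k z * J z)" for z :: "real ^ 'n"
  have [measurable]: "B \<in> borel_measurable borel" unfolding B_def by measurable
  have iB: "integrable lborel B" unfolding B_def using j by (intro integrable_mult_right J_integrable_power) auto
  have "integrable (lborel \<Otimes>\<^sub>M lborel) (\<lambda>(x, z). (wt k x * u0 x) * B z)"
  proof (rule lborel_pair.Fubini_integrable)
    show "integrable lborel (\<lambda>x. LINT y|lborel. norm (case (x, y) of (x, z) => wt k x * u0 x * B z))"
      using u0i iB by (simp add: abs_mult u0_nonneg)
    show "AE x in lborel. integrable lborel (\<lambda>y. case (x, y) of (x, z) => wt k x * u0 x * B z)"
      using iB by auto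
  qed measurable
  then have I: "integrable (lborel \<Otimes>\<^sub>M lborel) (\<lambda>(x, z). nj k j f \<tau> z (x + \<rho> *\<^sub>R z) * J z * u0 x)"
  proof (rule Bochner_Integration.integrable_bound)
    have "\<bar>nj k j f \<tau> z (x + \<rho> *\<^sub>R z) * J z * u0 x\<bar> <= (wt k x * u0 x) * B z" for x z
    proof -
      have "\<bar>nj k j f \<tau> z (x + \<rho> *\<^sub>R z)\<bar> <= nb k j f \<tau> * (norm z ^ j * kw k ((\<bar>\<rho>\<bar> + 1) *\<^sub>R z)) * wt k x"
        by (rule nj_ray_bound[OF k0 t j]) simp
      also have "... <= nb k j f \<tau> * (norm z ^ j * (L * kw k z)) * wt k x"
        unfolding L_def by (intro mult_right_mono mult_left_mono kw_scale_le k0 nb_nonneg t) auto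
      finally have "\<bar>nj k j f \<tau> z (x + \<rho> *\<^sub>R z)\<bar> * J z * u0 x <= nb k j f \<tau> * (norm z ^ j * (L * kw k z)) * wt k x * J z * u0 x"
        by (intro mult_right_mono J0 u0_nonneg)
      then show ?thesis by (simp add: abs_mult J0 u0_nonneg B_def ac_simps)
    qed
    then show "AE xz in lborel \<Otimes>\<^sub>M lborel. norm (case xz of (x, z) => nj k j f \<tau> z (x + \<rho> *\<^sub>R z) * J z * u0 x) <= norm (case xz of (x, z) => wt k x * u0 x * B z)"
      by (intro AE_I2) (auto simp: split_beta' simp del: abs_mult intro: order.trans[OF _ abs_ge_self])
  qed measurable
  from lborel_pair.Fubini_integral[OF this]
  have e: "(LBINT z. (LBINT x. nj k j f \<tau> z (x + \<rho> *\<^sub>R z) * J z * u0 x)) = (LBINT x. (LBINT z. nj k j f \<tau> z (x + \<rho> *\<^sub>R z) * J z * u0 x))" .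
  have "(LBINT z. ch j f \<tau> z \<rho> * J z) = (LBINT z. (LBINT x. nj k j f \<tau> z (x + \<rho> *\<^sub>R z) * J z * u0 x))"
    unfolding ch_def by (simp only: flip: integral_mult_left_zero) (simp only: mult_ac)
  also note e
  finally show "(LBINT z. ch j f \<tau> z \<rho> * J z) = (LBINT x. (LBINT z. nj k j f \<tau> z (x + \<rho> *\<^sub>R z) * J z) * u0 x)"
    by simp
  show "integrable lborel (\<lambda>x. (LBINT z. nj k j f \<tau> z (x + \<rho> *\<^sub>R z) * J z) * u0 x)"
    using lborel_pair.integrable_fst'[OF I] by simp
qed

text \<open>The expansion of the pointwise case, now averaged over the datum first. As no power of
  1/\<tau> occurs, the bound does not deteriorate as s tends to 0; the price is the norm of
  \<open>f\<close> in place of its local growth.\<close>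

lemma Rop_integrated_bound:
  obtains C where "0 <= C"
    "\<And>eps s f. 0 < eps ==> eps <= 1 ==> 0 < s ==> s <= 1 ==> \<bar>U0 (blf (Rop eps s) f)\<bar> <= C * eps\<^sup>2 * norm f"
proof -
  define I where "I = (LBINT x. wt k x * m x)"
  have I0: "0 <= I" unfolding I_def by (intro integral_nonneg_AE) (auto simp: m_nonneg)
  define N where "N = 3 powr k * (10 * hkM TYPE('n) (k + 4))"
  have N0: "0 <= N" unfolding N_def by (intro mult_nonneg_nonneg hkM_nonneg) auto
  \<comment> \<open>81 = 3^4 because exp s <= 3 for s <= 1. One factor \<open>3 powr k\<close>,
    inside \<open>N\<close>, pays for the width of the kernel, the other for the length of the
    jump.\<close>
  define C where "C = 81 * (N * 3 powr k * I) * MJ k / 24"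
  have "\<bar>U0 (blf (Rop eps s) f)\<bar> <= C * eps\<^sup>2 * norm f" if e: "0 < eps" "eps <= 1" and s: "0 < s" "s <= 1" for eps s f
  proof -
    define \<tau> where "\<tau> = tau s"
    have t: "0 < \<tau>" using s by (simp add: \<tau>_def tau_pos)
    define \<sigma> where "\<sigma> = eps * exp s"
    have s0: "0 < \<sigma>" using e by (simp add: \<sigma>_def)
    have es: "exp s <= 3" using exp_le s exp_le_cancel_iff[of s 1] by linarith
    have "eps * exp s <= 1 * 3" using e es by (intro mult_mono) auto
    then have s3: "\<sigma> <= 3" by (simp add: \<sigma>_def)
    have nb0: "nb k 0 f \<tau> <= norm f * N"
    proof -
      have "max 1 (sqrt \<tau>) powr k <= 3 powr k"
        using tau_le[of s] es k0 by (intro powr_mono2) (auto simp: \<tau>_def)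
      then show ?thesis unfolding nb_def N_def by (intro mult_left_mono mult_mono) (auto intro!: mult_nonneg_nonneg hkM_nonneg)
    qed
    define \<Delta> where "\<Delta> = (LBINT x. ev k (blf (cop k (dHk \<tau>)) f) x * u0 x)"
    define E where "E = norm f * (N * 3 powr k * I)"
    have "\<bar>(LBINT z. ch 0 f \<tau> z \<sigma> * J z) - (LBINT z. ch 0 f \<tau> z 0 * J z) - \<sigma>\<^sup>2 * \<Delta>\<bar> <= \<sigma> ^ 4 * (E * MJ k) / 24"
    proof (rule taylor_J[OF s0, where D="\<lambda>j. nb k j f \<tau> * I0" and chi="\<lambda>j. ch j f \<tau>"])
      show "(ch j f \<tau> z has_real_derivative ch (Suc j) f \<tau> z \<rho>) (at \<rho>)" if "j < 4" for j z \<rho>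
        by (rule ch_has_derivative[OF t that])
      show "(\<lambda>z. ch j f \<tau> z \<rho>) \<in> borel_measurable borel" for j \<rho>
        unfolding ch_def by measurable
      show "\<bar>ch j f \<tau> z \<rho>\<bar> <= nb k j f \<tau> * I0 * (norm z ^ j * kw k (\<rho> *\<^sub>R z))" if "j <= 4" for j z \<rho>
        by (rule ch_bound[OF t that])
      show "0 <= nb k j f \<tau> * I0" for j by (intro mult_nonneg_nonneg nb_nonneg t I0_nonneg)
      show "(LBINT z. ch 1 f \<tau> z 0 * J z) = 0"
        using nj_moments(1)[OF t] by (subst ch_swap[OF t]) auto
      show "(LBINT z. ch 2 f \<tau> z 0 * J z) = 2 * \<Delta>"
        using nj_moments(2)[OF t] by (subst ch_swap[OF t]) (auto simp: \<Delta>_def mult.assoc)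
      show "(LBINT z. ch 3 f \<tau> z 0 * J z) = 0"
        using nj_moments(3)[OF t] by (subst ch_swap[OF t]) auto
      show "\<bar>ch 4 f \<tau> z \<rho>\<bar> <= E * (norm z ^ 4 * kw k z)" if r: "0 <= \<rho>" "\<rho> <= \<sigma>" for z \<rho>
      proof -
        have "kw k (\<rho> *\<^sub>R z) <= kw k (3 *\<^sub>R z)"
          using r s3 by (intro kw_norm_mono k0) (auto intro!: mult_right_mono)
        also have "... <= 3 powr k * kw k z" using kw_scale_le[OF k0, of 3 z] by simp
        finally have kz: "kw k (\<rho> *\<^sub>R z) <= 3 powr k * kw k z" .
        have "\<bar>ch 4 f \<tau> z \<rho>\<bar> <= nb k 0 f \<tau> * (norm z ^ 4 * kw k (\<rho> *\<^sub>R z)) * I"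
          unfolding I_def by (rule ch_4_bound[OF t])
        also have "... <= (norm f * N) * (norm z ^ 4 * (3 powr k * kw k z)) * I"
          by (intro mult_right_mono mult_mono mult_left_mono nb0 kz I0) (auto intro!: mult_nonneg_nonneg N0)
        finally show ?thesis by (simp add: E_def ac_simps)
      qed
    qed simp
    from mult_left_mono[OF this, of "1 / eps\<^sup>2"]
    have b1: "\<bar>(1 / eps\<^sup>2) * ((LBINT z. ch 0 f \<tau> z \<sigma> * J z) - (LBINT z. ch 0 f \<tau> z 0 * J z) - \<sigma>\<^sup>2 * \<Delta>)\<bar>
        <= (1 / eps\<^sup>2) * (\<sigma> ^ 4 * (E * MJ k) / 24)"
      by (simp only: abs_mult abs_divide) simp
    have b2: "(1 / eps\<^sup>2) * ((LBINT z. ch 0 f \<tau> z \<sigma> * J z) - (LBINT z. ch 0 f \<tau> z 0 * J z) - \<sigma>\<^sup>2 * \<Delta>) = U0 (blf (Rop eps s) f)"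
    proof -
      have i: "integrable lborel (\<lambda>x. (LBINT z. nj k 0 f \<tau> z (x + \<rho> *\<^sub>R z) * J z) * u0 x)" for \<rho>
        by (rule integrable_ch_swap[OF t]) simp
      have i0: "integrable lborel (\<lambda>x. (LBINT z. nj k 0 f \<tau> z x * J z) * u0 x)" using i[of 0] by simp
      have i2: "integrable lborel (\<lambda>x. \<sigma>\<^sup>2 * (ev k (blf (cop k (dHk \<tau>)) f) x * u0 x))"
        by (intro integrable_mult_right integrable_ev_u0)
      have "U0 (blf (Rop eps s) f) = (LBINT x. (1 / eps\<^sup>2) * ((LBINT z. nj k 0 f \<tau> z (x + \<sigma> *\<^sub>R z) * J z) * u0 x
        - (LBINT z. nj k 0 f \<tau> z x * J z) * u0 x - \<sigma>\<^sup>2 * (ev k (blf (cop k (dHk \<tau>)) f) x * u0 x)))"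
        unfolding U0_def ev_Rop[OF e(1) s(1)] \<sigma>_def[symmetric] \<tau>_def[symmetric]
        by (intro Bochner_Integration.integral_cong refl) (simp only: left_diff_distrib right_diff_distrib mult.assoc)
      also have "... = (1 / eps\<^sup>2) * ((LBINT x. (LBINT z. nj k 0 f \<tau> z (x + \<sigma> *\<^sub>R z) * J z) * u0 x)
        - (LBINT x. (LBINT z. nj k 0 f \<tau> z x * J z) * u0 x) - \<sigma>\<^sup>2 * \<Delta>)"
        unfolding \<Delta>_def
        by (simp only: integral_mult_right_zero Bochner_Integration.integral_diff[OF Bochner_Integration.integrable_diff[OF i i0] i2]
            Bochner_Integration.integral_diff[OF i i0])
      finally show ?thesis using ch_swap[OF t, of 0 f \<sigma>] ch_swap[OF t, of 0 f 0] by simp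
    qed
    from b1 have "\<bar>U0 (blf (Rop eps s) f)\<bar> <= (1 / eps\<^sup>2) * (\<sigma> ^ 4 * (E * MJ k) / 24)" unfolding b2 .
    also have "(1 / eps\<^sup>2) * (\<sigma> ^ 4 * (E * MJ k) / 24) = (eps ^ 4 / eps\<^sup>2) * (exp s ^ 4 * (E * MJ k / 24))"
      by (simp add: \<sigma>_def power_mult_distrib)
    also have "eps ^ 4 / eps\<^sup>2 = eps\<^sup>2" using e by (simp add: power4_eq_xxxx power2_eq_square)
    also have "eps\<^sup>2 * (exp s ^ 4 * (E * MJ k / 24)) <= eps\<^sup>2 * (3 ^ 4 * (E * MJ k / 24))"
      using es MJ_nonneg[of k] N0 I0 unfolding E_def
      by (intro mult_left_mono mult_right_mono power_mono divide_nonneg_nonneg mult_nonneg_nonneg) auto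
    also have "... = C * eps\<^sup>2 * norm f" by (simp add: C_def E_def)
    finally show ?thesis .
  qed
  moreover have "0 <= C" using N0 I0 MJ_nonneg[of k] by (simp add: C_def)
  ultimately show ?thesis using that by blast
qed

end

subsection \<open>Comparison of the two evolutions\<close>

lemma derivative_bound_diff:
  fixes F \<Phi> :: "real => real"
  assumes ab: "a <= b"
    and F: "\<And>s. a <= s ==> s <= b ==> (F has_real_derivative F' s) (at s)"
    and \<Phi>: "\<And>s. a <= s ==> s <= b ==> (\<Phi> has_real_derivative \<Phi>' s) (at s)"
    and le: "\<And>s. a <= s ==> s <= b ==> \<bar>F' s\<bar> <= \<Phi>' s"
  shows "\<bar>F b - F a\<bar> <= \<Phi> b - \<Phi> a"
proof -
  have "\<Phi> a - F a <= \<Phi> b - F b"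
  proof (rule DERIV_nonneg_imp_nondecreasing[OF ab])
    fix s assume "a <= s" "s <= b"
    then show "\<exists>y. ((\<lambda>s. \<Phi> s - F s) has_real_derivative y) (at s) \<and> 0 <= y"
      using le[of s] by (intro exI[of _ "\<Phi>' s - F' s"] conjI DERIV_diff F \<Phi>) auto
  qed
  moreover have "\<Phi> a + F a <= \<Phi> b + F b"
  proof (rule DERIV_nonneg_imp_nondecreasing[OF ab])
    fix s assume "a <= s" "s <= b"
    then show "\<exists>y. ((\<lambda>s. \<Phi> s + F s) has_real_derivative y) (at s) \<and> 0 <= y"
      using le[of s] by (intro exI[of _ "\<Phi>' s + F' s"] conjI DERIV_add F \<Phi>) auto
  qed
  ultimately show ?thesis by linarith
qed

lemma cop_heat_one: "0 <= k ==> 0 < \<tau> ==> blf (cop k (Hk \<tau>)) (onek k) = onek k"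
  by (rule ev_inject[of k]) (simp add: ev_cop wkernel_heat integral_heat_kernel)

text \<open>Conservation of mass, differentiated in \<tau>.\<close>

lemma cop_dHk_one:
  fixes x :: "real ^ 'n"
  assumes k: "0 <= k" and t: "0 < \<tau>"
  shows "ev k (blf (cop k (dHk \<tau>)) (onek k)) x = 0"
proof -
  have "((\<lambda>\<tau>. ev k (blf (cop k (Hk \<tau>)) (onek k)) x) has_vector_derivative ev k (blf (cop k (dHk \<tau>)) (onek k)) x) (at \<tau>)"
    by (rule bounded_linear.has_vector_derivative[OF bounded_linear_compose[OF bounded_linear_ev blf.bounded_linear_left] heat_operator_derivative[OF k t]])
  then have "((\<lambda>\<tau>. 1) has_vector_derivative ev k (blf (cop k (dHk \<tau>)) (onek k)) x) (at \<tau>)"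
    by (rule has_vector_derivative_transform_within_open[of _ _ _ "{0<..}"]) (use t k in \<open>auto simp: cop_heat_one\<close>)
  then show ?thesis
    using vector_derivative_unique_at[OF has_vector_derivative_const] by metis
qed

context jump_kernel
begin

lemma lyapunov_abs:
  obtains c C where "0 < c" "0 <= C" "\<And>eps s t f a x. 0 < eps ==> eps <= 1 ==> 0 <= s ==> s <= t ==> 0 <= a ==>
    (\<forall>x. \<bar>ev k f x\<bar> <= a * om t x) ==> \<bar>ev k (blf (Pop eps s t) f) x\<bar> <= a * (exp (- c * (t - s)) * om s x + C)"
proof -
  obtain c C where c: "0 < c" "0 <= C" and l: "\<And>eps s t x. 0 < eps ==> eps <= 1 ==> 0 <= s ==> s <= t ==>
    ev k (blf (Pop eps s t) (W t)) x <= exp (- c * (t - s)) * om s x + C"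
    by (rule lyapunov) (rule that; assumption)
  show thesis
  proof (rule that[OF c])
    fix eps s t a :: real and f :: "(real ^ 'n) \<Rightarrow>\<^sub>C real" and x
    assume e: "0 < eps" "eps <= 1" and s: "0 <= s" "s <= t" and a: "0 <= a" and "\<forall>x. \<bar>ev k f x\<bar> <= a * om t x"
    then have f: "\<bar>ev k f x\<bar> <= a * om t x" for x by blast
    have p: "bpos (Pop eps s t)" by (rule bpos_Pop[OF e(1) s])
    have "ev k g x <= ev k (a *\<^sub>R W t) x" if "g = f \<or> g = - f" for g x
      using f[of x] s that by (auto simp: ev_W abs_le_iff)
    then have "ev k (blf (Pop eps s t) g) x <= ev k (blf (Pop eps s t) (a *\<^sub>R W t)) x" if "g = f \<or> g = - f" for g
      using that by (intro bpos_mono p) auto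
    from this[of f] this[of "- f"]
    have "\<bar>ev k (blf (Pop eps s t) f) x\<bar> <= a * ev k (blf (Pop eps s t) (W t)) x"
      by (simp add: blf.minus_right blf.scaleR_right abs_le_iff)
    also have "... <= a * (exp (- c * (t - s)) * om s x + C)"
      by (intro mult_left_mono l e s a)
    finally show "\<bar>ev k (blf (Pop eps s t) f) x\<bar> <= a * (exp (- c * (t - s)) * om s x + C)" .
  qed
qed

lemma Rop_one: "0 < eps ==> 0 < s ==> ev k (blf (Rop eps s) (onek k)) x = 0"
  unfolding Rop_def Nop_def
  by (simp add: cop_heat_one k0 tau_pos gen_def K_one cop_dHk_one)

text \<open>The function is split at the height of the Lyapunov constant: the truncated part is smoothed
  by the first half of the evolution, the excess has been damped by the second half.\<close>

lemma Rop_Pop_decay: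
  obtains C \<eta> where "0 <= C" "0 < \<eta>" "\<And>eps s T f x. 0 < eps ==> eps <= 1 ==> 1 <= s ==> s <= T ==>
    (\<forall>x. \<bar>ev k f x\<bar> <= om T x) ==> \<bar>ev k (blf (Rop eps s) (blf (Pop eps s T) f)) x\<bar> <= C * eps\<^sup>2 * exp (- \<eta> * (T - s)) * wt k x"
proof -
  obtain c C where c: "0 < c" "0 <= C" and ly: "\<And>eps s t f a x. 0 < eps ==> eps <= 1 ==> 0 <= s ==> s <= t ==> 0 <= a ==>
    (\<forall>x. \<bar>ev k f x\<bar> <= a * om t x) ==> \<bar>ev k (blf (Pop eps s t) f) x\<bar> <= a * (exp (- c * (t - s)) * om s x + C)"
    by (rule lyapunov_abs) (rule that; assumption)
  obtain S \<delta> where S: "0 <= S" "0 < \<delta>" and sm: "\<And>eps s t v. 0 < eps ==> eps <= 1 ==> 0 <= s ==> s <= t ==>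
    sbd k ((shop k v - 1) * Pop eps s t) (S * (1 + exp (- s) * norm v) * exp (- \<delta> * (t - s)))"
    by (rule smoothing) (rule that; assumption)
  have le1: "1 <= k + 1" and le2: "k <= k + 1" using k0 by auto
  obtain R1 where R1: "0 <= R1" and r1: "\<And>eps s f x A. 0 < eps ==> eps <= 1 ==> 1 <= s ==> 0 <= A ==>
    (\<forall>y. \<bar>ev k f (x + y)\<bar> <= A * kw 1 (exp (- s) *\<^sub>R y)) ==> \<bar>ev k (blf (Rop eps s) f) x\<bar> <= R1 * eps\<^sup>2 * A"
    by (rule Rop_pointwise_bound[of 1, OF zero_le_one le1]) (rule that; assumption)
  obtain R2 where R2: "0 <= R2" and r2: "\<And>eps s f x A. 0 < eps ==> eps <= 1 ==> 1 <= s ==> 0 <= A ==>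
    (\<forall>y. \<bar>ev k f (x + y)\<bar> <= A * kw k (exp (- s) *\<^sub>R y)) ==> \<bar>ev k (blf (Rop eps s) f) x\<bar> <= R2 * eps\<^sup>2 * A"
    by (rule Rop_pointwise_bound[of k, OF k0 le2]) (rule that; assumption)
  \<comment> \<open>Each of the two decay mechanisms acts on one half of [s, T], which halves its
    rate.\<close>
  define \<eta> where "\<eta> = min \<delta> c / 2"
  have eta: "0 < \<eta>" using S c by (simp add: \<eta>_def)
  show thesis
  proof (rule that[of "R1 * (S * C) + R2 * (1 + C)" \<eta>])
    show "0 <= R1 * (S * C) + R2 * (1 + C)" using S R1 R2 c by (intro add_nonneg_nonneg mult_nonneg_nonneg) auto
    fix eps s T :: real and f :: "(real ^ 'n) \<Rightarrow>\<^sub>C real" and x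
    assume e: "0 < eps" "eps <= 1" and s: "1 <= s" "s <= T" and f: "\<forall>x. \<bar>ev k f x\<bar> <= om T x"
    define r where "r = (s + T) / 2"
    have r: "0 <= s" "s <= r" "r <= T" "0 <= r" "r - s = (T - s) / 2" "T - r = (T - s) / 2" using s by (auto simp: r_def field_simps)
    define q where "q = exp (- \<eta> * (T - s))"
    have q: "exp (- \<delta> * (r - s)) <= q" "exp (- c * (T - r)) <= q" "0 <= q"
    proof -
      have le: "\<eta> <= \<delta> / 2" "\<eta> <= c / 2" by (auto simp: \<eta>_def)
      have Ts: "0 <= T - s" using s by simp
      have "\<eta> * (T - s) <= \<delta> / 2 * (T - s)" "\<eta> * (T - s) <= c / 2 * (T - s)"
        by (rule mult_right_mono[OF le(1) Ts], rule mult_right_mono[OF le(2) Ts])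
      then show "exp (- \<delta> * (r - s)) <= q" "exp (- c * (T - r)) <= q" by (simp_all add: q_def r(5,6))
    qed (simp add: q_def)
    define g where "g = blf (Pop eps r T) f"
    have g: "\<bar>ev k g x\<bar> <= q * om r x + C" for x
    proof -
      have "\<bar>ev k g x\<bar> <= 1 * (exp (- c * (T - r)) * om r x + C)"
        unfolding g_def by (rule ly) (use e r f in auto)
      moreover have "exp (- c * (T - r)) * om r x <= q * om r x" by (intro mult_right_mono q) simp
      ultimately show ?thesis unfolding mult_1_left by (rule order.trans[OF _ add_right_mono])
    qed
    \<comment> \<open>Cutting at height C leaves an excess of at most q times the Lyapunov weight,
      because C is the part of the Lyapunov bound that does not decay.\<close>
    define g1 where "g1 = mk k (\<lambda>x. max (- C) (min C (ev k g x)))"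
    have g1e: "ev k g1 x = max (- C) (min C (ev k g x))" for x
      unfolding g1_def
    proof (rule ev_mk[where C=C])
      show "\<bar>max (- C) (min C (ev k g x))\<bar> <= C * wt k x" for x
        using c mult_left_mono[OF wt_ge_1[OF k0], of C x] by (auto simp: abs_le_iff)
    qed (intro continuous_intros)
    define g2 where "g2 = g - g1"
    have g1: "\<bar>ev k g1 x\<bar> <= C" for x using c by (auto simp: g1e abs_le_iff)
    have g2: "\<bar>ev k g2 x\<bar> <= q * om r x" for x
      using g[of x] c mult_nonneg_nonneg[OF q(3) om_nonneg[of r x]] by (auto simp: g2_def g1e abs_le_iff)
    define h1 where "h1 = blf (Pop eps s r) g1"
    define h2 where "h2 = blf (Pop eps s r) g2"
    have h: "blf (Pop eps s T) f = h1 + h2"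
      unfolding Pop_split[OF e(1), of s T r] h1_def h2_def by (simp add: g2_def g_def flip: blf.add_right)
    \<comment> \<open>Subtracting the value at x is free and turns the smoothing estimate into a
      growth bound of order \<open>kw 1\<close> around x.\<close>
    have "ev k (blf (Rop eps s) (h1 - ev k h1 x *\<^sub>R onek k)) x = ev k (blf (Rop eps s) h1) x"
      using e s Rop_one[of eps s x] by (simp add: blf.diff_right blf.scaleR_right)
    moreover have "\<bar>ev k (blf (Rop eps s) (h1 - ev k h1 x *\<^sub>R onek k)) x\<bar> <= R1 * eps\<^sup>2 * (S * q * C)"
    proof (rule r1[OF e s(1) _ allI])
      show "0 <= S * q * C" using S q c by simp
      fix y
      have "\<bar>ev k (h1 - ev k h1 x *\<^sub>R onek k) (x + y)\<bar> = \<bar>ev k (blf ((shop k y - 1) * Pop eps s r) g1) x\<bar>"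
        by (simp add: h1_def ev_shop k0)
      also have "... <= S * (1 + exp (- s) * norm y) * exp (- \<delta> * (r - s)) * C"
        by (rule sbdD[OF sm[OF e r(1,2)] g1])
      also have "... <= S * (1 + exp (- s) * norm y) * q * C"
        using S c by (intro mult_right_mono mult_left_mono q) auto
      also have "1 + exp (- s) * norm y = kw 1 (exp (- s) *\<^sub>R y)"
        by (simp add: kw_def)
      finally show "\<bar>ev k (h1 - ev k h1 x *\<^sub>R onek k) (x + y)\<bar> <= S * q * C * kw 1 (exp (- s) *\<^sub>R y)"
        by (simp only: mult_ac)
    qed
    ultimately have 1: "\<bar>ev k (blf (Rop eps s) h1) x\<bar> <= R1 * eps\<^sup>2 * (S * q * C)" by simp
    have "R1 * eps\<^sup>2 * (S * q * C) * 1 <= R1 * eps\<^sup>2 * (S * q * C) * wt k x"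
      using R1 S q c by (intro mult_left_mono wt_ge_1 k0) auto
    with 1 have 1: "\<bar>ev k (blf (Rop eps s) h1) x\<bar> <= R1 * eps\<^sup>2 * (S * q * C) * wt k x" by linarith
    have h2: "\<bar>ev k h2 y\<bar> <= q * (1 + C) * om s y" for y
    proof -
      have "\<bar>ev k h2 y\<bar> <= q * (exp (- c * (r - s)) * om s y + C)"
        unfolding h2_def by (rule ly) (use e r q g2 in auto)
      also have "... <= q * (1 * om s y + C * om s y)"
        using c r mult_left_mono[OF om_ge_1[of s y], of C] by (intro mult_left_mono add_mono mult_right_mono q) auto
      finally show ?thesis by (simp add: algebra_simps)
    qed
    have "\<bar>ev k (blf (Rop eps s) h2) x\<bar> <= R2 * eps\<^sup>2 * (q * (1 + C) * wt k x)"
    proof (rule r2[OF e s(1) _ allI])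
      show "0 <= q * (1 + C) * wt k x" using q c by simp
      fix y
      have "\<bar>ev k h2 (x + y)\<bar> <= q * (1 + C) * (om s x * kw k (exp (- s) *\<^sub>R y))"
        by (rule order.trans[OF h2]) (intro mult_left_mono om_add, use q c in simp)
      also have "... <= q * (1 + C) * (wt k x * kw k (exp (- s) *\<^sub>R y))"
        using q c r by (intro mult_left_mono mult_right_mono om_le_wt) auto
      finally show "\<bar>ev k h2 (x + y)\<bar> <= q * (1 + C) * wt k x * kw k (exp (- s) *\<^sub>R y)" by (simp only: mult_ac)
    qed
    with 1 have "\<bar>ev k (blf (Rop eps s) (h1 + h2)) x\<bar> <= R1 * eps\<^sup>2 * (S * q * C) * wt k x + R2 * eps\<^sup>2 * (q * (1 + C) * wt k x)"
      unfolding blf.add_right ev_linear by linarith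
    also have "... = (R1 * (S * C) + R2 * (1 + C)) * eps\<^sup>2 * q * wt k x" by algebra
    finally show "\<bar>ev k (blf (Rop eps s) (blf (Pop eps s T) f)) x\<bar> <= (R1 * (S * C) + R2 * (1 + C)) * eps\<^sup>2 * exp (- \<eta> * (T - s)) * wt k x"
      unfolding h q_def .
  qed (rule eta)
qed

lemma Nop_has_vector_derivative:
  assumes s: "0 < s"
  shows "(Nop has_vector_derivative exp (2 * s) *\<^sub>R cop k (dHk (tau s))) (at s)"
proof -
  have "(tau has_vector_derivative exp (2 * s)) (at s)"
    unfolding tau_def has_real_derivative_iff_has_vector_derivative[symmetric] by (auto intro!: derivative_eq_intros)
  from vector_diff_chain_at[OF this heat_operator_derivative[OF k0 tau_pos[OF s]]]
  show ?thesis by (simp add: Nop_def[abs_def] comp_def)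
qed

text \<open>The heat flow contributes its generator and the jump evolution minus its own. Since
  everything commutes, the difference can be collected in front of \<open>Pop\<close>.\<close>

lemma Nop_Pop_has_vector_derivative:
  assumes e: "0 < eps" and s: "0 < s"
  shows "((\<lambda>s. Nop s * Pop eps s T) has_vector_derivative - (Rop eps s * Pop eps s T)) (at s)"
proof -
  have "((\<lambda>s. Pop eps s T) has_vector_derivative - (Pop eps s T * gen eps s)) (at s within {0..s + 1})"
    using s by (intro Pop_has_vector_derivative_lower e) auto
  then have P: "((\<lambda>s. Pop eps s T) has_vector_derivative - (Pop eps s T * gen eps s)) (at s)"
    using s by (simp add: at_within_Icc_at)
  have c: "Nop s * gen eps s = gen eps s * Nop s"
    using s unfolding Nop_def by (intro commute_gen e) (auto simp: K_def intro!: cop_commute k0 wkernel_rescale_J wkernel_heat tau_pos)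
  have "Nop s * (Pop eps s T * gen eps s) = gen eps s * Nop s * Pop eps s T"
    unfolding gen_commute_Pop[OF e, symmetric] mult.assoc[symmetric] c ..
  then have "Nop s * - (Pop eps s T * gen eps s) + exp (2 * s) *\<^sub>R cop k (dHk (tau s)) * Pop eps s T = - (Rop eps s * Pop eps s T)"
    by (simp add: Rop_def left_diff_distrib)
  with has_vector_derivative_mult[OF Nop_has_vector_derivative[OF s] P] show ?thesis by simp
qed

text \<open>With the kernel fixed at time 1, the limit s -> 0 becomes continuity in the dilation of
  the argument.\<close>

lemma ev_Nop:
  assumes s: "0 < s"
  shows "ev k (blf (Nop s) g) x = (LBINT z. ev k g (x + sqrt (tau s) *\<^sub>R z) * Hk 1 z)"
proof -
  have t: "0 < tau s" using s by (rule tau_pos)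
  have "ev k (blf (Nop s) g) x = (LBINT y. ev k g (x + y) * rescale (sqrt (tau s)) (Hk 1) y)"
    unfolding Nop_def heat_kernel_rescale[OF t, symmetric] by (rule ev_cop[OF k0 wkernel_heat[OF k0 t]])
  also have "... = (LBINT z. ev k g (x + sqrt (tau s) *\<^sub>R z) * Hk 1 z)"
    using t by (intro integral_rescale) auto
  finally show ?thesis .
qed

lemma ev_scaled_heat:
  fixes g :: "(real ^ 'n) \<Rightarrow>\<^sub>C real"
  assumes "\<bar>\<rho>\<bar> <= R"
  shows "\<bar>ev k g (x + \<rho> *\<^sub>R z) * Hk 1 z\<bar> <= norm g * wt k x * (max 1 (R + 1) powr k * (kw k z * Hk 1 z))"
proof -
  have "kw k (\<rho> *\<^sub>R z) <= kw k ((R + 1) *\<^sub>R z)"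
    using assms by (intro kw_norm_mono k0) (auto intro!: mult_right_mono)
  also have "... <= max 1 (R + 1) powr k * kw k z" using assms by (intro kw_scale_le k0) auto
  finally have "norm g * wt k x * kw k (\<rho> *\<^sub>R z) <= norm g * wt k x * (max 1 (R + 1) powr k * kw k z)"
    by (intro mult_left_mono) auto
  with ev_shift_bound[OF k0, of g x "\<rho> *\<^sub>R z"]
  have "\<bar>ev k g (x + \<rho> *\<^sub>R z)\<bar> * Hk 1 z <= norm g * wt k x * (max 1 (R + 1) powr k * kw k z) * Hk 1 z"
    by (intro mult_right_mono heat_kernel_nonneg) auto
  then show ?thesis by (simp add: abs_mult heat_kernel_nonneg mult.assoc)
qed

lemma integrable_kw_Hk: "integrable lborel (\<lambda>z :: real ^ 'n. kw k z * Hk 1 z)"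
proof -
  have "wkernel k (Hk 1 :: real ^ 'n => real)" by (rule wkernel_heat[OF k0]) simp
  then show ?thesis by (simp add: wkernel_def heat_kernel_nonneg)
qed

lemma integrable_scaled_heat:
  fixes g :: "(real ^ 'n) \<Rightarrow>\<^sub>C real"
  shows "integrable lborel (\<lambda>z. ev k g (x + \<rho> *\<^sub>R z) * Hk 1 z)"
  by (rule Bochner_Integration.integrable_bound[OF integrable_mult_right[OF integrable_mult_right[OF integrable_kw_Hk]]])
     (use ev_scaled_heat[of \<rho> "\<bar>\<rho>\<bar>" g x, OF order.refl] in \<open>auto intro!: AE_I2 order.trans[OF _ abs_ge_self]\<close>)

lemma scaled_heat_bound:
  fixes g :: "(real ^ 'n) \<Rightarrow>\<^sub>C real"
  assumes "\<bar>\<rho>\<bar> <= R"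
  shows "\<bar>LBINT z. ev k g (x + \<rho> *\<^sub>R z) * Hk 1 z\<bar> <= norm g * wt k x * (max 1 (R + 1) powr k * (LBINT z. kw k z * Hk 1 (z :: real ^ 'n)))"
proof -
  have "\<bar>LBINT z. ev k g (x + \<rho> *\<^sub>R z) * Hk 1 z\<bar> <= (LBINT z. norm g * wt k x * (max 1 (R + 1) powr k * (kw k z * Hk 1 (z :: real ^ 'n))))"
  proof (rule order.trans[OF integral_abs_bound integral_mono])
    show "integrable lborel (\<lambda>z. \<bar>ev k g (x + \<rho> *\<^sub>R z) * Hk 1 z\<bar>)"
      by (intro integrable_abs integrable_scaled_heat)
    show "integrable lborel (\<lambda>z :: real ^ 'n. norm g * wt k x * (max 1 (R + 1) powr k * (kw k z * Hk 1 z)))"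
      by (intro integrable_mult_right integrable_kw_Hk)
  qed (rule ev_scaled_heat[OF assms])
  then show ?thesis by simp
qed

end

context jump_datum
begin

text \<open>Convergence in norm is not to be expected for a test function that is not uniformly
  continuous. Paired with the datum, dominated convergence suffices.\<close>

lemma Nop_tendsto: "((\<lambda>s. U0 (blf (Nop s) g)) \<longlongrightarrow> U0 g) (at_right 0)"
proof -
  define G where "G \<rho> = (LBINT x. (LBINT z. ev k g (x + \<rho> *\<^sub>R z) * Hk 1 z) * u0 x)" for \<rho> :: real
  define H where "H = (LBINT z. kw k z * Hk 1 (z :: real ^ 'n))"
  have "continuous_on UNIV G"
    unfolding G_def
  proof (rule continuous_on_param_integral)
    fix x :: "real ^ 'n"
    have "continuous_on UNIV (\<lambda>\<rho> :: real. (LBINT z. ev k g (x + \<rho> *\<^sub>R z) * Hk 1 z))"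
    proof (rule continuous_on_param_integral)
      fix R :: real
      have "integrable lborel (\<lambda>z :: real ^ 'n. norm g * wt k x * (max 1 (R + 1) powr k * (kw k z * Hk 1 z)))"
        by (intro integrable_mult_right integrable_kw_Hk)
      moreover have "\<forall>\<rho> z. norm \<rho> <= R \<longrightarrow> \<bar>ev k g (x + \<rho> *\<^sub>R z) * Hk 1 z\<bar> <= norm g * wt k x * (max 1 (R + 1) powr k * (kw k z * Hk 1 z))"
        unfolding real_norm_def by (intro allI impI ev_scaled_heat)
      ultimately show "\<exists>h. integrable lborel h \<and> (\<forall>\<rho> z. norm \<rho> <= R \<longrightarrow> \<bar>ev k g (x + \<rho> *\<^sub>R z) * Hk 1 z\<bar> <= h z)"
        by blast
    qed (auto intro!: continuous_intros)
    then show "continuous_on UNIV (\<lambda>\<rho> :: real. (LBINT z. ev k g (x + \<rho> *\<^sub>R z) * Hk 1 z) * u0 x)"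
      by (intro continuous_intros)
  next
    fix R :: real
    have "integrable lborel (\<lambda>x. norm g * (max 1 (R + 1) powr k * H) * (wt k x * u0 x))"
      by (intro integrable_mult_right u0i)
    moreover have "\<bar>(LBINT z. ev k g (x + \<rho> *\<^sub>R z) * Hk 1 z) * u0 x\<bar> <= norm g * (max 1 (R + 1) powr k * H) * (wt k x * u0 x)"
      if "norm \<rho> <= R" for \<rho> x
      using mult_right_mono[OF scaled_heat_bound[of \<rho> R g x] u0_nonneg[of x]] that
      by (simp add: abs_mult u0_nonneg H_def ac_simps)
    ultimately show "\<exists>h. integrable lborel h \<and> (\<forall>\<rho> x. norm \<rho> <= R \<longrightarrow> \<bar>(LBINT z. ev k g (x + \<rho> *\<^sub>R z) * Hk 1 z) * u0 x\<bar> <= h x)"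
      by blast
  qed measurable
  then have "isCont G 0" by (simp add: continuous_on_eq_continuous_at)
  moreover have "((\<lambda>s. sqrt (tau s)) \<longlongrightarrow> sqrt (tau 0)) (at_right 0)"
    unfolding tau_def by (intro tendsto_intros) simp
  then have "((\<lambda>s. sqrt (tau s)) \<longlongrightarrow> 0) (at_right 0)" by (simp add: tau_def)
  ultimately have "((\<lambda>s. G (sqrt (tau s))) \<longlongrightarrow> G 0) (at_right 0)"
    by (rule isCont_tendsto_compose)
  moreover have "\<forall>\<^sub>F s in at_right 0. G (sqrt (tau s)) = U0 (blf (Nop s) g)"
    unfolding eventually_at_right_field by (rule exI[of _ 1]) (auto simp: G_def U0_def ev_Nop)
  moreover have "G 0 = U0 g" by (simp add: G_def U0_def integral_heat_kernel)
  ultimately show ?thesis using tendsto_cong by fastforce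
qed

lemma norm_Nop_bounded: obtains B where "\<And>s. 0 < s ==> s <= 1 ==> norm (Nop s) <= B"
proof (rule that)
  fix s :: real assume s: "0 < s" "s <= 1"
  have e3: "sqrt (tau s) <= 3" using tau_le[of s] exp_le s exp_le_cancel_iff[of s 1] by linarith
  show "norm (Nop s) <= max 1 (3 + 1) powr k * (LBINT z. kw k z * Hk 1 (z :: real ^ 'n))"
  proof (rule norm_bop_le_ev[of _ k])
    show "0 <= max 1 (3 + 1) powr k * (LBINT z. kw k z * Hk 1 (z :: real ^ 'n))"
      by (intro mult_nonneg_nonneg integral_nonneg_AE AE_I2) (auto intro!: mult_nonneg_nonneg heat_kernel_nonneg)
    fix f x
    show "\<bar>ev k (blf (Nop s) f) x\<bar> <= max 1 (3 + 1) powr k * (LBINT z. kw k z * Hk 1 (z :: real ^ 'n)) * norm f * wt k x"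
      unfolding ev_Nop[OF s(1)]
      by (rule order.trans[OF scaled_heat_bound[of _ 3]]) (use e3 s tau_pos[of s] in \<open>auto simp: ac_simps\<close>)
  qed
qed

text \<open>\<open>Pop\<close> converges in norm and \<open>Nop\<close> only weakly; the bound on
  \<open>norm (Nop s)\<close> lets the two limits be combined.\<close>

lemma Nop_Pop_tendsto:
  assumes e: "0 < eps"
  shows "((\<lambda>s. U0 (blf (Nop s * Pop eps s T) f)) \<longlongrightarrow> U0 (blf (Pop eps 0 T) f)) (at_right 0)"
proof -
  obtain B where B: "\<And>s. 0 < s ==> s <= 1 ==> norm (Nop s) <= B" by (rule norm_Nop_bounded) blast
  have B0: "0 <= B" using B[of 1] norm_ge_zero[of "Nop 1"] by linarith
  have "((\<lambda>s. Pop eps s T) has_vector_derivative - (Pop eps 0 T * gen eps 0)) (at 0 within {0..1})"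
    by (rule Pop_has_vector_derivative_lower[OF e]) simp
  then have "((\<lambda>s. Pop eps s T) \<longlongrightarrow> Pop eps 0 T) (at 0 within {0..1})"
    using has_vector_derivative_continuous continuous_within by blast
  then have P: "((\<lambda>s. Pop eps s T) \<longlongrightarrow> Pop eps 0 T) (at_right 0)"
    by (simp add: at_within_Icc_at_right)
  have "((\<lambda>s. I0 * (B * norm (blf (Pop eps s T - Pop eps 0 T) f))) \<longlongrightarrow> I0 * (B * norm (blf (Pop eps 0 T - Pop eps 0 T) f))) (at_right 0)"
    by (intro tendsto_intros blf.tendsto P)
  then have l0: "((\<lambda>s. I0 * (B * norm (blf (Pop eps s T - Pop eps 0 T) f))) \<longlongrightarrow> 0) (at_right 0)" by simp
  have "((\<lambda>s. U0 (blf (Nop s) (blf (Pop eps s T - Pop eps 0 T) f))) \<longlongrightarrow> 0) (at_right 0)"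
  proof (rule Lim_null_comparison[OF _ l0])
    have "\<bar>U0 (blf (Nop s) (blf (Pop eps s T - Pop eps 0 T) f))\<bar> <= I0 * (B * norm (blf (Pop eps s T - Pop eps 0 T) f))" if s: "0 < s" "s < 1" for s
    proof -
      define h where "h = blf (Pop eps s T - Pop eps 0 T) f"
      have "\<bar>U0 (blf (Nop s) h)\<bar> <= norm (blf (Nop s) h) * I0" by (rule U0_bound[OF ev_bound])
      also have "norm (blf (Nop s) h) <= norm (Nop s) * norm h" by (rule norm_blf)
      also have "... <= B * norm h" using s by (intro mult_right_mono B) auto
      finally show ?thesis using I0_nonneg by (simp add: h_def mult_right_mono mult.commute)
    qed
    then show "\<forall>\<^sub>F s in at_right 0. norm (U0 (blf (Nop s) (blf (Pop eps s T - Pop eps 0 T) f))) <= I0 * (B * norm (blf (Pop eps s T - Pop eps 0 T) f))"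
      unfolding eventually_at_right_field by (intro exI[of _ 1]) auto
  qed
  from tendsto_add[OF this Nop_tendsto[of "blf (Pop eps 0 T) f"]]
  show ?thesis by (simp add: U0_linear[symmetric] blf.add_right[symmetric])
qed

text \<open>The derivative is available for s > 0 only, so the increment is estimated on [a, T] and
  then a tends to 0. The split at s = 1 joins the two bounds for the consistency error.\<close>

lemma evolution_comparison:
  obtains C where "0 <= C" "\<And>eps T f. 0 < eps ==> eps <= 1 ==> 0 < T ==> (\<forall>x. \<bar>ev k f x\<bar> <= om T x) ==>
    \<bar>U0 (blf (Nop T) f) - U0 (blf (Pop eps 0 T) f)\<bar> <= C * eps\<^sup>2"
proof -
  obtain c C where c: "0 < c" "0 <= C" and ly: "\<And>eps s t f a x. 0 < eps ==> eps <= 1 ==> 0 <= s ==> s <= t ==> 0 <= a ==>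
    (\<forall>x. \<bar>ev k f x\<bar> <= a * om t x) ==> \<bar>ev k (blf (Pop eps s t) f) x\<bar> <= a * (exp (- c * (t - s)) * om s x + C)"
    by (rule lyapunov_abs) (rule that; assumption)
  obtain A where A: "0 <= A" and short: "\<And>eps s f. 0 < eps ==> eps <= 1 ==> 0 < s ==> s <= 1 ==> \<bar>U0 (blf (Rop eps s) f)\<bar> <= A * eps\<^sup>2 * norm f"
    by (rule Rop_integrated_bound) (rule that; assumption)
  obtain B \<eta> where B: "0 <= B" "0 < \<eta>" and long: "\<And>eps s T f x. 0 < eps ==> eps <= 1 ==> 1 <= s ==> s <= T ==>
    (\<forall>x. \<bar>ev k f x\<bar> <= om T x) ==> \<bar>ev k (blf (Rop eps s) (blf (Pop eps s T) f)) x\<bar> <= B * eps\<^sup>2 * exp (- \<eta> * (T - s)) * wt k x"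
    by (rule Rop_Pop_decay) (rule that; assumption)
  \<comment> \<open>The first summand is the bound on an interval of length at most 1, with 1 + C
    bounding the norm of the evolved test function; the second comes from integrating exp (- \<eta>
    (T - s)), at most 1/\<eta>.\<close>
  define D where "D = A * (1 + C) + B * I0 / \<eta>"
  have D1: "0 <= B * I0 / \<eta>" using B I0_nonneg by simp
  have D2: "0 <= A * (1 + C)" using A c by simp
  have "\<bar>U0 (blf (Nop T) f) - U0 (blf (Pop eps 0 T) f)\<bar> <= D * eps\<^sup>2"
    if e: "0 < eps" "eps <= 1" and T: "0 < T" and f: "\<forall>x. \<bar>ev k f x\<bar> <= om T x" for eps T f
  proof -
    define F where "F s = U0 (blf (Nop s * Pop eps s T) f)" for s
    define F' where "F' s = - U0 (blf (Rop eps s) (blf (Pop eps s T) f))" for s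
    have dF: "(F has_real_derivative F' s) (at s)" if "0 < s" for s
    proof -
      have "((\<lambda>s. U0 (blf (Nop s * Pop eps s T) f)) has_vector_derivative U0 (blf (- (Rop eps s * Pop eps s T)) f)) (at s)"
        by (rule bounded_linear.has_vector_derivative[OF bounded_linear_compose[OF bounded_linear_U0 blf.bounded_linear_left] Nop_Pop_has_vector_derivative[OF e(1) that]])
      moreover have "U0 (blf (- (Rop eps s * Pop eps s T)) f) = F' s"
        unfolding F'_def using U0_linear(3)[of "- 1"] by simp
      ultimately show ?thesis
        unfolding F_def[abs_def] has_real_derivative_iff_has_vector_derivative by simp
    qed
    have f1: "\<bar>ev k f x\<bar> <= 1 * om T x" for x using f by simp
    have nP: "norm (blf (Pop eps s T) f) <= 1 + C" if s: "0 <= s" "s <= T" for s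
    proof (rule norm_le_ev[of k])
      fix x
      have "\<bar>ev k (blf (Pop eps s T) f) x\<bar> <= 1 * (exp (- c * (T - s)) * om s x + C)"
        by (rule ly) (use e s f1 in auto)
      also have "... <= 1 * (1 * wt k x + C * wt k x)"
        using c s mult_left_mono[OF wt_ge_1[OF k0], of C x]
        by (intro mult_left_mono add_mono mult_mono om_le_wt) auto
      finally show "\<bar>ev k (blf (Pop eps s T) f) x\<bar> <= (1 + C) * wt k x" by (simp add: algebra_simps)
    qed
    have early: "\<bar>F b - F a\<bar> <= A * (1 + C) * eps\<^sup>2" if ab: "0 < a" "a <= b" "b <= 1" "b <= T" for a b
    proof -
      have "\<bar>F b - F a\<bar> <= A * eps\<^sup>2 * (1 + C) * b - A * eps\<^sup>2 * (1 + C) * a"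
      proof (rule derivative_bound_diff[OF ab(2)])
        fix s assume s: "a <= s" "s <= b"
        show "(F has_real_derivative F' s) (at s)" using s ab by (intro dF) auto
        show "((\<lambda>s. A * eps\<^sup>2 * (1 + C) * s) has_real_derivative A * eps\<^sup>2 * (1 + C)) (at s)"
          by (auto intro!: derivative_eq_intros)
        have "\<bar>F' s\<bar> <= A * eps\<^sup>2 * norm (blf (Pop eps s T) f)"
          unfolding F'_def abs_minus_cancel using s ab by (intro short e) auto
        also have "... <= A * eps\<^sup>2 * (1 + C)" using s ab A by (intro mult_left_mono nP) auto
        finally show "\<bar>F' s\<bar> <= A * eps\<^sup>2 * (1 + C)" .
      qed
      also have "... = (A * (1 + C) * eps\<^sup>2) * (b - a)" by (simp add: algebra_simps)
      also have "... <= (A * (1 + C) * eps\<^sup>2) * 1" using ab D2 by (intro mult_left_mono) auto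
      finally show ?thesis by simp
    qed
    have late: "\<bar>F T - F 1\<bar> <= B * I0 / \<eta> * eps\<^sup>2" if T1: "1 <= T"
    proof -
      have "\<bar>F T - F 1\<bar> <= B * I0 / \<eta> * eps\<^sup>2 * exp (- \<eta> * (T - T)) - B * I0 / \<eta> * eps\<^sup>2 * exp (- \<eta> * (T - 1))"
      proof (rule derivative_bound_diff[OF T1])
        fix s assume s: "1 <= s" "s <= T"
        show "(F has_real_derivative F' s) (at s)" using s by (intro dF) auto
        show "((\<lambda>s. B * I0 / \<eta> * eps\<^sup>2 * exp (- \<eta> * (T - s))) has_real_derivative (B * eps\<^sup>2 * exp (- \<eta> * (T - s))) * I0) (at s)"
          using B by (auto intro!: derivative_eq_intros)
        show "\<bar>F' s\<bar> <= (B * eps\<^sup>2 * exp (- \<eta> * (T - s))) * I0"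
          unfolding F'_def abs_minus_cancel by (intro U0_bound long e s f)
      qed
      moreover have "0 <= B * I0 / \<eta> * eps\<^sup>2 * exp (- \<eta> * (T - 1))" using D1 by (intro mult_nonneg_nonneg) auto
      ultimately show ?thesis by simp
    qed
    have "\<bar>F T - F a\<bar> <= D * eps\<^sup>2" if a: "0 < a" "a <= 1" "a <= T" for a
    proof (cases "T <= 1")
      case True
      have "0 <= B * I0 / \<eta> * eps\<^sup>2" using D1 by (intro mult_nonneg_nonneg) auto
      then show ?thesis using early[of a T] a True by (simp add: D_def distrib_right)
    next
      case False
      then show ?thesis using early[of a 1] late a by (simp add: D_def distrib_right)
    qed
    then have ev: "\<forall>\<^sub>F a in at_right 0. \<bar>F T - F a\<bar> <= D * eps\<^sup>2"
      unfolding eventually_at_right_field using T by (intro exI[of _ "min 1 T"]) auto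
    have "((\<lambda>a. \<bar>F T - F a\<bar>) \<longlongrightarrow> \<bar>F T - U0 (blf (Pop eps 0 T) f)\<bar>) (at_right 0)"
      unfolding F_def by (intro tendsto_intros Nop_Pop_tendsto e)
    from tendsto_upperbound[OF this ev] show ?thesis by (simp add: F_def)
  qed
  moreover have "0 <= D" using D1 D2 by (simp add: D_def)
  ultimately show thesis using that by blast
qed

end

subsection \<open>Fourth differences of the initial datum\<close>

lemma line_derivative:
  fixes f :: "real ^ 'n => real"
  assumes "\<And>x. f differentiable (at x)"
  shows "((\<lambda>t. f (y + t *\<^sub>R v)) has_real_derivative (\<Sum>i\<in>UNIV. v $ i * partial_deriv i f (y + t *\<^sub>R v))) (at t)"
proof -
  define D where "D z = frechet_derivative f (at z)" for z
  have D: "(f has_derivative D z) (at z)" for z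
    unfolding D_def using assms by (simp add: frechet_derivative_works)
  have dir: "((\<lambda>t. f (z + t *\<^sub>R w)) has_real_derivative D (z + s *\<^sub>R w) w) (at s)" for z w s
  proof -
    have "((\<lambda>t. z + t *\<^sub>R w) has_derivative (\<lambda>h. h *\<^sub>R w)) (at s)" by (auto intro!: derivative_eq_intros)
    from diff_chain_at[OF this D]
    have "((\<lambda>t. f (z + t *\<^sub>R w)) has_derivative (\<lambda>h. D (z + s *\<^sub>R w) (h *\<^sub>R w))) (at s)" by (simp add: comp_def)
    moreover have "D (z + s *\<^sub>R w) (h *\<^sub>R w) = D (z + s *\<^sub>R w) w * h" for h
      using linear_scale[OF has_derivative_linear[OF D]] by (simp add: mult.commute)
    ultimately show ?thesis by (simp add: has_field_derivative_def)
  qed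
  have p: "partial_deriv i f z = D z (axis i 1)" for i z
    unfolding partial_deriv_def using dir[of z "axis i 1" 0] by (simp add: DERIV_imp_deriv)
  have "v = (\<Sum>i\<in>UNIV. v $ i *\<^sub>R axis i 1)"
    using basis_expansion[of v] by (simp add: scalar_mult_eq_scaleR)
  then have "D (y + t *\<^sub>R v) v = D (y + t *\<^sub>R v) (\<Sum>i\<in>UNIV. v $ i *\<^sub>R axis i 1)" by simp
  also have "... = (\<Sum>i\<in>UNIV. v $ i * partial_deriv i f (y + t *\<^sub>R v))"
    using has_derivative_linear[OF D[of "y + t *\<^sub>R v"]] by (simp add: linear_sum linear_scale p)
  finally show ?thesis using dir[of y v t] by simp
qed

lemma axis_derivative:
  assumes "\<And>x. f differentiable (at x)"
  shows "((\<lambda>t. f (y + t *\<^sub>R axis i 1)) has_real_derivative partial_deriv i f (y + t *\<^sub>R axis i 1)) (at t)"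
proof -
  have "(\<Sum>j\<in>UNIV. axis i 1 $ j * partial_deriv j f (y + t *\<^sub>R axis i 1)) = partial_deriv i f (y + t *\<^sub>R axis i 1)"
    by (simp add: axis_def if_distrib[of "\<lambda>x. x * _"] cong: if_cong)
  then show ?thesis using line_derivative[OF assms, of y "axis i 1" t] by simp
qed

lemma mixed_difference:
  assumes f: "C_class 2 f" and a: "0 < a"
  shows "\<exists>s t. 0 < s \<and> s < a \<and> 0 < t \<and> t < a \<and>
    f (x + a *\<^sub>R axis i 1 + a *\<^sub>R axis j 1) - f (x + a *\<^sub>R axis i 1) - f (x + a *\<^sub>R axis j 1) + f x
      = a * (a * partial_deriv j (partial_deriv i f) (x + s *\<^sub>R axis i 1 + t *\<^sub>R axis j 1))"
proof -
  have d: "\<And>x. f differentiable (at x)" "\<And>x. partial_deriv i f differentiable (at x)"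
    using f by (auto simp: eval_nat_numeral)
  define \<phi> where "\<phi> s = f ((x + a *\<^sub>R axis j 1) + s *\<^sub>R axis i 1) - f (x + s *\<^sub>R axis i 1)" for s
  have "\<exists>s. 0 < s \<and> s < a \<and> \<phi> a - \<phi> 0 = (a - 0) * (partial_deriv i f ((x + a *\<^sub>R axis j 1) + s *\<^sub>R axis i 1) - partial_deriv i f (x + s *\<^sub>R axis i 1))"
    by (rule MVT2[OF a]) (unfold \<phi>_def, intro DERIV_diff axis_derivative d)
  then obtain s where s: "0 < s" "s < a" and e: "\<phi> a - \<phi> 0 = a * (partial_deriv i f ((x + a *\<^sub>R axis j 1) + s *\<^sub>R axis i 1) - partial_deriv i f (x + s *\<^sub>R axis i 1))"
    by auto
  have "\<exists>t. 0 < t \<and> t < a \<and> partial_deriv i f ((x + s *\<^sub>R axis i 1) + a *\<^sub>R axis j 1) - partial_deriv i f ((x + s *\<^sub>R axis i 1) + 0 *\<^sub>R axis j 1)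
      = (a - 0) * partial_deriv j (partial_deriv i f) ((x + s *\<^sub>R axis i 1) + t *\<^sub>R axis j 1)"
    by (rule MVT2[OF a]) (intro axis_derivative d)
  then obtain t where t: "0 < t" "t < a" and e2: "partial_deriv i f ((x + s *\<^sub>R axis i 1) + a *\<^sub>R axis j 1) - partial_deriv i f (x + s *\<^sub>R axis i 1)
      = a * partial_deriv j (partial_deriv i f) ((x + s *\<^sub>R axis i 1) + t *\<^sub>R axis j 1)" by auto
  have "x + a *\<^sub>R axis j 1 + s *\<^sub>R axis i 1 = (x + s *\<^sub>R axis i 1) + a *\<^sub>R axis j 1" for s :: real by (simp add: add_ac)
  then have "\<phi> a - \<phi> 0 = a * (a * partial_deriv j (partial_deriv i f) (x + s *\<^sub>R axis i 1 + t *\<^sub>R axis j 1))"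
    unfolding e by (simp only: e2)
  moreover have "\<phi> a - \<phi> 0 = f (x + a *\<^sub>R axis i 1 + a *\<^sub>R axis j 1) - f (x + a *\<^sub>R axis i 1) - f (x + a *\<^sub>R axis j 1) + f x"
    by (simp add: \<phi>_def add_ac)
  ultimately show ?thesis using s t by auto
qed

text \<open>Schwarz's theorem: the mixed second difference is symmetric in i and j, and divided by
  the squared step it converges to either mixed derivative.\<close>

lemma partial_deriv_commute:
  assumes f: "C_class 2 f"
  shows "partial_deriv i (partial_deriv j f) = partial_deriv j (partial_deriv i f)"
proof
  fix x
  define a where "a n = inverse (real (Suc n))" for n
  have a: "0 < a n" for n by (simp add: a_def)
  have al: "a \<longlonglongrightarrow> 0" unfolding a_def by (rule LIMSEQ_inverse_real_of_nat)
  define D where "D i j n = f (x + a n *\<^sub>R axis i 1 + a n *\<^sub>R axis j 1) - f (x + a n *\<^sub>R axis i 1) - f (x + a n *\<^sub>R axis j 1) + f x" for i j n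
  have lim: "(\<lambda>n. D i j n / (a n * a n)) \<longlonglongrightarrow> partial_deriv j (partial_deriv i f) x" for i j
  proof -
    have "\<forall>n. \<exists>st. (0 < fst st \<and> fst st < a n) \<and> (0 < snd st \<and> snd st < a n) \<and>
        D i j n = a n * (a n * partial_deriv j (partial_deriv i f) (x + fst st *\<^sub>R axis i 1 + snd st *\<^sub>R axis j 1))"
    proof
      fix n
      obtain s t where "0 < s" "s < a n" "0 < t" "t < a n"
        "D i j n = a n * (a n * partial_deriv j (partial_deriv i f) (x + s *\<^sub>R axis i 1 + t *\<^sub>R axis j 1))"
        using mixed_difference[OF f a[of n], where x=x and i=i and j=j] unfolding D_def by blast
      then show "\<exists>st. (0 < fst st \<and> fst st < a n) \<and> (0 < snd st \<and> snd st < a n) \<and>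
        D i j n = a n * (a n * partial_deriv j (partial_deriv i f) (x + fst st *\<^sub>R axis i 1 + snd st *\<^sub>R axis j 1))"
        by (intro exI[of _ "(s, t)"]) simp
    qed
    from choice[OF this] obtain p where p: "\<And>n. 0 < fst (p n) \<and> fst (p n) < a n" "\<And>n. 0 < snd (p n) \<and> snd (p n) < a n"
      "\<And>n. D i j n = a n * (a n * partial_deriv j (partial_deriv i f) (x + fst (p n) *\<^sub>R axis i 1 + snd (p n) *\<^sub>R axis j 1))"
      by blast
    have l: "(\<lambda>n. fst (p n)) \<longlonglongrightarrow> 0" "(\<lambda>n. snd (p n)) \<longlonglongrightarrow> 0"
      by (rule tendsto_sandwich[OF _ _ tendsto_const al], use p in \<open>auto simp: less_imp_le\<close>)+
    have "continuous_on UNIV (partial_deriv j (partial_deriv i f))" using f by (auto simp: eval_nat_numeral)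
    then have "(\<lambda>n. partial_deriv j (partial_deriv i f) (x + fst (p n) *\<^sub>R axis i 1 + snd (p n) *\<^sub>R axis j 1))
        \<longlonglongrightarrow> partial_deriv j (partial_deriv i f) (x + 0 *\<^sub>R axis i 1 + 0 *\<^sub>R axis j 1)"
    proof (rule continuous_on_tendsto_compose)
      show "(\<lambda>n. x + fst (p n) *\<^sub>R axis i 1 + snd (p n) *\<^sub>R axis j 1) \<longlonglongrightarrow> x + 0 *\<^sub>R axis i 1 + 0 *\<^sub>R axis j 1"
        by (intro tendsto_intros l)
    qed auto
    moreover have "D i j n / (a n * a n) = partial_deriv j (partial_deriv i f) (x + fst (p n) *\<^sub>R axis i 1 + snd (p n) *\<^sub>R axis j 1)" for n
      using a[of n] by (simp add: p(3))
    ultimately show ?thesis by simp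
  qed
  have "D i j = D j i" by (rule ext) (simp add: D_def add_ac)
  then show "partial_deriv i (partial_deriv j f) x = partial_deriv j (partial_deriv i f) x"
    using LIMSEQ_unique[OF lim[of i j]] lim[of j i] by simp
qed

lemma C_class_mono: "C_class m f ==> l <= m ==> C_class l f"
proof (induction m arbitrary: l f)
  case (Suc m)
  show ?case
  proof (cases l)
    case 0
    then show ?thesis using Suc.prems
      by (auto intro!: continuous_at_imp_continuous_on differentiable_imp_continuous_within)
  qed (use Suc in auto)
qed simp

text \<open>\<open>mi_deriv\<close> takes derivatives in one chosen order of coordinates, whereas
  expanding a directional derivative yields words in all orders. If the first letters i and j
  differ, both words are compared with words beginning i j and j i over a common rest.\<close>

lemma fold_partial_deriv_mset:
  assumes "C_class (length is) f" "mset is = mset js"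
  shows "fold partial_deriv is f = fold partial_deriv js f"
  using assms
proof (induction "length is" arbitrary: "is" js f)
  case (Suc n)
  obtain i is' where i: "is = i # is'" using Suc.hyps(2) by (cases "is") auto
  obtain j js' where j: "js = j # js'" using Suc.prems(2) i by (cases js) auto
  have len: "length is' = n" "length js' = n"
    using Suc.hyps(2) mset_eq_length[OF Suc.prems(2)] by (auto simp: i j)
  have C: "C_class n (partial_deriv l f)" for l using Suc.prems(1) by (simp add: i len)
  show ?case
  proof (cases "i = j")
    case True
    then show ?thesis using Suc.hyps(1)[of is' "partial_deriv i f" js'] Suc.prems(2) C len by (simp add: i j)
  next
    case False
    define w where "w = remove1 j is'"
    have "j \<in># mset is'" using Suc.prems(2) False by (metis i j insert_noteq_member list.set_intros(1) mset.simps(2) set_mset_mset)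
    then have w: "mset is' = add_mset j (mset w)" by (simp add: w_def)
    have w': "mset js' = add_mset i (mset w)"
      using Suc.prems(2) by (simp add: i j w add_mset_commute[of i j])
    have lw: "Suc (length w) = n" using mset_eq_length[of is' "j # w"] w len by simp
    have "fold partial_deriv is f = fold partial_deriv (j # w) (partial_deriv i f)"
      unfolding i fold_Cons comp_def using Suc.hyps(1)[of is' "partial_deriv i f" "j # w"] C len w by simp
    also have "... = fold partial_deriv (i # w) (partial_deriv j f)"
      using partial_deriv_commute[OF C_class_mono[OF Suc.prems(1)], of i j] lw Suc.hyps(2) by simp
    also have "... = fold partial_deriv js f"
      unfolding j fold_Cons comp_def using Suc.hyps(1)[of js' "partial_deriv j f" "i # w"] C len w' by simp
    finally show ?thesis .
  qed
qed simp

lemma coords: "distinct (coords :: 'n::finite list)" "set (coords :: 'n list) = UNIV"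
proof -
  have "\<exists>is :: 'n list. distinct is \<and> set is = UNIV" using finite_distinct_list[of "UNIV :: 'n set"] by auto
  then have "distinct (coords :: 'n list) \<and> set (coords :: 'n list) = UNIV" unfolding coords_def by (rule someI_ex)
  then show "distinct (coords :: 'n list)" "set (coords :: 'n list) = UNIV" by auto
qed

lemma fold_partial_deriv_mi_deriv:
  assumes "C_class (length is) f"
  shows "fold partial_deriv is f = mi_deriv (count (mset is)) f" "mi_order (count (mset is)) = length is"
proof -
  have r: "fold g (replicate n i) = g i ^^ n" for g :: "'a => 'b => 'b" and n i
    by (induction n) (auto simp: funpow_swap1)
  have e: "fold (\<lambda>i. partial_deriv i ^^ \<alpha> i) xs f = fold partial_deriv (concat (map (\<lambda>i. replicate (\<alpha> i) i) xs)) f" for \<alpha> xs and f :: "real ^ 'a => real"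
    by (induction xs arbitrary: f) (simp_all add: r)
  have "count (mset (concat (map (\<lambda>i. replicate (\<alpha> i) i) xs))) j = (if j \<in> set xs then \<alpha> j else 0)" if "distinct xs" for xs \<alpha> and j :: 'a
    using that by (induction xs) auto
  then have "mset (concat (map (\<lambda>i. replicate (count (mset is) i) i) coords)) = mset is"
    by (intro multiset_eqI) (simp add: coords)
  then show "fold partial_deriv is f = mi_deriv (count (mset is)) f"
    unfolding mi_deriv_def e by (intro fold_partial_deriv_mset assms) simp
  show "mi_order (count (mset is)) = length is"
    unfolding mi_order_def using size_multiset_overloaded_eq[of "mset is"] 
      sum.mono_neutral_left[of UNIV "set_mset (mset is)" "count (mset is)"] by (simp add: not_in_iff)
qed

lemma fold_partial_deriv_differentiable:
  "C_class m f ==> length is < m ==> fold partial_deriv is f differentiable (at x)"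
proof (induction "is" arbitrary: m f)
  case Nil then show ?case by (cases m) auto
next
  case (Cons i "is") then show ?case by (cases m) auto
qed

text \<open>The fourth difference is a fourth directional derivative at an intermediate point,
  expanded over the CARD('n)^4 words of length 4. Each word is a multi-index derivative of order 4,
  covered by the hypothesis.\<close>

lemma fourth_difference_bound:
  fixes f :: "real ^ 'n => real"
  assumes f: "C_class 4 f" and c: "0 < c" and K: "0 <= K"
    and b: "\<And>\<alpha> x. mi_order \<alpha> = 4 ==> \<bar>mi_deriv \<alpha> f x\<bar> <= c * (1 + (norm x)\<^sup>2) powr (- K / 2)"
    and h: "norm h <= 1"
  shows "\<bar>f (x - 4 *\<^sub>R h) - 4 * f (x - 3 *\<^sub>R h) + 6 * f (x - 2 *\<^sub>R h) - 4 * f (x - h) + f x\<bar>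
    <= norm h ^ 4 * (real CARD('n) ^ 4 * c * 5 powr K * jb x powr (- K))"
proof -
  define L where "L n = {is :: 'n list. set is \<subseteq> UNIV \<and> length is = n}" for n
  have fL: "finite (L n)" and cL: "card (L n) = CARD('n) ^ n" for n
    unfolding L_def by (rule finite_lists_length_eq, simp, rule card_lists_length_eq, simp)
  define v where "v = - h"
  define w where "w is = (\<Prod>i\<leftarrow>is. v $ i)" for "is"
  define G where "G n t = (\<Sum>is\<in>L n. w is * fold partial_deriv is f (x + t *\<^sub>R v))" for n t
  have dG: "(G n has_real_derivative G (Suc n) t) (at t)" if n: "n < 4" for n t
  proof -
    have "(G n has_real_derivative (\<Sum>is\<in>L n. w is * (\<Sum>i\<in>UNIV. v $ i * partial_deriv i (fold partial_deriv is f) (x + t *\<^sub>R v)))) (at t)"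
      unfolding G_def[abs_def]
      by (intro DERIV_sum DERIV_cmult line_derivative fold_partial_deriv_differentiable[OF f]) (use n in \<open>simp add: L_def\<close>)
    also have "(\<Sum>is\<in>L n. w is * (\<Sum>i\<in>UNIV. v $ i * partial_deriv i (fold partial_deriv is f) (x + t *\<^sub>R v)))
        = (\<Sum>(is, i)\<in>L n \<times> UNIV. w (is @ [i]) * fold partial_deriv (is @ [i]) f (x + t *\<^sub>R v))"
      by (simp add: sum.cartesian_product[symmetric] w_def sum_distrib_left mult.assoc)
    also have "... = (\<Sum>is\<in>L (Suc n). w is * fold partial_deriv is f (x + t *\<^sub>R v))"
    proof (rule sum.reindex_bij_witness[of _ "\<lambda>is. (butlast is, last is)" "\<lambda>(is, i). is @ [i]"])
      fix a assume "a \<in> L (Suc n)"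
      then have "a \<noteq> []" by (auto simp: L_def)
      then show "(case (butlast a, last a) of (is, i) => is @ [i]) = a" by simp
    qed (auto simp: L_def)
    finally show ?thesis by (simp add: G_def[abs_def])
  qed
  obtain \<xi> where xi: "0 <= \<xi>" "\<xi> <= 0 + real 4 * 1" "(fdiff 1 ^^ 4) (G 0) 0 = 1 ^ 4 * G 4 \<xi>"
    using fdiff_mean_value[of 1 4 G 0] dG by auto
  have "L 0 = {[]}" by (auto simp: L_def)
  then have G0: "G 0 t = f (x - t *\<^sub>R h)" for t by (simp add: G_def w_def v_def)
  have eq: "f (x - 4 *\<^sub>R h) - 4 * f (x - 3 *\<^sub>R h) + 6 * f (x - 2 *\<^sub>R h) - 4 * f (x - h) + f x = G 4 \<xi>"
    using xi(3) unfolding fdiff_4 G0 by simp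
  \<comment> \<open>The intermediate point lies within distance 4 of x, so the brackets differ by at
    most the factor 5.\<close>
  have jx: "jb (x + \<xi> *\<^sub>R v) powr (- K) <= 5 powr K * jb x powr (- K)"
  proof -
    have "jb x <= jb (x + \<xi> *\<^sub>R v) * (1 + norm (- (\<xi> *\<^sub>R v)))"
      using jb_add[of "x + \<xi> *\<^sub>R v" "- (\<xi> *\<^sub>R v)"] by simp
    also have "norm (- (\<xi> *\<^sub>R v)) <= 4 * 1"
      using xi mult_mono[of \<xi> 4 "norm h" 1] h unfolding v_def by simp
    finally have "jb x <= jb (x + \<xi> *\<^sub>R v) * 5" by (simp add: mult_left_mono less_imp_le)
    then have "jb x powr K <= (jb (x + \<xi> *\<^sub>R v) * 5) powr K" using K by (intro powr_mono2) (auto simp: less_imp_le)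
    then have "jb x powr K <= jb (x + \<xi> *\<^sub>R v) powr K * 5 powr K" by (simp add: powr_mult less_imp_le)
    then show ?thesis by (simp add: powr_minus field_simps)
  qed
  have trm: "\<bar>w is * fold partial_deriv is f (x + \<xi> *\<^sub>R v)\<bar> <= norm h ^ 4 * (c * (5 powr K * jb x powr (- K)))" if "is \<in> L 4" for "is"
  proof -
    have len: "length is = 4" using that by (simp add: L_def)
    have "\<bar>w is\<bar> <= norm h ^ length is"
    proof (induction "is")
      case (Cons i "is")
      have "\<bar>v $ i\<bar> * \<bar>w is\<bar> <= norm h * norm h ^ length is"
        using component_le_norm_cart[of v i] by (intro mult_mono Cons) (auto simp: v_def)
      then show ?case by (simp add: w_def abs_mult)
    qed (simp add: w_def)
    moreover have "\<bar>fold partial_deriv is f (x + \<xi> *\<^sub>R v)\<bar> <= c * (5 powr K * jb x powr (- K))"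
    proof -
      have "\<bar>fold partial_deriv is f (x + \<xi> *\<^sub>R v)\<bar> <= c * (1 + (norm (x + \<xi> *\<^sub>R v))\<^sup>2) powr (- K / 2)"
        using fold_partial_deriv_mi_deriv[of "is" f] f len b[of "count (mset is)" "x + \<xi> *\<^sub>R v"] by simp
      also have "(1 + (norm (x + \<xi> *\<^sub>R v))\<^sup>2) powr (- K / 2) = jb (x + \<xi> *\<^sub>R v) powr (- K)"
        using wt_eq[of "- K" "x + \<xi> *\<^sub>R v"] by (simp add: wt_def)
      also have "c * ... <= c * (5 powr K * jb x powr (- K))" using c by (intro mult_left_mono jx) auto
      finally show ?thesis .
    qed
    ultimately show ?thesis unfolding abs_mult len by (intro mult_mono) auto
  qed
  have "\<bar>G 4 \<xi>\<bar> <= (\<Sum>is\<in>L 4. \<bar>w is * fold partial_deriv is f (x + \<xi> *\<^sub>R v)\<bar>)" unfolding G_def by (rule sum_abs)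
  also have "... <= (\<Sum>is\<in>L 4. norm h ^ 4 * (c * (5 powr K * jb x powr (- K))))" by (intro sum_mono trm)
  finally show ?thesis unfolding eq by (simp add: cL ac_simps)
qed

section \<open>Integrability of algebraic tails\<close>

lemma nn_integral_tail_powr:
  assumes \<kappa>: "1 < \<kappa>"
  shows "(\<integral>\<^sup>+t. ennreal ((1 + \<bar>t\<bar>) powr (- \<kappa>)) \<partial>lborel) < \<infinity>"
proof -
  define f where "f t = ennreal ((1 + \<bar>t\<bar>) powr (- \<kappa>)) * indicator {0..} t" for t :: real
  have [measurable]: "f \<in> borel_measurable borel" unfolding f_def by measurable
  have "(\<integral>\<^sup>+t. ennreal ((1 + \<bar>t\<bar>) powr (- \<kappa>)) * indicator {0..} t \<partial>lborel) = ennreal (0 - (- ((1 + 0) powr (1 - \<kappa>) / (\<kappa> - 1))))"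
  proof (rule nn_integral_FTC_atLeast)
    fix t :: real assume t: "0 <= t"
    have "((\<lambda>t. - ((1 + t) powr (1 - \<kappa>) / (\<kappa> - 1))) has_real_derivative (1 + t) powr (- \<kappa>)) (at t)"
    proof -
      have "((\<lambda>t. (1 + t) powr (1 - \<kappa>)) has_real_derivative ((1 - \<kappa>) * (1 + t) powr (1 - \<kappa> - 1)) * 1) (at t)"
        by (rule DERIV_chain2[where f="\<lambda>z. z powr (1 - \<kappa>)" and g="\<lambda>t. 1 + t"])
           (use t in \<open>auto intro!: derivative_eq_intros has_real_derivative_powr\<close>)
      from DERIV_minus[OF DERIV_cdivide[OF this, of "\<kappa> - 1"]] show ?thesis
        by (rule DERIV_cong) (use \<kappa> in \<open>simp add: field_simps\<close>)
    qed
    then show "((\<lambda>t. - ((1 + t) powr (1 - \<kappa>) / (\<kappa> - 1))) has_real_derivative (1 + \<bar>t\<bar>) powr (- \<kappa>)) (at t)" using t by simp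
  next
    have "filterlim (\<lambda>t :: real. 1 + t) at_top at_top" by (intro filterlim_tendsto_add_at_top[OF tendsto_const] filterlim_ident)
    then have "((\<lambda>t. (1 + t) powr (1 - \<kappa>)) \<longlongrightarrow> 0) at_top"
      using \<kappa> by (intro tendsto_neg_powr) auto
    then have "((\<lambda>t. - ((1 + t) powr (1 - \<kappa>) / (\<kappa> - 1))) \<longlongrightarrow> - (0 / (\<kappa> - 1))) at_top"
      using \<kappa> by (intro tendsto_intros) auto
    then show "((\<lambda>t. - ((1 + t) powr (1 - \<kappa>) / (\<kappa> - 1))) \<longlongrightarrow> 0) at_top" by simp
  qed (auto)
  then have fin: "(\<integral>\<^sup>+t. f t \<partial>lborel) < \<infinity>" unfolding f_def by simp
  have "(\<integral>\<^sup>+t. f t \<partial>lborel) = (\<integral>\<^sup>+t. f (- t) \<partial>lborel)"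
    using nn_integral_real_affine[of f "- 1" 0] by simp
  then have fin2: "(\<integral>\<^sup>+t. f (- t) \<partial>lborel) < \<infinity>" using fin by simp
  have "(\<integral>\<^sup>+t. ennreal ((1 + \<bar>t\<bar>) powr (- \<kappa>)) \<partial>lborel) <= (\<integral>\<^sup>+t. f t + f (- t) \<partial>lborel)"
    by (intro nn_integral_mono) (auto simp: f_def split: split_indicator)
  also have "... = (\<integral>\<^sup>+t. f t \<partial>lborel) + (\<integral>\<^sup>+t. f (- t) \<partial>lborel)" by (rule nn_integral_add) measurable
  also have "... < \<infinity>" using fin fin2 by simp
  finally show ?thesis .
qed

text \<open>Distributing the exponent evenly over the coordinates bounds the function by a product
  of one-dimensional tails with exponent a/d > 1, so no polar coordinates are needed.\<close>

lemma integrable_jb_powr: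
  assumes a: "real CARD('n) < a"
  shows "integrable lborel (\<lambda>x :: real ^ 'n. jb x powr (- a))"
proof -
  define \<kappa> where "\<kappa> = a / real CARD('n)"
  have \<kappa>: "1 < \<kappa>" using a by (simp add: \<kappa>_def)
  have le: "jb x powr (- a) <= (\<Prod>i\<in>UNIV. 2 powr \<kappa> * (1 + \<bar>x $ i\<bar>) powr (- \<kappa>))" for x :: "real ^ 'n"
  proof -
    have "jb x powr (- a) = (\<Prod>i\<in>(UNIV :: 'n set). jb x powr (- \<kappa>))"
      by (simp add: powr_realpow[symmetric] powr_powr \<kappa>_def)
    also have "... <= (\<Prod>i\<in>UNIV. 2 powr \<kappa> * (1 + \<bar>x $ i\<bar>) powr (- \<kappa>))"
    proof (intro prod_mono conjI)
      fix i
      have "1 + \<bar>x $ i\<bar> <= 2 * jb x"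
        using component_le_norm_cart[of x i] norm_le_jb[of x] jb_ge_1[of x] by linarith
      then have "(1 + \<bar>x $ i\<bar>) powr \<kappa> <= (2 * jb x) powr \<kappa>" using \<kappa> by (intro powr_mono2) auto
      then have "(1 + \<bar>x $ i\<bar>) powr \<kappa> <= 2 powr \<kappa> * jb x powr \<kappa>" by (simp add: powr_mult less_imp_le)
      moreover have "0 < (1 + \<bar>x $ i\<bar>) powr \<kappa>" by simp
      ultimately show "jb x powr (- \<kappa>) <= 2 powr \<kappa> * (1 + \<bar>x $ i\<bar>) powr (- \<kappa>)"
        by (simp add: powr_minus field_simps)
    qed simp
    finally show ?thesis .
  qed
  have "(\<integral>\<^sup>+x. ennreal (jb x powr (- a)) \<partial>(lborel :: (real ^ 'n) measure)) <= (\<integral>\<^sup>+x. (\<Prod>i\<in>UNIV. ennreal (2 powr \<kappa> * (1 + \<bar>x $ i\<bar>) powr (- \<kappa>))) \<partial>(lborel :: (real ^ 'n) measure))"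
    by (intro nn_integral_mono) (simp add: prod_ennreal ennreal_leI le)
  also have "... = (\<Prod>i\<in>(UNIV :: 'n set). \<integral>\<^sup>+t. ennreal (2 powr \<kappa> * (1 + \<bar>t\<bar>) powr (- \<kappa>)) \<partial>lborel)"
    by (rule nn_integral_prod_vec) measurable
  also have "(\<integral>\<^sup>+t. ennreal (2 powr \<kappa> * (1 + \<bar>t\<bar>) powr (- \<kappa>)) \<partial>lborel) = ennreal (2 powr \<kappa>) * (\<integral>\<^sup>+t. ennreal ((1 + \<bar>t\<bar>) powr (- \<kappa>)) \<partial>lborel)"
    by (simp add: ennreal_mult nn_integral_cmult)
  also have "(\<Prod>i\<in>(UNIV :: 'n set). ennreal (2 powr \<kappa>) * (\<integral>\<^sup>+t. ennreal ((1 + \<bar>t\<bar>) powr (- \<kappa>)) \<partial>lborel)) < \<infinity>"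
    using nn_integral_tail_powr[OF \<kappa>] by (simp add: ennreal_mult_less_top power_less_top_ennreal)
  finally show ?thesis
    by (intro integrableI_bounded) (auto simp: jb_def)
qed

subsection \<open>Mild solutions tested against weighted functions\<close>

lemma lebesgue_Borel_version:
  fixes g :: "real ^ 'n => real"
  assumes "g \<in> borel_measurable lebesgue"
  obtains g' where "g' \<in> borel_measurable borel" "AE x in lebesgue. g' x = g x"
proof -
  from completion_ex_borel_measurable_real[OF assms] obtain g' where "g' \<in> borel_measurable lborel" "AE x in lborel. g x = g' x" by blast
  then have "g' \<in> borel_measurable borel" "AE x in lborel. g' x = g x" by (auto simp: eq_commute)
  then show thesis using that AE_completion by blast
qed

lemma
  fixes g g' :: "real ^ 'n => 'b::euclidean_space"
  assumes g': "g' \<in> borel_measurable borel" and ae: "AE x in lebesgue. g' x = g x"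
  shows lebesgue_integral_version: "(LINT x|lebesgue. g x) = (LBINT x. g' x)"
    and lebesgue_integrable_version: "integrable lebesgue g \<longleftrightarrow> integrable lborel g'"
proof -
  have m: "g' \<in> borel_measurable lebesgue" using g' by (intro measurable_completion) simp
  have mg: "g \<in> borel_measurable lebesgue" by (rule borel_measurable_AE[OF m ae])
  have "(LINT x|lebesgue. g x) = (LINT x|lebesgue. g' x)" by (rule integral_cong_AE[OF mg m]) (use ae in auto)
  then show "(LINT x|lebesgue. g x) = (LBINT x. g' x)" using integral_completion[of g' lborel] g' by simp
  have "integrable lebesgue g \<longleftrightarrow> integrable lebesgue g'" by (rule integrable_cong_AE[OF mg m]) (use ae in auto)
  then show "integrable lebesgue g \<longleftrightarrow> integrable lborel g'" using integrable_completion[of g' lborel] g' by simp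
qed

lemma kw_le_weight:
  assumes k: "0 <= k" shows "kw k x <= 2 powr k * weight k x"
proof -
  have "kw k x <= (2 * max 1 (norm x)) powr k" unfolding kw_def using k by (intro powr_mono2) auto
  also have "... = 2 powr k * max 1 (norm x) powr k" by (simp add: powr_mult)
  also have "... <= 2 powr k * weight k x" unfolding weight_def by (intro mult_left_mono) (auto simp: max_def)
  finally show ?thesis .
qed

lemma wt_le_weight: "0 <= k ==> wt k x <= 2 powr k * weight k x"
  by (rule order.trans[OF wt_le_kw kw_le_weight])

lemma weight_le_wt:
  assumes k: "0 <= k" shows "weight k x <= 2 * wt k x"
proof -
  have "norm x powr k <= wt k x" unfolding wt_def by (intro powr_mono2 norm_le_jb k) auto
  then show ?thesis using wt_ge_1[OF k, of x] by (simp add: weight_def)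
qed

lemma weight_nonneg [simp]: "0 <= weight k x"
  by (simp add: weight_def)

lemma weight_measurable [measurable]: "weight k \<in> borel_measurable borel"
  unfolding weight_def[abs_def] by measurable

lemma wt_scale_ge:
  assumes k: "0 <= k" and c: "1 <= c" shows "wt k (c *\<^sub>R y) <= c powr k * wt k y"
proof -
  have "(jb (c *\<^sub>R y))\<^sup>2 <= (c * jb y)\<^sup>2"
    using c power_mono[of 1 c 2] by (simp add: jb_power2 power_mult_distrib distrib_left)
  then have "jb (c *\<^sub>R y) <= c * jb y" by (rule power2_le_imp_le) (use c in \<open>simp add: less_imp_le\<close>)
  then have "wt k (c *\<^sub>R y) <= (c * jb y) powr k" unfolding wt_def by (intro powr_mono2 k) (auto simp: less_imp_le)
  then show ?thesis using c by (simp add: powr_mult less_imp_le wt_def)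
qed

lemma L1w_measurable: "g \<in> L1w k ==> g \<in> borel_measurable lebesgue"
  by (simp add: L1w_def)

lemma
  assumes k: "0 <= k" and g: "g \<in> L1w k" and p: "\<psi> \<in> borel_measurable borel" and b: "\<And>x. \<bar>\<psi> x\<bar> <= A * wt k x"
  shows integrable_test: "integrable lebesgue (\<lambda>x. \<psi> x * g x)"
    and test_bound: "\<bar>LINT x|lebesgue. \<psi> x * g x\<bar> <= A * 2 powr k * L1w_norm k g"
proof -
  have i: "integrable lebesgue (\<lambda>x. A * 2 powr k * (weight k x * \<bar>g x\<bar>))"
    using g by (intro integrable_mult_right) (simp add: L1w_def)
  have A: "0 <= A"
    using order.trans[OF abs_ge_zero b[of 0]] wt_pos[of k 0] by (auto simp: zero_le_mult_iff dest: leD)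
  have le: "\<bar>\<psi> x * g x\<bar> <= A * 2 powr k * (weight k x * \<bar>g x\<bar>)" for x
  proof -
    have "\<bar>\<psi> x\<bar> * \<bar>g x\<bar> <= (A * (2 powr k * weight k x)) * \<bar>g x\<bar>"
      by (intro mult_right_mono order.trans[OF b] mult_left_mono wt_le_weight k A) auto
    then show ?thesis by (simp add: abs_mult mult.assoc)
  qed
  have [measurable]: "\<psi> \<in> borel_measurable lebesgue" "g \<in> borel_measurable lebesgue"
    using p L1w_measurable[OF g] by (auto intro: measurable_completion)
  show ip: "integrable lebesgue (\<lambda>x. \<psi> x * g x)"
    by (rule Bochner_Integration.integrable_bound[OF i]) (use le in \<open>auto intro!: AE_I2 order.trans[OF _ abs_ge_self]\<close>)
  have "\<bar>LINT x|lebesgue. \<psi> x * g x\<bar> <= (LINT x|lebesgue. A * 2 powr k * (weight k x * \<bar>g x\<bar>))"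
    by (rule order.trans[OF integral_abs_bound]) (intro integral_mono integrable_abs ip i le)
  then show "\<bar>LINT x|lebesgue. \<psi> x * g x\<bar> <= A * 2 powr k * L1w_norm k g" by (simp add: L1w_norm_def)
qed

lemma L1w_Borel_version:
  assumes k: "0 <= k" and g: "g \<in> L1w k"
  obtains g' where "g' \<in> borel_measurable borel" "AE x in lebesgue. g' x = g x" "integrable lborel (\<lambda>x. wt k x * \<bar>g' x\<bar>)"
proof -
  obtain g' where m[measurable]: "g' \<in> borel_measurable borel" and g': "AE x in lebesgue. g' x = g x"
    using lebesgue_Borel_version[OF L1w_measurable[OF g]] by blast
  have "integrable lebesgue (\<lambda>x. wt k x * g x)" by (rule integrable_test[OF k g, of _ 1]) auto
  moreover have "AE x in lebesgue. wt k x * g' x = wt k x * g x" using g' by eventually_elim simp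
  ultimately have "integrable lborel (\<lambda>x. wt k x * g' x)"
    using lebesgue_integrable_version[of "\<lambda>x. wt k x * g' x" "\<lambda>x. wt k x * g x"] by simp
  from integrable_abs[OF this] show thesis by (intro that[OF m g']) (simp add: abs_mult)
qed

lemma L1w_lincomb:
  assumes f: "f \<in> L1w k" and g: "g \<in> L1w k"
  shows "(\<lambda>x. a * f x + b * g x) \<in> L1w k"
proof -
  have [measurable]: "f \<in> borel_measurable lebesgue" "g \<in> borel_measurable lebesgue" "weight k \<in> borel_measurable (lebesgue :: (real ^ 'a) measure)"
    using f g by (auto simp: L1w_def intro!: measurable_completion)
  have "integrable lebesgue (\<lambda>x. weight k x * \<bar>a * f x + b * g x\<bar>)"
  proof (rule Bochner_Integration.integrable_bound)
    show "integrable lebesgue (\<lambda>x. \<bar>a\<bar> * (weight k x * \<bar>f x\<bar>) + \<bar>b\<bar> * (weight k x * \<bar>g x\<bar>))"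
      using f g by (intro Bochner_Integration.integrable_add integrable_mult_right) (auto simp: L1w_def)
    have "weight k x * \<bar>a * f x + b * g x\<bar> <= weight k x * (\<bar>a\<bar> * \<bar>f x\<bar> + \<bar>b\<bar> * \<bar>g x\<bar>)" for x
      unfolding abs_mult[symmetric] by (intro mult_left_mono abs_triangle_ineq) auto
    then show "AE x in lebesgue. norm (weight k x * \<bar>a * f x + b * g x\<bar>) <= norm (\<bar>a\<bar> * (weight k x * \<bar>f x\<bar>) + \<bar>b\<bar> * (weight k x * \<bar>g x\<bar>))"
      by (intro AE_I2) (simp add: abs_mult algebra_simps)
  qed measurable
  then show ?thesis by (simp add: L1w_def)
qed

lemma L1w_diff: "f \<in> L1w k ==> g \<in> L1w k ==> (\<lambda>x. f x - g x) \<in> L1w k"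
  using L1w_lincomb[of f k g 1 "- 1"] by simp

lemma L1w_sum:
  assumes "finite A" "\<And>i. i \<in> A ==> F i \<in> L1w k"
  shows "(\<lambda>x. \<Sum>i\<in>A. c i * F i x) \<in> L1w k"
  using assms
proof (induction A rule: finite_induct)
  case (insert i A)
  then show ?case using L1w_lincomb[of "F i" k "\<lambda>x. \<Sum>i\<in>A. c i * F i x" "c i" 1] by simp
qed (simp add: L1w_def)

text \<open>Pairing with a weighted test function is linear and bounded for the norm of L1w k, so it
  carries the Henstock sums of the vector integral to those of a real integral.\<close>

lemma has_L1w_integral_test:
  assumes k: "0 <= k" and I: "has_L1w_integral k F I a b"
    and p: "\<psi> \<in> borel_measurable borel" and b: "\<And>x. \<bar>\<psi> x\<bar> <= A * wt k x"
  shows "((\<lambda>s. LINT x|lebesgue. \<psi> x * F s x) has_integral (LINT x|lebesgue. \<psi> x * I x)) {a..b}"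
  unfolding has_integral_real
proof (intro allI impI)
  fix e :: real assume e: "0 < e"
  have A: "0 <= A"
    using order.trans[OF abs_ge_zero b[of 0]] wt_pos[of k 0] by (auto simp: zero_le_mult_iff dest: leD)
  define B where "B = A * 2 powr k"
  have B: "0 <= B" using A by (simp add: B_def)
  have F: "F s \<in> L1w k" if "s \<in> {a..b}" for s using I that by (simp add: has_L1w_integral_def)
  have IL: "I \<in> L1w k" using I by (simp add: has_L1w_integral_def)
  \<comment> \<open>The 1 avoids a division by zero when the test function vanishes.\<close>
  have "0 < e / (B + 1)" using e B by simp
  with I obtain \<gamma> where g: "gauge \<gamma>" and le: "\<And>\<D>. \<D> tagged_division_of {a..b} ==> \<gamma> fine \<D> ==>
    L1w_norm k (\<lambda>x. (\<Sum>(s, S)\<in>\<D>. measure lborel S * F s x) - I x) < e / (B + 1)"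
    unfolding has_L1w_integral_def by meson
  show "\<exists>\<gamma>. gauge \<gamma> \<and> (\<forall>\<D>. \<D> tagged_division_of {a..b} \<and> \<gamma> fine \<D> \<longrightarrow>
      norm ((\<Sum>(s, S)\<in>\<D>. measure lborel S *\<^sub>R (LINT x|lebesgue. \<psi> x * F s x)) - (LINT x|lebesgue. \<psi> x * I x)) < e)"
  proof (intro exI[of _ \<gamma>] conjI allI impI g)
    fix \<D> assume D: "\<D> tagged_division_of {a..b} \<and> \<gamma> fine \<D>"
    have fin: "finite \<D>" using D by (auto intro: tagged_division_ofD(1))
    have FD: "F (fst p) \<in> L1w k" if "p \<in> \<D>" for p
      using tagged_division_ofD(2,3)[of \<D> "{a..b}" "fst p" "snd p"] D that by (intro F) auto
    define h where "h x = (\<Sum>p\<in>\<D>. measure lborel (snd p) * F (fst p) x) - I x" for x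
    have hL: "h \<in> L1w k" unfolding h_def by (intro L1w_diff IL L1w_sum fin FD)
    have "(\<Sum>(s, S)\<in>\<D>. measure lborel S *\<^sub>R (LINT x|lebesgue. \<psi> x * F s x)) = (\<Sum>p\<in>\<D>. LINT x|lebesgue. measure lborel (snd p) * (\<psi> x * F (fst p) x))"
      by (simp add: split_beta)
    also have "... = (LINT x|lebesgue. (\<Sum>p\<in>\<D>. measure lborel (snd p) * (\<psi> x * F (fst p) x)))"
      by (intro Bochner_Integration.integral_sum[symmetric] integrable_mult_right integrable_test[OF k _ p b] FD)
    also have "... - (LINT x|lebesgue. \<psi> x * I x) = (LINT x|lebesgue. (\<Sum>p\<in>\<D>. measure lborel (snd p) * (\<psi> x * F (fst p) x)) - \<psi> x * I x)"
      by (intro Bochner_Integration.integral_diff[symmetric] Bochner_Integration.integrable_sum integrable_mult_right integrable_test[OF k _ p b] FD IL)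
    also have "... = (LINT x|lebesgue. \<psi> x * h x)"
      by (simp add: h_def right_diff_distrib sum_distrib_left mult.left_commute)
    finally have eq: "(\<Sum>(s, S)\<in>\<D>. measure lborel S *\<^sub>R (LINT x|lebesgue. \<psi> x * F s x)) - (LINT x|lebesgue. \<psi> x * I x) = (LINT x|lebesgue. \<psi> x * h x)" .
    have "\<bar>LINT x|lebesgue. \<psi> x * h x\<bar> <= B * L1w_norm k h" unfolding B_def by (rule test_bound[OF k hL p b])
    also have "... <= B * (e / (B + 1))"
      using le[of \<D>] D B by (intro mult_left_mono) (auto simp: h_def[abs_def] split_beta less_imp_le)
    also have "... < e" using e B by (simp add: field_simps)
    finally show "norm ((\<Sum>(s, S)\<in>\<D>. measure lborel S *\<^sub>R (LINT x|lebesgue. \<psi> x * F s x)) - (LINT x|lebesgue. \<psi> x * I x)) < e"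
      unfolding eq by simp
  qed
qed

lemma AE_lebesgue_affine:
  fixes y :: "real ^ 'n"
  assumes "AE x in lebesgue. P x" and c: "c \<noteq> 0"
  shows "AE w in lebesgue. P (c *\<^sub>R (y - w))"
proof -
  obtain N where N: "negligible N" "{x. \<not> P x} \<subseteq> N"
    using assms(1) unfolding eventually_ae_filter_negligible by blast
  have "negligible ((\<lambda>z. (- inverse c) *\<^sub>R z) ` N)"
    by (rule negligible_differentiable_image_negligible[OF order.refl N(1)]) (auto intro!: derivative_intros)
  then have "negligible ((+) y ` ((\<lambda>z. (- inverse c) *\<^sub>R z) ` N))"
    by (rule negligible_translation)
  moreover have "{w. \<not> P (c *\<^sub>R (y - w))} \<subseteq> (+) y ` ((\<lambda>z. (- inverse c) *\<^sub>R z) ` N)"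
  proof
    fix w assume "w \<in> {w. \<not> P (c *\<^sub>R (y - w))}"
    then have "c *\<^sub>R (y - w) \<in> N" using N by blast
    moreover have "w = y + (- inverse c) *\<^sub>R (c *\<^sub>R (y - w))" using c by simp
    ultimately show "w \<in> (+) y ` ((\<lambda>z. (- inverse c) *\<^sub>R z) ` N)" by blast
  qed
  ultimately show ?thesis unfolding eventually_ae_filter_negligible by blast
qed

text \<open>For each fixed y, the points where the two kernels differ form a reflected, dilated and
  translated null set, so every single value of the convolution agrees.\<close>

lemma convol_version:
  fixes J Jl g g' :: "real ^ 'n => real"
  assumes [measurable]: "J \<in> borel_measurable borel" "g' \<in> borel_measurable borel"
    and Jl: "AE x in lebesgue. J x = Jl x" and g: "AE x in lebesgue. g' x = g x" and e: "0 < eps"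
  shows "convol (rescale eps Jl) g y = (LBINT w. rescale eps J (y - w) * g' w)"
  unfolding convol_def
proof (rule lebesgue_integral_version)
  have "AE w in lebesgue. J (inverse eps *\<^sub>R (y - w)) = Jl (inverse eps *\<^sub>R (y - w))"
    using AE_lebesgue_affine[OF Jl, of "inverse eps" y] e by simp
  with g show "AE w in lebesgue. rescale eps J (y - w) * g' w = rescale eps Jl (y - w) * g w"
    by eventually_elim (simp add: rescale_def)
qed measurable

lemma
  fixes f :: "(real ^ 'n) \<Rightarrow>\<^sub>C real"
  assumes k: "0 <= k" and c: "1 <= c" and Je: "wkernel k Je" and g'[measurable]: "g' \<in> borel_measurable borel"
    and wt_g: "integrable lborel (\<lambda>w. wt k w * \<bar>g' w\<bar>)"
  shows convolution_test: "(LBINT y. ev k f (c *\<^sub>R y) * (LBINT w. Je (y - w) * g' w))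
      = (LBINT w. (LBINT z. ev k f (c *\<^sub>R (w + z)) * Je z) * g' w)"
    and integrable_convolution_test: "integrable lborel (\<lambda>y. ev k f (c *\<^sub>R y) * (LBINT w. Je (y - w) * g' w))"
proof -
  have [measurable]: "Je \<in> borel_measurable borel" using Je by (simp add: wkernel_def)
  have fb: "\<bar>ev k f (c *\<^sub>R (w + z))\<bar> <= norm f * c powr k * (wt k w * kw k z)" for w z :: "real ^ 'n"
  proof -
    have "\<bar>ev k f (c *\<^sub>R (w + z))\<bar> <= norm f * wt k (c *\<^sub>R (w + z))" by (rule ev_bound)
    also have "... <= norm f * (c powr k * (wt k w * kw k z))"
      by (intro mult_left_mono order.trans[OF wt_scale_ge[OF k c]] wt_add k) auto
    finally show ?thesis by (simp add: mult.assoc)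
  qed
  have iz: "integrable lborel (\<lambda>z. ev k f (c *\<^sub>R (w + z)) * Je z)" for w
    by (rule wkernel_integrable_mono[OF Je, of _ "norm f * c powr k * wt k w"])
       (use fb[of w] in \<open>auto simp: abs_mult mult.assoc[symmetric] intro!: mult_right_mono\<close>)
  have "integrable (lborel \<Otimes>\<^sub>M lborel) (\<lambda>(w, y). ev k f (c *\<^sub>R y) * (Je (y - w) * g' w))"
  proof (rule lborel_pair.Fubini_integrable)
    have sh: "ev k f (c *\<^sub>R y) * (Je (y - w) * g' w) = (\<lambda>z. ev k f (c *\<^sub>R (w + z)) * Je z * g' w) (y - w)" for y w :: "real ^ 'n"
      by simp
    have "integrable lborel (\<lambda>y. (\<lambda>z. ev k f (c *\<^sub>R (w + z)) * Je z * g' w) (y + - w))" for w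
      by (subst integrable_shift_iff) (use iz[of w] in auto)
    then show "AE w in lborel. integrable lborel (\<lambda>y. case (w, y) of (w, y) => ev k f (c *\<^sub>R y) * (Je (y - w) * g' w))"
      by (simp add: sh)
    have i: "(LINT y|lborel. \<bar>ev k f (c *\<^sub>R y) * (Je (y - w) * g' w)\<bar>) = (LBINT z. \<bar>ev k f (c *\<^sub>R (w + z)) * Je z\<bar>) * \<bar>g' w\<bar>" for w
    proof -
      have "(LINT y|lborel. \<bar>ev k f (c *\<^sub>R y) * (Je (y - w) * g' w)\<bar>) = (LINT y|lborel. (\<lambda>z. \<bar>ev k f (c *\<^sub>R (w + z)) * Je z\<bar> * \<bar>g' w\<bar>) (y + - w))"
        by (simp add: abs_mult mult.assoc)
      also have "... = (LINT z|lborel. \<bar>ev k f (c *\<^sub>R (w + z)) * Je z\<bar> * \<bar>g' w\<bar>)"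
        by (rule integral_shift) measurable
      finally show ?thesis by simp
    qed
    have "integrable lborel (\<lambda>w. (LBINT z. \<bar>ev k f (c *\<^sub>R (w + z)) * Je z\<bar>) * \<bar>g' w\<bar>)"
    proof (rule Bochner_Integration.integrable_bound)
      show "integrable lborel (\<lambda>w. norm f * c powr k * kn k Je * (wt k w * \<bar>g' w\<bar>))"
        by (intro integrable_mult_right wt_g)
      have "(LBINT z. \<bar>ev k f (c *\<^sub>R (w + z)) * Je z\<bar>) <= norm f * c powr k * kn k Je * wt k w" for w
      proof -
        have "(LBINT z. \<bar>ev k f (c *\<^sub>R (w + z)) * Je z\<bar>) <= (LBINT z. norm f * c powr k * wt k w * (kw k z * \<bar>Je z\<bar>))"
        proof (rule integral_mono)
          show "integrable lborel (\<lambda>z. norm f * c powr k * wt k w * (kw k z * \<bar>Je z\<bar>))"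
            using Je by (intro integrable_mult_right) (simp add: wkernel_def)
          fix z
          show "\<bar>ev k f (c *\<^sub>R (w + z)) * Je z\<bar> <= norm f * c powr k * wt k w * (kw k z * \<bar>Je z\<bar>)"
            using mult_right_mono[OF fb[of w z], of "\<bar>Je z\<bar>"] by (simp add: abs_mult mult.assoc)
        qed (intro integrable_abs iz)
        then show ?thesis unfolding integral_mult_right_zero kn_def[symmetric] by (simp only: mult_ac)
      qed
      from mult_right_mono[OF this abs_ge_zero]
      show "AE w in lborel. norm ((LBINT z. \<bar>ev k f (c *\<^sub>R (w + z)) * Je z\<bar>) * \<bar>g' w\<bar>) <= norm (norm f * c powr k * kn k Je * (wt k w * \<bar>g' w\<bar>))"
        by (intro AE_I2) (auto simp: abs_mult kn_nonneg mult.assoc)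
    qed measurable
    then show "integrable lborel (\<lambda>w. LINT y|lborel. norm (case (w, y) of (w, y) => ev k f (c *\<^sub>R y) * (Je (y - w) * g' w)))"
      by (simp only: prod.case real_norm_def i)
  qed measurable
  note I = this
  from lborel_pair.Fubini_integral[OF I]
  have F: "(LBINT y. (LBINT w. ev k f (c *\<^sub>R y) * (Je (y - w) * g' w))) = (LBINT w. (LBINT y. ev k f (c *\<^sub>R y) * (Je (y - w) * g' w)))" .
  have inner: "(LBINT y. ev k f (c *\<^sub>R y) * (Je (y - w) * g' w)) = (LINT z|lborel. ev k f (c *\<^sub>R (w + z)) * Je z) * g' w" for w
  proof -
    have "(LBINT y. ev k f (c *\<^sub>R y) * (Je (y - w) * g' w)) = (LINT y|lborel. (\<lambda>z. ev k f (c *\<^sub>R (w + z)) * Je z * g' w) (y + - w))"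
      by (simp add: mult.assoc)
    also have "... = (LINT z|lborel. ev k f (c *\<^sub>R (w + z)) * Je z * g' w)"
      by (rule integral_shift) measurable
    finally show ?thesis by simp
  qed
  show "(LBINT y. ev k f (c *\<^sub>R y) * (LBINT w. Je (y - w) * g' w))
      = (LBINT w. (LBINT z. ev k f (c *\<^sub>R (w + z)) * Je z) * g' w)"
    using F unfolding inner by simp
  show "integrable lborel (\<lambda>y. ev k f (c *\<^sub>R y) * (LBINT w. Je (y - w) * g' w))"
    using lborel_pair.integrable_snd[OF I] by simp
qed

context jump_datum
begin

text \<open>Testing at \<open>c *\<^sub>R y\<close> magnifies the jump by c; with c = exp s this is
  the origin of the jump length eps exp s in the generator.\<close>

lemma convol_test:
  assumes e: "0 < eps" and c: "1 <= c" and g: "g \<in> L1w k" and Jl: "AE x in lebesgue. J x = Jl x"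
  shows "(LBINT y. ev k f (c *\<^sub>R y) * convol (rescale eps Jl) g y) = (LINT w|lebesgue. ev k (blf (K (eps * c)) f) (c *\<^sub>R w) * g w)"
    and "convol (rescale eps Jl) g \<in> borel_measurable borel"
proof -
  obtain g' where [measurable]: "g' \<in> borel_measurable borel" and g': "AE x in lebesgue. g' x = g x"
    and wt_g: "integrable lborel (\<lambda>w. wt k w * \<bar>g' w\<bar>)" by (rule L1w_Borel_version[OF k0 g])
  have cv: "convol (rescale eps Jl) g y = (LBINT w. rescale eps J (y - w) * g' w)" for y
    by (rule convol_version[OF _ _ Jl g' e]) measurable
  then have "convol (rescale eps Jl) g = (\<lambda>y. (LBINT w. rescale eps J (y - w) * g' w))" by (rule ext)
  then show "convol (rescale eps Jl) g \<in> borel_measurable borel" by simp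
  have inner: "(LINT z|lborel. ev k f (c *\<^sub>R (w + z)) * rescale eps J z) = ev k (blf (K (eps * c)) f) (c *\<^sub>R w)" for w
  proof -
    have "(LINT z|lborel. ev k f (c *\<^sub>R (w + z)) * rescale eps J z) = (LINT z|lborel. ev k f (c *\<^sub>R (w + eps *\<^sub>R z)) * J z)"
      by (rule integral_rescale(1)[of "\<lambda>z. ev k f (c *\<^sub>R (w + z))"]) (use e in auto)
    also have "... = ev k (blf (K (eps * c)) f) (c *\<^sub>R w)"
      using e c by (simp add: ev_K scaleR_add_right mult.commute)
    finally show ?thesis .
  qed
  have "(LBINT y. ev k f (c *\<^sub>R y) * convol (rescale eps Jl) g y) = (LBINT w. ev k (blf (K (eps * c)) f) (c *\<^sub>R w) * g' w)"
    unfolding cv convolution_test[OF k0 c wkernel_rescale_J[OF e] \<open>g' \<in> borel_measurable borel\<close> wt_g] inner ..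
  also have "... = (LINT w|lebesgue. ev k (blf (K (eps * c)) f) (c *\<^sub>R w) * g w)"
    by (rule lebesgue_integral_version[symmetric]) (use g' in \<open>auto elim!: eventually_mono\<close>)
  finally show "(LBINT y. ev k f (c *\<^sub>R y) * convol (rescale eps Jl) g y) = (LINT w|lebesgue. ev k (blf (K (eps * c)) f) (c *\<^sub>R w) * g w)" .
qed

text \<open>The dimensional part of the exponential is the Jacobian of the dilation, which carries
  exp t x to exp s y. What remains is the probability of no jump during [s, t].\<close>

lemma transport_test:
  fixes G :: "real ^ 'n => real"
  assumes [measurable]: "G \<in> borel_measurable borel"
  shows "(LINT x|lebesgue. ev k f (exp t *\<^sub>R x) * transport eps (t - s) G x) = exp (- (t - s) / eps\<^sup>2) * (LBINT y. ev k f (exp s *\<^sub>R y) * G y)"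
proof -
  define q where "q y = ev k f (exp s *\<^sub>R y) * G y" for y
  have [measurable]: "q \<in> borel_measurable borel" unfolding q_def by measurable
  have "(LINT x|lebesgue. ev k f (exp t *\<^sub>R x) * transport eps (t - s) G x) = (LBINT x. ev k f (exp t *\<^sub>R x) * transport eps (t - s) G x)"
    unfolding transport_def by (rule integral_completion) measurable
  also have "... = (LBINT x. exp (- (t - s) / eps\<^sup>2) * (exp (t - s) ^ CARD('n) * q (0 + exp (t - s) *\<^sub>R x)))"
  proof (rule Bochner_Integration.integral_cong[OF refl])
    fix x :: "real ^ 'n"
    have "exp ((real CARD('n) - 1 / eps\<^sup>2) * (t - s)) = exp (- (t - s) / eps\<^sup>2) * exp (t - s) ^ CARD('n)"
      by (simp add: exp_of_nat_mult[symmetric] exp_add[symmetric] algebra_simps diff_divide_distrib)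
    moreover have "q (0 + exp (t - s) *\<^sub>R x) = ev k f (exp t *\<^sub>R x) * G (exp (t - s) *\<^sub>R x)"
      by (simp add: q_def exp_add[symmetric])
    ultimately show "ev k f (exp t *\<^sub>R x) * transport eps (t - s) G x = exp (- (t - s) / eps\<^sup>2) * (exp (t - s) ^ CARD('n) * q (0 + exp (t - s) *\<^sub>R x))"
      by (simp add: transport_def mult_ac)
  qed
  also have "... = exp (- (t - s) / eps\<^sup>2) * (LBINT y. q y)"
    by (subst integral_scale[of q "exp (t - s)" 0]) simp_all
  finally show ?thesis by (simp add: q_def)
qed

definition Ut :: "(real => real ^ 'n => real) => real => ((real ^ 'n) \<Rightarrow>\<^sub>C real) => real" where
  "Ut u t f = (LINT x|lebesgue. ev k f (exp t *\<^sub>R x) * u t x)"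

lemma ev_exp_bound: "0 <= t ==> \<bar>ev k f (exp t *\<^sub>R x)\<bar> <= norm f * exp t powr k * wt k x"
  using mult_left_mono[OF wt_scale_ge[OF k0, of "exp t" x] norm_ge_zero[of f]]
  by (intro order.trans[OF ev_bound]) (simp add: mult.assoc)

text \<open>Duhamel's formula paired with \<open>f\<close> at \<open>exp t *\<^sub>R x\<close>.
  Multiplication by exp (t / eps^2) removes the no-jump factor, so the integrand no longer depends
  on the final time and the equation can be iterated.\<close>

lemma mild_test:
  assumes e: "0 < eps" and Jl: "AE x in lebesgue. J x = Jl x" and u: "mild_solution k eps Jl u0 u" and t: "0 <= t"
  shows "((\<lambda>s. exp (s / eps\<^sup>2) * Ut u s (blf (K (eps * exp s)) f)) has_integral eps\<^sup>2 * (exp (t / eps\<^sup>2) * Ut u t f - U0 f)) {0..t}"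
proof -
  obtain I where I: "has_L1w_integral k (\<lambda>s. transport eps (t - s) (convol (rescale eps Jl) (u s))) I 0 t"
    and ae: "AE x in lebesgue. u t x = transport eps t u0 x + 1 / eps\<^sup>2 * I x"
    using u t unfolding mild_solution_def by blast
  have uL: "u s \<in> L1w k" if "0 <= s" for s using u that by (simp add: mild_solution_def continuous_L1w_def)
  have IL: "I \<in> L1w k" using I by (simp add: has_L1w_integral_def)
  define \<psi> where "\<psi> x = ev k f (exp t *\<^sub>R x)" for x
  have [measurable]: "\<psi> \<in> borel_measurable borel" unfolding \<psi>_def by measurable
  have b: "\<bar>\<psi> x\<bar> <= norm f * exp t powr k * wt k x" for x unfolding \<psi>_def by (rule ev_exp_bound[OF t])
  have [measurable]: "\<psi> \<in> borel_measurable lebesgue" "u t \<in> borel_measurable lebesgue" "I \<in> borel_measurable lebesgue"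
    using L1w_measurable[OF uL[OF t]] L1w_measurable[OF IL] by (auto intro!: measurable_completion)
  have iI: "integrable lebesgue (\<lambda>x. \<psi> x * I x)" and iu: "integrable lebesgue (\<lambda>x. \<psi> x * u t x)"
    by (intro integrable_test[OF k0 _ _ b] IL uL t; measurable)+
  have "(LINT x|lebesgue. \<psi> x * u t x - 1 / eps\<^sup>2 * (\<psi> x * I x)) = (LINT x|lebesgue. \<psi> x * transport eps t u0 x)"
  proof (rule integral_cong_AE)
    show "(\<lambda>x. \<psi> x * transport eps t u0 x) \<in> borel_measurable lebesgue"
      unfolding transport_def by (intro measurable_completion) measurable
    show "AE x in lebesgue. \<psi> x * u t x - 1 / eps\<^sup>2 * (\<psi> x * I x) = \<psi> x * transport eps t u0 x"
      using ae by eventually_elim (simp add: algebra_simps)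
  qed measurable
  moreover have "(LINT x|lebesgue. \<psi> x * u t x - 1 / eps\<^sup>2 * (\<psi> x * I x)) = Ut u t f - 1 / eps\<^sup>2 * (LINT x|lebesgue. \<psi> x * I x)"
    using iI iu by (simp add: Ut_def \<psi>_def)
  moreover have "(LINT x|lebesgue. \<psi> x * transport eps t u0 x) = exp (- t / eps\<^sup>2) * U0 f"
    using transport_test[of u0 f t eps 0] by (simp add: \<psi>_def U0_def)
  ultimately have Uteq: "(LINT x|lebesgue. \<psi> x * I x) = eps\<^sup>2 * (Ut u t f - exp (- t / eps\<^sup>2) * U0 f)"
    using e by (simp add: field_simps)
  have "((\<lambda>s. LINT x|lebesgue. \<psi> x * transport eps (t - s) (convol (rescale eps Jl) (u s)) x) has_integral (LINT x|lebesgue. \<psi> x * I x)) {0..t}"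
    by (rule has_L1w_integral_test[OF k0 I _ b]) measurable
  from has_integral_mult_right[OF this, of "exp (t / eps\<^sup>2)"]
  have h: "((\<lambda>s. exp (t / eps\<^sup>2) * (LINT x|lebesgue. \<psi> x * transport eps (t - s) (convol (rescale eps Jl) (u s)) x))
      has_integral exp (t / eps\<^sup>2) * (LINT x|lebesgue. \<psi> x * I x)) {0..t}" .
  have "exp (t / eps\<^sup>2) * (LINT x|lebesgue. \<psi> x * I x) = eps\<^sup>2 * (exp (t / eps\<^sup>2) * Ut u t f - (exp (t / eps\<^sup>2) * exp (- t / eps\<^sup>2)) * U0 f)"
    unfolding Uteq by (simp only: right_diff_distrib mult_ac)
  also have "exp (t / eps\<^sup>2) * exp (- t / eps\<^sup>2) = 1" by (simp flip: exp_add)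
  finally have v: "exp (t / eps\<^sup>2) * (LINT x|lebesgue. \<psi> x * I x) = eps\<^sup>2 * (exp (t / eps\<^sup>2) * Ut u t f - U0 f)" by simp
  have "exp (t / eps\<^sup>2) * (LINT x|lebesgue. \<psi> x * transport eps (t - s) (convol (rescale eps Jl) (u s)) x) = exp (s / eps\<^sup>2) * Ut u s (blf (K (eps * exp s)) f)"
    if s: "s \<in> {0..t}" for s
  proof -
    have c: "convol (rescale eps Jl) (u s) \<in> borel_measurable borel"
      using s by (intro convol_test(2)[OF e order.refl _ Jl] uL) auto
    have "(LINT x|lebesgue. \<psi> x * transport eps (t - s) (convol (rescale eps Jl) (u s)) x) = exp (- (t - s) / eps\<^sup>2) * Ut u s (blf (K (eps * exp s)) f)"
      unfolding \<psi>_def transport_test[OF c] Ut_def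
      using s by (subst convol_test(1)[OF e _ _ Jl]) (auto intro: uL)
    moreover have "exp (t / eps\<^sup>2) * exp (- (t - s) / eps\<^sup>2) = exp (s / eps\<^sup>2)"
      by (simp add: diff_divide_distrib flip: exp_add)
    ultimately show ?thesis by (metis mult.assoc)
  qed
  from has_integral_cong[THEN iffD1, OF this h] show ?thesis unfolding v .
qed

end

lemma L1w_norm_diff_bound:
  assumes f: "f \<in> L1w k" and g: "g \<in> L1w k"
  shows "\<bar>L1w_norm k f - L1w_norm k g\<bar> <= L1w_norm k (\<lambda>x. f x - g x)"
proof -
  have i: "integrable lebesgue (\<lambda>x. weight k x * \<bar>f x\<bar>)" "integrable lebesgue (\<lambda>x. weight k x * \<bar>g x\<bar>)"
    "integrable lebesgue (\<lambda>x. weight k x * \<bar>f x - g x\<bar>)"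
    using f g L1w_diff[OF f g] by (auto simp: L1w_def)
  have "L1w_norm k f <= (LINT x|lebesgue. weight k x * \<bar>g x\<bar> + weight k x * \<bar>f x - g x\<bar>)" unfolding L1w_norm_def
    by (intro integral_mono Bochner_Integration.integrable_add i) (auto simp: distrib_left[symmetric] intro!: mult_left_mono)
  moreover have "L1w_norm k g <= (LINT x|lebesgue. weight k x * \<bar>f x\<bar> + weight k x * \<bar>f x - g x\<bar>)" unfolding L1w_norm_def
    by (intro integral_mono Bochner_Integration.integrable_add i) (auto simp: distrib_left[symmetric] intro!: mult_left_mono)
  ultimately show ?thesis by (simp add: i L1w_norm_def abs_le_iff)
qed

lemma continuous_L1w_norm_bounded:
  assumes u: "continuous_L1w k u"
  obtains M where "\<And>s. 0 <= s ==> s <= T ==> L1w_norm k (u s) <= M"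
proof -
  have "continuous_on {0..T} (\<lambda>s. L1w_norm k (u s))"
    unfolding continuous_on_def
  proof
    fix t assume t: "t \<in> {0..T}"
    have "((\<lambda>s. L1w_norm k (\<lambda>x. u s x - u t x)) \<longlongrightarrow> 0) (at t within {0..})"
      using u t by (simp add: continuous_L1w_def)
    then have l: "((\<lambda>s. L1w_norm k (\<lambda>x. u s x - u t x)) \<longlongrightarrow> 0) (at t within {0..T})"
      by (rule tendsto_within_subset) auto
    have "((\<lambda>s. L1w_norm k (u s) - L1w_norm k (u t)) \<longlongrightarrow> 0) (at t within {0..T})"
    proof (rule Lim_null_comparison[OF _ l])
      have "norm (L1w_norm k (u s) - L1w_norm k (u t)) <= L1w_norm k (\<lambda>x. u s x - u t x)" if "s \<in> {0..T}" for s
        using u t that unfolding real_norm_def by (intro L1w_norm_diff_bound) (auto simp: continuous_L1w_def)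
      then show "\<forall>\<^sub>F s in at t within {0..T}. norm (L1w_norm k (u s) - L1w_norm k (u t)) <= L1w_norm k (\<lambda>x. u s x - u t x)"
        unfolding eventually_at_filter by (auto intro!: always_eventually)
    qed
    then show "((\<lambda>s. L1w_norm k (u s)) \<longlongrightarrow> L1w_norm k (u t)) (at t within {0..T})" by (rule LIM_zero_cancel)
  qed
  then have "bounded ((\<lambda>s. L1w_norm k (u s)) ` {0..T})"
    by (intro compact_imp_bounded compact_continuous_image) auto
  then obtain M where "\<forall>x\<in>(\<lambda>s. L1w_norm k (u s)) ` {0..T}. norm x <= M" unfolding bounded_iff by blast
  then show thesis by (intro that[of M]) (force intro: order.trans[OF abs_ge_self])
qed

context jump_datum
begin

lemma Pop_integral:
  assumes e: "0 < eps" and t: "0 <= t"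
  shows "((\<lambda>s. exp (s / eps\<^sup>2) * U0 (blf (Pop eps 0 s) (blf (K (eps * exp s)) f)))
    has_integral eps\<^sup>2 * (exp (t / eps\<^sup>2) * U0 (blf (Pop eps 0 t) f) - U0 f)) {0..t}"
proof -
  define F where "F s = eps\<^sup>2 * (exp (s / eps\<^sup>2) * U0 (blf (Pop eps 0 s) f))" for s
  have d: "(F has_vector_derivative exp (s / eps\<^sup>2) * U0 (blf (Pop eps 0 s) (blf (K (eps * exp s)) f))) (at s within {0..t})"
    if s: "s \<in> {0..t}" for s
  proof -
    have "((\<lambda>s. U0 (blf (Pop eps 0 s) f)) has_vector_derivative U0 (blf (Pop eps 0 s * gen eps s) f)) (at s within {0..t})"
      by (rule bounded_linear.has_vector_derivative[OF bounded_linear_compose[OF bounded_linear_U0 blf.bounded_linear_left] Pop_has_vector_derivative_upper[OF e s]])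
    then have dP: "((\<lambda>s. U0 (blf (Pop eps 0 s) f)) has_real_derivative U0 (blf (Pop eps 0 s * gen eps s) f)) (at s within {0..t})"
      by (simp add: has_real_derivative_iff_has_vector_derivative)
    have dE: "((\<lambda>s. exp (s / eps\<^sup>2)) has_real_derivative exp (s / eps\<^sup>2) / eps\<^sup>2) (at s within {0..t})"
      using DERIV_chain2[OF DERIV_exp DERIV_cdivide[OF DERIV_ident]] by simp
    have "((\<lambda>s. exp (s / eps\<^sup>2) * U0 (blf (Pop eps 0 s) f)) has_real_derivative
        exp (s / eps\<^sup>2) / eps\<^sup>2 * U0 (blf (Pop eps 0 s) f) + U0 (blf (Pop eps 0 s * gen eps s) f) * exp (s / eps\<^sup>2)) (at s within {0..t})"
      by (rule DERIV_mult[OF dE dP])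
    from DERIV_cmult[OF this, of "eps\<^sup>2"] have "(F has_real_derivative
        eps\<^sup>2 * (exp (s / eps\<^sup>2) / eps\<^sup>2 * U0 (blf (Pop eps 0 s) f) + U0 (blf (Pop eps 0 s * gen eps s) f) * exp (s / eps\<^sup>2))) (at s within {0..t})"
      unfolding F_def[abs_def] .
    moreover have "U0 (blf (Pop eps 0 s * gen eps s) f) = (1 / eps\<^sup>2) * (U0 (blf (Pop eps 0 s) (blf (K (eps * exp s)) f)) - U0 (blf (Pop eps 0 s) f))"
      unfolding gen_def by (simp only: blf_simps blf.scaleR_right blf.diff_right U0_linear)
    moreover have "eps\<^sup>2 * (E / eps\<^sup>2 * a + (1 / eps\<^sup>2) * (b - a) * E) = E * b" for E a b :: real
      using e by (simp add: field_simps power2_eq_square)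
    ultimately show ?thesis
      unfolding has_real_derivative_iff_has_vector_derivative[symmetric] by simp
  qed
  have "((\<lambda>s. exp (s / eps\<^sup>2) * U0 (blf (Pop eps 0 s) (blf (K (eps * exp s)) f))) has_integral F t - F 0) {0..t}"
    by (rule fundamental_theorem_of_calculus[OF t d])
  then show ?thesis by (simp add: F_def right_diff_distrib)
qed

text \<open>Both sides satisfy the same Duhamel equation; iterating it on their difference gives
  the terms of an exponential series, hence zero.\<close>

lemma mild_representation:
  assumes e: "0 < eps" and Jl: "AE x in lebesgue. J x = Jl x" and u: "mild_solution k eps Jl u0 u" and T: "0 <= T"
  shows "Ut u T f = U0 (blf (Pop eps 0 T) f)"
proof -
  have cu: "continuous_L1w k u" using u by (simp add: mild_solution_def)
  obtain M1 where M1: "\<And>s. 0 <= s ==> s <= T ==> L1w_norm k (u s) <= M1"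
    by (rule continuous_L1w_norm_bounded[OF cu, of T]) blast
  have "continuous_on {0..T} (\<lambda>s. Pop eps 0 s)"
    unfolding continuous_on_eq_continuous_within
    using has_vector_derivative_continuous[OF Pop_has_vector_derivative_upper[OF e]] by blast
  then have "bounded ((\<lambda>s. Pop eps 0 s) ` {0..T})"
    by (intro compact_imp_bounded compact_continuous_image) auto
  then obtain M2 where "\<forall>X\<in>(\<lambda>s. Pop eps 0 s) ` {0..T}. norm X <= M2" unfolding bounded_iff by blast
  then have M2: "\<And>s. s \<in> {0..T} ==> norm (Pop eps 0 s) <= M2" by blast
  have "bounded ((\<lambda>s. K (eps * exp s)) ` {0..T})"
    by (intro compact_imp_bounded compact_continuous_image continuous_on_K e) auto
  then obtain B where "\<forall>X\<in>(\<lambda>s. K (eps * exp s)) ` {0..T}. norm X <= B" unfolding bounded_iff by blast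
  then have B: "\<And>s. s \<in> {0..T} ==> norm (K (eps * exp s)) <= B" by blast
  have B0: "0 <= B" using B[of 0] T norm_ge_zero[of "K (eps * exp 0)"] by (simp del: norm_ge_zero)
  have M10: "0 <= M1"
    using M1[of 0] T order.trans[of 0 "L1w_norm k (u 0)" M1] by (simp add: L1w_norm_def)
  have M20: "0 <= M2" using M2[of 0] T order.trans[OF norm_ge_zero] by fastforce
  define D where "D t f = exp (t / eps\<^sup>2) * (Ut u t f - U0 (blf (Pop eps 0 t) f))" for t f
  define M where "M = exp (T / eps\<^sup>2) * (exp T powr k * 2 powr k * M1 + M2 * I0)"
  define lam where "lam = B / eps\<^sup>2"
  have M0: "0 <= M" unfolding M_def using M10 M20 I0_nonneg by (intro mult_nonneg_nonneg add_nonneg_nonneg) auto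
  have base: "\<bar>D t f\<bar> <= M * norm f" if t: "t \<in> {0..T}" for t f
  proof -
    have "\<bar>Ut u t f\<bar> <= (norm f * exp t powr k) * 2 powr k * L1w_norm k (u t)"
      unfolding Ut_def
      by (rule test_bound[OF k0]) (use cu t in \<open>auto simp: continuous_L1w_def intro!: ev_exp_bound\<close>)
    also have "... <= (norm f * exp T powr k) * 2 powr k * M1"
      using t M1[of t] k0 by (intro mult_mono mult_right_mono mult_left_mono powr_mono2) (auto simp: L1w_norm_def intro!: integral_nonneg_AE)
    finally have 1: "\<bar>Ut u t f\<bar> <= norm f * (exp T powr k * 2 powr k * M1)" by (simp add: mult.assoc)
    have "\<bar>U0 (blf (Pop eps 0 t) f)\<bar> <= norm (blf (Pop eps 0 t) f) * I0" by (rule U0_bound[OF ev_bound])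
    also have "... <= (M2 * norm f) * I0"
      using t by (intro mult_right_mono order.trans[OF norm_blf] M2 I0_nonneg) auto
    finally have "\<bar>Ut u t f - U0 (blf (Pop eps 0 t) f)\<bar> <= norm f * (exp T powr k * 2 powr k * M1 + M2 * I0)"
      using 1 by (simp add: algebra_simps)
    moreover have "exp (t / eps\<^sup>2) <= exp (T / eps\<^sup>2)" using t e by (simp add: divide_right_mono)
    ultimately have "exp (t / eps\<^sup>2) * \<bar>Ut u t f - U0 (blf (Pop eps 0 t) f)\<bar> <= exp (T / eps\<^sup>2) * (norm f * (exp T powr k * 2 powr k * M1 + M2 * I0))"
      by (intro mult_mono) auto
    then show ?thesis by (simp add: D_def M_def abs_mult mult_ac)
  qed
  have step: "((\<lambda>s. D s (blf (K (eps * exp s)) f)) has_integral eps\<^sup>2 * D t f) {0..t}" if t: "t \<in> {0..T}" for t f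
  proof -
    have "0 <= t" using t by simp
    from has_integral_diff[OF mild_test[OF e Jl u this, of f] Pop_integral[OF e this, of f]]
    show ?thesis by (simp add: D_def right_diff_distrib)
  qed
  \<comment> \<open>The test function must be arbitrary in the induction: the Duhamel step evaluates
    the previous bound at its image under \<open>K\<close>.\<close>
  have "\<bar>D t f\<bar> <= M * norm f * ((lam * t) ^ n / fact n)" if "t \<in> {0..T}" for t f n
    using that
  proof (induction n arbitrary: t f)
    case 0
    then show ?case using base by simp
  next
    case (Suc n)
    have t: "0 <= t" using Suc.prems by simp
    define G where "G s = M * B * norm f * (lam ^ n / fact n) * (s ^ Suc n / real (Suc n))" for s
    define g where "g s = M * B * norm f * (lam ^ n / fact n) * s ^ n" for s
    have "(g has_integral G t - G 0) {0..t}"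
    proof (rule fundamental_theorem_of_calculus[OF t])
      fix s
      have "((\<lambda>s. s ^ Suc n / real (Suc n)) has_real_derivative s ^ n) (at s within {0..t})"
        using DERIV_cdivide[OF DERIV_pow[of "Suc n" s], where c="real (Suc n)"] by (simp del: of_nat_Suc)
      from DERIV_cmult[OF this] show "(G has_vector_derivative g s) (at s within {0..t})"
        unfolding G_def[abs_def] g_def has_real_derivative_iff_has_vector_derivative[symmetric] .
    qed
    then have gi: "(g has_integral G t) {0..t}" by (simp add: G_def)
    have b: "\<bar>D s (blf (K (eps * exp s)) f)\<bar> <= g s" if s: "s \<in> {0..t}" for s
    proof -
      have s': "s \<in> {0..T}" using s Suc.prems by simp
      have "\<bar>D s (blf (K (eps * exp s)) f)\<bar> <= M * norm (blf (K (eps * exp s)) f) * ((lam * s) ^ n / fact n)" by (rule Suc.IH[OF s'])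
      also have "... <= M * (B * norm f) * ((lam * s) ^ n / fact n)"
        using s B0 M0 by (intro mult_right_mono mult_left_mono order.trans[OF norm_blf] B s') (auto simp: lam_def)
      also have "... = g s" by (simp add: g_def power_mult_distrib)
      finally show ?thesis .
    qed
    have "eps\<^sup>2 * D t f <= G t"
      by (rule has_integral_le[OF step[OF Suc.prems] gi]) (use b in \<open>auto simp: abs_le_iff\<close>)
    moreover have "- (eps\<^sup>2 * D t f) <= G t"
      by (rule has_integral_le[OF has_integral_neg[OF step[OF Suc.prems]] gi]) (use b in \<open>auto simp: abs_le_iff\<close>)
    ultimately have "eps\<^sup>2 * \<bar>D t f\<bar> <= G t" by (auto simp: abs_if)
    then have "\<bar>D t f\<bar> <= G t / eps\<^sup>2" using e by (simp add: field_simps)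
    also have "G t / eps\<^sup>2 = M * norm f * ((lam * t) ^ Suc n / fact (Suc n))"
      by (simp add: G_def lam_def power_mult_distrib power_divide ac_simps)
    finally show ?case .
  qed
  then have le: "\<bar>D T f\<bar> <= M * norm f * ((lam * T) ^ n / fact n)" for n using T by simp
  have "(\<lambda>n. (lam * T) ^ n / fact n) \<longlonglongrightarrow> 0"
    using summable_LIMSEQ_zero[OF summable_exp[of "lam * T"]] by (simp add: divide_inverse mult.commute)
  from tendsto_mult_right_zero[OF this, of "M * norm f"] have "\<bar>D T f\<bar> <= 0"
    by (rule LIMSEQ_le_const) (use le in auto)
  then show ?thesis by (simp add: D_def)
qed

section \<open>From the weak estimate to the weighted L1 norm\<close>

text \<open>Test functions close to \<open>wt\<close> times the sign of \<open>g\<close> recover the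
  integral of \<open>wt\<close> times |g|. The factor 2 is the comparison of \<open>weight\<close>
  with \<open>wt\<close>.\<close>

lemma weighted_duality:
  assumes g: "g \<in> L1w k" and T: "0 <= T"
    and B: "\<And>f. (\<forall>x. \<bar>ev k f x\<bar> <= om T x) ==> \<bar>LINT x|lebesgue. ev k f (exp T *\<^sub>R x) * g x\<bar> <= B"
  shows "L1w_norm k g <= 2 * B"
proof -
  obtain g' where g'm[measurable]: "g' \<in> borel_measurable borel" and g': "AE x in lebesgue. g' x = g x"
    and i: "integrable lborel (\<lambda>x. wt k x * \<bar>g' x\<bar>)" by (rule L1w_Borel_version[OF k0 g])
  have "(\<lambda>x. sgn (g' x)) \<in> borel_measurable lebesgue" by (intro measurable_completion) measurable
  from measurable_continuous_AE_limit[OF this]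
  obtain h where h: "\<And>n :: nat. continuous_on UNIV (h n)" "AE x in lebesgue. (\<lambda>n. h n x) \<longlonglongrightarrow> sgn (g' x)" by blast
  have hl: "AE x in lborel. (\<lambda>n. h n x) \<longlonglongrightarrow> sgn (g' x)" using h(2) AE_completion_iff by blast
  \<comment> \<open>Clipping to [-1, 1] makes the approximants admissible test functions without
    changing their limit, a sign.\<close>
  define \<phi> where "\<phi> n x = wt k x * max (- 1) (min 1 (h n x))" for n x
  have \<phi>c: "continuous_on UNIV (\<phi> n)" for n unfolding \<phi>_def by (intro continuous_intros h)
  have [measurable]: "\<phi> n \<in> borel_measurable borel" for n by (intro borel_measurable_continuous_onI \<phi>c)
  have \<phi>b: "\<bar>\<phi> n x\<bar> <= wt k x" for n x
  proof -
    have "wt k x * \<bar>max (- 1) (min 1 (h n x))\<bar> <= wt k x * 1" by (intro mult_left_mono) auto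
    then show ?thesis by (simp add: \<phi>_def abs_mult)
  qed
  have test: "\<bar>LBINT x. \<phi> n x * g' x\<bar> <= B" for n
  proof -
    define f where "f = mk k (\<lambda>y. \<phi> n (exp (- T) *\<^sub>R y))"
    have fo: "\<bar>\<phi> n (exp (- T) *\<^sub>R y)\<bar> <= om T y" for y unfolding om_def by (rule \<phi>b)
    have fe: "ev k f y = \<phi> n (exp (- T) *\<^sub>R y)" for y
      unfolding f_def
    proof (rule ev_mk[where C=1])
      show "continuous_on UNIV (\<lambda>y. \<phi> n (exp (- T) *\<^sub>R y))"
        by (intro continuous_on_compose2[OF \<phi>c] continuous_intros) auto
      show "\<bar>\<phi> n (exp (- T) *\<^sub>R y)\<bar> <= 1 * wt k y" for y using order.trans[OF fo om_le_wt[OF T]] by simp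
    qed
    have "(LINT x|lebesgue. ev k f (exp T *\<^sub>R x) * g x) = (LBINT x. \<phi> n x * g' x)"
    proof (rule lebesgue_integral_version)
      show "AE x in lebesgue. \<phi> n x * g' x = ev k f (exp T *\<^sub>R x) * g x"
        using g' by eventually_elim (simp add: fe exp_add[symmetric])
    qed measurable
    then show ?thesis using B[of f] fo fe by simp
  qed
  have "(\<lambda>n. (LBINT x. \<phi> n x * g' x)) \<longlonglongrightarrow> (LBINT x. wt k x * \<bar>g' x\<bar>)"
  proof (rule integral_dominated_convergence[OF _ _ i])
    show "AE x in lborel. (\<lambda>n. \<phi> n x * g' x) \<longlonglongrightarrow> wt k x * \<bar>g' x\<bar>"
      using hl
    proof eventually_elim
      fix x assume "(\<lambda>n. h n x) \<longlonglongrightarrow> sgn (g' x)"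
      then have "(\<lambda>n. \<phi> n x * g' x) \<longlonglongrightarrow> wt k x * max (- 1) (min 1 (sgn (g' x))) * g' x"
        unfolding \<phi>_def by (intro tendsto_intros)
      moreover have "max (- 1) (min 1 (sgn (g' x))) * g' x = \<bar>g' x\<bar>" by (auto simp: sgn_if)
      ultimately show "(\<lambda>n. \<phi> n x * g' x) \<longlonglongrightarrow> wt k x * \<bar>g' x\<bar>" by (simp add: mult.assoc)
    qed
    show "AE x in lborel. norm (\<phi> n x * g' x) <= wt k x * \<bar>g' x\<bar>" for n
      using \<phi>b[of n] by (intro AE_I2) (auto simp: abs_mult intro!: mult_right_mono)
  qed measurable
  then have "(LBINT x. wt k x * \<bar>g' x\<bar>) <= B"
    by (rule LIMSEQ_le_const2) (use test in \<open>auto simp: abs_le_iff\<close>)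
  moreover have "L1w_norm k g = (LBINT x. weight k x * \<bar>g' x\<bar>)"
    unfolding L1w_norm_def
  proof (rule lebesgue_integral_version)
    show "AE x in lebesgue. weight k x * \<bar>g' x\<bar> = weight k x * \<bar>g x\<bar>" using g' by eventually_elim simp
  qed measurable
  moreover have "(LBINT x. weight k x * \<bar>g' x\<bar>) <= (LBINT x. 2 * (wt k x * \<bar>g' x\<bar>))"
  proof (rule integral_mono)
    have b: "weight k x * \<bar>g' x\<bar> <= 2 * (wt k x * \<bar>g' x\<bar>)" for x
      using mult_right_mono[OF weight_le_wt[OF k0, of x], of "\<bar>g' x\<bar>"] by (simp add: mult.assoc)
    then show "weight k x * \<bar>g' x\<bar> <= 2 * (wt k x * \<bar>g' x\<bar>)" for x .
    show i2: "integrable lborel (\<lambda>x. 2 * (wt k x * \<bar>g' x\<bar>))" by (intro integrable_mult_right i)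
    show "integrable lborel (\<lambda>x. weight k x * \<bar>g' x\<bar>)"
      by (rule Bochner_Integration.integrable_bound[OF i2]) (use b in \<open>auto intro!: AE_I2 simp: abs_mult\<close>)
  qed
  ultimately show ?thesis by simp
qed

text \<open>The factor exp (d t) is the Jacobian of y = exp t x, and Fubini moves the heat kernel
  onto the test function. At t = 0 the solution is the datum itself and no kernel occurs, whence the
  case distinction.\<close>

lemma fokker_planck_test:
  assumes t: "0 <= t"
  shows "fokker_planck_solution u0 t \<in> L1w k"
    and "(LINT x|lebesgue. ev k f (exp t *\<^sub>R x) * fokker_planck_solution u0 t x) = (if t = 0 then U0 f else U0 (blf (Nop t) f))"
proof -
  define h where "h = heat_solution u0 (tau t)"
  have wu: "integrable lborel (\<lambda>w. wt k w * \<bar>u0 w\<bar>)" using u0i by (simp add: u0_nonneg)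
  \<comment> \<open>The weight is itself a test function; using it yields the weighted integrability
    of the heat solution.\<close>
  have wtc: "ev k (mk k (wt k)) x = wt k x" for x :: "real ^ 'n"
    by (rule ev_mk[where C=1]) (auto intro!: continuous_intros)
  have h: "h \<in> borel_measurable borel \<and> integrable lborel (\<lambda>y. wt k y * h y) \<and> (\<forall>y. 0 <= h y) \<and>
      (LBINT y. ev k f y * h y) = (if t = 0 then U0 f else U0 (blf (Nop t) f))"
  proof (cases "t = 0")
    case True
    then have "h = u0" by (simp add: h_def heat_solution_def tau_def)
    then show ?thesis using True u0i by (simp add: u0_nonneg U0_def)
  next
    case False
    then have tau: "0 < tau t" using t by (intro tau_pos) simp
    have he: "h = (\<lambda>y. (LBINT w. Hk (tau t) (y - w) * u0 w))"
    proof
      fix y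
      have "(LINT w|lebesgue. Hk (tau t) (y - w) * u0 w) = (LBINT w. Hk (tau t) (y - w) * u0 w)"
        by (rule integral_completion) measurable
      then show "h y = (LBINT w. Hk (tau t) (y - w) * u0 w)"
        using tau by (simp add: h_def heat_solution_def convol_def)
    qed
    have wk: "wkernel k (Hk (tau t) :: real ^ 'n => real)" by (rule wkernel_heat[OF k0 tau])
    have "integrable lborel (\<lambda>y. ev k (mk k (wt k)) (1 *\<^sub>R y) * (LBINT w. Hk (tau t) (y - w) * u0 w))"
      by (rule integrable_convolution_test[OF k0 order.refl wk u0m wu])
    then have "integrable lborel (\<lambda>y. wt k y * h y)" by (simp add: wtc he)
    moreover have "h \<in> borel_measurable borel" unfolding he by measurable
    moreover have "\<forall>y. 0 <= h y"
      unfolding he by (auto intro!: integral_nonneg_AE AE_I2 mult_nonneg_nonneg heat_kernel_nonneg tau u0_nonneg)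
    moreover have "(LBINT y. ev k f y * h y) = U0 (blf (Nop t) f)"
      using convolution_test[OF k0 order.refl wk u0m wu, of f] unfolding he U0_def Nop_def ev_cop[OF k0 wk] by simp
    ultimately show ?thesis using False by simp
  qed
  then have [measurable]: "h \<in> borel_measurable borel" by blast
  define v where "v = fokker_planck_solution u0 t"
  have v: "v x = exp t ^ CARD('n) * h (exp t *\<^sub>R x)" for x
    by (simp add: v_def fokker_planck_solution_def h_def tau_def exp_of_nat_mult[symmetric])
  have [measurable]: "v \<in> borel_measurable borel" unfolding v[abs_def] by measurable
  have "integrable lborel (\<lambda>x. wt k (0 + exp t *\<^sub>R x) * h (0 + exp t *\<^sub>R x))"
    by (subst integrable_scale_iff[of "\<lambda>y. wt k y * h y" "exp t" 0]) (use h in auto)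
  then have "integrable lborel (\<lambda>x. 2 * exp t ^ CARD('n) * (wt k (exp t *\<^sub>R x) * h (exp t *\<^sub>R x)))" by simp
  then have "integrable lborel (\<lambda>x. weight k x * \<bar>v x\<bar>)"
  proof (rule Bochner_Integration.integrable_bound)
    have "weight k x * \<bar>v x\<bar> <= 2 * exp t ^ CARD('n) * (wt k (exp t *\<^sub>R x) * h (exp t *\<^sub>R x))" for x
    proof -
      have "wt k x = wt k (exp (- t) *\<^sub>R (exp t *\<^sub>R x))" by (simp add: exp_add[symmetric])
      also have "... <= wt k (exp t *\<^sub>R x)" using t by (intro wt_scale_le k0) auto
      finally have "weight k x <= 2 * wt k (exp t *\<^sub>R x)" using weight_le_wt[OF k0, of x] by linarith
      then have "weight k x * v x <= 2 * wt k (exp t *\<^sub>R x) * v x" using h by (intro mult_right_mono) (auto simp: v)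
      then show ?thesis using h by (simp add: v mult_ac)
    qed
    then show "AE x in lborel. norm (weight k x * \<bar>v x\<bar>) <= norm (2 * exp t ^ CARD('n) * (wt k (exp t *\<^sub>R x) * h (exp t *\<^sub>R x)))"
      using h by (intro AE_I2) (simp add: abs_mult)
  qed measurable
  then have "integrable lebesgue (\<lambda>x. weight k x * \<bar>v x\<bar>)" using integrable_completion[of "\<lambda>x. weight k x * \<bar>v x\<bar>" lborel] by simp
  then show "fokker_planck_solution u0 t \<in> L1w k"
    unfolding v_def[symmetric] L1w_def by (simp add: measurable_completion)
  have "(LINT x|lebesgue. ev k f (exp t *\<^sub>R x) * v x) = (LBINT x. ev k f (exp t *\<^sub>R x) * v x)"
    by (rule integral_completion) measurable
  also have "... = exp t ^ CARD('n) * (LBINT x. (\<lambda>y. ev k f y * h y) (0 + exp t *\<^sub>R x))"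
    by (simp add: v mult.left_commute)
  also have "... = (LBINT y. ev k f y * h y)"
    by (rule integral_scale[symmetric]) auto
  finally show "(LINT x|lebesgue. ev k f (exp t *\<^sub>R x) * fokker_planck_solution u0 t x) = (if t = 0 then U0 f else U0 (blf (Nop t) f))"
    using h by (simp add: v_def)
qed

text \<open>\<open>Jl\<close> is the kernel of the given equation and \<open>J\<close> its Borel
  version; they are equal almost everywhere only, so both occur.\<close>

lemma convergence_estimate:
  obtains C where "0 <= C" "\<And>eps Jl u t. 0 < eps ==> eps <= 1 ==> AE x in lebesgue. J x = Jl x ==> mild_solution k eps Jl u0 u ==> 0 <= t ==>
    (\<lambda>x. u t x - fokker_planck_solution u0 t x) \<in> L1w k \<and> L1w_norm k (\<lambda>x. u t x - fokker_planck_solution u0 t x) <= C * eps\<^sup>2"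
proof -
  obtain C where C: "0 <= C" and cmp: "\<And>eps T f. 0 < eps ==> eps <= 1 ==> 0 < T ==> (\<forall>x. \<bar>ev k f x\<bar> <= om T x) ==>
    \<bar>U0 (blf (Nop T) f) - U0 (blf (Pop eps 0 T) f)\<bar> <= C * eps\<^sup>2"
    by (rule evolution_comparison) (rule that; assumption)
  show thesis
  proof (rule that[of "2 * C"])
    fix eps t :: real and Jl u
    assume e: "0 < eps" "eps <= 1" and Jl: "AE x in lebesgue. J x = Jl x" and u: "mild_solution k eps Jl u0 u" and t: "0 <= t"
    have uL: "u t \<in> L1w k" using u t by (simp add: mild_solution_def continuous_L1w_def)
    have vL: "fokker_planck_solution u0 t \<in> L1w k" by (rule fokker_planck_test(1)[OF t])
    have d: "(\<lambda>x. u t x - fokker_planck_solution u0 t x) \<in> L1w k" by (rule L1w_diff[OF uL vL])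
    have "L1w_norm k (\<lambda>x. u t x - fokker_planck_solution u0 t x) <= 2 * (C * eps\<^sup>2)"
    proof (rule weighted_duality[OF d t])
      fix f assume f: "\<forall>x. \<bar>ev k f x\<bar> <= om t x"
      have "(LINT x|lebesgue. ev k f (exp t *\<^sub>R x) * (u t x - fokker_planck_solution u0 t x))
          = Ut u t f - (LINT x|lebesgue. ev k f (exp t *\<^sub>R x) * fokker_planck_solution u0 t x)"
        unfolding Ut_def right_diff_distrib
        by (intro Bochner_Integration.integral_diff integrable_test[OF k0 _ _ ev_exp_bound[OF t]] uL vL; measurable)
      also have "... = U0 (blf (Pop eps 0 t) f) - (if t = 0 then U0 f else U0 (blf (Nop t) f))"
        unfolding fokker_planck_test(2)[OF t] mild_representation[OF e(1) Jl u t] ..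
      also have "\<bar>...\<bar> <= C * eps\<^sup>2"
        using cmp[OF e, of t f] f t C by (cases "t = 0") (auto simp: abs_minus_commute)
      finally show "\<bar>LINT x|lebesgue. ev k f (exp t *\<^sub>R x) * (u t x - fokker_planck_solution u0 t x)\<bar> <= C * eps\<^sup>2" .
    qed
    with d show "(\<lambda>x. u t x - fokker_planck_solution u0 t x) \<in> L1w k \<and> L1w_norm k (\<lambda>x. u t x - fokker_planck_solution u0 t x) <= 2 * C * eps\<^sup>2"
      by simp
  qed (use C in simp)
qed

end

section \<open>From the hypotheses to the locale, and conclusion\<close>

text \<open>A Borel version of J is made nonnegative everywhere by taking the positive part, which
  alters it on a null set only; all moments carry over.\<close>

lemma jump_datum_of_hypotheses:
  fixes k :: real and J u\<^sub>0 :: "real ^ 'n => real" and c K :: real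
  assumes k: "k \<ge> 0"
    and J: "\<And>x. J x \<ge> 0" "J \<in> L1w (k + 4 + real CARD('n))"
    and J1: "(LINT x|lebesgue. J x) = 1"
    and Jx: "(LINT x|lebesgue. J x *\<^sub>R x) = 0"
    and Jxx: "\<And>i j. (LINT x|lebesgue. J x * (x $ i) * (x $ j)) = (if i = j then 2 else 0)"
    and Jxxx: "\<And>\<alpha>. mi_order \<alpha> = 3 ==> (LINT x|lebesgue. J x * mi_power x \<alpha>) = 0"
    and u: "u\<^sub>0 \<in> L1w k" "C_class 4 u\<^sub>0" "prob_density u\<^sub>0"
    and c: "c > 0" and K: "K > k + real CARD('n)"
    and D4: "\<And>\<alpha> x. mi_order \<alpha> = 4 ==> \<bar>mi_deriv \<alpha> u\<^sub>0 x\<bar> <= c * (1 + (norm x)\<^sup>2) powr (- K / 2)"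
  obtains J' where "AE x in lebesgue. J' x = J x"
    "jump_datum k J' u\<^sub>0 (\<lambda>x. real CARD('n) ^ 4 * c * 5 powr K * jb x powr (- K))"
proof -
  obtain J0 where J0m: "J0 \<in> borel_measurable borel" and J0: "AE x in lebesgue. J0 x = J x"
    using lebesgue_Borel_version[OF L1w_measurable[OF J(2)]] by blast
  define J' where "J' x = max 0 (J0 x)" for x
  have J'm[measurable]: "J' \<in> borel_measurable borel" unfolding J'_def using J0m by measurable
  have ae: "AE x in lebesgue. J' x = J x"
    using J0 by eventually_elim (use J(1) in \<open>simp add: J'_def\<close>)
  have J'0: "0 <= J' x" for x by (simp add: J'_def)
  define a where "a = k + 4 + real CARD('n)"
  \<comment> \<open>The dimension is at least 1, so the assumed exponent k + 4 + d reaches k +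
    5.\<close>
  have a: "0 <= a" "k + 5 <= a" using k by (auto simp: a_def Suc_leI)
  have "integrable lborel (\<lambda>x. weight a x * J' x)"
  proof (subst lebesgue_integrable_version[symmetric])
    show "AE x in lebesgue. weight a x * J' x = weight a x * \<bar>J x\<bar>"
      using ae by eventually_elim (use J(1) in simp)
    show "integrable lebesgue (\<lambda>x. weight a x * \<bar>J x\<bar>)" using J(2) by (simp add: L1w_def a_def)
  qed measurable
  then have "integrable lborel (\<lambda>x. 2 powr a * (weight a x * J' x))" by simp
  then have iJ: "integrable lborel (\<lambda>x. kw (k + 5) x * J' x)"
  proof (rule Bochner_Integration.integrable_bound)
    have "kw (k + 5) x * J' x <= 2 powr a * weight a x * J' x" for x
      by (intro mult_right_mono order.trans[OF kw_mono[OF a(2)] kw_le_weight] a J'0)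
    then show "AE x in lborel. norm (kw (k + 5) x * J' x) <= norm (2 powr a * (weight a x * J' x))"
      by (intro AE_I2) (simp add: abs_mult J'0 mult.assoc)
  qed measurable
  have wk: "wkernel (k + 5) J'" using iJ by (simp add: wkernel_def J'0)
  have moment: "(LBINT z. g z * J' z) = (LINT x|lebesgue. J x * g x)"
    if [measurable]: "g \<in> borel_measurable borel" for g
    by (rule lebesgue_integral_version[symmetric]) (use ae in \<open>auto elim!: eventually_mono\<close>)
  have Jx': "(LBINT z. z $ i * J' z) = 0" for i
  proof -
    have e: "(LBINT z. J' z *\<^sub>R z) = 0"
      unfolding Jx[symmetric] by (rule lebesgue_integral_version[symmetric]) (use ae in \<open>auto elim!: eventually_mono\<close>)
    have "integrable lborel (\<lambda>z. J' z *\<^sub>R z)"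
    proof (rule Bochner_Integration.integrable_bound[OF iJ])
      have "J' z * norm z <= kw (k + 5) z * J' z" for z
      proof -
        have "norm z <= kw 4 z" using norm_power_le_kw[of 1 z] by simp
        also have "... <= kw (k + 5) z" using k by (intro kw_mono) simp
        finally have "J' z * norm z <= J' z * kw (k + 5) z" by (intro mult_left_mono J'0)
        then show ?thesis by (simp add: mult.commute)
      qed
      then show "AE z in lborel. norm (J' z *\<^sub>R z) <= norm (kw (k + 5) z * J' z)"
        by (intro AE_I2) (simp add: abs_mult J'0)
    qed measurable
    from integral_bounded_linear[OF bounded_linear_vec_nth[of i] this] show ?thesis
      by (simp add: e mult.commute)
  qed
  have Jxxx': "(LBINT z. z $ i * z $ j * z $ l * J' z) = 0" for i j l
  proof -
    \<comment> \<open>The multi-index counts the occurrences of i, j and l, which need not be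
      distinct.\<close>
    define \<alpha> where "\<alpha> m = (if m = i then 1 else 0) + (if m = j then 1 else 0) + (if m = l then 1 else (0::nat))" for m
    have p: "(\<Prod>m\<in>UNIV. (x $ m) ^ (if m = i then 1 else 0)) = x $ i" for x :: "real ^ 'n" and i
      by (simp add: if_distrib[of "\<lambda>n. _ ^ n"] cong: if_cong)
    have "mi_power x \<alpha> = x $ i * x $ j * x $ l" for x
      unfolding mi_power_def \<alpha>_def power_add prod.distrib p ..
    moreover have "mi_order \<alpha> = 3" by (simp add: mi_order_def \<alpha>_def sum.distrib)
    ultimately have "(LINT x|lebesgue. J x * (x $ i * x $ j * x $ l)) = 0" using Jxxx[of \<alpha>] by simp
    then show ?thesis by (subst moment) auto
  qed
  have u0c: "continuous_on UNIV u\<^sub>0" using C_class_mono[OF u(2), of 0] by simp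
  have u0m: "u\<^sub>0 \<in> borel_measurable borel" by (rule borel_measurable_continuous_onI[OF u0c])
  have K0: "0 <= K" using K k by simp
  have "jump_datum k J' u\<^sub>0 (\<lambda>x. real CARD('n) ^ 4 * c * 5 powr K * jb x powr (- K))"
  proof
    show "0 <= k" "wkernel (k + 5) J'" "\<And>x. 0 <= J' x" "u\<^sub>0 \<in> borel_measurable borel" by fact+
    show "(LBINT x. J' x) = 1" using moment[of "\<lambda>_. 1"] J1 by simp
    show "(LBINT z. z $ i * J' z) = 0" for i by (rule Jx')
    show "(LBINT z. z $ i * z $ j * J' z) = (if i = j then 2 else 0)" for i j
      using Jxx[of i j] moment[of "\<lambda>z. z $ i * z $ j"] by (simp add: mult.assoc)
    show "(LBINT z. z $ i * z $ j * z $ l * J' z) = 0" for i j l by (rule Jxxx')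
    show "0 <= u\<^sub>0 x" for x using u(3) by (simp add: prob_density_def)
    have "integrable lebesgue (\<lambda>x. wt k x * u\<^sub>0 x)" by (rule integrable_test[OF k u(1), of _ 1]) auto
    then show "integrable lborel (\<lambda>x. wt k x * u\<^sub>0 x)"
      using integrable_completion[of "\<lambda>x. wt k x * u\<^sub>0 x" lborel] u0m by simp
    show "(\<lambda>x. real CARD('n) ^ 4 * c * 5 powr K * jb x powr (- K)) \<in> borel_measurable borel"
      unfolding jb_def by measurable
    show "0 <= real CARD('n) ^ 4 * c * 5 powr K * jb x powr (- K)" for x :: "real ^ 'n" using c by simp
    \<comment> \<open>The weight consumes k of the K powers of decay; the remaining exponent K - k
      exceeds the dimension.\<close>
    have "integrable lborel (\<lambda>x :: real ^ 'n. real CARD('n) ^ 4 * c * 5 powr K * jb x powr (- (K - k)))"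
      using K by (intro integrable_mult_right integrable_jb_powr) simp
    also have "(\<lambda>x :: real ^ 'n. real CARD('n) ^ 4 * c * 5 powr K * jb x powr (- (K - k)))
        = (\<lambda>x. wt k x * (real CARD('n) ^ 4 * c * 5 powr K * jb x powr (- K)))"
      by (rule ext) (simp add: wt_def powr_diff powr_minus field_simps)
    finally show "integrable lborel (\<lambda>x :: real ^ 'n. wt k x * (real CARD('n) ^ 4 * c * 5 powr K * jb x powr (- K)))" .
    show "\<bar>u\<^sub>0 (x - 4 *\<^sub>R h) - 4 * u\<^sub>0 (x - 3 *\<^sub>R h) + 6 * u\<^sub>0 (x - 2 *\<^sub>R h) - 4 * u\<^sub>0 (x - h) + u\<^sub>0 x\<bar>
        <= norm h ^ 4 * (real CARD('n) ^ 4 * c * 5 powr K * jb x powr (- K))" if "norm h <= 1" for h x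
      by (rule fourth_difference_bound[OF u(2) c K0 D4 that])
  qed
  with ae that show thesis by blast
qed

theorem theorem1p3:
  fixes k :: real and J u\<^sub>0 :: "real ^ 'n \<Rightarrow> real" and p :: ennreal and c K :: real
  assumes "k \<ge> 0"
    and "\<And>x. J x \<ge> 0"
    and "J \<in> L1w (k + 4 + real CARD('n))"
    and "1 < p" and "J \<in> Lp p"
    and "(LINT x|lebesgue. J x) = 1"
    and "(LINT x|lebesgue. J x *\<^sub>R x) = 0"
    and "\<And>i j. (LINT x|lebesgue. J x * (x $ i) * (x $ j)) = (if i = j then 2 else 0)"
    and "\<And>\<alpha>. mi_order \<alpha> = 3 \<Longrightarrow> (LINT x|lebesgue. J x * mi_power x \<alpha>) = 0"
    and "u\<^sub>0 \<in> L1w k" and "C_class 4 u\<^sub>0" and "prob_density u\<^sub>0"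
    and "c > 0" and "K > k + real CARD('n)"
    and "\<And>\<alpha> x. mi_order \<alpha> = 4 \<Longrightarrow> \<bar>mi_deriv \<alpha> u\<^sub>0 x\<bar> \<le> c * (1 + (norm x)\<^sup>2) powr (- K / 2)"
  shows "\<exists>C>0. \<forall>\<epsilon>\<in>{0<..1}. \<forall>u. mild_solution k \<epsilon> J u\<^sub>0 u \<longrightarrow>
    (\<forall>t\<ge>0. (\<lambda>x. u t x - fokker_planck_solution u\<^sub>0 t x) \<in> L1w k \<and>
      L1w_norm k (\<lambda>x. u t x - fokker_planck_solution u\<^sub>0 t x) \<le> C * \<epsilon>\<^sup>2)"
proof -
  obtain J' where ae: "AE x in lebesgue. J' x = J x"
    and "jump_datum k J' u\<^sub>0 (\<lambda>x. real CARD('n) ^ 4 * c * 5 powr K * jb x powr (- K))"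
    by (rule jump_datum_of_hypotheses[OF assms(1-3,6-15)])
  then interpret jump_datum k J' u\<^sub>0 "\<lambda>x. real CARD('n) ^ 4 * c * 5 powr K * jb x powr (- K)"
    by simp
  obtain C where C: "0 <= C" and est: "\<And>eps Jl u t. 0 < eps ==> eps <= 1 ==> AE x in lebesgue. J' x = Jl x ==> mild_solution k eps Jl u\<^sub>0 u ==> 0 <= t ==>
    (\<lambda>x. u t x - fokker_planck_solution u\<^sub>0 t x) \<in> L1w k \<and> L1w_norm k (\<lambda>x. u t x - fokker_planck_solution u\<^sub>0 t x) <= C * eps\<^sup>2"
    by (rule convergence_estimate) (rule that; assumption)
  show ?thesis
  \<comment> \<open>The constant obtained is only nonnegative, while a positive one is asked
    for.\<close>
  proof (intro exI[of _ "C + 1"] conjI ballI allI impI)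
    show "0 < C + 1" using C by simp
    fix eps u t assume e: "eps \<in> {0<..1}" and u: "mild_solution k eps J u\<^sub>0 u" and t: "0 <= (t :: real)"
    have "(\<lambda>x. u t x - fokker_planck_solution u\<^sub>0 t x) \<in> L1w k \<and> L1w_norm k (\<lambda>x. u t x - fokker_planck_solution u\<^sub>0 t x) <= C * eps\<^sup>2"
      using e by (intro est[OF _ _ ae u t]) auto
    moreover have "C * eps\<^sup>2 <= (C + 1) * eps\<^sup>2" by (intro mult_right_mono) auto
    ultimately show "(\<lambda>x. u t x - fokker_planck_solution u\<^sub>0 t x) \<in> L1w k"
      "L1w_norm k (\<lambda>x. u t x - fokker_planck_solution u\<^sub>0 t x) <= (C + 1) * eps\<^sup>2" by linarith+
  qed
qed

end
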